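(* Let $\xi$, $\eta$ and $\zeta$ be variational multivectors of degrees $r$, $s$ and $t$, respectively. Then the variational Schouten bracket satisfies the graded Jacobi identity $$(-1)^{(r-1)(t-1)}\llbracket\xi,\llbracket\eta,\zeta\rrbracket\rrbracket+(-1)^{(r-1)(s-1)}\llbracket\eta,\llbracket\zeta,\xi\rrbracket\rrbracket+(-1)^{(s-1)(t-1)}\llbracket\zeta,\llbracket\xi,\eta\rrbracket\rrbracket=0 .$$
   Context: Setting. $\pi\colon E\to M$ is a vector bundle of rank $m$ over a smooth oriented $n$-dimensional manifold $M$; $x^i$ are coordinates on $M$, $q^\alpha$ fibre coordinates, and $J^\infty(\pi)$ is the infinite jet space with coordinates $x^i,q^\alpha_\sigma$ ($\sigma$ a multi-index); $\mathcal F(\pi)$ is the ring of smooth functions on $J^\infty(\pi)$. Let $\widehat\pi\colon E^*\otimes\Lambda^n(M)\to M$. The parity-reversed horizontal jet bundle $\overline{J^\infty_\pi}(\Pi\widehat\pi)$ over $J^\infty(\pi)$ has coordinates $x^i,q^\alpha_\sigma,b_{\alpha,\sigma}$, where the $b_{\alpha,\sigma}$ are odd (anticommuting). The total derivatives are $D_i=\partial/\partial x^i+\sum q^\alpha_{\sigma+1_i}\partial/\partial q^\alpha_\sigma+\sum b_{\alpha,\sigma+1_i}\partial/\partial b_{\alpha,\sigma}$; $D_\sigma$ is the corresponding composition. Variational multivectors. A variational $k$-vector ($k\ge 0$) is a class $\xi=\int f\,\mathrm{dVol}$ of top-degree horizontal forms modulo horizontally exact ones (i.e. modulo total divergences $\sum_i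 D_i(g^i)$) having a density $f$ that is a homogeneous polynomial of degree $k$ in the $b_{\alpha,\sigma}$, with coefficients in $\mathcal F(\pi)$. Its degree is $k$. A variational multivector is a variational $k$-vector for some $k$. Variational derivatives. For a density $f$, $\delta f/\delta q^\alpha=\sum_\sigma(-1)^{|\sigma|}D_\sigma(\partial f/\partial q^\alpha_\sigma)$, and similarly for $b_\alpha$. Arrows indicate the direction in which the variation is transported: $\overleftarrow{\delta f}/\delta b_\alpha$ is obtained by moving $\delta b_\alpha$ to the far left ($\delta_b f=\sum_\alpha\delta b_\alpha\,\overleftarrow{\delta f}/\delta b_\alpha$ modulo total divergences), and $\overrightarrow{\delta f}/\delta b_\alpha$ by moving it to the far right; for the even $q^\alpha$ both arrows give the same result. These do not depend on the choice of density. Schouten bracket. For a $k$-vector $\xi$ and an $\ell$-vector $\eta$, the bracket is the $(k+\ell-1)$-vector $$\llbracket\xi,\eta\rrbracket=\int\sum_\alpha\left[\frac{\overrightarrow{\delta\xi}}{\delta q^\alpha}\frac{\overleftarrow{\delta\eta}}{\delta b_\alpha}-\frac{\overrightarrow{\delta\xi}}{\delta b_\alpha}\frac{\overleftarrow{\delta\eta}}{\delta q^\alpha}\right]$$ (variational derivatives being taken of the densities, and the result multiplied by $\mathrm{dVol}$); in particular the bracket of two $0$-vectors is $0$. *)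

theory Defs
  imports "HOL-Analysis.Analysis" "HOL-Library.Groups_Big_Fun"
begin

section \<open>Smooth functions of coordinates\<close>

text \<open>
  Partial derivatives are taken along a family \<open>sh c t\<close> of shifts of the coordinate \<open>c\<close> by \<open>t\<close>,
  so that one definition serves both for \<open>R^n\<close> and for jet space, which has infinitely
  many coordinates. A function is smooth on an open set if all its iterated partial derivatives
  exist and are continuous; on functions of finitely many coordinates this is the usual notion.
\<close>

definition pder :: "('c \<Rightarrow> real \<Rightarrow> 'p \<Rightarrow> 'p) \<Rightarrow> 'c \<Rightarrow> ('p \<Rightarrow> real) \<Rightarrow> 'p \<Rightarrow> real" where
  "pder sh c f p = deriv (\<lambda>t. f (sh c t p)) 0"

definition smooth_along ::
  "('c \<Rightarrow> real \<Rightarrow> 'p \<Rightarrow> 'p) \<Rightarrow> 'p::topological_space set \<Rightarrow> ('p \<Rightarrow> real) \<Rightarrow> bool" where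
  "smooth_along sh S f \<longleftrightarrow>
     (\<forall>cs. continuous_on S (foldr (pder sh) cs f) \<and>
        (\<forall>c. \<forall>p\<in>S. (\<lambda>t. foldr (pder sh) cs f (sh c t p)) field_differentiable at 0))"

definition base_shift :: "'n \<Rightarrow> real \<Rightarrow> real^'n \<Rightarrow> real^'n::finite" where
  "base_shift i t x = x + t *\<^sub>R axis i 1"

section \<open>Multi-indices and jet coordinates\<close>

type_synonym 'n multi_index = "'n \<Rightarrow> nat"

text \<open>A jet index \<open>(\<alpha>, \<sigma>)\<close> labels both the even coordinate \<open>q\<^sup>\<alpha>\<^sub>\<sigma>\<close> and the odd coordinate
  \<open>b\<^sub>\<alpha>\<^sub>,\<^sub>\<sigma>\<close>.\<close>

type_synonym ('n, 'm) jet_index = "'m \<times> 'n multi_index"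

text \<open>Points \<open>(x, q)\<close> of the infinite jet space over a chart, with the product topology.\<close>

type_synonym ('n, 'm) jet = "(real^'n) \<times> (('n, 'm) jet_index \<Rightarrow> real)"

definition mi_size :: "'n::finite multi_index \<Rightarrow> nat" where
  "mi_size \<sigma> = (\<Sum>i\<in>UNIV. \<sigma> i)"

definition raise :: "'n \<Rightarrow> ('n, 'm) jet_index \<Rightarrow> ('n, 'm) jet_index" where
  "raise i a = (fst a, (snd a)(i := Suc (snd a i)))"

fun jet_shift ::
  "'n + ('n, 'm) jet_index \<Rightarrow> real \<Rightarrow> ('n::finite, 'm) jet \<Rightarrow> ('n, 'm) jet" where
  "jet_shift (Inl i) t (x, q) = (base_shift i t x, q)"
| "jet_shift (Inr a) t (x, q) = (x, q(a := q a + t))"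

text \<open>Iteration \<open>D\<^sub>\<sigma>\<close> of operators \<open>D\<^sub>i\<close>. The \<open>D\<^sub>i\<close> it is applied to commute on smooth functions, so the
  chosen enumeration of the directions does not matter.\<close>

definition directions :: "'n::finite list" where
  "directions = (SOME is. distinct is \<and> set is = UNIV)"

definition iter_mi :: "('n \<Rightarrow> 'f \<Rightarrow> 'f) \<Rightarrow> 'n::finite multi_index \<Rightarrow> 'f \<Rightarrow> 'f" where
  "iter_mi D \<sigma> = foldr (\<lambda>i. D i ^^ \<sigma> i) directions"

section \<open>Polynomials in the odd variables\<close>

text \<open>
  A polynomial in anticommuting variables \<open>b\<^sub>a\<close> is represented by its antisymmetric
  coefficients: \<open>w\<close> stands for the sum over \<open>k\<close> of
  \<open>(1 / k!) \<Sum> w [a\<^sub>1, \<dots>, a\<^sub>k] b\<^sub>a\<^sub>1 \<dots> b\<^sub>a\<^sub>k\<close>, the inner sum running over all lists of length \<open>k\<close>.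
  In this normalisation the left and right derivatives with respect to \<open>b\<^sub>a\<close> are the
  operations of fixing the first, respectively last, index to be \<open>a\<close>. The product is determined by
  its constant term and by the graded Leibniz rule for left derivatives.
\<close>

type_synonym 'i odd_poly = "'i list \<Rightarrow> real"

definition alternating :: "'i odd_poly \<Rightarrow> bool" where
  "alternating w \<longleftrightarrow> (\<forall>u a b v. w (u @ a # b # v) = - w (u @ b # a # v))"

definition odd_var :: "'i \<Rightarrow> 'i odd_poly" where
  "odd_var a = (\<lambda>l. if l = [a] then 1 else 0)"

definition lder :: "'i \<Rightarrow> 'i odd_poly \<Rightarrow> 'i odd_poly" where
  "lder a w = (\<lambda>l. w (a # l))"

definition rder :: "'i \<Rightarrow> 'i odd_poly \<Rightarrow> 'i odd_poly" where
  "rder a w = (\<lambda>l. w (l @ [a]))"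

fun odd_mult :: "'i odd_poly \<Rightarrow> 'i odd_poly \<Rightarrow> 'i odd_poly" where
  "odd_mult v w [] = v [] * w []"
| "odd_mult v w (a # l) =
     odd_mult (lder a v) w l + odd_mult (\<lambda>l. (-1) ^ length l * v l) (lder a w) l"

text \<open>The linear substitution \<open>b'\<^sub>c = \<Sum>\<^sub>a T c a b\<^sub>a\<close> in a polynomial in the \<open>b'\<^sub>c\<close>.\<close>

definition odd_subst :: "('i \<Rightarrow> 'i \<Rightarrow> real) \<Rightarrow> 'i odd_poly \<Rightarrow> 'i odd_poly" where
  "odd_subst T w l =
     Sum_any (\<lambda>l'. if length l' = length l then w l' * (\<Prod>k<length l. T (l' ! k) (l ! k)) else 0)"

section \<open>Densities over a chart and variational derivatives\<close>

type_synonym ('n, 'm) density = "('n, 'm) jet \<Rightarrow> ('n, 'm) jet_index odd_poly"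

definition x_der :: "'n \<Rightarrow> ('n::finite, 'm) density \<Rightarrow> ('n, 'm) density" where
  "x_der i f = (\<lambda>p l. pder jet_shift (Inl i) (\<lambda>p. f p l) p)"

definition q_der :: "('n, 'm) jet_index \<Rightarrow> ('n::finite, 'm) density \<Rightarrow> ('n, 'm) density" where
  "q_der a f = (\<lambda>p l. pder jet_shift (Inr a) (\<lambda>p. f p l) p)"

definition total_der :: "'n \<Rightarrow> ('n::finite, 'm) density \<Rightarrow> ('n, 'm) density" where
  "total_der i f = (\<lambda>p l.
     x_der i f p l
     + Sum_any (\<lambda>a. snd p (raise i a) * q_der a f p l)
     + Sum_any (\<lambda>a. odd_mult (odd_var (raise i a)) (lder a (f p)) l))"

definition euler :: "('n multi_index \<Rightarrow> ('n::finite, 'm) density) \<Rightarrow> ('n, 'm) density" where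
  "euler F = (\<lambda>p l. Sum_any (\<lambda>\<sigma>. (-1) ^ mi_size \<sigma> * iter_mi total_der \<sigma> (F \<sigma>) p l))"

definition var_q :: "'m \<Rightarrow> ('n::finite, 'm) density \<Rightarrow> ('n, 'm) density" where
  "var_q \<alpha> f = euler (\<lambda>\<sigma>. q_der (\<alpha>, \<sigma>) f)"

definition var_b_left :: "'m \<Rightarrow> ('n::finite, 'm) density \<Rightarrow> ('n, 'm) density" where
  "var_b_left \<alpha> f = euler (\<lambda>\<sigma> p. lder (\<alpha>, \<sigma>) (f p))"

definition var_b_right :: "'m \<Rightarrow> ('n::finite, 'm) density \<Rightarrow> ('n, 'm) density" where
  "var_b_right \<alpha> f = euler (\<lambda>\<sigma> p. rder (\<alpha>, \<sigma>) (f p))"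

definition schouten_density ::
  "('n::finite, 'm::finite) density \<Rightarrow> ('n, 'm) density \<Rightarrow> ('n, 'm) density" where
  "schouten_density f g = (\<lambda>p l. \<Sum>\<alpha>\<in>UNIV.
     odd_mult (var_q \<alpha> f p) (var_b_left \<alpha> g p) l - odd_mult (var_b_right \<alpha> f p) (var_q \<alpha> g p) l)"

text \<open>Regularity over \<open>U \<times> R^\<infinity>\<close>: the coefficients are smooth and of jet order at most \<open>N\<close>,
  and only the finitely many \<open>b\<^sub>\<alpha>\<^sub>,\<^sub>\<sigma>\<close> of order at most \<open>N\<close> occur. Values off \<open>U \<times> R^\<infinity>\<close> are
  irrelevant here and below.\<close>

definition regular_density :: "nat \<Rightarrow> (real^'n) set \<Rightarrow> ('n::finite, 'm) density \<Rightarrow> bool" where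
  "regular_density N U f \<longleftrightarrow>
     (\<forall>l. smooth_along jet_shift (U \<times> UNIV) (\<lambda>p. f p l)) \<and>
     (\<forall>x\<in>U. \<forall>q q'. (\<forall>a. mi_size (snd a) \<le> N \<longrightarrow> q a = q' a) \<longrightarrow> f (x, q) = f (x, q')) \<and>
     (\<forall>x\<in>U. \<forall>q l. (\<exists>a\<in>set l. mi_size (snd a) > N) \<longrightarrow> f (x, q) l = 0) \<and>
     (\<forall>x\<in>U. \<forall>q. alternating (f (x, q)))"

section \<open>Vector bundles over oriented manifolds\<close>

text \<open>A bundle chart consists of its domain in the base, base coordinates and fibre coordinates.\<close>

datatype ('a, 'e, 'n, 'm) bundle_chart =
  Bundle_Chart (chart_dom: "'a set") (base_coord: "'a \<Rightarrow> real^'n") (fibre_coord: "'e \<Rightarrow> real^'m")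

record ('a, 'e, 'n, 'm) vector_bundle =
  base :: "'a topology"
  total :: "'e topology"
  proj :: "'e \<Rightarrow> 'a"
  charts :: "('a, 'e, 'n, 'm) bundle_chart set"

definition total_over :: "('a, 'e, 'n::finite, 'm::finite) vector_bundle \<Rightarrow> 'a set \<Rightarrow> 'e set" where
  "total_over B S = {e \<in> topspace (total B). proj B e \<in> S}"

definition chart_inv :: "('a, 'e, 'n::finite, 'm::finite) bundle_chart \<Rightarrow> real^'n \<Rightarrow> 'a" where
  "chart_inv c = inv_into (chart_dom c) (base_coord c)"

definition base_image :: "('a, 'e, 'n::finite, 'm::finite) bundle_chart \<Rightarrow> (real^'n) set" where
  "base_image c = base_coord c ` chart_dom c"

definition overlap ::
  "('a, 'e, 'n::finite, 'm::finite) bundle_chart \<Rightarrow> ('a, 'e, 'n, 'm) bundle_chart \<Rightarrow> (real^'n) set" where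
  "overlap c d = base_coord c ` (chart_dom c \<inter> chart_dom d)"

definition base_trans ::
  "('a, 'e, 'n::finite, 'm::finite) bundle_chart \<Rightarrow> ('a, 'e, 'n, 'm) bundle_chart \<Rightarrow> real^'n \<Rightarrow> real^'n" where
  "base_trans c d x = base_coord d (chart_inv c x)"

definition base_jacobian ::
  "('a, 'e, 'n::finite, 'm::finite) bundle_chart \<Rightarrow> ('a, 'e, 'n, 'm) bundle_chart \<Rightarrow> real^'n \<Rightarrow> real^'n^'n" where
  "base_jacobian c d x = (\<chi> j i. pder base_shift i (\<lambda>x. base_trans c d x $ j) x)"

definition fibre_point ::
  "('a, 'e, 'n::finite, 'm::finite) vector_bundle \<Rightarrow> ('a, 'e, 'n, 'm) bundle_chart \<Rightarrow> 'a \<Rightarrow> real^'m \<Rightarrow> 'e" where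
  "fibre_point B c u v = (THE e. e \<in> total_over B {u} \<and> fibre_coord c e = v)"

definition fibre_trans ::
  "('a, 'e, 'n::finite, 'm::finite) vector_bundle \<Rightarrow> ('a, 'e, 'n, 'm) bundle_chart \<Rightarrow> ('a, 'e, 'n, 'm) bundle_chart
    \<Rightarrow> real^'n \<Rightarrow> real^'m \<Rightarrow> real^'m" where
  "fibre_trans B c d x v = fibre_coord d (fibre_point B c (chart_inv c x) v)"

text \<open>
  The orientation of the base is that in which all charts are positively oriented. The
  bundle charts also determine the smooth structure of the total space and the linear
  structure of the fibres.
\<close>

definition oriented_vector_bundle :: "('a, 'e, 'n::finite, 'm::finite) vector_bundle \<Rightarrow> bool" where
  "oriented_vector_bundle B \<longleftrightarrow>
     Hausdorff_space (base B) \<and>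
     second_countable (base B) \<and>
     proj B ` topspace (total B) \<subseteq> topspace (base B) \<and>
     \<Union> (chart_dom ` charts B) = topspace (base B) \<and>
     (\<forall>c\<in>charts B.
        openin (base B) (chart_dom c) \<and> open (base_image c) \<and>
        homeomorphic_map (subtopology (base B) (chart_dom c)) (top_of_set (base_image c))
          (base_coord c) \<and>
        openin (total B) (total_over B (chart_dom c)) \<and>
        homeomorphic_map (subtopology (total B) (total_over B (chart_dom c)))
          (prod_topology (subtopology (base B) (chart_dom c)) euclidean)
          (\<lambda>e. (proj B e, fibre_coord c e))) \<and>
     (\<forall>c\<in>charts B. \<forall>d\<in>charts B.
        (\<forall>j. smooth_along base_shift (overlap c d) (\<lambda>x. base_trans c d x $ j)) \<and>
        (\<forall>x\<in>overlap c d. det (base_jacobian c d x) > 0) \<and>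
        (\<forall>x\<in>overlap c d. linear (fibre_trans B c d x)) \<and>
        (\<forall>\<beta> \<alpha>. smooth_along base_shift (overlap c d) (\<lambda>x. matrix (fibre_trans B c d x) $ \<beta> $ \<alpha>)))"

section \<open>Horizontal forms on the parity-reversed jet bundle\<close>

text \<open>
  If the components of sections of a vector bundle in the charts \<open>c\<close> and \<open>d\<close> are related by
  \<open>s\<^sub>d (base_trans c d x) = G x *v s\<^sub>c x\<close>, then their derivatives at corresponding points are
  related by \<open>\<partial>\<^sub>\<tau> s\<^sub>d\<^sup>\<beta> = \<Sum> prolong c d G x (\<beta>, \<tau>) (\<alpha>, \<sigma>) * \<partial>\<^sub>\<sigma> s\<^sub>c\<^sup>\<alpha>\<close>. The entry
  of this matrix is obtained from the section whose only nonzero component, the one with index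
  \<open>\<alpha>\<close>, is the monomial \<open>(z - x)^\<sigma> / \<sigma>!\<close>.
\<close>

definition prolong ::
  "('a, 'e, 'n::finite, 'm::finite) bundle_chart \<Rightarrow> ('a, 'e, 'n, 'm) bundle_chart \<Rightarrow> (real^'n \<Rightarrow> real^'m^'m)
    \<Rightarrow> real^'n \<Rightarrow> ('n, 'm) jet_index \<Rightarrow> ('n, 'm) jet_index \<Rightarrow> real" where
  "prolong c d G x b a =
     iter_mi (pder base_shift) (snd b)
       (\<lambda>y. let z = base_trans d c y in
          G z $ fst b $ fst a * (\<Prod>i\<in>UNIV. (z $ i - x $ i) ^ snd a i / fact (snd a i)))
       (base_trans c d x)"

definition bundle_matrix ::
  "('a, 'e, 'n::finite, 'm::finite) vector_bundle \<Rightarrow> ('a, 'e, 'n, 'm) bundle_chart \<Rightarrow> ('a, 'e, 'n, 'm) bundle_chart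
    \<Rightarrow> real^'n \<Rightarrow> real^'m^'m" where
  "bundle_matrix B c d x = matrix (fibre_trans B c d x)"

text \<open>Transition matrix of \<open>E\<^sup>* \<otimes> \<Lambda>\<^sup>n(M)\<close> with respect to the frames (dual frame) \<open>\<otimes> dx\<^sup>1 \<and> \<dots> \<and> dx\<^sup>n\<close>.\<close>

definition codensity_matrix ::
  "('a, 'e, 'n::finite, 'm::finite) vector_bundle \<Rightarrow> ('a, 'e, 'n, 'm) bundle_chart
    \<Rightarrow> ('a, 'e, 'n, 'm) bundle_chart \<Rightarrow> real^'n \<Rightarrow> real^'m^'m" where
  "codensity_matrix B c d x =
     (1 / det (base_jacobian c d x)) *\<^sub>R transpose (matrix_inv (bundle_matrix B c d x))"

definition jet_trans ::
  "('a, 'e, 'n::finite, 'm::finite) vector_bundle \<Rightarrow> ('a, 'e, 'n, 'm) bundle_chart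
    \<Rightarrow> ('a, 'e, 'n, 'm) bundle_chart \<Rightarrow> ('n, 'm) jet \<Rightarrow> ('n, 'm) jet" where
  "jet_trans B c d p = (base_trans c d (fst p),
     \<lambda>b. Sum_any (\<lambda>a. prolong c d (bundle_matrix B c d) (fst p) b a * snd p a))"

text \<open>A density over the chart \<open>d\<close>, expressed in the even and odd coordinates of the chart \<open>c\<close>.\<close>

definition pull_density ::
  "('a, 'e, 'n::finite, 'm::finite) vector_bundle \<Rightarrow> ('a, 'e, 'n, 'm) bundle_chart
    \<Rightarrow> ('a, 'e, 'n, 'm) bundle_chart \<Rightarrow> ('n, 'm) density \<Rightarrow> ('n, 'm) density" where
  "pull_density B c d f = (\<lambda>p.
     odd_subst (prolong c d (codensity_matrix B c d) (fst p)) (f (jet_trans B c d p)))"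

text \<open>
  A horizontal \<open>n\<close>-form is a family \<open>\<omega>\<close> of densities such that the expressions
  \<open>\<omega> c dx\<^sup>1 \<and> \<dots> \<and> dx\<^sup>n\<close> agree on overlaps. A horizontal \<open>(n-1)\<close>-form is a family \<open>\<gamma>\<close> such
  that the contractions of \<open>dx\<^sup>1 \<and> \<dots> \<and> dx\<^sup>n\<close> with \<open>\<Sum>\<^sub>i \<gamma> c i \<partial>/\<partial>x\<^sup>i\<close> agree on overlaps; its
  horizontal differential is \<open>(\<Sum>\<^sub>i D\<^sub>i (\<gamma> c i)) dx\<^sup>1 \<and> \<dots> \<and> dx\<^sup>n\<close>.
\<close>

type_synonym ('a, 'e, 'n, 'm) density_family =
  "('a, 'e, 'n, 'm) bundle_chart \<Rightarrow> ('n, 'm) density"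

definition top_form ::
  "('a, 'e, 'n::finite, 'm::finite) vector_bundle \<Rightarrow> ('a, 'e, 'n, 'm) density_family \<Rightarrow> bool" where
  "top_form B \<omega> \<longleftrightarrow>
     (\<exists>N. \<forall>c\<in>charts B. regular_density N (base_image c) (\<omega> c)) \<and>
     (\<forall>c\<in>charts B. \<forall>d\<in>charts B. \<forall>x\<in>overlap c d. \<forall>q l.
        \<omega> c (x, q) l = det (base_jacobian c d x) * pull_density B c d (\<omega> d) (x, q) l)"

definition subtop_form ::
  "('a, 'e, 'n::finite, 'm::finite) vector_bundle
    \<Rightarrow> (('a, 'e, 'n, 'm) bundle_chart \<Rightarrow> 'n \<Rightarrow> ('n, 'm) density) \<Rightarrow> bool" where
  "subtop_form B \<gamma> \<longleftrightarrow>
     (\<exists>N. \<forall>c\<in>charts B. \<forall>i. regular_density N (base_image c) (\<gamma> c i)) \<and>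
     (\<forall>c\<in>charts B. \<forall>d\<in>charts B. \<forall>x\<in>overlap c d. \<forall>q l i.
        \<gamma> c i (x, q) l = det (base_jacobian c d x) *
          (\<Sum>j\<in>UNIV. base_jacobian d c (base_trans c d x) $ i $ j * pull_density B c d (\<gamma> d j) (x, q) l))"

definition cohomologous ::
  "('a, 'e, 'n::finite, 'm::finite) vector_bundle \<Rightarrow> ('a, 'e, 'n, 'm) density_family
    \<Rightarrow> ('a, 'e, 'n, 'm) density_family \<Rightarrow> bool" where
  "cohomologous B \<omega> \<omega>' \<longleftrightarrow>
     (\<exists>\<gamma>. subtop_form B \<gamma> \<and>
        (\<forall>c\<in>charts B. \<forall>x\<in>base_image c. \<forall>q l.
           \<omega> c (x, q) l = \<omega>' c (x, q) l + (\<Sum>i\<in>UNIV. total_der i (\<gamma> c i) (x, q) l)))"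

section \<open>Variational multivectors and the Schouten bracket\<close>

type_synonym ('a, 'e, 'n, 'm) form_class = "('a, 'e, 'n, 'm) density_family set"

definition form_class ::
  "('a, 'e, 'n::finite, 'm::finite) vector_bundle \<Rightarrow> ('a, 'e, 'n, 'm) density_family
    \<Rightarrow> ('a, 'e, 'n, 'm) form_class" where
  "form_class B \<omega> = {\<omega>'. top_form B \<omega>' \<and> cohomologous B \<omega>' \<omega>}"

definition homogeneous ::
  "('a, 'e, 'n::finite, 'm::finite) vector_bundle \<Rightarrow> nat \<Rightarrow> ('a, 'e, 'n, 'm) density_family \<Rightarrow> bool" where
  "homogeneous B k \<omega> \<longleftrightarrow>
     (\<forall>c\<in>charts B. \<forall>x\<in>base_image c. \<forall>q l. length l \<noteq> k \<longrightarrow> \<omega> c (x, q) l = 0)"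

definition variational_vector ::
  "('a, 'e, 'n::finite, 'm::finite) vector_bundle \<Rightarrow> nat \<Rightarrow> ('a, 'e, 'n, 'm) form_class \<Rightarrow> bool" where
  "variational_vector B k \<xi> \<longleftrightarrow> (\<exists>\<omega>. top_form B \<omega> \<and> homogeneous B k \<omega> \<and> \<xi> = form_class B \<omega>)"

text \<open>Operations on classes are given by the classes of the results on representatives.\<close>

definition schouten ::
  "('a, 'e, 'n::finite, 'm::finite) vector_bundle \<Rightarrow> ('a, 'e, 'n, 'm) form_class
    \<Rightarrow> ('a, 'e, 'n, 'm) form_class \<Rightarrow> ('a, 'e, 'n, 'm) form_class" where
  "schouten B \<xi> \<eta> = (\<Union>f\<in>\<xi>. \<Union>g\<in>\<eta>. form_class B (\<lambda>c. schouten_density (f c) (g c)))"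

definition class_add ::
  "('a, 'e, 'n::finite, 'm::finite) vector_bundle \<Rightarrow> ('a, 'e, 'n, 'm) form_class
    \<Rightarrow> ('a, 'e, 'n, 'm) form_class \<Rightarrow> ('a, 'e, 'n, 'm) form_class" where
  "class_add B \<xi> \<eta> = (\<Union>f\<in>\<xi>. \<Union>g\<in>\<eta>. form_class B (\<lambda>c p l. f c p l + g c p l))"

definition class_scale ::
  "('a, 'e, 'n::finite, 'm::finite) vector_bundle \<Rightarrow> real \<Rightarrow> ('a, 'e, 'n, 'm) form_class
    \<Rightarrow> ('a, 'e, 'n, 'm) form_class" where
  "class_scale B r \<xi> = (\<Union>f\<in>\<xi>. form_class B (\<lambda>c p l. r * f c p l))"

definition class_zero ::
  "('a, 'e, 'n::finite, 'm::finite) vector_bundle \<Rightarrow> ('a, 'e, 'n, 'm) form_class" where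
  "class_zero B = form_class B (\<lambda>c p l. 0)"

end

theory Submission
  imports Defs "HOL-Library.Function_Algebras"
begin

text \<open>The proof has an algebraic part, over one coordinate domain, and a global part.

 Over a coordinate domain, a density \<open>f\<close> defines an evolutionary derivation \<open>Q f\<close>. Its
 components are \<open>\<delta>f/\<delta>q\<close> along \<open>b\<close> and minus the right derivative \<open>\<delta>f/\<delta>b\<close> along \<open>q\<close>, so
 that the bracket of \<open>f\<close> and \<open>g\<close> differs from \<open>Q f g\<close> by a total divergence (\<open>Q_br\<close>). Since
 \<open>Q f\<close> commutes with total derivatives, the Leibniz rule writes \<open>Q f\<close> of the bracket of \<open>g\<close> and
 \<open>h\<close> as a sum \<open>T f g h\<close> plus or minus \<open>T f h g\<close> (\<open>Q_bracket\<close>). Here \<open>T f g h\<close> is, modulo divergences,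
 the second variation of \<open>g\<close> in the directions \<open>Q f\<close> and \<open>Q h\<close> (\<open>T_second_variation\<close>), which is
 graded symmetric in \<open>f\<close> and \<open>h\<close>. In the Jacobi identity the six terms therefore cancel in pairs
 (\<open>jacobi_dv\<close>). The argument uses only the algebraic laws collected in the locale
 \<open>jet_superalgebra\<close>. All the divergences which it produces have coefficients in any
 differential ideal containing one of \<open>f\<close>, \<open>g\<close>, \<open>h\<close>, so primitives vanish over every open set over
 which one of the three densities vanishes.

 The bracket does not depend on coordinates. Pulling densities back along a change of charts
 commutes with the product, and the total derivatives are related by
 \<open>D\<^sub>i \<Phi> = \<Sum>\<^sub>j J\<^sub>j\<^sub>i \<Phi> D\<^sub>j\<close> (\<open>Phi_dD\<close>). With the Piola identity this yields the transformation of the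
 Euler operators, of the bracket (\<open>bracket_Phi\<close>) and of divergences (\<open>piola_Phi\<close>).

 The primitive of the Jacobiator found in a chart is not canonical and need not agree
 with those of other charts. The Jacobiator is additive in \<open>h\<close>, though, so \<open>h\<close> can be split by
 cut-off functions. If \<open>\<rho>\<close> is supported in a chart domain, then the primitive of the Jacobiator of
 \<open>f\<close>, \<open>g\<close>, \<open>\<rho> h\<close> found in this chart vanishes where \<open>\<rho>\<close> does, and hence extends by zero
 (\<open>prim_extend\<close>). The orders of these primitives have a common bound, so their locally
 finite sum is a global primitive (\<open>jac_exact\<close>). Finally, brackets of classes can be
 computed on representatives, because Euler operators annihilate divergences
 (\<open>schouten_form_class\<close>).\<close>

abbreviation bder :: "'n => (real^'n::finite => real) => real^'n => real" where
 "bder \<equiv> pder base_shift"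

abbreviation base_smooth :: "(real^'n::finite) set => (real^'n => real) => bool" where
 "base_smooth \<equiv> smooth_along base_shift"

abbreviation qder :: "('n, 'm) jet_index => (('n::finite, 'm) jet => real) => ('n, 'm) jet => real" where
 "qder a \<equiv> pder jet_shift (Inr a)"

abbreviation jacobian :: "('a, 'e, 'n::finite, 'm::finite) bundle_chart => ('a, 'e, 'n, 'm) bundle_chart => real^'n => real^'n^'n" where
 "jacobian \<equiv> base_jacobian"


section \<open>Smoothness along commuting flows\<close>

text \<open>The coordinate shifts of \<open>R\<^sup>n\<close>, of \<open>R\<^sup>n \<times> R\<^sup>n\<close> and of the jet space are all instances, so calculus is
 developed once for finitely and infinitely many coordinates.\<close>

locale commuting_flows =
 fixes sh :: "'c => real => 'p::topological_space => 'p"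
 assumes sh_0 [simp]: "sh c 0 p = p"
  and sh_add: "sh c s (sh c t p) = sh c (s + t) p"
  and sh_commute: "sh c s (sh d t p) = sh d t (sh c s p)"
  and sh_cont: "continuous_on UNIV (\<lambda>(t, p). sh c t p)"

lemma smooth_along_iff:
 "smooth_along sh S f \<longleftrightarrow> continuous_on S f \<and>
   (\<forall>c. \<forall>p\<in>S. (\<lambda>t. f (sh c t p)) field_differentiable at 0) \<and>
   (\<forall>c. smooth_along sh S (pder sh c f))" (is "?L \<longleftrightarrow> ?R")
proof
 assume L: ?L
 have "smooth_along sh S (pder sh c f)" for c
  unfolding smooth_along_def
 proof
  fix cs
  have "foldr (pder sh) cs (pder sh c f) = foldr (pder sh) (cs @ [c]) f" by simp
  then show "continuous_on S (foldr (pder sh) cs (pder sh c f)) \<and>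
   (\<forall>ca. \<forall>p\<in>S. (\<lambda>t. foldr (pder sh) cs (pder sh c f) (sh ca t p)) field_differentiable at 0)"
   using L unfolding smooth_along_def by metis
 qed
 moreover have "foldr (pder sh) [] f = f" by simp
 ultimately show ?R using L unfolding smooth_along_def by metis
next
 assume R: ?R
 show ?L unfolding smooth_along_def
 proof
  fix cs
  show "continuous_on S (foldr (pder sh) cs f) \<and>
   (\<forall>ca. \<forall>p\<in>S. (\<lambda>t. foldr (pder sh) cs f (sh ca t p)) field_differentiable at 0)"
  proof (cases cs rule: rev_cases)
   case Nil
   with R show ?thesis by auto
  next
   case (snoc ds c)
   then show ?thesis using R unfolding smooth_along_def by simp
  qed
 qed
qed

lemma smooth_along_continuous: "smooth_along sh S f ==> continuous_on S f"
 and smooth_along_differentiable: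
  "smooth_along sh S f ==> p \<in> S ==> (\<lambda>t. f (sh c t p)) field_differentiable at 0"
 and smooth_along_pder: "smooth_along sh S f ==> smooth_along sh S (pder sh c f)"
 by (drule smooth_along_iff[THEN iffD1], blast)+

lemma smooth_along_subset: "smooth_along sh S f ==> T \<subseteq> S ==> smooth_along sh T f"
 unfolding smooth_along_def by (meson continuous_on_subset subsetD)

lemma smooth_along_local:
 fixes S :: "'p::topological_space set"
 assumes "\<And>p. p \<in> S ==> \<exists>T. open T \<and> p \<in> T \<and> smooth_along sh T f"
 shows "smooth_along sh S f"
 unfolding smooth_along_def
proof (intro allI conjI ballI)
 fix cs
 show "continuous_on S (foldr (pder sh) cs f)"
  unfolding continuous_on_def
 proof
  fix p assume "p \<in> S"
  then obtain T where T: "open T" "p \<in> T" "smooth_along sh T f" using assms by blast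
  then have "(foldr (pder sh) cs f \<longlongrightarrow> foldr (pder sh) cs f p) (at p)"
   unfolding smooth_along_def continuous_on_def using at_within_open by metis
  then show "(foldr (pder sh) cs f \<longlongrightarrow> foldr (pder sh) cs f p) (at p within S)"
   by (rule tendsto_mono[OF at_le, rotated]) simp
 qed
next
 fix cs c p assume "p \<in> S"
 then obtain T where "open T" "p \<in> T" "smooth_along sh T f" using assms by blast
 then show "(\<lambda>t. foldr (pder sh) cs f (sh c t p)) field_differentiable at 0"
  unfolding smooth_along_def by blast
qed

lemma continuous_on_open_tendsto:
 assumes "open S" "continuous_on S f" "p \<in> S"
 shows "(f \<longlongrightarrow> f p) (nhds p)"
proof -
 have "(f \<longlongrightarrow> f p) (at p within S)" using assms(2,3) unfolding continuous_on_def by blast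
 then show ?thesis by (simp add: at_within_open[OF assms(3,1)] tendsto_at_iff_tendsto_nhds)
qed

lemma pder_const [simp]: "pder sh c (\<lambda>p. k) = (\<lambda>p. 0)"
 by (simp add: pder_def fun_eq_iff)

lemma pderI: "((\<lambda>t. f (sh c t p)) has_real_derivative D) (at 0) ==> pder sh c f p = D"
 unfolding pder_def by (rule DERIV_imp_deriv)

context commuting_flows
begin

lemma sh_tendsto:
 assumes "(a \<longlongrightarrow> t) F" "(b \<longlongrightarrow> p) F"
 shows "((\<lambda>x. sh c (a x) (b x)) \<longlongrightarrow> sh c t p) F"
proof -
 have "((\<lambda>x. (\<lambda>(t, p). sh c t p) (a x, b x)) \<longlongrightarrow> (\<lambda>(t, p). sh c t p) (t, p)) F"
  by (rule continuous_on_tendsto_compose[OF sh_cont]) (auto intro!: tendsto_intros assms)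
 then show ?thesis by simp
qed

lemma eventually_sh_in:
 assumes "open S" "sh c t p \<in> S"
 shows "eventually (\<lambda>u. sh c u p \<in> S) (nhds t)"
 by (rule topological_tendstoD[OF _ assms])
   (rule sh_tendsto, simp_all add: filterlim_ident)

lemma pder_cong:
 assumes "open S" "p \<in> S" "\<And>p. p \<in> S ==> f p = g p"
 shows "pder sh c f p = pder sh c g p"
 unfolding pder_def
proof (rule deriv_cong_ev)
 have "eventually (\<lambda>u. sh c u p \<in> S) (nhds 0)" by (rule eventually_sh_in) (simp_all add: assms)
 then show "\<forall>\<^sub>F x in nhds 0. f (sh c x p) = g (sh c x p)"
  by (rule eventually_mono) (rule assms(3))
qed simp

lemma differentiable_cong:
 assumes "open S" "p \<in> S" "\<And>p. p \<in> S ==> f p = g p"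
  and "(\<lambda>t. f (sh c t p)) field_differentiable at 0"
 shows "(\<lambda>t. g (sh c t p)) field_differentiable at 0"
proof -
 have "eventually (\<lambda>u. sh c u p \<in> S) (nhds 0)" by (rule eventually_sh_in) (simp_all add: assms)
 then have ev: "\<forall>\<^sub>F x in nhds 0. f (sh c x p) = g (sh c x p)"
  by (rule eventually_mono) (rule assms(3))
 from assms(4) obtain D where "((\<lambda>t. f (sh c t p)) has_field_derivative D) (at 0)"
  unfolding field_differentiable_def by blast
 then have "((\<lambda>t. g (sh c t p)) has_field_derivative D) (at 0)"
  using DERIV_cong_ev[OF refl ev refl] by blast
 then show ?thesis unfolding field_differentiable_def by blast
qed

text \<open>To see that a function is smooth it suffices to place it in a class of differentiable functions
 closed under partial derivatives. Products, quotients and compositions are treated in this way.\<close>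

lemma smooth_along_coinduct:
 assumes S: "open S" and X: "X f"
  and cont: "\<And>g. X g ==> continuous_on S g"
  and diff: "\<And>g c p. X g ==> p \<in> S ==> (\<lambda>t. g (sh c t p)) field_differentiable at 0"
  and der: "\<And>g c. X g ==> \<exists>g'. X g' \<and> (\<forall>p\<in>S. pder sh c g p = g' p)"
 shows "smooth_along sh S f"
 unfolding smooth_along_def
proof
 fix cs
 have "\<exists>g. X g \<and> (\<forall>p\<in>S. foldr (pder sh) cs f p = g p)"
 proof (induction cs)
  case Nil
  then show ?case using X by auto
 next
  case (Cons c cs)
  then obtain g where g: "X g" "\<forall>p\<in>S. foldr (pder sh) cs f p = g p" by blast
  obtain g' where g': "X g'" "\<forall>p\<in>S. pder sh c g p = g' p" using der[OF g(1)] by blast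
  have "foldr (pder sh) (c # cs) f p = g' p" if "p \<in> S" for p
   using pder_cong[OF S that, of "foldr (pder sh) cs f" g c] g g' that by simp
  with g'(1) show ?case by blast
 qed
 then obtain g where g: "X g" "\<forall>p\<in>S. foldr (pder sh) cs f p = g p" by blast
 have "continuous_on S (foldr (pder sh) cs f)"
  using cont[OF g(1)] continuous_on_cong[OF refl, of S "foldr (pder sh) cs f" g] g(2) by simp
 moreover have "(\<lambda>t. foldr (pder sh) cs f (sh c t p)) field_differentiable at 0" if "p \<in> S" for c p
  by (rule differentiable_cong[OF S that _ diff[OF g(1) that]]) (use g(2) in auto)
 ultimately show "continuous_on S (foldr (pder sh) cs f) \<and>
  (\<forall>c. \<forall>p\<in>S. (\<lambda>t. foldr (pder sh) cs f (sh c t p)) field_differentiable at 0)" by blast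
qed

lemma smooth_along_cong:
 assumes "open S" "smooth_along sh S f" "\<And>p. p \<in> S ==> f p = g p"
 shows "smooth_along sh S g"
proof (rule smooth_along_coinduct[where X = "\<lambda>g. \<exists>f. smooth_along sh S f \<and> (\<forall>p\<in>S. f p = g p)"])
 show "open S" "\<exists>f. smooth_along sh S f \<and> (\<forall>p\<in>S. f p = g p)" using assms by auto
 fix g assume "\<exists>f. smooth_along sh S f \<and> (\<forall>p\<in>S. f p = g p)"
 then obtain f where f: "smooth_along sh S f" "\<forall>p\<in>S. f p = g p" by blast
 show "continuous_on S g" 
  using smooth_along_continuous[OF f(1)] continuous_on_cong[OF refl, of S f g] f(2) by simp
 show "(\<lambda>t. g (sh c t p)) field_differentiable at 0" if "p \<in> S" for c p
  by (rule differentiable_cong[OF assms(1) that _ smooth_along_differentiable[OF f(1) that]])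
    (use f in auto)
 show "\<exists>g'. (\<exists>f. smooth_along sh S f \<and> (\<forall>p\<in>S. f p = g' p)) \<and> (\<forall>p\<in>S. pder sh c g p = g' p)" for c
  using pder_cong[OF assms(1), of _ g f c] f smooth_along_pder[OF f(1), of c] by metis
qed

lemma smooth_DERIV_at:
 assumes "open S" "smooth_along sh S f" "sh c t p \<in> S"
 shows "((\<lambda>u. f (sh c u p)) has_real_derivative pder sh c f (sh c t p)) (at t)"
proof -
 have "(\<lambda>u. f (sh c u (sh c t p))) field_differentiable at 0"
  by (rule smooth_along_differentiable[OF assms(2,3)])
 then have "((\<lambda>u. f (sh c u (sh c t p))) has_real_derivative pder sh c f (sh c t p)) (at 0)"
  unfolding pder_def using field_differentiable_derivI by blast
 then have "((\<lambda>u. f (sh c (u + t) p)) has_real_derivative pder sh c f (sh c t p)) (at 0)"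
  by (simp add: sh_add)
 then show ?thesis using DERIV_shift[of "\<lambda>u. f (sh c u p)" _ 0 t] by simp
qed

lemma smooth_DERIV:
 assumes "smooth_along sh S f" "p \<in> S"
 shows "((\<lambda>u. f (sh c u p)) has_real_derivative pder sh c f p) (at 0)"
 unfolding pder_def using smooth_along_differentiable[OF assms] field_differentiable_derivI by blast

lemma smooth_const [simp]: "smooth_along sh S (\<lambda>p. k)"
proof -
 have *: "\<exists>k'. foldr (pder sh) cs (\<lambda>p. k) = (\<lambda>p. k')" for cs
  by (induction cs) auto
 show ?thesis unfolding smooth_along_def
 proof
  fix cs
  obtain k' where "foldr (pder sh) cs (\<lambda>p. k) = (\<lambda>p. k')" using * by blast
  then show "continuous_on S (foldr (pder sh) cs (\<lambda>p. k)) \<and>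
   (\<forall>c. \<forall>p\<in>S. (\<lambda>t. foldr (pder sh) cs (\<lambda>p. k) (sh c t p)) field_differentiable at 0)" by simp
 qed
qed

lemma pder_add:
 assumes "smooth_along sh S f" "smooth_along sh S g" "p \<in> S"
 shows "pder sh c (\<lambda>p. f p + g p) p = pder sh c f p + pder sh c g p"
 by (rule pderI) (intro derivative_intros smooth_DERIV[OF assms(1)] smooth_DERIV[OF assms(2)] assms)

lemma pder_mult:
 assumes "smooth_along sh S f" "smooth_along sh S g" "p \<in> S"
 shows "pder sh c (\<lambda>p. f p * g p) p = pder sh c f p * g p + f p * pder sh c g p"
 by (rule pderI, rule DERIV_cong,
   rule DERIV_mult[OF smooth_DERIV[OF assms(1,3)] smooth_DERIV[OF assms(2,3)]]) simp

lemma smooth_add: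
 assumes S: "open S" and "smooth_along sh S f" "smooth_along sh S g"
 shows "smooth_along sh S (\<lambda>p. f p + g p)"
proof (rule smooth_along_coinduct[OF S, where
   X = "\<lambda>h. \<exists>f g. smooth_along sh S f \<and> smooth_along sh S g \<and> h = (\<lambda>p. f p + g p)"])
 show "\<exists>f' g'. smooth_along sh S f' \<and> smooth_along sh S g' \<and> (\<lambda>p. f p + g p) = (\<lambda>p. f' p + g' p)"
  using assms by blast
 fix h assume "\<exists>f g. smooth_along sh S f \<and> smooth_along sh S g \<and> h = (\<lambda>p. f p + g p)"
 then obtain f g where fg: "smooth_along sh S f" "smooth_along sh S g" and h: "h = (\<lambda>p. f p + g p)"
  by blast
 show "continuous_on S h" unfolding h
  by (intro continuous_intros smooth_along_continuous[OF fg(1)] smooth_along_continuous[OF fg(2)])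
 show "(\<lambda>t. h (sh c t p)) field_differentiable at 0" if "p \<in> S" for c p unfolding h
  by (intro derivative_intros smooth_along_differentiable[OF fg(1)]
     smooth_along_differentiable[OF fg(2)] that)
 show "\<exists>h'. (\<exists>f g. smooth_along sh S f \<and> smooth_along sh S g \<and> h' = (\<lambda>p. f p + g p)) \<and>
   (\<forall>p\<in>S. pder sh c h p = h' p)" for c
  unfolding h using pder_add[OF fg, of _ c] smooth_along_pder[OF fg(1), of c]
   smooth_along_pder[OF fg(2), of c] by blast
qed

text \<open>By the Leibniz rule, finite sums of products of smooth functions are closed under
 partial derivatives.\<close>

lemma smooth_mult:
 assumes S: "open S" and "smooth_along sh S f" "smooth_along sh S g"
 shows "smooth_along sh S (\<lambda>p. f p * g p)"
proof -
 define X where "X h \<longleftrightarrow> (\<exists>L. (\<forall>(f, g)\<in>set L. smooth_along sh S f \<and> smooth_along sh S g) \<and>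
   h = (\<lambda>p. \<Sum>(f, g)\<leftarrow>L. f p * g p))" for h
 have pr: "continuous_on S (\<lambda>p. \<Sum>(f, g)\<leftarrow>L. f p * g p) \<and>
   (\<forall>c. \<forall>p\<in>S. (\<lambda>t. \<Sum>(f, g)\<leftarrow>L. f (sh c t p) * g (sh c t p)) field_differentiable at 0) \<and>
   (\<forall>c. \<forall>p\<in>S. pder sh c (\<lambda>p. \<Sum>(f, g)\<leftarrow>L. f p * g p) p =
    (\<Sum>(f, g)\<leftarrow>concat (map (\<lambda>(f, g). [(pder sh c f, g), (f, pder sh c g)]) L). f p * g p))"
  if "\<forall>(f, g)\<in>set L. smooth_along sh S f \<and> smooth_along sh S g" for L
  using that
 proof (induction L)
  case Nil
  then show ?case by simp
 next
  case (Cons a L)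
  obtain f g where a: "a = (f, g)" by (cases a)
  with Cons.prems have fg: "smooth_along sh S f" "smooth_along sh S g" by auto
  define R where "R = (\<lambda>p. \<Sum>(f, g)\<leftarrow>L. f p * g p)"
  have R: "continuous_on S R" "\<And>c p. p \<in> S ==> (\<lambda>t. R (sh c t p)) field_differentiable at 0"
   "\<And>c p. p \<in> S ==> pder sh c R p =
    (\<Sum>(f, g)\<leftarrow>concat (map (\<lambda>(f, g). [(pder sh c f, g), (f, pder sh c g)]) L). f p * g p)"
   using Cons unfolding R_def by auto
  have D: "((\<lambda>u. R (sh c u p)) has_real_derivative pder sh c R p) (at 0)" if "p \<in> S" for c p
   unfolding pder_def using R(2)[OF that] field_differentiable_derivI by blast
  have "pder sh c (\<lambda>p. f p * g p + R p) p = pder sh c f p * g p + f p * pder sh c g p + pder sh c R p"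
   if "p \<in> S" for c p
   by (rule pderI, rule DERIV_cong, rule DERIV_add[OF DERIV_mult[OF smooth_DERIV[OF fg(1) that]
     smooth_DERIV[OF fg(2) that]] D[OF that]]) simp
  then have 1: "pder sh c (\<lambda>p. \<Sum>(f, g)\<leftarrow>a # L. f p * g p) p =
    (\<Sum>(f, g)\<leftarrow>concat (map (\<lambda>(f, g). [(pder sh c f, g), (f, pder sh c g)]) (a # L)). f p * g p)"
   if "p \<in> S" for c p
   using R(3)[OF that] that by (simp add: a R_def)
  have "continuous_on S (\<lambda>p. f p * g p + R p)"
   by (intro continuous_intros smooth_along_continuous[OF fg(1)] smooth_along_continuous[OF fg(2)] R(1))
  then have 2: "continuous_on S (\<lambda>p. \<Sum>(f, g)\<leftarrow>a # L. f p * g p)" by (simp add: a R_def)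
  have "(\<lambda>t. f (sh c t p) * g (sh c t p) + R (sh c t p)) field_differentiable at 0"
   if "p \<in> S" for c p
   by (intro derivative_intros smooth_along_differentiable[OF fg(1)]
     smooth_along_differentiable[OF fg(2)] that R(2))
  then have 3: "(\<lambda>t. \<Sum>(f, g)\<leftarrow>a # L. f (sh c t p) * g (sh c t p)) field_differentiable at 0"
   if "p \<in> S" for c p using that by (simp add: a R_def)
  show ?case using 1 2 3 by blast
 qed
 show ?thesis
 proof (rule smooth_along_coinduct[OF S, where X = X])
  show "X (\<lambda>p. f p * g p)" unfolding X_def by (rule exI[of _ "[(f, g)]"]) (use assms in auto)
  fix h assume "X h"
  then obtain L where L: "\<forall>(f, g)\<in>set L. smooth_along sh S f \<and> smooth_along sh S g"
   and h: "h = (\<lambda>p. \<Sum>(f, g)\<leftarrow>L. f p * g p)" unfolding X_def by blast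
  note * = pr[OF L]
  show "continuous_on S h" using * h by auto
  show "(\<lambda>t. h (sh c t p)) field_differentiable at 0" if "p \<in> S" for c p using * h that by auto
  show "\<exists>h'. X h' \<and> (\<forall>p\<in>S. pder sh c h p = h' p)" for c
  proof (intro exI conjI)
   show "X (\<lambda>p. \<Sum>(f, g)\<leftarrow>concat (map (\<lambda>(f, g). [(pder sh c f, g), (f, pder sh c g)]) L). f p * g p)"
    unfolding X_def
    by (rule exI, rule conjI[OF _ refl]) (use L smooth_along_pder in fastforce)
   show "\<forall>p\<in>S. pder sh c h p = (\<Sum>(f, g)\<leftarrow>concat (map (\<lambda>(f, g). [(pder sh c f, g), (f, pder sh c g)]) L). f p * g p)"
    using * h by auto
  qed
 qed
qed

lemma smooth_cmult: "open S ==> smooth_along sh S f ==> smooth_along sh S (\<lambda>p. k * f p)"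
 by (rule smooth_mult) auto

lemma smooth_minus: "open S ==> smooth_along sh S f ==> smooth_along sh S (\<lambda>p. - f p)"
 using smooth_cmult[of S f "-1"] by simp

lemma smooth_diff:
 "open S ==> smooth_along sh S f ==> smooth_along sh S g ==> smooth_along sh S (\<lambda>p. f p - g p)"
 using smooth_add[of S f "\<lambda>p. - g p"] smooth_minus[of S g] by simp

lemma smooth_sum:
 assumes "open S" "\<And>k. k \<in> K ==> smooth_along sh S (f k)"
 shows "smooth_along sh S (\<lambda>p. \<Sum>k\<in>K. f k p)"
 using assms(2) by (induction K rule: infinite_finite_induct) (auto intro: smooth_add assms(1))

lemma smooth_prod:
 assumes "open S" "\<And>k. k \<in> K ==> smooth_along sh S (f k)"
 shows "smooth_along sh S (\<lambda>p. \<Prod>k\<in>K. f k p)"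
 using assms(2) by (induction K rule: infinite_finite_induct) (auto intro: smooth_mult assms(1))

lemma smooth_power:
 assumes "open S" "smooth_along sh S f"
 shows "smooth_along sh S (\<lambda>p. f p ^ k)"
 by (induction k) (auto intro: smooth_mult assms)

lemma pder_cmult:
 "smooth_along sh S f ==> p \<in> S ==> pder sh c (\<lambda>p. k * f p) p = k * pder sh c f p"
 using pder_mult[of S "\<lambda>p. k" f p c] by simp

lemma pder_minus:
 "smooth_along sh S f ==> p \<in> S ==> pder sh c (\<lambda>p. - f p) p = - pder sh c f p"
 using pder_cmult[of S f p c "-1"] by simp

lemma pder_sum:
 assumes "open S" "\<And>k. k \<in> K ==> smooth_along sh S (f k)" "p \<in> S"
 shows "pder sh c (\<lambda>p. \<Sum>k\<in>K. f k p) p = (\<Sum>k\<in>K. pder sh c (f k) p)"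
 using assms(2)
proof (induction K rule: infinite_finite_induct)
 case (insert x F)
 have "smooth_along sh S (\<lambda>p. \<Sum>k\<in>F. f k p)" 
  by (rule smooth_sum[OF assms(1)]) (use insert.prems in auto)
 then show ?case using insert by (simp add: pder_add[OF _ _ assms(3)])
qed simp_all

lemma flow_mvt:
 assumes S: "open S" "smooth_along sh S f" and in_S: "\<And>u. \<bar>u\<bar> \<le> \<bar>x\<bar> ==> sh c u q \<in> S"
 shows "\<exists>\<theta>. \<bar>\<theta>\<bar> \<le> \<bar>x\<bar> \<and> f (sh c x q) - f q = x * pder sh c f (sh c \<theta> q)"
proof -
 have D: "((\<lambda>u. f (sh c u q)) has_real_derivative pder sh c f (sh c u q)) (at u)"
  if "\<bar>u\<bar> \<le> \<bar>x\<bar>" for u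
  by (rule smooth_DERIV_at[OF S in_S[OF that]])
 consider "x = 0" | "x > 0" | "x < 0" by linarith
 then show ?thesis
 proof cases
  case 2
  have "\<exists>z>0. z < x \<and> f (sh c x q) - f (sh c 0 q) = (x - 0) * pder sh c f (sh c z q)"
   by (rule MVT2[OF 2]) (use D in auto)
  then show ?thesis by force
 next
  case 3
  have "\<exists>z>x. z < 0 \<and> f (sh c 0 q) - f (sh c x q) = (0 - x) * pder sh c f (sh c z q)"
   by (rule MVT2[OF 3]) (use D in auto)
  then obtain z where "z > x" "z < 0" "f (sh c 0 q) - f (sh c x q) = (0 - x) * pder sh c f (sh c z q)"
   by blast
  then show ?thesis by (intro exI[of _ z]) (auto simp: algebra_simps)
 qed auto
qed

lemma small_box:
 assumes "open S" "p \<in> S"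
 obtains e where "e > 0" "\<And>s t. \<bar>s\<bar> < e ==> \<bar>t\<bar> < e ==> sh c s (sh d t p) \<in> S"
proof -
 have "((\<lambda>x. fst x) \<longlongrightarrow> fst (0, 0)) (nhds (0::real, 0::real))"
  "((\<lambda>x. snd x) \<longlongrightarrow> snd (0, 0)) (nhds (0::real, 0::real))"
  using tendsto_fst[OF filterlim_ident[of "nhds (0::real, 0::real)"]]
   tendsto_snd[OF filterlim_ident[of "nhds (0::real, 0::real)"]] by simp_all
 then have "((\<lambda>x. sh c (fst x) (sh d (snd x) p)) \<longlongrightarrow> sh c (fst (0, 0)) (sh d (snd (0, 0)) p)) (nhds (0::real, 0::real))"
  by (intro sh_tendsto tendsto_const)
 then have "eventually (\<lambda>x. sh c (fst x) (sh d (snd x) p) \<in> S) (nhds (0::real, 0::real))"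
  by (rule topological_tendstoD) (use assms in auto)
 then obtain \<delta> where \<delta>: "\<delta> > 0"
  "\<And>x. dist x (0::real, 0::real) < \<delta> ==> sh c (fst x) (sh d (snd x) p) \<in> S"
  unfolding eventually_nhds_metric by blast
 show thesis
 proof (rule that[of "\<delta> / 2"])
  fix s t :: real assume "\<bar>s\<bar> < \<delta> / 2" "\<bar>t\<bar> < \<delta> / 2"
  moreover have "dist (s, t) (0, 0) \<le> \<bar>s\<bar> + \<bar>t\<bar>"
   by (simp add: dist_Pair_Pair sqrt_sum_squares_le_sum_abs)
  ultimately have "dist (s, t) (0, 0) < \<delta>" by linarith
  from \<delta>(2)[OF this] show "sh c s (sh d t p) \<in> S" by simp
 qed (use \<delta> in simp)
qed

text \<open>Schwarz: the second difference quotient is symmetric, and by the mean value theorem it is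
 a value of either mixed derivative close to \<open>p\<close>.\<close>

lemma second_difference:
 assumes S: "open S" "smooth_along sh S f"
  and box: "\<And>s t. \<bar>s\<bar> < e ==> \<bar>t\<bar> < e ==> sh c s (sh d t p) \<in> S"
  and h: "0 < h" "h < e"
 shows "\<exists>s t. 0 < s \<and> s < h \<and> 0 < t \<and> t < h \<and>
   f (sh c h (sh d h p)) - f (sh c h p) - f (sh d h p) + f p =
    h * h * pder sh d (pder sh c f) (sh c s (sh d t p))"
proof -
 have box': "sh d t (sh c s p) \<in> S" if "\<bar>s\<bar> < e" "\<bar>t\<bar> < e" for s t
  using box[OF that] by (simp add: sh_commute[of d])
 have "\<exists>s>0. s < h \<and> (f (sh c h (sh d h p)) - f (sh c h p)) - (f (sh c 0 (sh d h p)) - f (sh c 0 p)) =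
   (h - 0) * (pder sh c f (sh c s (sh d h p)) - pder sh c f (sh c s p))"
  by (rule MVT2[OF h(1)], intro derivative_intros smooth_DERIV_at[OF S])
    (use box[of _ h] box[of _ 0] h in auto)
 then obtain s where s: "0 < s" "s < h" and 1: "(f (sh c h (sh d h p)) - f (sh c h p)) - (f (sh d h p) - f p) =
   h * (pder sh c f (sh c s (sh d h p)) - pder sh c f (sh c s p))" by auto
 have "\<exists>t>0. t < h \<and> pder sh c f (sh d h (sh c s p)) - pder sh c f (sh d 0 (sh c s p)) =
   (h - 0) * pder sh d (pder sh c f) (sh d t (sh c s p))"
  by (rule MVT2[OF h(1)], rule smooth_DERIV_at[OF S(1) smooth_along_pder[OF S(2)]])
    (use box' s h in auto)
 then obtain t where t: "0 < t" "t < h" and 2: "pder sh c f (sh d h (sh c s p)) - pder sh c f (sh c s p) =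
   h * pder sh d (pder sh c f) (sh d t (sh c s p))" by auto
 have "f (sh c h (sh d h p)) - f (sh c h p) - f (sh d h p) + f p =
   h * (pder sh c f (sh c s (sh d h p)) - pder sh c f (sh c s p))" using 1 by linarith
 also have "\<dots> = h * h * pder sh d (pder sh c f) (sh c s (sh d t p))"
  using 2 by (simp add: sh_commute[of d])
 finally show ?thesis using s t by blast
qed

lemma pder_commute:
 assumes S: "open S" "smooth_along sh S f" and p: "p \<in> S"
 shows "pder sh c (pder sh d f) p = pder sh d (pder sh c f) p" (is "?A p = ?B p")
proof (rule ccontr)
 assume ne: "?A p \<noteq> ?B p"
 define \<epsilon> where "\<epsilon> = \<bar>?A p - ?B p\<bar> / 2"
 have "\<epsilon> > 0" using ne by (simp add: \<epsilon>_def)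
 have cA: "continuous_on S ?A" and cB: "continuous_on S ?B"
  using S(2) by (auto intro!: smooth_along_continuous smooth_along_pder)
 define N where "N = {q\<in>S. \<bar>?A q - ?A p\<bar> < \<epsilon>} \<inter> {q\<in>S. \<bar>?B q - ?B p\<bar> < \<epsilon>}"
 have "open {q\<in>S. \<bar>?A q - ?A p\<bar> < \<epsilon>}"
 proof -
  have "open (?A -` ball (?A p) \<epsilon> \<inter> S)" using continuous_open_preimage[OF cA S(1)] by (simp add: Int_commute)
  moreover have "?A -` ball (?A p) \<epsilon> \<inter> S = {q\<in>S. \<bar>?A q - ?A p\<bar> < \<epsilon>}"
   by (auto simp: dist_real_def abs_minus_commute)
  ultimately show ?thesis by simp
 qed
 moreover have "open {q\<in>S. \<bar>?B q - ?B p\<bar> < \<epsilon>}"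
 proof -
  have "open (?B -` ball (?B p) \<epsilon> \<inter> S)" using continuous_open_preimage[OF cB S(1)] by (simp add: Int_commute)
  moreover have "?B -` ball (?B p) \<epsilon> \<inter> S = {q\<in>S. \<bar>?B q - ?B p\<bar> < \<epsilon>}"
   by (auto simp: dist_real_def abs_minus_commute)
  ultimately show ?thesis by simp
 qed
 ultimately have N: "open N" "p \<in> N" using p \<open>\<epsilon> > 0\<close> by (auto simp: N_def)
 obtain e where e: "e > 0" "\<And>s t. \<bar>s\<bar> < e ==> \<bar>t\<bar> < e ==> sh c s (sh d t p) \<in> N"
  using small_box[OF N] by blast
 have e1: "sh c s (sh d t p) \<in> S" and e2: "sh d s (sh c t p) \<in> S" and e3: "sh d s (sh c t p) \<in> N"
  if "\<bar>s\<bar> < e" "\<bar>t\<bar> < e" for s t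
  using e(2)[OF that] e(2)[OF that(2,1)] by (auto simp: N_def sh_commute[of d])
 define h where "h = e / 2"
 have h: "0 < h" "h < e" using e by (auto simp: h_def)
 obtain s t where st: "0 < s" "s < h" "0 < t" "t < h"
  "f (sh c h (sh d h p)) - f (sh c h p) - f (sh d h p) + f p = h * h * ?B (sh c s (sh d t p))"
  using second_difference[OF S e1 h] by blast
 obtain s' t' where st': "0 < s'" "s' < h" "0 < t'" "t' < h"
  "f (sh d h (sh c h p)) - f (sh d h p) - f (sh c h p) + f p = h * h * ?A (sh d s' (sh c t' p))"
  using second_difference[OF S e2 h] by blast
 have "h * h * ?B (sh c s (sh d t p)) = h * h * ?A (sh d s' (sh c t' p))"
  using st(5) st'(5) unfolding sh_commute[of d h c h] by linarith
 then have eq: "?B (sh c s (sh d t p)) = ?A (sh d s' (sh c t' p))" using h by simp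
 have "sh c s (sh d t p) \<in> N" "sh d s' (sh c t' p) \<in> N" using e(2) e3 st st' h by auto
 then have "\<bar>?B (sh c s (sh d t p)) - ?B p\<bar> < \<epsilon>" "\<bar>?A (sh d s' (sh c t' p)) - ?A p\<bar> < \<epsilon>"
  by (auto simp: N_def)
 then have "\<bar>?A p - ?B p\<bar> < 2 * \<epsilon>" using eq by linarith
 then show False by (simp add: \<epsilon>_def)
qed

lemma foldr_sh_tendsto:
 assumes "\<And>c. c \<in> set cs ==> (\<delta> c \<longlongrightarrow> 0) F"
 shows "((\<lambda>t. foldr (\<lambda>c. sh c (\<delta> c t)) cs p) \<longlongrightarrow> p) F"
 using assms
proof (induction cs)
 case (Cons c cs)
 have "((\<lambda>t. sh c (\<delta> c t) (foldr (\<lambda>c. sh c (\<delta> c t)) cs p)) \<longlongrightarrow> sh c 0 p) F"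
  by (rule sh_tendsto) (use Cons in auto)
 then show ?case by simp
qed simp

text \<open>Moving along several coordinates one after another reduces the chain rule to single
 coordinates; continuity of the partial derivatives allows the base point to move.\<close>

lemma chain_list:
 fixes \<delta> :: "'c => real => real"
 assumes S: "open S" "smooth_along sh S f" "p \<in> S"
  and "\<And>c. c \<in> set cs ==> \<delta> c 0 = 0"
  and "\<And>c. c \<in> set cs ==> (\<delta> c has_real_derivative \<delta>' c) (at 0)"
 shows "((\<lambda>t. f (foldr (\<lambda>c. sh c (\<delta> c t)) cs p)) has_real_derivative
      (\<Sum>c\<leftarrow>cs. \<delta>' c * pder sh c f p)) (at 0)"
 using assms(4,5)
proof (induction cs)
 case Nil
 then show ?case by simp
next
 case (Cons c cs)
 define r where "r t = foldr (\<lambda>c. sh c (\<delta> c t)) cs p" for t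
 have d0: "\<delta> c 0 = 0" and d1: "(\<delta> c has_real_derivative \<delta>' c) (at 0)" using Cons by auto
 have lim: "(\<delta> k \<longlongrightarrow> 0) (at 0)" if "k \<in> set (c # cs)" for k
  using DERIV_isCont[OF Cons.prems(2)[OF that]] Cons.prems(1)[OF that] unfolding isCont_def by simp
 have r0: "r 0 = p" unfolding r_def using Cons.prems(1)
  by (induction cs) auto
 have rlim: "(r \<longlongrightarrow> p) (at 0)" unfolding r_def by (rule foldr_sh_tendsto) (use lim in auto)
 have IH: "((\<lambda>t. f (r t)) has_real_derivative (\<Sum>c\<leftarrow>cs. \<delta>' c * pder sh c f p)) (at 0)"
  unfolding r_def using Cons by auto
 have ev: "\<forall>\<^sub>F t in at 0. \<exists>\<theta>. \<bar>\<theta>\<bar> \<le> \<bar>\<delta> c t\<bar> \<and>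
   f (sh c (\<delta> c t) (r t)) - f (r t) = \<delta> c t * pder sh c f (sh c \<theta> (r t))"
 proof -
  have "((\<lambda>x. sh c (fst x) (snd x)) \<longlongrightarrow> sh c (fst (0::real, p)) (snd (0::real, p))) (nhds (0::real, p))"
   by (rule sh_tendsto[OF tendsto_fst[OF filterlim_ident] tendsto_snd[OF filterlim_ident]])
  then have "eventually (\<lambda>x. sh c (fst x) (snd x) \<in> S) (nhds (0::real, p))"
   by (rule topological_tendstoD) (use S in auto)
  then obtain M where M: "open M" "(0, p) \<in> M" "\<And>x. x \<in> M ==> sh c (fst x) (snd x) \<in> S"
   unfolding eventually_nhds by blast
  obtain A B where "open A" "open B" "(0, p) \<in> A \<times> B" "A \<times> B \<subseteq> M"
   using open_prod_elim[OF M(1,2)] by blast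
  then have AB: "open A" "open B" "0 \<in> A" "p \<in> B"
   and in_S: "\<And>u q. u \<in> A ==> q \<in> B ==> sh c u q \<in> S"
   using M(3) by force+
  obtain e where e: "e > 0" "ball 0 e \<subseteq> A" using AB openE by blast
  have "\<forall>\<^sub>F t in at 0. r t \<in> B" using topological_tendstoD[OF rlim] AB by blast
  moreover have "\<forall>\<^sub>F t in at 0. \<delta> c t \<in> ball 0 e"
   using topological_tendstoD[OF lim[of c], of "ball 0 e"] e by auto
  ultimately show ?thesis
  proof eventually_elim
   case (elim t)
   show ?case
   proof (rule flow_mvt[OF S(1,2)])
    fix u assume "\<bar>u\<bar> \<le> \<bar>\<delta> c t\<bar>"
    then have "u \<in> A" using elim e by (auto simp: dist_real_def subset_iff)
    then show "sh c u (r t) \<in> S" using in_S elim by blast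
   qed
  qed
 qed
 define \<theta> where "\<theta> t = (SOME \<theta>. \<bar>\<theta>\<bar> \<le> \<bar>\<delta> c t\<bar> \<and>
   f (sh c (\<delta> c t) (r t)) - f (r t) = \<delta> c t * pder sh c f (sh c \<theta> (r t)))" for t
 have \<theta>: "\<forall>\<^sub>F t in at 0. \<bar>\<theta> t\<bar> \<le> \<bar>\<delta> c t\<bar> \<and>
   f (sh c (\<delta> c t) (r t)) - f (r t) = \<delta> c t * pder sh c f (sh c (\<theta> t) (r t))"
  using ev by (rule eventually_mono) (unfold \<theta>_def, rule someI_ex)
 have \<theta>lim: "(\<theta> \<longlongrightarrow> 0) (at 0)"
 proof (rule Lim_null_comparison[where g = "\<lambda>t. \<bar>\<delta> c t\<bar>"])
  show "\<forall>\<^sub>F t in at 0. norm (\<theta> t) \<le> \<bar>\<delta> c t\<bar>" using \<theta> by (rule eventually_mono) simp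
  show "((\<lambda>t. \<bar>\<delta> c t\<bar>) \<longlongrightarrow> 0) (at 0)" using tendsto_rabs_zero[OF lim[of c]] by simp
 qed
 have plim: "((\<lambda>t. pder sh c f (sh c (\<theta> t) (r t))) \<longlongrightarrow> pder sh c f p) (at 0)"
 proof -
  have "(pder sh c f \<longlongrightarrow> pder sh c f p) (nhds p)"
   by (rule continuous_on_open_tendsto[OF S(1) smooth_along_continuous[OF smooth_along_pder[OF S(2)]] S(3)])
  moreover have "((\<lambda>t. sh c (\<theta> t) (r t)) \<longlongrightarrow> p) (at 0)"
   using sh_tendsto[OF \<theta>lim rlim, of c] by simp
  ultimately show ?thesis by (rule filterlim_compose)
 qed
 have qlim: "((\<lambda>t. \<delta> c t / t) \<longlongrightarrow> \<delta>' c) (at 0)"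
  using d1 d0 unfolding DERIV_def by simp
 have "((\<lambda>t. f (sh c (\<delta> c t) (r t)) - f (r t)) has_real_derivative \<delta>' c * pder sh c f p) (at 0)"
  unfolding DERIV_def
 proof (rule Lim_transform_eventually[OF tendsto_mult[OF qlim plim]])
  show "\<forall>\<^sub>F t in at 0. \<delta> c t / t * pder sh c f (sh c (\<theta> t) (r t)) =
   (f (sh c (\<delta> c (0 + t)) (r (0 + t))) - f (r (0 + t)) - (f (sh c (\<delta> c 0) (r 0)) - f (r 0))) / t"
   using \<theta> by (rule eventually_mono) (simp add: d0 r0)
 qed
 from DERIV_add[OF this IH] show ?case by (simp add: r_def)
qed

end

locale coordinate_flows = commuting_flows sh for sh :: "'c => real => 'p::topological_space => 'p" +
 fixes co :: "'c => 'p => real"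
 assumes co_sh: "co d (sh c t p) = co d p + (if d = c then t else 0)"
begin

text \<open>Along a path, a function of finitely many coordinates takes the values obtained by shifting only
 these coordinates. This makes the chain rule available on the jet space.\<close>

definition depends_on :: "'c set => 'p set => ('p => real) => bool" where
 "depends_on K S f \<longleftrightarrow> (\<forall>u\<in>S. \<forall>v\<in>S. (\<forall>k\<in>K. co k u = co k v) \<longrightarrow> f u = f v)"

lemma depends_on_pder:
 assumes "open S" "depends_on K S f"
 shows "depends_on K S (pder sh c f)"
 unfolding depends_on_def
proof (intro ballI impI)
 fix u v assume uv: "u \<in> S" "v \<in> S" "\<forall>k\<in>K. co k u = co k v"
 have "eventually (\<lambda>t. sh c t u \<in> S) (nhds 0)" "eventually (\<lambda>t. sh c t v \<in> S) (nhds 0)"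
  by (rule eventually_sh_in[OF assms(1)], simp add: uv)+
 then have "\<forall>\<^sub>F t in nhds 0. f (sh c t u) = f (sh c t v)"
 proof eventually_elim
  case (elim t)
  moreover have "\<forall>k\<in>K. co k (sh c t u) = co k (sh c t v)" using uv by (simp add: co_sh)
  ultimately show ?case using assms(2) unfolding depends_on_def by blast
 qed
 then show "pder sh c f u = pder sh c f v"
  unfolding pder_def by (rule deriv_cong_ev) simp
qed

lemma pder_independent:
 assumes "open S" "depends_on K S f" "c \<notin> K" "p \<in> S"
 shows "pder sh c f p = 0"
proof -
 have "eventually (\<lambda>t. sh c t p \<in> S) (nhds 0)"
  by (rule eventually_sh_in[OF assms(1)], simp add: assms)
 then have "\<forall>\<^sub>F t in nhds 0. f (sh c t p) = f p"
 proof eventually_elim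
  case (elim t)
  moreover have "\<forall>k\<in>K. co k (sh c t p) = co k p" using assms(3) by (auto simp: co_sh)
  ultimately show ?case using assms(2,4) unfolding depends_on_def by blast
 qed
 then have "deriv (\<lambda>t. f (sh c t p)) 0 = deriv (\<lambda>t. f p) 0" by (rule deriv_cong_ev) simp
 then show ?thesis unfolding pder_def by simp
qed

lemma co_foldr:
 "distinct cs ==> co d (foldr (\<lambda>c. sh c (\<delta> c)) cs p) = co d p + (if d \<in> set cs then \<delta> d else 0)"
 by (induction cs) (auto simp: co_sh)

lemma chain_rule_DERIV:
 fixes src :: "'d => real => 'q::topological_space => 'q"
 assumes src: "commuting_flows src" and S: "open S" "q \<in> S" and S': "open S'" "\<phi> ` S \<subseteq> S'"
  and F: "smooth_along sh S' F" "depends_on K S' F" and K: "finite K"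
  and \<phi>: "\<And>k. k \<in> K ==> smooth_along src S (\<lambda>q. co k (\<phi> q))"
 shows "((\<lambda>t. F (\<phi> (src c t q))) has_real_derivative
      (\<Sum>k\<in>K. pder src c (\<lambda>q. co k (\<phi> q)) q * pder sh k F (\<phi> q))) (at 0)"
proof -
 interpret src: commuting_flows src by (rule src)
 obtain cs where cs: "set cs = K" "distinct cs" using finite_distinct_list[OF K] by blast
 define \<delta> where "\<delta> k t = co k (\<phi> (src c t q)) - co k (\<phi> q)" for k t
 have \<delta>: "\<delta> k 0 = 0" "(\<delta> k has_real_derivative pder src c (\<lambda>q. co k (\<phi> q)) q) (at 0)" if "k \<in> set cs" for k
 proof -
  show "\<delta> k 0 = 0" by (simp add: \<delta>_def)
  show "(\<delta> k has_real_derivative pder src c (\<lambda>q. co k (\<phi> q)) q) (at 0)"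
   unfolding \<delta>_def by (rule DERIV_cong, rule DERIV_diff,
    rule src.smooth_DERIV[OF \<phi>[of k] S(2)]) (use that cs in auto)
 qed
 have p: "\<phi> q \<in> S'" using S S' by blast
 have chain: "((\<lambda>t. F (foldr (\<lambda>c. sh c (\<delta> c t)) cs (\<phi> q))) has_real_derivative
   (\<Sum>k\<leftarrow>cs. pder src c (\<lambda>q. co k (\<phi> q)) q * pder sh k F (\<phi> q))) (at 0)"
  by (rule chain_list[OF S'(1) F(1) p]) (use \<delta> in auto)
 have lim: "((\<lambda>t. foldr (\<lambda>c. sh c (\<delta> c t)) cs (\<phi> q)) \<longlongrightarrow> \<phi> q) (nhds 0)"
 proof (rule foldr_sh_tendsto)
  fix k assume k: "k \<in> set cs"
  show "(\<delta> k \<longlongrightarrow> 0) (nhds 0)"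
   using DERIV_isCont[OF \<delta>(2)[OF k]] \<delta>(1)[OF k] tendsto_at_iff_tendsto_nhds[of "\<delta> k" 0]
   unfolding isCont_def by simp
 qed
 have "eventually (\<lambda>t. foldr (\<lambda>c. sh c (\<delta> c t)) cs (\<phi> q) \<in> S') (nhds 0)"
  using topological_tendstoD[OF lim S'(1) p] .
 moreover have "eventually (\<lambda>t. src c t q \<in> S) (nhds 0)"
  by (rule src.eventually_sh_in[OF S(1)]) (simp add: S)
 ultimately have ev: "\<forall>\<^sub>F t in nhds 0. F (foldr (\<lambda>c. sh c (\<delta> c t)) cs (\<phi> q)) = F (\<phi> (src c t q))"
 proof eventually_elim
  case (elim t)
  then have "\<phi> (src c t q) \<in> S'" using S' by blast
  moreover have "co k (foldr (\<lambda>c. sh c (\<delta> c t)) cs (\<phi> q)) = co k (\<phi> (src c t q))" if "k \<in> K" for k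
   using co_foldr[OF cs(2), of k "\<lambda>c. \<delta> c t" "\<phi> q"] that cs by (simp add: \<delta>_def)
  ultimately show ?case using F(2) elim unfolding depends_on_def by blast
 qed
 have "(\<Sum>k\<leftarrow>cs. pder src c (\<lambda>q. co k (\<phi> q)) q * pder sh k F (\<phi> q)) =
   (\<Sum>k\<in>K. pder src c (\<lambda>q. co k (\<phi> q)) q * pder sh k F (\<phi> q))"
  using cs by (simp add: sum_list_distinct_conv_sum_set)
 with chain DERIV_cong_ev[OF refl ev refl] show ?thesis by simp
qed

lemma chain_rule:
 fixes src :: "'d => real => 'q::topological_space => 'q"
 assumes src: "commuting_flows src" and S: "open S" "q \<in> S" and S': "open S'" "\<phi> ` S \<subseteq> S'"
  and F: "smooth_along sh S' F" "depends_on K S' F" and K: "finite K"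
  and \<phi>: "\<And>k. k \<in> K ==> smooth_along src S (\<lambda>q. co k (\<phi> q))"
 shows "pder src c (\<lambda>q. F (\<phi> q)) q =
      (\<Sum>k\<in>K. pder src c (\<lambda>q. co k (\<phi> q)) q * pder sh k F (\<phi> q))"
 by (rule pderI) (rule chain_rule_DERIV[OF assms])

text \<open>By the chain rule, sums of products of a smooth function with a composite are closed under
 partial derivatives.\<close>

lemma smooth_compose:
 fixes src :: "'d => real => 'q::topological_space => 'q"
 assumes src: "commuting_flows src" and S: "open S" and S': "open S'" "\<phi> ` S \<subseteq> S'"
  and F: "smooth_along sh S' F" "depends_on K S' F" and K: "finite K"
  and \<phi>: "\<And>k. k \<in> K ==> smooth_along src S (\<lambda>q. co k (\<phi> q))"
  and cont: "continuous_on S \<phi>"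
 shows "smooth_along src S (\<lambda>q. F (\<phi> q))"
proof -
 interpret src: commuting_flows src by (rule src)
 define good where "good F \<longleftrightarrow> smooth_along sh S' F \<and> depends_on K S' F" for F
 \<comment> \<open>natural numbers index the sums, so that \<open>X\<close> does not depend on a type of indices\<close>
 define X where "X h \<longleftrightarrow> (\<exists>(I :: nat set) s G. finite I \<and> (\<forall>i\<in>I. smooth_along src S (s i) \<and> good (G i)) \<and>
   h = (\<lambda>q. \<Sum>i\<in>I. s i q * G i (\<phi> q)))" for h
 obtain \<kappa> :: "'c => nat" where \<kappa>: "inj_on \<kappa> K" using finite_imp_inj_to_nat_seg[OF K] by blast
 have Xadd: "X (\<lambda>q. f q + g q)" if fg: "X f" "X g" for f g
 proof -
  obtain I :: "nat set" and s G where f: "finite I" "\<forall>i\<in>I. smooth_along src S (s i) \<and> good (G i)"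
   "f = (\<lambda>q. \<Sum>i\<in>I. s i q * G i (\<phi> q))" using fg(1) unfolding X_def by blast
  obtain J :: "nat set" and t H where g: "finite J" "\<forall>i\<in>J. smooth_along src S (t i) \<and> good (H i)"
   "g = (\<lambda>q. \<Sum>i\<in>J. t i q * H i (\<phi> q))" using fg(2) unfolding X_def by blast
  define u where "u i = (if even i then s (i div 2) else t (i div 2))" for i
  define U where "U i = (if even i then G (i div 2) else H (i div 2))" for i
  have "(\<Sum>i\<in>(\<lambda>i. 2 * i) ` I \<union> (\<lambda>i. 2 * i + 1) ` J. u i q * U i (\<phi> q)) =
    (\<Sum>i\<in>I. s i q * G i (\<phi> q)) + (\<Sum>i\<in>J. t i q * H i (\<phi> q))" for q
  proof (subst sum.union_disjoint)
   show "(\<lambda>i. 2 * i) ` I \<inter> (\<lambda>i. 2 * i + 1) ` J = {}"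
    by auto presburger
  qed (use f(1) g(1) in \<open>auto simp: sum.reindex inj_on_def u_def U_def\<close>)
  then show ?thesis unfolding X_def f(3) g(3)
   by (intro exI[of _ "(\<lambda>i. 2 * i) ` I \<union> (\<lambda>i. 2 * i + 1) ` J"] exI[of _ u] exI[of _ U])
    (use f g in \<open>auto simp: u_def U_def\<close>)
 qed
 have Xone: "X (\<lambda>q. s q * G (\<phi> q))" if "smooth_along src S s" "good G" for s G
  unfolding X_def by (intro exI[of _ "{0}"] exI[of _ "\<lambda>_. s"] exI[of _ "\<lambda>_. G"]) (use that in auto)
 have Xzero: "X (\<lambda>q. 0)" unfolding X_def by (intro exI[of _ "{}"]) auto
 have Xsum: "X (\<lambda>q. \<Sum>j\<in>J. f j q)" if "\<And>j. j \<in> J ==> X (f j)" for J :: "'j set" and f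
  using that by (induction J rule: infinite_finite_induct) (auto intro: Xadd Xzero)
 have G\<phi>: "continuous_on S (\<lambda>q. G (\<phi> q))"
  "q \<in> S ==> ((\<lambda>t. G (\<phi> (src c t q))) has_real_derivative
    (\<Sum>k\<in>K. pder src c (\<lambda>q. co k (\<phi> q)) q * pder sh k G (\<phi> q))) (at 0)" if "good G" for G c q
 proof -
  have G: "smooth_along sh S' G" "depends_on K S' G" using that by (auto simp: good_def)
  show "continuous_on S (\<lambda>q. G (\<phi> q))"
   using continuous_on_compose2[OF smooth_along_continuous[OF G(1)] cont S'(2)] .
  show "q \<in> S ==> ((\<lambda>t. G (\<phi> (src c t q))) has_real_derivative
    (\<Sum>k\<in>K. pder src c (\<lambda>q. co k (\<phi> q)) q * pder sh k G (\<phi> q))) (at 0)"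
   by (rule chain_rule_DERIV[OF src S _ S' G K \<phi>])
 qed
 show ?thesis
 proof (rule src.smooth_along_coinduct[OF S, where X = X])
  show "X (\<lambda>q. F (\<phi> q))" using Xone[of "\<lambda>_. 1" F] F by (simp add: good_def)
  fix h assume "X h"
  then obtain I :: "nat set" and s G where h: "finite I" "\<forall>i\<in>I. smooth_along src S (s i) \<and> good (G i)"
   "h = (\<lambda>q. \<Sum>i\<in>I. s i q * G i (\<phi> q))" unfolding X_def by blast
  show "continuous_on S h" unfolding h(3)
   by (intro continuous_intros) (use h(2) G\<phi>(1) in \<open>auto intro: smooth_along_continuous\<close>)
  have D: "((\<lambda>t. h (src c t q)) has_real_derivative
    (\<Sum>i\<in>I. pder src c (s i) q * G i (\<phi> q) +
     (\<Sum>k\<in>K. (s i q * pder src c (\<lambda>q. co k (\<phi> q)) q) * pder sh k (G i) (\<phi> q)))) (at 0)"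
   if "q \<in> S" for c q unfolding h(3)
  proof (rule DERIV_sum)
   fix i assume i: "i \<in> I"
   show "((\<lambda>t. s i (src c t q) * G i (\<phi> (src c t q))) has_real_derivative
    pder src c (s i) q * G i (\<phi> q) +
     (\<Sum>k\<in>K. (s i q * pder src c (\<lambda>q. co k (\<phi> q)) q) * pder sh k (G i) (\<phi> q))) (at 0)"
    by (rule DERIV_cong, rule DERIV_mult[OF src.smooth_DERIV[of S] G\<phi>(2)])
     (use h(2) i that in \<open>auto simp: sum_distrib_left mult_ac\<close>)
  qed
  show "(\<lambda>t. h (src c t q)) field_differentiable at 0" if "q \<in> S" for c q
   using D[OF that] unfolding field_differentiable_def by blast
  show "\<exists>h'. X h' \<and> (\<forall>q\<in>S. pder src c h q = h' q)" for c
  proof (intro exI conjI ballI)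
   show "X (\<lambda>q. \<Sum>i\<in>I. pder src c (s i) q * G i (\<phi> q) +
     (\<Sum>k\<in>K. (s i q * pder src c (\<lambda>q. co k (\<phi> q)) q) * pder sh k (G i) (\<phi> q)))"
   proof (intro Xsum Xadd Xone)
    fix i k assume "i \<in> I" "k \<in> K"
    then show "smooth_along src S (\<lambda>q. s i q * pder src c (\<lambda>q. co k (\<phi> q)) q)"
     using h(2) \<phi> by (intro src.smooth_mult S smooth_along_pder) auto
    show "good (pder sh k (G i))" using h(2) \<open>i \<in> I\<close>
     by (auto simp: good_def intro: smooth_along_pder depends_on_pder S')
   qed (use h(2) in \<open>auto intro: smooth_along_pder\<close>)
  qed (rule pderI, rule D)
 qed
qed

end

section \<open>Multi-indices\<close>

definition up :: "'n => 'n multi_index => 'n multi_index" where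
 "up i \<sigma> = \<sigma>(i := Suc (\<sigma> i))"

definition down :: "'n => 'n multi_index => 'n multi_index" where
 "down i \<sigma> = \<sigma>(i := \<sigma> i - 1)"

definition lower :: "'n => ('n, 'm) jet_index => ('n, 'm) jet_index" where
 "lower i a = (fst a, down i (snd a))"

definition mis :: "nat => 'n::finite multi_index set" where
 "mis N = {\<sigma>. mi_size \<sigma> \<le> N}"

definition idx :: "nat => ('n::finite, 'm::finite) jet_index set" where
 "idx N = {a. mi_size (snd a) \<le> N}"

lemma raise_up: "raise i a = (fst a, up i (snd a))" by (simp add: raise_def up_def)
lemma fst_raise [simp]: "fst (raise i a) = fst a" and snd_raise: "snd (raise i a) = up i (snd a)"
 by (simp_all add: raise_up)
lemma fst_lower [simp]: "fst (lower i a) = fst a" and snd_lower: "snd (lower i a) = down i (snd a)"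
 by (simp_all add: lower_def)
lemma up_pos [simp]: "up i \<sigma> i > 0" by (simp add: up_def)
lemma down_up [simp]: "down i (up i \<sigma>) = \<sigma>" by (simp add: up_def down_def)
lemma up_down [simp]: "\<sigma> i > 0 ==> up i (down i \<sigma>) = \<sigma>" by (auto simp: up_def down_def)
lemma up_commute: "up i (up j \<sigma>) = up j (up i \<sigma>)" by (auto simp: up_def)
lemma raise_commute: "raise i (raise j a) = raise j (raise i a)" by (simp add: raise_up up_commute)
lemma lower_raise [simp]: "lower i (raise i a) = a" by (simp add: lower_def raise_up)
lemma raise_lower [simp]: "snd a i > 0 ==> raise i (lower i a) = a" by (simp add: lower_def raise_up)
lemma raise_pos [simp]: "snd (raise i a) i > 0" by (simp add: raise_up)

lemma mi_size_up [simp]: "mi_size (up i \<sigma>) = Suc (mi_size \<sigma>)"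
proof -
 have "mi_size (up i \<sigma>) = (\<Sum>j\<in>UNIV. \<sigma> j + (if j = i then 1 else 0))"
  unfolding mi_size_def up_def by (rule sum.cong) auto
 then show ?thesis by (simp add: sum.distrib mi_size_def)
qed

lemma mi_size_down: "\<sigma> i > 0 ==> Suc (mi_size (down i \<sigma>)) = mi_size \<sigma>"
 using mi_size_up[of i "down i \<sigma>"] by simp

lemma mi_size_0 [simp]: "mi_size (\<lambda>_. 0) = 0" by (simp add: mi_size_def)
lemma mi_size_eq_0: "mi_size \<sigma> = 0 \<longleftrightarrow> \<sigma> = (\<lambda>_. 0)" by (auto simp: mi_size_def)

lemma multi_index_induct [case_names zero up]:
 assumes "P (\<lambda>_. 0)" "\<And>i \<sigma>. P \<sigma> ==> P (up i \<sigma>)"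
 shows "P (\<sigma> :: 'n::finite multi_index)"
proof (induction "mi_size \<sigma>" arbitrary: \<sigma>)
 case 0
 then show ?case using assms(1) mi_size_eq_0[of \<sigma>] by simp
next
 case (Suc k)
 have "\<exists>i. \<sigma> i > 0" using Suc(2) by (metis mi_size_eq_0 neq0_conv old.nat.distinct(1))
 then obtain i where i: "\<sigma> i > 0" by blast
 then have "P (down i \<sigma>)" using Suc mi_size_down[of \<sigma> i] by auto
 from assms(2)[OF this, of i] show ?case using i by simp
qed

lemma finite_mis [simp, intro]: "finite (mis N :: 'n::finite multi_index set)"
proof (rule finite_subset)
 show "mis N \<subseteq> PiE (UNIV :: 'n set) (\<lambda>_. {..N})"
 proof
  fix \<sigma> :: "'n multi_index" assume "\<sigma> \<in> mis N"
  moreover have "\<sigma> i \<le> mi_size \<sigma>" for i unfolding mi_size_def by (rule member_le_sum) auto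
  ultimately show "\<sigma> \<in> PiE UNIV (\<lambda>_. {..N})" by (auto simp: mis_def PiE_UNIV_domain intro: order_trans)
 qed
 show "finite (PiE (UNIV :: 'n set) (\<lambda>_. {..N}))" by (rule finite_PiE) auto
qed

lemma idx_times: "idx N = UNIV \<times> mis N" by (auto simp: idx_def mis_def)

lemma finite_idx [simp, intro]: "finite (idx N :: ('n::finite, 'm::finite) jet_index set)"
 unfolding idx_times by simp

lemma sum_idx: "(\<Sum>a\<in>idx N. F a) = (\<Sum>\<alpha>\<in>UNIV. \<Sum>\<sigma>\<in>mis N. F (\<alpha>, \<sigma>))"
 unfolding idx_times by (simp add: sum.cartesian_product)

lemma mis_mono: "N \<le> M ==> mis N \<subseteq> mis M" by (auto simp: mis_def)
lemma idx_mono: "N \<le> M ==> idx N \<subseteq> idx M" by (auto simp: idx_def)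

text \<open>Lowering a multi-index reindexes the sum over those of order at most \<open>N + 1\<close> with positive \<open>i\<close>-th entry.\<close>

lemma sum_shift_mis:
 fixes F :: "'n::finite multi_index => 'n multi_index => 'r::comm_monoid_add"
 shows "(\<Sum>\<sigma>\<in>mis (Suc N). if \<sigma> i > 0 then F (down i \<sigma>) \<sigma> else 0) = (\<Sum>\<sigma>\<in>mis N. F \<sigma> (up i \<sigma>))"
proof -
 have "(\<Sum>\<sigma>\<in>mis (Suc N). if \<sigma> i > 0 then F (down i \<sigma>) \<sigma> else 0) =
   (\<Sum>\<sigma>\<in>{\<sigma>\<in>mis (Suc N). \<sigma> i > 0}. F (down i \<sigma>) \<sigma>)"
  by (rule sum.inter_filter[symmetric]) simp
 also have "\<dots> = (\<Sum>\<sigma>\<in>mis N. F \<sigma> (up i \<sigma>))"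
  by (rule sum.reindex_bij_witness[where i = "up i" and j = "down i"])
    (auto simp: mis_def dest: mi_size_down)
 finally show ?thesis .
qed

lemma sum_shift_idx:
 fixes F :: "('n::finite, 'm::finite) jet_index => ('n, 'm) jet_index => 'r::comm_monoid_add"
 shows "(\<Sum>a\<in>idx (Suc N). if snd a i > 0 then F (lower i a) a else 0) = (\<Sum>a\<in>idx N. F a (raise i a))"
 unfolding sum_idx lower_def raise_up fst_conv snd_conv
 by (rule sum.cong[OF refl]) (rule sum_shift_mis)

lemma directions: "distinct (directions :: 'n::finite list)" "set (directions :: 'n list) = UNIV"
proof -
 have "\<exists>is. distinct is \<and> set is = (UNIV :: 'n set)"
  using finite_distinct_list[of "UNIV :: 'n set"] by auto
 from someI_ex[OF this] show "distinct (directions :: 'n list)" "set (directions :: 'n list) = UNIV"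
  unfolding directions_def by auto
qed

lemma funpow_closed: "\<lbrakk>\<And>x. x \<in> C ==> f x \<in> C; x \<in> C\<rbrakk> \<Longrightarrow> (f ^^ k) x \<in> C"
 by (induction k) auto

lemma iter_mi_closed:
 assumes "\<And>i x. x \<in> C ==> D i x \<in> C" "x \<in> C"
 shows "iter_mi D \<sigma> x \<in> C"
proof -
 have "foldr (\<lambda>i. D i ^^ \<sigma> i) is x \<in> C" for "is"
  by (induction "is") (use assms in \<open>auto intro: funpow_closed\<close>)
 then show ?thesis by (simp add: iter_mi_def)
qed

lemma iter_mi_rel:
 assumes "\<And>i x y. R x y ==> R (D i x) (D' i y)" "R x y"
 shows "R (iter_mi D \<sigma> x) (iter_mi D' \<sigma> y)"
proof -
 have p: "R ((D i ^^ k) x) ((D' i ^^ k) y)" if "R x y" for i k x y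
  by (induction k) (use that assms(1) in auto)
 have "R (foldr (\<lambda>i. D i ^^ \<sigma> i) is x) (foldr (\<lambda>i. D' i ^^ \<sigma> i) is y)" for "is"
  by (induction "is") (use assms p in auto)
 then show ?thesis by (simp add: iter_mi_def)
qed

lemma iter_mi_0 [simp]: "iter_mi D (\<lambda>_. 0) x = x"
proof -
 have "foldr (\<lambda>i. D i ^^ 0) is x = x" for "is" by (induction "is") auto
 then show ?thesis by (simp add: iter_mi_def)
qed

lemma iter_mi_commute:
 assumes "\<And>i x. x \<in> C ==> D i x \<in> C" "\<And>i x. x \<in> C ==> T (D i x) = D' i (T x)" "x \<in> C"
 shows "T (iter_mi D \<sigma> x) = iter_mi D' \<sigma> (T x)"
 using iter_mi_rel[where R = "\<lambda>x y. x \<in> C \<and> y = T x" and D = D and D' = D'] assms by auto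

lemma iter_mi_up:
 assumes cl: "\<And>i x. x \<in> C ==> D i x \<in> C"
  and com: "\<And>i j x. x \<in> C ==> D i (D j x) = D j (D i x)" and x: "x \<in> C"
 shows "iter_mi D (up i \<sigma>) x = D i (iter_mi D \<sigma> x)"
proof -
 have pow: "(D j ^^ k) (D i x) = D i ((D j ^^ k) x)" if "x \<in> C" for j k x
 proof (induction k)
  case (Suc k)
  have "(D j ^^ k) x \<in> C" using that cl by (rule funpow_closed[rotated])
  with Suc show ?case by (simp add: com)
 qed simp
 have fold_in: "foldr (\<lambda>i. D i ^^ \<sigma> i) is x \<in> C" for "is"
  by (induction "is") (use x cl in \<open>auto intro: funpow_closed\<close>)
 have no: "foldr (\<lambda>j. D j ^^ up i \<sigma> j) is x = foldr (\<lambda>j. D j ^^ \<sigma> j) is x" if "i \<notin> set is" for "is"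
  using that by (induction "is") (auto simp: up_def)
 have "foldr (\<lambda>j. D j ^^ up i \<sigma> j) is x = D i (foldr (\<lambda>j. D j ^^ \<sigma> j) is x)"
  if "distinct is" "i \<in> set is" for "is"
  using that
 proof (induction "is")
  case (Cons j js)
  show ?case
  proof (cases "i = j")
   case True
   then have "i \<notin> set js" using Cons by auto
   with True no show ?thesis by (simp add: up_def)
  next
   case False
   then have "foldr (\<lambda>j. D j ^^ up i \<sigma> j) js x = D i (foldr (\<lambda>j. D j ^^ \<sigma> j) js x)"
    using Cons by auto
   moreover have "up i \<sigma> j = \<sigma> j" using False by (simp add: up_def)
   ultimately show ?thesis using pow[OF fold_in] by simp
  qed
 qed simp
 from this[OF directions(1), unfolded directions(2)] show ?thesis by (simp add: iter_mi_def)
qed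

section \<open>The Jacobi identity in an algebra of densities\<close>

definition sg :: "bool => 'r::ab_group_add => 'r" where
 "sg b x = (if b then - x else x)"

lemma sg_simps [simp]: "sg False x = x" "sg b 0 = 0" "sg b (- x) = - sg b x"
 "sg True x = - x" "sg b (sg c x) = sg (b \<noteq> c) x"
 by (auto simp: sg_def)

lemma sg_add: "sg b (x + y) = sg b x + sg b y" by (simp add: sg_def)
lemma sg_sum: "sg b (sum f A) = (\<Sum>x\<in>A. sg b (f x))" by (simp add: sg_def sum_negf)

text \<open>\<open>C N\<close> stands for the densities of order at most \<open>N\<close>; a bound on the order keeps all sums over
 multi-indices finite. \<open>pd False a\<close> and \<open>pd True a\<close> stand for the derivative in the even variable and
 for the left derivative in the odd variable with index \<open>a\<close>, and \<open>par\<close> for the parity automorphism, by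
 which the sign rules are expressed. The differential ideal \<open>I\<close> is arbitrary; it serves to
 control the supports of primitives.\<close>

locale jet_superalgebra =
 fixes C :: "nat => 'r::ab_group_add set"
  and mul :: "'r => 'r => 'r" (infixl "\<odot>" 70)
  and par :: "'r => 'r"
  and D :: "'n::finite => 'r => 'r"
  and pd :: "bool => ('n, 'm::finite) jet_index => 'r => 'r"
  and I :: "'r set"
 assumes C_mono: "N \<le> M ==> C N \<subseteq> C M"
  and C_zero [simp, intro]: "0 \<in> C N"
  and C_add [intro]: "x \<in> C N ==> y \<in> C N ==> x + y \<in> C N"
  and C_minus [intro]: "x \<in> C N ==> - x \<in> C N"
  and C_mul [intro]: "x \<in> C N ==> y \<in> C N ==> x \<odot> y \<in> C N"
  and C_par [intro]: "x \<in> C N ==> par x \<in> C N"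
  and C_D: "x \<in> C N ==> D i x \<in> C (Suc N)"
  and C_pd [intro]: "x \<in> C N ==> pd k a x \<in> C N"
  and pd_order: "x \<in> C N ==> N < mi_size (snd a) ==> pd k a x = 0"
  and mul_add_left: "(x + y) \<odot> z = x \<odot> z + y \<odot> z"
  and mul_add_right: "x \<odot> (y + z) = x \<odot> y + x \<odot> z"
  and mul_assoc: "(x \<odot> y) \<odot> z = x \<odot> (y \<odot> z)"
  and mul_commute: "par x = sg b x ==> par y = sg c y ==> y \<odot> x = sg (b \<and> c) (x \<odot> y)"
  and par_add: "par (x + y) = par x + par y"
  and par_mul: "par (x \<odot> y) = par x \<odot> par y"
  and D_add: "x \<in> C N ==> y \<in> C N ==> D i (x + y) = D i x + D i y"
  and D_mul: "x \<in> C N ==> y \<in> C N ==> D i (x \<odot> y) = D i x \<odot> y + x \<odot> D i y"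
  and D_commute: "x \<in> C N ==> D i (D j x) = D j (D i x)"
  and par_D: "x \<in> C N ==> par (D i x) = D i (par x)"
  and pd_add: "x \<in> C N ==> y \<in> C N ==> pd k a (x + y) = pd k a x + pd k a y"
  and pd_mul: "x \<in> C N ==> y \<in> C N ==>
   pd k a (x \<odot> y) = pd k a x \<odot> y + (if k then par x else x) \<odot> pd k a y"
  and pd_D: "x \<in> C N ==>
   pd k a (D i x) = D i (pd k a x) + (if snd a i > 0 then pd k (lower i a) x else 0)"
  and pd_pd: "x \<in> C N ==> pd k a (pd k' a' x) = sg (k \<and> k') (pd k' a' (pd k a x))"
  and par_pd: "x \<in> C N ==> par (pd k a x) = sg k (pd k a (par x))"
  and I_zero [simp, intro]: "0 \<in> I"
  and I_add [intro]: "x \<in> I ==> y \<in> I ==> x + y \<in> I"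
  and I_minus [intro]: "x \<in> I ==> - x \<in> I"
  and I_mul: "x \<in> I \<or> y \<in> I ==> x \<odot> y \<in> I"
  and I_par [intro]: "x \<in> I ==> par x \<in> I"
  and I_D [intro]: "x \<in> I ==> D i x \<in> I"
  and I_pd [intro]: "x \<in> I ==> pd k a x \<in> I"
begin

definition CC :: "'r set" where "CC = (\<Union>N. C N)"

lemma CC_I: "x \<in> C N ==> x \<in> CC" by (auto simp: CC_def)

lemma CC_E2:
 assumes "x \<in> CC" "y \<in> CC"
 obtains N where "x \<in> C N" "y \<in> C N"
proof -
 obtain N M where "x \<in> C N" "y \<in> C M" using assms by (auto simp: CC_def)
 then have "x \<in> C (max N M)" "y \<in> C (max N M)"
  using C_mono[of N "max N M"] C_mono[of M "max N M"] by auto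
 then show thesis by (rule that)
qed

lemma C_le: "x \<in> C N ==> N \<le> M ==> x \<in> C M" using C_mono by blast

lemma I_sg: "x \<in> I ==> sg b x \<in> I" by (auto simp: sg_def)
lemma C_sum: "(\<And>k. k \<in> K ==> f k \<in> C N) ==> sum f K \<in> C N"
 by (induction K rule: infinite_finite_induct) auto
lemma I_sum: "(\<And>k. k \<in> K ==> f k \<in> I) ==> sum f K \<in> I"
 by (induction K rule: infinite_finite_induct) auto

lemma mul_0_left [simp]: "0 \<odot> x = 0" and mul_0_right [simp]: "x \<odot> 0 = 0"
 using mul_add_left[of 0 0 x] mul_add_right[of x 0 0] by simp_all

lemma mul_minus_left [simp]: "(- x) \<odot> y = - (x \<odot> y)" and mul_minus_right [simp]: "x \<odot> (- y) = - (x \<odot> y)"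
 using mul_add_left[of "-x" x y] mul_add_right[of x "-y" y] by (simp_all add: eq_neg_iff_add_eq_0)

lemma mul_sg_left [simp]: "sg b x \<odot> y = sg b (x \<odot> y)" and mul_sg_right [simp]: "x \<odot> sg b y = sg b (x \<odot> y)"
 by (simp_all add: sg_def)

lemma mul_sum_left: "sum f K \<odot> y = (\<Sum>k\<in>K. f k \<odot> y)"
 by (induction K rule: infinite_finite_induct) (auto simp: mul_add_left)
lemma mul_sum_right: "y \<odot> sum f K = (\<Sum>k\<in>K. y \<odot> f k)"
 by (induction K rule: infinite_finite_induct) (auto simp: mul_add_right)

lemma par_0 [simp]: "par 0 = 0" using par_add[of 0 0] by simp
lemma par_minus [simp]: "par (- x) = - par x" using par_add[of "-x" x] by (simp add: eq_neg_iff_add_eq_0)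
lemma par_sg [simp]: "par (sg b x) = sg b (par x)" by (simp add: sg_def)
lemma par_sum: "par (sum f K) = (\<Sum>k\<in>K. par (f k))"
 by (induction K rule: infinite_finite_induct) (auto simp: par_add)

lemma D_0 [simp]: "D i 0 = 0" using D_add[of 0 0 0 i] by simp
lemma D_minus: "x \<in> C N ==> D i (- x) = - D i x"
 using D_add[of "-x" N x i] by (auto simp: eq_neg_iff_add_eq_0)
lemma D_sum: "(\<And>k. k \<in> K ==> f k \<in> C N) ==> D i (sum f K) = (\<Sum>k\<in>K. D i (f k))"
proof (induction K rule: infinite_finite_induct)
 case (insert x F)
 then show ?case using D_add[OF _ C_sum[of F f N], of "f x" i] by simp
qed simp_all

lemma pd_0 [simp]: "pd k a 0 = 0" using pd_add[of 0 0 0 k a] by simp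
lemma pd_minus: "x \<in> C N ==> pd k a (- x) = - pd k a x"
 using pd_add[of "-x" N x k a] by (auto simp: eq_neg_iff_add_eq_0)
lemma pd_sg: "x \<in> C N ==> pd k a (sg b x) = sg b (pd k a x)" by (auto simp: sg_def pd_minus)
lemma pd_sum: "(\<And>j. j \<in> K ==> f j \<in> C N) ==> pd k a (sum f K) = (\<Sum>j\<in>K. pd k a (f j))"
proof (induction K rule: infinite_finite_induct)
 case (insert x F)
 then show ?case using pd_add[OF _ C_sum[of F f N], of "f x" k a] by simp
qed simp_all

text \<open>\<open>ad \<sigma>\<close> is the formal adjoint of \<open>Dm \<sigma>\<close>; the sign sits inside the iteration, so that both obey
 the same recursion.\<close>

definition Dm :: "'n multi_index => 'r => 'r" where "Dm = iter_mi D"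
definition ad :: "'n multi_index => 'r => 'r" where "ad = iter_mi (\<lambda>i x. - D i x)"

lemma D_CC: "x \<in> CC ==> D i x \<in> CC" using C_D by (auto simp: CC_def)
lemma minus_CC: "x \<in> CC ==> - x \<in> CC" by (auto simp: CC_def)

lemma Dm_0 [simp]: "Dm (\<lambda>_. 0) x = x" and ad_0 [simp]: "ad (\<lambda>_. 0) x = x"
 by (simp_all add: Dm_def ad_def)

lemma D_commute': "x \<in> CC ==> D i (D j x) = D j (D i x)" using D_commute by (auto simp: CC_def)
lemma D_minus': "x \<in> CC ==> D i (- x) = - D i x" using D_minus by (auto simp: CC_def)

lemma Dm_up: "x \<in> CC ==> Dm (up i \<sigma>) x = D i (Dm \<sigma> x)"
 unfolding Dm_def by (rule iter_mi_up[where C = CC]) (auto intro: D_CC D_commute')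

lemma ad_up: "x \<in> CC ==> ad (up i \<sigma>) x = - D i (ad \<sigma> x)"
 unfolding ad_def
 by (rule iter_mi_up[where C = CC])
  (auto intro: D_CC minus_CC simp: D_minus'[OF D_CC] D_commute')

lemma Dm_CC: "x \<in> CC ==> Dm \<sigma> x \<in> CC" unfolding Dm_def by (rule iter_mi_closed) (auto intro: D_CC)
lemma ad_CC: "x \<in> CC ==> ad \<sigma> x \<in> CC"
 unfolding ad_def by (rule iter_mi_closed) (auto intro: D_CC minus_CC)

lemma C_Dm: "x \<in> C N ==> Dm \<sigma> x \<in> C (N + mi_size \<sigma>)"
proof (induction \<sigma> rule: multi_index_induct)
 case (up i \<sigma>)
 then show ?case using C_D by (simp add: Dm_up[OF CC_I])
qed simp

lemma C_ad: "x \<in> C N ==> ad \<sigma> x \<in> C (N + mi_size \<sigma>)"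
proof (induction \<sigma> rule: multi_index_induct)
 case (up i \<sigma>)
 then show ?case using C_D C_minus by (simp add: ad_up[OF CC_I])
qed simp

lemma I_Dm: "x \<in> I ==> Dm \<sigma> x \<in> I"
 unfolding Dm_def by (rule iter_mi_closed) auto
lemma I_ad: "x \<in> I ==> ad \<sigma> x \<in> I"
 unfolding ad_def by (rule iter_mi_closed) auto

lemma Dm_0_right [simp]: "Dm \<sigma> 0 = 0" and ad_0_right [simp]: "ad \<sigma> 0 = 0"
proof -
 show "Dm \<sigma> 0 = 0" unfolding Dm_def
  using iter_mi_closed[where C = "{0}" and D = D and x = 0 and \<sigma> = \<sigma>] by auto
 show "ad \<sigma> 0 = 0" unfolding ad_def
  using iter_mi_closed[where C = "{0}" and D = "\<lambda>i x. - D i x" and x = 0 and \<sigma> = \<sigma>] by auto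
qed

lemma Dm_D: "x \<in> CC ==> Dm \<sigma> (D i x) = D i (Dm \<sigma> x)"
proof (induction \<sigma> rule: multi_index_induct)
 case (up j \<sigma>)
 then show ?case by (simp add: Dm_up D_CC Dm_CC D_commute'[of "Dm \<sigma> x"])
qed simp

lemma ad_D: "x \<in> CC ==> ad \<sigma> (D i x) = D i (ad \<sigma> x)"
proof (induction \<sigma> rule: multi_index_induct)
 case (up j \<sigma>)
 then show ?case by (simp add: ad_up D_CC ad_CC D_commute'[of "ad \<sigma> x"] D_minus')
qed simp

lemma D_add': "x \<in> CC ==> y \<in> CC ==> D i (x + y) = D i x + D i y"
 by (erule (1) CC_E2) (rule D_add)

lemma ad_add: "x \<in> CC ==> y \<in> CC ==> ad \<sigma> (x + y) = ad \<sigma> x + ad \<sigma> y"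
proof (induction \<sigma> rule: multi_index_induct)
 case (up j \<sigma>)
 have "x + y \<in> CC" using up(2,3) by (meson C_add CC_E2 CC_I)
 with up show ?case by (simp add: ad_up ad_CC D_add')
qed simp

lemma ad_minus: "x \<in> CC ==> ad \<sigma> (- x) = - ad \<sigma> x"
 using ad_add[of "-x" x \<sigma>] minus_CC[of x] by (simp add: eq_neg_iff_add_eq_0)

lemma ad_sum: "(\<And>k. k \<in> K ==> f k \<in> C N) ==> ad \<sigma> (sum f K) = (\<Sum>k\<in>K. ad \<sigma> (f k))"
proof (induction K rule: infinite_finite_induct)
 case (insert x F)
 then have "f x \<in> CC" "sum f F \<in> CC" by (auto intro: CC_I[of _ N] C_sum)
 with insert show ?case by (simp add: ad_add)
qed simp_all

lemma par_Dm: "x \<in> CC ==> par (Dm \<sigma> x) = Dm \<sigma> (par x)"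
 unfolding Dm_def by (rule iter_mi_commute[where C = CC]) (auto simp: CC_def par_D dest: C_D)

lemma par_ad: "x \<in> CC ==> par (ad \<sigma> x) = ad \<sigma> (par x)"
 unfolding ad_def by (rule iter_mi_commute[where C = CC]) (auto simp: CC_def par_D dest: C_D)

lemma Dm_minus: "x \<in> CC ==> Dm \<sigma> (- x) = - Dm \<sigma> x"
 unfolding Dm_def by (rule iter_mi_commute[where C = CC and T = uminus, symmetric])
  (auto intro: D_CC simp: D_minus')

lemma Dm_sg: "x \<in> CC ==> Dm \<sigma> (sg b x) = sg b (Dm \<sigma> x)" by (simp add: sg_def Dm_minus)
lemma ad_sg: "x \<in> CC ==> ad \<sigma> (sg b x) = sg b (ad \<sigma> x)" by (simp add: sg_def ad_minus)

subsection \<open>Euler operators\<close>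

definition E :: "bool => 'm => 'r => 'r" where
 "E k \<alpha> x = Sum_any (\<lambda>\<sigma>. ad \<sigma> (pd k (\<alpha>, \<sigma>) x))"

lemma E_eq:
 assumes "x \<in> C N" "N \<le> M"
 shows "E k \<alpha> x = (\<Sum>\<sigma>\<in>mis M. ad \<sigma> (pd k (\<alpha>, \<sigma>) x))"
 unfolding E_def
proof (rule Sum_any.expand_superset)
 show "{\<sigma>. ad \<sigma> (pd k (\<alpha>, \<sigma>) x) \<noteq> 0} \<subseteq> mis M"
 proof (rule subsetI, rule ccontr)
  fix \<sigma> assume "\<sigma> \<in> {\<sigma>. ad \<sigma> (pd k (\<alpha>, \<sigma>) x) \<noteq> 0}" "\<sigma> \<notin> mis M"
  then show False using pd_order[OF assms(1), of "(\<alpha>, \<sigma>)" k] assms(2) by (simp add: mis_def)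
 qed
qed simp

lemma C_E: "x \<in> C N ==> E k \<alpha> x \<in> C (N + N)"
 unfolding E_eq[OF _ order_refl]
 by (rule C_sum) (rule C_le[OF C_ad[OF C_pd]], auto simp: mis_def)

lemma I_E: "x \<in> C N ==> x \<in> I ==> E k \<alpha> x \<in> I"
 unfolding E_eq[OF _ order_refl] by (rule I_sum) (auto intro: I_ad)

lemma E_add:
 assumes "x \<in> C N" "y \<in> C N"
 shows "E k \<alpha> (x + y) = E k \<alpha> x + E k \<alpha> y"
proof -
 have "x + y \<in> C N" using assms by auto
 moreover have "ad \<sigma> (pd k a (x + y)) = ad \<sigma> (pd k a x) + ad \<sigma> (pd k a y)" for \<sigma> a
  unfolding pd_add[OF assms] by (rule ad_add) (use assms in \<open>auto intro: CC_I\<close>)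
 ultimately show ?thesis using assms by (simp add: E_eq[where M = N] sum.distrib)
qed

lemma E_0 [simp]: "E k \<alpha> 0 = 0" by (simp add: E_def)

lemma E_sum: "(\<And>j. j \<in> K ==> f j \<in> C N) ==> E k \<alpha> (sum f K) = (\<Sum>j\<in>K. E k \<alpha> (f j))"
proof (induction K rule: infinite_finite_induct)
 case (insert x F)
 then show ?case using E_add[OF _ C_sum[of F f N], of "f x" k \<alpha>] by simp
qed simp_all

lemma par_E:
 assumes "x \<in> C N" "par x = sg e x"
 shows "par (E k \<alpha> x) = sg (e \<noteq> k) (E k \<alpha> x)"
proof -
 have "par (ad \<sigma> (pd k a x)) = sg (e \<noteq> k) (ad \<sigma> (pd k a x))" for \<sigma> a
 proof -
  have "par (pd k a x) = sg k (sg e (pd k a x))"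
   by (simp only: par_pd[OF assms(1)] assms(2) pd_sg[OF assms(1)])
  then have "par (pd k a x) = sg (e \<noteq> k) (pd k a x)" by (cases e; cases k) simp_all
  then show ?thesis using assms by (simp add: par_ad[OF CC_I[OF C_pd]] ad_sg[OF CC_I[OF C_pd]])
 qed
 then show ?thesis unfolding E_eq[OF assms(1) order_refl] by (simp add: par_sum sg_sum)
qed

text \<open>Summation by parts over multi-indices.\<close>

lemma sum_ad_shift:
 assumes Y: "\<And>\<sigma>. Y \<sigma> \<in> CC" and Y0: "\<And>\<sigma>. mi_size \<sigma> \<ge> N ==> Y \<sigma> = 0"
 shows "(\<Sum>\<sigma>\<in>mis N. ad \<sigma> (if \<sigma> i > 0 then Y (down i \<sigma>) else 0)) = - (\<Sum>\<sigma>\<in>mis N. D i (ad \<sigma> (Y \<sigma>)))"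
proof (cases N)
 case 0
 then have "(\<Sum>\<sigma>\<in>mis N. ad \<sigma> (if \<sigma> i > 0 then Y (down i \<sigma>) else 0)) = 0"
  by (intro sum.neutral) (auto simp: mis_def mi_size_eq_0)
 moreover have "(\<Sum>\<sigma>\<in>mis N. D i (ad \<sigma> (Y \<sigma>))) = 0"
  by (intro sum.neutral) (use 0 Y0 in auto)
 ultimately show ?thesis by simp
next
 case (Suc M)
 have "(\<Sum>\<sigma>\<in>mis N. ad \<sigma> (if \<sigma> i > 0 then Y (down i \<sigma>) else 0)) =
   (\<Sum>\<sigma>\<in>mis (Suc M). if \<sigma> i > 0 then ad \<sigma> (Y (down i \<sigma>)) else 0)"
  unfolding Suc by (rule sum.cong) auto
 also have "\<dots> = (\<Sum>\<sigma>\<in>mis M. ad (up i \<sigma>) (Y \<sigma>))" by (rule sum_shift_mis)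
 also have "\<dots> = - (\<Sum>\<sigma>\<in>mis M. D i (ad \<sigma> (Y \<sigma>)))" using Y by (simp add: ad_up sum_negf)
 also have "(\<Sum>\<sigma>\<in>mis M. D i (ad \<sigma> (Y \<sigma>))) = (\<Sum>\<sigma>\<in>mis N. D i (ad \<sigma> (Y \<sigma>)))"
  unfolding Suc
  by (rule sum.mono_neutral_left[OF finite_mis mis_mono]) (use Suc Y0 in \<open>auto simp: mis_def\<close>)
 finally show ?thesis .
qed

text \<open>Commuting a partial derivative past \<open>D\<^sub>i\<close> lowers its multi-index, and the lowered terms
 cancel the others in the alternating sum.\<close>

lemma E_D: "x \<in> C N ==> E k \<alpha> (D i x) = 0"
proof -
 assume x: "x \<in> C N"
 have xp: "pd k a x \<in> CC" for a using x by (auto intro: CC_I)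
 let ?M = "Suc N"
 have "E k \<alpha> (D i x) = (\<Sum>\<sigma>\<in>mis ?M. ad \<sigma> (pd k (\<alpha>, \<sigma>) (D i x)))"
  by (rule E_eq[OF C_D[OF x]]) simp
 also have "\<dots> = (\<Sum>\<sigma>\<in>mis ?M. ad \<sigma> (D i (pd k (\<alpha>, \<sigma>) x)) +
   ad \<sigma> (if \<sigma> i > 0 then pd k (\<alpha>, down i \<sigma>) x else 0))"
 proof (rule sum.cong[OF refl])
  fix \<sigma> :: "'n multi_index"
  have "(if \<sigma> i > 0 then pd k (\<alpha>, down i \<sigma>) x else 0) \<in> CC" using xp by (auto intro: CC_I)
  then show "ad \<sigma> (pd k (\<alpha>, \<sigma>) (D i x)) = ad \<sigma> (D i (pd k (\<alpha>, \<sigma>) x)) +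
   ad \<sigma> (if \<sigma> i > 0 then pd k (\<alpha>, down i \<sigma>) x else 0)"
   using xp by (simp only: pd_D[OF x] ad_add D_CC lower_def snd_conv fst_conv)
 qed
 also have "\<dots> = (\<Sum>\<sigma>\<in>mis ?M. D i (ad \<sigma> (pd k (\<alpha>, \<sigma>) x))) - (\<Sum>\<sigma>\<in>mis ?M. D i (ad \<sigma> (pd k (\<alpha>, \<sigma>) x)))"
  unfolding sum.distrib
  by (subst sum_ad_shift[where Y = "\<lambda>\<sigma>. pd k (\<alpha>, \<sigma>) x"])
    (use xp pd_order[OF x] in \<open>auto simp: ad_D\<close>)
 finally show ?thesis by simp
qed

subsection \<open>Integration by parts\<close>

definition dv :: "nat => 'r set" where
 "dv N = {x. \<exists>\<gamma>. (\<forall>i. \<gamma> i \<in> C N \<and> \<gamma> i \<in> I) \<and> x = (\<Sum>i\<in>UNIV. D i (\<gamma> i))}"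

lemma dv_0 [simp, intro]: "0 \<in> dv N"
 unfolding dv_def by (auto intro!: exI[of _ "\<lambda>_. 0"])

lemma dv_add: "x \<in> dv N ==> y \<in> dv N ==> x + y \<in> dv N"
 unfolding dv_def
proof clarsimp
 fix \<gamma> \<gamma>' :: "'n => 'r" assume *: "\<forall>i. \<gamma> i \<in> C N \<and> \<gamma> i \<in> I" "\<forall>i. \<gamma>' i \<in> C N \<and> \<gamma>' i \<in> I"
 then show "\<exists>\<gamma>''. (\<forall>i. \<gamma>'' i \<in> C N \<and> \<gamma>'' i \<in> I) \<and>
   (\<Sum>i\<in>UNIV. D i (\<gamma> i)) + (\<Sum>i\<in>UNIV. D i (\<gamma>' i)) = (\<Sum>i\<in>UNIV. D i (\<gamma>'' i))"
  by (intro exI[of _ "\<lambda>i. \<gamma> i + \<gamma>' i"]) (auto simp: D_add[where N = N] sum.distrib)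
qed

lemma dv_minus: "x \<in> dv N ==> - x \<in> dv N"
 unfolding dv_def
proof clarsimp
 fix \<gamma> :: "'n => 'r" assume *: "\<forall>i. \<gamma> i \<in> C N \<and> \<gamma> i \<in> I"
 then show "\<exists>\<gamma>''. (\<forall>i. \<gamma>'' i \<in> C N \<and> \<gamma>'' i \<in> I) \<and> - (\<Sum>i\<in>UNIV. D i (\<gamma> i)) = (\<Sum>i\<in>UNIV. D i (\<gamma>'' i))"
  by (intro exI[of _ "\<lambda>i. - \<gamma> i"]) (auto simp: D_minus[where N = N] sum_negf)
qed

lemma dv_diff: "x \<in> dv N ==> y \<in> dv N ==> x - y \<in> dv N"
 using dv_add[of x N "-y"] dv_minus by simp

lemma dv_sg: "x \<in> dv N ==> sg b x \<in> dv N" using dv_minus by (auto simp: sg_def)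

lemma dv_sum: "(\<And>k. k \<in> K ==> f k \<in> dv N) ==> sum f K \<in> dv N"
 by (induction K rule: infinite_finite_induct) (auto intro: dv_add)

lemma dv_mono:
 assumes "x \<in> dv N" "N \<le> M"
 shows "x \<in> dv M"
proof -
 obtain \<gamma> where "\<forall>i. \<gamma> i \<in> C N \<and> \<gamma> i \<in> I" "x = (\<Sum>i\<in>UNIV. D i (\<gamma> i))"
  using assms unfolding dv_def by auto
 moreover from this have "\<forall>i. \<gamma> i \<in> C M \<and> \<gamma> i \<in> I" using C_le[OF _ assms(2)] by auto
 ultimately show ?thesis unfolding dv_def by auto
qed

lemma dv_D:
 assumes "x \<in> C N" "x \<in> I"
 shows "D i x \<in> dv N"
proof -
 have "D i x = (\<Sum>j\<in>UNIV. D j (if j = i then x else 0))"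
  by (simp add: if_distrib[of "D _"] cong: if_cong)
 then show ?thesis unfolding dv_def mem_Collect_eq
  by (intro exI[of _ "\<lambda>j. if j = i then x else 0"] conjI) (use assms in auto)
qed

lemma integrate_by_parts:
 "x \<in> C N ==> y \<in> C N ==> x \<in> I \<or> y \<in> I ==> Dm \<sigma> x \<odot> y - x \<odot> ad \<sigma> y \<in> dv (N + mi_size \<sigma>)"
proof (induction \<sigma> arbitrary: y N rule: multi_index_induct)
 case (up i \<sigma>)
 define z where "z = - D i y"
 have z: "z \<in> C (Suc N)" "x \<in> I \<or> z \<in> I" using up.prems by (auto simp: z_def intro: C_D)
 have x: "x \<in> C (Suc N)" using up.prems by (auto intro: C_le)
 have 1: "D i (Dm \<sigma> x \<odot> y) \<in> dv (N + mi_size (up i \<sigma>))"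
  by (rule dv_D, rule C_mul) (use up.prems in \<open>auto intro: C_le[OF C_Dm] C_le I_mul I_Dm\<close>)
 have 2: "Dm \<sigma> x \<odot> z - x \<odot> ad \<sigma> z \<in> dv (N + mi_size (up i \<sigma>))"
  using up.IH[OF x z] by simp
 have "ad (up i \<sigma>) y = ad \<sigma> z"
  using up.prems by (simp add: z_def ad_up[OF CC_I] ad_minus[OF D_CC[OF CC_I]] ad_D[OF CC_I])
 moreover have "D i (Dm \<sigma> x \<odot> y) = D i (Dm \<sigma> x) \<odot> y + Dm \<sigma> x \<odot> D i y"
  by (rule D_mul[where N = "N + mi_size \<sigma>"]) (use up.prems in \<open>auto intro: C_Dm C_le\<close>)
 moreover have "Dm (up i \<sigma>) x = D i (Dm \<sigma> x)" using up.prems by (simp add: Dm_up[OF CC_I])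
 ultimately have "Dm (up i \<sigma>) x \<odot> y - x \<odot> ad (up i \<sigma>) y =
   D i (Dm \<sigma> x \<odot> y) + (Dm \<sigma> x \<odot> z - x \<odot> ad \<sigma> z)"
  by (simp add: z_def)
 with dv_add[OF 1 2] show ?case by simp
qed simp

lemma integrate_by_parts':
 "x \<in> C N ==> y \<in> C N ==> x \<in> I \<or> y \<in> I ==> ad \<sigma> x \<odot> y - x \<odot> Dm \<sigma> y \<in> dv (N + mi_size \<sigma>)"
proof (induction \<sigma> arbitrary: y N rule: multi_index_induct)
 case (up i \<sigma>)
 define z where "z = D i y"
 have z: "z \<in> C (Suc N)" "x \<in> I \<or> z \<in> I" using up.prems by (auto simp: z_def intro: C_D)
 have x: "x \<in> C (Suc N)" using up.prems by (auto intro: C_le)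
 have 1: "D i (ad \<sigma> x \<odot> y) \<in> dv (N + mi_size (up i \<sigma>))"
  by (rule dv_D, rule C_mul) (use up.prems in \<open>auto intro: C_le[OF C_ad] C_le I_mul I_ad\<close>)
 have 2: "ad \<sigma> x \<odot> z - x \<odot> Dm \<sigma> z \<in> dv (N + mi_size (up i \<sigma>))"
  using up.IH[OF x z] by simp
 have "Dm (up i \<sigma>) y = Dm \<sigma> z"
  using up.prems by (simp add: z_def Dm_up[OF CC_I] Dm_D[OF CC_I])
 moreover have "D i (ad \<sigma> x \<odot> y) = D i (ad \<sigma> x) \<odot> y + ad \<sigma> x \<odot> D i y"
  by (rule D_mul[where N = "N + mi_size \<sigma>"]) (use up.prems in \<open>auto intro: C_ad C_le\<close>)
 moreover have "ad (up i \<sigma>) x = - D i (ad \<sigma> x)" using up.prems by (simp add: ad_up[OF CC_I])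
 ultimately have "ad (up i \<sigma>) x \<odot> y - x \<odot> Dm (up i \<sigma>) y =
   - D i (ad \<sigma> x \<odot> y) + (ad \<sigma> x \<odot> z - x \<odot> Dm \<sigma> z)"
  by (simp add: z_def)
 with dv_add[OF dv_minus[OF 1] 2] show ?case by simp
qed simp

subsection \<open>The bracket and its evolutionary derivations\<close>

text \<open>The components of the evolutionary derivation of \<open>f\<close>. On alternating coefficients a right
 derivative is the parity of the left one, so \<open>chr f False\<close> is minus the right variational derivative
 in \<open>b\<close>, and \<open>br\<close> below is the Schouten bracket.\<close>

definition chr :: "'r => bool => 'm => 'r" where
 "chr f k \<alpha> = (if k then E False \<alpha> f else - par (E True \<alpha> f))"

definition br :: "'r => 'r => 'r" where
 "br f g = (\<Sum>\<alpha>\<in>UNIV. \<Sum>k\<in>UNIV. chr f k \<alpha> \<odot> E k \<alpha> g)"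

definition Qt :: "'r => ('n, 'm) jet_index => 'r => 'r" where
 "Qt f a x = (\<Sum>k\<in>UNIV. Dm (snd a) (chr f k (fst a)) \<odot> pd k a x)"

definition Q :: "'r => 'r => 'r" where
 "Q f x = Sum_any (\<lambda>a. Qt f a x)"

lemma Q_eq:
 assumes "x \<in> C N" "N \<le> M"
 shows "Q f x = (\<Sum>a\<in>idx M. Qt f a x)"
 unfolding Q_def
proof (rule Sum_any.expand_superset)
 show "{a. Qt f a x \<noteq> 0} \<subseteq> idx M"
 proof (rule subsetI, rule ccontr)
  fix a assume "a \<in> {a. Qt f a x \<noteq> 0}" "a \<notin> idx M"
  then show False using pd_order[OF assms(1), of a] assms(2) by (simp add: idx_def Qt_def)
 qed
qed simp

lemma C_chr: "f \<in> C N ==> chr f k \<alpha> \<in> C (N + N)" by (auto simp: chr_def intro: C_E)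
lemma CC_chr: "f \<in> C N ==> chr f k \<alpha> \<in> CC" using C_chr CC_I by blast
lemma I_chr: "f \<in> C N ==> f \<in> I ==> chr f k \<alpha> \<in> I" by (auto simp: chr_def intro: I_E)

lemma C_br: "f \<in> C N ==> g \<in> C N ==> br f g \<in> C (N + N)"
 unfolding br_def by (intro C_sum C_mul C_chr C_E)

lemma I_br: "f \<in> C N ==> g \<in> C N ==> f \<in> I \<or> g \<in> I ==> br f g \<in> I"
 unfolding br_def by (intro I_sum I_mul) (auto intro: I_chr I_E)

lemma C_Qt: "f \<in> C M ==> x \<in> C N ==> Qt f a x \<in> C (M + M + N + mi_size (snd a))"
 unfolding Qt_def by (intro C_sum C_mul) (auto intro: C_le[OF C_Dm[OF C_chr]] C_le[OF C_pd])

lemma CC_Q: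
 assumes f: "f \<in> C M" and x: "x \<in> C N"
 shows "Q f x \<in> C (M + M + N + N)"
 unfolding Q_eq[OF x order_refl]
 by (rule C_sum) (rule C_le[OF C_Qt[OF f x]], auto simp: idx_def)

lemma par_chr:
 assumes "f \<in> C N" "par f = sg e f"
 shows "par (chr f k \<alpha>) = sg (e = k) (chr f k \<alpha>)"
proof -
 have "par (E False \<alpha> f) = sg e (E False \<alpha> f)" "par (E True \<alpha> f) = sg (\<not> e) (E True \<alpha> f)"
  using par_E[OF assms, of False] par_E[OF assms, of True] by auto
 then show ?thesis by (cases k) (auto simp: chr_def)
qed

lemma chr_eq:
 assumes "f \<in> C N" "par f = sg e f"
 shows "chr f k \<alpha> = sg (\<not> k \<and> e) (E (\<not> k) \<alpha> f)"
proof -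
 have "par (E True \<alpha> f) = sg (\<not> e) (E True \<alpha> f)" using par_E[OF assms, of True] by auto
 then show ?thesis by (cases k; cases e) (auto simp: chr_def sg_def)
qed

lemma E_eq_chr:
 assumes "f \<in> C N" "par f = sg e f"
 shows "E k \<alpha> f = sg (k \<and> e) (chr f (\<not> k) \<alpha>)"
 by (simp add: chr_eq[OF assms])

lemma mul_commute': "par x = sg b x ==> par y = sg c y ==> x \<odot> y = sg (b \<and> c) (y \<odot> x)"
 using mul_commute[of x b y c] by simp

lemma Qt_mul:
 assumes f: "f \<in> C M" "par f = sg e f" and x: "x \<in> C N" "par x = sg b x" and y: "y \<in> C N"
 shows "Qt f a (x \<odot> y) = Qt f a x \<odot> y + sg (\<not> e \<and> b) (x \<odot> Qt f a y)"
proof -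
 have "Dm (snd a) (chr f k (fst a)) \<odot> pd k a (x \<odot> y) =
   Dm (snd a) (chr f k (fst a)) \<odot> pd k a x \<odot> y +
   sg (\<not> e \<and> b) (x \<odot> (Dm (snd a) (chr f k (fst a)) \<odot> pd k a y))" for k
 proof -
  let ?c = "Dm (snd a) (chr f k (fst a))"
  have "par ?c = sg (e = k) ?c"
   using par_chr[OF f] by (simp add: par_Dm[OF CC_chr[OF f(1)]] Dm_sg[OF CC_chr[OF f(1)]])
  then have c: "?c \<odot> x = sg ((e = k) \<and> b) (x \<odot> ?c)" using mul_commute' x(2) by blast
  have "(if k then par x else x) = sg (k \<and> b) x" using x(2) by simp
  then have "?c \<odot> pd k a (x \<odot> y) = ?c \<odot> pd k a x \<odot> y + sg (k \<and> b) (?c \<odot> x \<odot> pd k a y)"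
   using pd_mul[OF x(1) y] by (simp add: mul_add_right mul_assoc)
  also have "sg (k \<and> b) (?c \<odot> x \<odot> pd k a y) = sg (\<not> e \<and> b) (x \<odot> (?c \<odot> pd k a y))"
   unfolding c by (cases k; cases b; cases e) (simp_all add: mul_assoc)
  finally show ?thesis .
 qed
 then show ?thesis by (simp add: Qt_def mul_sum_left mul_sum_right sum.distrib sg_sum)
qed

lemma Q_mul:
 assumes f: "f \<in> C M" "par f = sg e f" and x: "x \<in> C N" "par x = sg b x" and y: "y \<in> C N"
 shows "Q f (x \<odot> y) = Q f x \<odot> y + sg (\<not> e \<and> b) (x \<odot> Q f y)"
proof -
 have xy: "x \<odot> y \<in> C N" using x y by auto
 show ?thesis
  unfolding Q_eq[OF xy order_refl] Q_eq[OF x(1) order_refl] Q_eq[OF y order_refl]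
  by (simp add: Qt_mul[OF assms] sum.distrib mul_sum_left mul_sum_right sg_sum)
qed

lemma Qt_add: "x \<in> C N ==> y \<in> C N ==> Qt f a (x + y) = Qt f a x + Qt f a y"
 by (simp add: Qt_def pd_add mul_add_right sum.distrib)

lemma Q_add:
 assumes x: "x \<in> C N" and y: "y \<in> C N"
 shows "Q f (x + y) = Q f x + Q f y"
proof -
 have xy: "x + y \<in> C N" using x y by auto
 show ?thesis
  unfolding Q_eq[OF xy order_refl] Q_eq[OF x order_refl] Q_eq[OF y order_refl]
  by (simp add: Qt_add[OF x y] sum.distrib)
qed

lemma Q_0 [simp]: "Q f 0 = 0" by (simp add: Q_def Qt_def)

lemma Q_minus: "x \<in> C N ==> Q f (- x) = - Q f x"
 using Q_add[of "-x" N x f] by (auto simp: eq_neg_iff_add_eq_0)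

lemma Q_sg: "x \<in> C N ==> Q f (sg b x) = sg b (Q f x)" by (auto simp: sg_def Q_minus)

lemma Q_sum: "(\<And>j. j \<in> K ==> F j \<in> C N) ==> Q f (sum F K) = (\<Sum>j\<in>K. Q f (F j))"
proof (induction K rule: infinite_finite_induct)
 case (insert x G)
 then show ?case using Q_add[OF _ C_sum[of G F N], of "F x" f] by simp
qed simp_all

text \<open>The coefficients of an evolutionary derivation are arranged so that the commutators of
 the \<open>\<partial>/\<partial>u\<^sub>\<sigma>\<close> with \<open>D\<^sub>i\<close> cancel against the derivatives of the coefficients.\<close>

lemma Q_D:
 assumes f: "f \<in> C M" and x: "x \<in> C N"
 shows "Q f (D i x) = D i (Q f x)"
proof -
 define c where "c k a = Dm (snd a) (chr f k (fst a))" for k a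
 have cC: "c k a \<in> CC" for k a unfolding c_def by (rule Dm_CC[OF CC_chr[OF f]])
 have cr: "c k (raise i a) = D i (c k a)" for k a
  by (simp add: c_def snd_raise Dm_up[OF CC_chr[OF f]])
 have Dx: "D i x \<in> C (Suc N)" by (rule C_D[OF x])
 have Dmul: "D i (c k a \<odot> pd k a x) = D i (c k a) \<odot> pd k a x + c k a \<odot> D i (pd k a x)" for k a
  using CC_E2[OF cC[of k a] CC_I[OF C_pd[OF x, of k a]]] D_mul by metis
 have split: "Qt f a (D i x) = (\<Sum>k\<in>UNIV. c k a \<odot> D i (pd k a x)) +
   (if snd a i > 0 then (\<Sum>k\<in>UNIV. c k a \<odot> pd k (lower i a) x) else 0)" for a
  by (simp add: Qt_def pd_D[OF x] c_def[symmetric] mul_add_right sum.distrib)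
 have "Q f (D i x) = (\<Sum>a\<in>idx (Suc N). \<Sum>k\<in>UNIV. c k a \<odot> D i (pd k a x)) +
   (\<Sum>a\<in>idx (Suc N). if snd a i > 0 then (\<Sum>k\<in>UNIV. c k a \<odot> pd k (lower i a) x) else 0)"
  unfolding Q_eq[OF Dx order_refl] split by (rule sum.distrib)
 also have "(\<Sum>a\<in>idx (Suc N). if snd a i > 0 then (\<Sum>k\<in>UNIV. c k a \<odot> pd k (lower i a) x) else 0) =
   (\<Sum>a\<in>idx N. \<Sum>k\<in>UNIV. D i (c k a) \<odot> pd k a x)"
  by (subst sum_shift_idx[where F = "\<lambda>a' a. \<Sum>k\<in>UNIV. c k a \<odot> pd k a' x"]) (simp add: cr)
 also have "(\<Sum>a\<in>idx (Suc N). \<Sum>k\<in>UNIV. c k a \<odot> D i (pd k a x)) =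
   (\<Sum>a\<in>idx N. \<Sum>k\<in>UNIV. c k a \<odot> D i (pd k a x))"
  by (rule sum.mono_neutral_right[OF finite_idx idx_mono]) (auto simp: idx_def pd_order[OF x])
 finally have 1: "Q f (D i x) = (\<Sum>a\<in>idx N. \<Sum>k\<in>UNIV. D i (c k a \<odot> pd k a x))"
  unfolding Dmul by (simp add: sum.distrib add.commute)
 have "D i (Q f x) = (\<Sum>a\<in>idx N. D i (Qt f a x))"
  unfolding Q_eq[OF x order_refl]
  by (rule D_sum) (rule C_le[OF C_Qt[OF f x], where M = "M + M + N + N"], auto simp: idx_def)
 also have "\<dots> = (\<Sum>a\<in>idx N. \<Sum>k\<in>UNIV. D i (c k a \<odot> pd k a x))"
 proof (rule sum.cong[OF refl])
  fix a :: "('n, 'm) jet_index"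
  show "D i (Qt f a x) = (\<Sum>k\<in>UNIV. D i (c k a \<odot> pd k a x))" unfolding Qt_def c_def
   by (rule D_sum[where N = "M + M + mi_size (snd a) + N"], rule C_mul)
     (auto intro: C_le[OF C_Dm[OF C_chr[OF f]]] C_le[OF C_pd[OF x]])
 qed
 finally show ?thesis using 1 by simp
qed

lemma Q_ad:
 assumes f: "f \<in> C M" and x: "x \<in> C N"
 shows "Q f (ad \<sigma> x) = ad \<sigma> (Q f x)"
 unfolding ad_def
proof (rule iter_mi_commute[where C = CC])
 show "x \<in> CC" using x by (rule CC_I)
 show "- D i y \<in> CC" if "y \<in> CC" for i y using that by (intro minus_CC D_CC)
 show "Q f (- D i y) = - D i (Q f y)" if "y \<in> CC" for i y
 proof -
  obtain N where "y \<in> C N" using \<open>y \<in> CC\<close> by (auto simp: CC_def)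
  then show ?thesis using Q_minus[OF C_D[of y N i]] Q_D[OF f] by simp
 qed
qed

lemma par_Q:
 assumes f: "f \<in> C M" "par f = sg e f" and x: "x \<in> C N" "par x = sg b x"
 shows "par (Q f x) = sg (b = e) (Q f x)"
proof -
 have "par (Dm (snd a) (chr f k (fst a)) \<odot> pd k a x) = sg (b = e) (Dm (snd a) (chr f k (fst a)) \<odot> pd k a x)" for k a
 proof -
  have c: "par (Dm (snd a) (chr f k (fst a))) = sg (e = k) (Dm (snd a) (chr f k (fst a)))"
   using par_chr[OF f] by (simp add: par_Dm[OF CC_chr[OF f(1)]] Dm_sg[OF CC_chr[OF f(1)]])
  have "par (pd k a x) = sg k (sg b (pd k a x))"
   by (simp only: par_pd[OF x(1)] x(2) pd_sg[OF x(1)])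
  with c show ?thesis by (cases b; cases e; cases k) (simp_all add: par_mul)
 qed
 then have "par (Qt f a x) = sg (b = e) (Qt f a x)" for a
  by (simp add: Qt_def par_sum sg_sum)
 then show ?thesis by (simp add: Q_eq[OF x(1) order_refl] par_sum sg_sum)
qed

text \<open>Integration by parts moves the total derivatives from the components of \<open>Q f\<close> to the partial
 derivatives of \<open>x\<close>.\<close>

lemma Q_br:
 assumes f: "f \<in> C N" and k: "x \<in> C N" and I: "f \<in> I \<or> x \<in> I"
 shows "Q f x - br f x \<in> dv (N + N + N)"
proof -
 have "br f x = (\<Sum>a\<in>idx N. \<Sum>k\<in>UNIV. chr f k (fst a) \<odot> ad (snd a) (pd k a x))"
  by (simp add: br_def E_eq[OF k order_refl] mul_sum_right sum_idx sum.swap[of _ "mis N"])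
 then have "Q f x - br f x = (\<Sum>a\<in>idx N. \<Sum>k\<in>UNIV.
   Dm (snd a) (chr f k (fst a)) \<odot> pd k a x - chr f k (fst a) \<odot> ad (snd a) (pd k a x))"
  by (simp add: Q_eq[OF k order_refl] Qt_def sum_subtractf)
 also have "\<dots> \<in> dv (N + N + N)"
 proof (intro dv_sum)
  fix a :: "('n, 'm) jet_index" and k assume "a \<in> idx N"
  then show "Dm (snd a) (chr f k (fst a)) \<odot> pd k a x - chr f k (fst a) \<odot> ad (snd a) (pd k a x) \<in> dv (N + N + N)"
   using f \<open>x \<in> C N\<close> I
   by (intro dv_mono[OF integrate_by_parts[where N = "N + N"]])
     (auto simp: idx_def intro: C_chr C_le[OF C_pd] I_chr)
 qed
 finally show ?thesis .
qed

text \<open>The part of \<open>Q f (br g h)\<close> in which \<open>Q f\<close> acts on the variational derivatives of \<open>g\<close>.\<close>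

definition T :: "'r => 'r => 'r => 'r" where
 "T f g h = (\<Sum>\<alpha>\<in>UNIV. \<Sum>k\<in>UNIV. Q f (chr g k \<alpha>) \<odot> E k \<alpha> h)"

lemma sum_bool_not: "(\<Sum>k\<in>UNIV. F (\<not> k)) = (\<Sum>k\<in>(UNIV :: bool set). F k)"
 for F :: "bool => 'x::ab_group_add"
 by (simp add: UNIV_bool add.commute)

text \<open>In the terms in which \<open>Q f\<close> acts on \<open>h\<close>, the two factors are commuted and the even and odd directions
 exchanged. The signs combine to one depending on the parities of \<open>g\<close> and \<open>h\<close> only.\<close>

lemma Q_bracket:
 assumes f: "f \<in> C N" "par f = sg ef f" and g: "g \<in> C N" "par g = sg eg g"
  and h: "h \<in> C N" "par h = sg eh h"
 shows "Q f (br g h) = T f g h + sg (eg \<or> eh) (T f h g)"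
proof -
 have "Q f (chr g k \<alpha> \<odot> E k \<alpha> h) = Q f (chr g k \<alpha>) \<odot> E k \<alpha> h +
   sg (eg \<or> eh) (Q f (chr h (\<not> k) \<alpha>) \<odot> E (\<not> k) \<alpha> g)" for k \<alpha>
 proof -
  have "Q f (chr g k \<alpha> \<odot> E k \<alpha> h) = Q f (chr g k \<alpha>) \<odot> E k \<alpha> h +
    sg (\<not> ef \<and> (eg = k)) (chr g k \<alpha> \<odot> Q f (E k \<alpha> h))"
   by (rule Q_mul[OF f C_chr[OF g(1)] par_chr[OF g] C_E[OF h(1)]])
  also have "chr g k \<alpha> = sg (\<not> k \<and> eg) (E (\<not> k) \<alpha> g)" by (rule chr_eq[OF g])
  also have "E k \<alpha> h = sg (k \<and> eh) (chr h (\<not> k) \<alpha>)" by (rule E_eq_chr[OF h])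
  also have "Q f (sg (k \<and> eh) (chr h (\<not> k) \<alpha>)) = sg (k \<and> eh) (Q f (chr h (\<not> k) \<alpha>))"
   by (rule Q_sg[OF C_chr[OF h(1)]])
  also have "sg (\<not> ef \<and> (eg = k)) (sg (\<not> k \<and> eg) (E (\<not> k) \<alpha> g) \<odot> sg (k \<and> eh) (Q f (chr h (\<not> k) \<alpha>)))
    = sg (eg \<or> eh) (Q f (chr h (\<not> k) \<alpha>) \<odot> E (\<not> k) \<alpha> g)"
   using mul_commute'[OF par_E[OF g, of "\<not> k" \<alpha>] par_Q[OF f C_chr[OF h(1)] par_chr[OF h, of "\<not> k" \<alpha>]]]
   by (cases ef; cases eg; cases eh; cases k) simp_all
  finally show ?thesis by (simp add: chr_eq[OF g] E_eq_chr[OF h])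
 qed
 moreover have "Q f (br g h) = (\<Sum>\<alpha>\<in>UNIV. \<Sum>k\<in>UNIV. Q f (chr g k \<alpha> \<odot> E k \<alpha> h))"
  unfolding br_def using C_mul[OF C_chr[OF g(1)] C_E[OF h(1)]]
  by (simp add: Q_sum[where N = "N + N"] C_sum)
 ultimately show ?thesis
  by (simp add: T_def sum.distrib sg_sum sum_bool_not[where F = "\<lambda>k. sg _ (Q f (chr h k _) \<odot> E k _ g)"])
qed

text \<open>The second variation of \<open>g\<close> in the directions \<open>chr f\<close> and \<open>chr h\<close>, before the derivatives
 falling on \<open>chr h\<close> are moved away.\<close>

definition second_variation :: "nat => 'r => 'r => 'r => bool => bool => 'r" where
 "second_variation N f g h eg eh = (\<Sum>a\<in>idx N. \<Sum>j\<in>UNIV. \<Sum>b\<in>idx N. \<Sum>k\<in>UNIV.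
   sg ((j \<and> eg) \<noteq> (\<not> j \<and> eh))
    (Dm (snd b) (chr f k (fst b)) \<odot> pd k b (pd j a g) \<odot> Dm (snd a) (chr h j (fst a))))"

text \<open>\<open>Q f\<close> commutes with the adjoints in the Euler operator of \<open>g\<close>, which are then moved to \<open>chr h\<close> by
 integration by parts.\<close>

lemma T_second_variation:
 assumes f: "f \<in> C N" "par f = sg ef f" and g: "g \<in> C N" "par g = sg eg g"
  and h: "h \<in> C N" "par h = sg eh h" and I: "f \<in> I \<or> g \<in> I \<or> h \<in> I"
 shows "T f g h - second_variation N f g h eg eh \<in> dv (5 * N)"
proof -
 have QE: "Q f (E j \<alpha> g) = (\<Sum>\<sigma>\<in>mis N. ad \<sigma> (Q f (pd j (\<alpha>, \<sigma>) g)))" for j \<alpha>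
 proof -
  have "Q f (E j \<alpha> g) = (\<Sum>\<sigma>\<in>mis N. Q f (ad \<sigma> (pd j (\<alpha>, \<sigma>) g)))"
   unfolding E_eq[OF g(1) order_refl]
   by (rule Q_sum[where N = "N + N"]) (rule C_le[OF C_ad[OF C_pd[OF g(1)]]], auto simp: mis_def)
  then show ?thesis by (simp add: Q_ad[OF f(1) C_pd[OF g(1)]])
 qed
 have "T f g h = (\<Sum>\<alpha>\<in>UNIV. \<Sum>k\<in>UNIV. sg ((\<not> k \<and> eg) \<noteq> (k \<and> eh)) (Q f (E (\<not> k) \<alpha> g) \<odot> chr h (\<not> k) \<alpha>))"
 proof -
  have "Q f (chr g k \<alpha>) \<odot> E k \<alpha> h =
    sg ((\<not> k \<and> eg) \<noteq> (k \<and> eh)) (Q f (E (\<not> k) \<alpha> g) \<odot> chr h (\<not> k) \<alpha>)" for k \<alpha>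
   unfolding chr_eq[OF g] E_eq_chr[OF h] Q_sg[OF C_E[OF g(1)]]
   by (cases k; cases eg; cases eh) simp_all
  then show ?thesis unfolding T_def by (intro sum.cong[OF refl])
 qed
 also have "\<dots> = (\<Sum>\<alpha>\<in>UNIV. \<Sum>j\<in>UNIV. sg ((j \<and> eg) \<noteq> (\<not> j \<and> eh)) (Q f (E j \<alpha> g) \<odot> chr h j \<alpha>))"
  by (subst sum_bool_not[where F = "\<lambda>j. sg ((j \<and> eg) \<noteq> (\<not> j \<and> eh)) (Q f (E j _ g) \<odot> chr h j _)", symmetric]) simp
 also have "\<dots> = (\<Sum>a\<in>idx N. \<Sum>j\<in>UNIV. sg ((j \<and> eg) \<noteq> (\<not> j \<and> eh))
   (ad (snd a) (Q f (pd j a g)) \<odot> chr h j (fst a)))"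
  by (simp add: QE mul_sum_left sg_sum sum_idx sum.swap[of _ "mis N"])
 finally have T: "T f g h = \<dots>" .
 have SV: "second_variation N f g h eg eh = (\<Sum>a\<in>idx N. \<Sum>j\<in>UNIV. sg ((j \<and> eg) \<noteq> (\<not> j \<and> eh))
   (Q f (pd j a g) \<odot> Dm (snd a) (chr h j (fst a))))"
  unfolding second_variation_def Q_eq[OF C_pd[OF g(1)] order_refl] Qt_def
  by (simp add: mul_sum_left sg_sum)
 have "T f g h - second_variation N f g h eg eh = (\<Sum>a\<in>idx N. \<Sum>j\<in>UNIV. sg ((j \<and> eg) \<noteq> (\<not> j \<and> eh))
   (ad (snd a) (Q f (pd j a g)) \<odot> chr h j (fst a) - Q f (pd j a g) \<odot> Dm (snd a) (chr h j (fst a))))"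
  unfolding T SV by (simp add: sum_subtractf[symmetric] sg_def cong: if_cong) (simp add: sum_subtractf sg_def if_distrib cong: if_cong)
 also have "\<dots> \<in> dv (5 * N)"
 proof (intro dv_sum dv_sg)
  fix a :: "('n, 'm) jet_index" and j assume a: "a \<in> idx N"
  have 1: "Q f (pd j a g) \<in> C (4 * N)" using C_le[OF CC_Q[OF f(1) C_pd[OF g(1)]]] by simp
  have 2: "chr h j (fst a) \<in> C (4 * N)" by (rule C_le[OF C_chr[OF h(1)]]) simp
  have 3: "Q f (pd j a g) \<in> I \<or> chr h j (fst a) \<in> I"
  proof -
   have "Q f (pd j a g) \<in> I" if "f \<in> I \<or> g \<in> I"
    unfolding Q_eq[OF C_pd[OF g(1)] order_refl] Qt_def
    by (intro I_sum I_mul) (use that in \<open>auto intro: I_Dm I_chr f(1)\<close>)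
   then show ?thesis using I I_chr[OF h(1)] by blast
  qed
  show "ad (snd a) (Q f (pd j a g)) \<odot> chr h j (fst a) - Q f (pd j a g) \<odot> Dm (snd a) (chr h j (fst a)) \<in> dv (5 * N)"
   using a by (intro dv_mono[OF integrate_by_parts'[OF 1 2 3]]) (simp add: idx_def)
 qed
 finally show ?thesis .
qed

text \<open>Second partial derivatives commute up to sign, and so do the components along the two directions.\<close>

lemma second_variation_symmetric:
 assumes f: "f \<in> C N" "par f = sg ef f" and g: "g \<in> C N" "par g = sg eg g"
  and h: "h \<in> C N" "par h = sg eh h"
 shows "second_variation N f g h eg eh =
   sg (((ef \<and> eg) \<noteq> (eg \<and> eh)) = (ef \<and> eh)) (second_variation N h g f eg ef)"
proof -
 let ?F = "\<lambda>k b. Dm (snd b) (chr f k (fst b))" and ?H = "\<lambda>k b. Dm (snd b) (chr h k (fst b))"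
 let ?s = "((ef \<and> eg) \<noteq> (eg \<and> eh)) = (ef \<and> eh)"
 have pF: "par (?F k b) = sg (ef = k) (?F k b)" for b k
  using par_chr[OF f] by (simp add: par_Dm[OF CC_chr[OF f(1)]] Dm_sg[OF CC_chr[OF f(1)]])
 have pH: "par (?H k b) = sg (eh = k) (?H k b)" for b k
  using par_chr[OF h] by (simp add: par_Dm[OF CC_chr[OF h(1)]] Dm_sg[OF CC_chr[OF h(1)]])
 have pG: "par (pd k b (pd j a g)) = sg (eg \<noteq> (j \<noteq> k)) (pd k b (pd j a g))" for k b j a
  using g by (cases eg; cases j; cases k) (simp_all add: par_pd[OF C_pd[OF g(1)]] par_pd[OF g(1)]
    pd_sg[OF g(1)] pd_minus[OF g(1)] pd_sg[OF C_pd[OF g(1)]] pd_minus[OF C_pd[OF g(1)]])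
 have rev: "sg ((j \<and> eg) \<noteq> (\<not> j \<and> eh)) (?F k b \<odot> pd k b (pd j a g) \<odot> ?H j a) =
   sg ?s (sg ((k \<and> eg) \<noteq> (\<not> k \<and> ef)) (?H j a \<odot> pd j a (pd k b g) \<odot> ?F k b))" for j k a b
 proof -
  let ?G = "pd k b (pd j a g)"
  have "?F k b \<odot> ?G \<odot> ?H j a = sg ((ef = k) \<and> (eg \<noteq> (j \<noteq> k))) (?G \<odot> ?F k b \<odot> ?H j a)"
   using mul_commute'[OF pF[of b k] pG[where k = k and b = b and j = j and a = a]] by simp
  also have "?G \<odot> ?F k b \<odot> ?H j a = sg ((ef = k) \<and> (eh = j)) (?G \<odot> ?H j a \<odot> ?F k b)"
   using mul_commute'[OF pF[of b k] pH[of a j]] by (simp add: mul_assoc)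
  also have "?G \<odot> ?H j a = sg ((eg \<noteq> (j \<noteq> k)) \<and> (eh = j)) (?H j a \<odot> ?G)"
   using mul_commute'[OF pG[where k = k and b = b and j = j and a = a] pH[of a j]] by simp
  finally have 1: "?F k b \<odot> ?G \<odot> ?H j a = sg ((ef = k) \<and> (eg \<noteq> (j \<noteq> k))) (sg ((ef = k) \<and> (eh = j))
    (sg ((eg \<noteq> (j \<noteq> k)) \<and> (eh = j)) (?H j a \<odot> ?G) \<odot> ?F k b))" .
  have 2: "?H j a \<odot> ?G \<odot> ?F k b = sg (k \<and> j) (?H j a \<odot> pd j a (pd k b g) \<odot> ?F k b)"
   unfolding pd_pd[OF g(1), of k b j a] by simp
  show ?thesis unfolding 1 mul_sg_left 2 by (cases ef; cases eg; cases eh; cases j; cases k) simp_all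
 qed
 have "second_variation N f g h eg eh = (\<Sum>a\<in>idx N. \<Sum>j\<in>UNIV. \<Sum>b\<in>idx N. \<Sum>k\<in>UNIV.
   sg ?s (sg ((k \<and> eg) \<noteq> (\<not> k \<and> ef)) (?H j a \<odot> pd j a (pd k b g) \<odot> ?F k b)))"
  unfolding second_variation_def rev ..
 also have "\<dots> = (\<Sum>b\<in>idx N. \<Sum>k\<in>UNIV. \<Sum>a\<in>idx N. \<Sum>j\<in>UNIV.
   sg ?s (sg ((k \<and> eg) \<noteq> (\<not> k \<and> ef)) (?H j a \<odot> pd j a (pd k b g) \<odot> ?F k b)))"
  (is "(\<Sum>a\<in>idx N. \<Sum>j\<in>UNIV. \<Sum>b\<in>idx N. \<Sum>k\<in>UNIV. ?X a j b k) = _")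
 proof -
  have "(\<Sum>a\<in>idx N. \<Sum>j\<in>UNIV. \<Sum>b\<in>idx N. \<Sum>k\<in>UNIV. ?X a j b k) =
    (\<Sum>a\<in>idx N. \<Sum>b\<in>idx N. \<Sum>j\<in>UNIV. \<Sum>k\<in>UNIV. ?X a j b k)"
   by (rule sum.cong[OF refl]) (rule sum.swap)
  also have "\<dots> = (\<Sum>b\<in>idx N. \<Sum>a\<in>idx N. \<Sum>j\<in>UNIV. \<Sum>k\<in>UNIV. ?X a j b k)" by (rule sum.swap)
  also have "\<dots> = (\<Sum>b\<in>idx N. \<Sum>a\<in>idx N. \<Sum>k\<in>UNIV. \<Sum>j\<in>UNIV. ?X a j b k)"
   by (rule sum.cong[OF refl], rule sum.cong[OF refl], rule sum.swap)
  also have "\<dots> = (\<Sum>b\<in>idx N. \<Sum>k\<in>UNIV. \<Sum>a\<in>idx N. \<Sum>j\<in>UNIV. ?X a j b k)"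
   by (rule sum.cong[OF refl]) (rule sum.swap)
  finally show ?thesis .
 qed
 finally show ?thesis unfolding second_variation_def sg_sum .
qed

text \<open>Each double bracket is a sum of two terms \<open>T\<close>, and the symmetry of the second variation relates
 \<open>T f g h\<close> to \<open>T h g f\<close>, which occurs with the opposite sign in another double bracket.\<close>

theorem jacobi_dv:
 assumes f: "f \<in> C N" "par f = sg ef f" and g: "g \<in> C N" "par g = sg eg g"
  and h: "h \<in> C N" "par h = sg eh h" and I: "f \<in> I \<or> g \<in> I \<or> h \<in> I"
 shows "sg (\<not> ef \<and> \<not> eh) (br f (br g h)) + sg (\<not> ef \<and> \<not> eg) (br g (br h f)) +
   sg (\<not> eg \<and> \<not> eh) (br h (br f g)) \<in> dv (6 * N)"
proof -
 have B: "br f (br g h) - (T f g h + sg (eg \<or> eh) (T f h g)) \<in> dv (6 * N)"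
  if f: "f \<in> C N" "par f = sg ef f" and g: "g \<in> C N" "par g = sg eg g"
  and h: "h \<in> C N" "par h = sg eh h" and I: "f \<in> I \<or> g \<in> I \<or> h \<in> I" for f g h ef eg eh
 proof -
  have "Q f (br g h) - br f (br g h) \<in> dv (N + N + (N + N) + (N + N))"
   by (rule Q_br) (use f g h I in \<open>auto intro: C_le C_br I_br\<close>)
  then have "- (Q f (br g h) - br f (br g h)) \<in> dv (6 * N)" by (intro dv_minus, elim dv_mono) simp
  then show ?thesis using Q_bracket[OF f g h] by simp
 qed
 have S: "T f g h - sg (((ef \<and> eg) \<noteq> (eg \<and> eh)) = (ef \<and> eh)) (T h g f) \<in> dv (6 * N)"
  if f: "f \<in> C N" "par f = sg ef f" and g: "g \<in> C N" "par g = sg eg g"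
  and h: "h \<in> C N" "par h = sg eh h" and I: "f \<in> I \<or> g \<in> I \<or> h \<in> I" for f g h ef eg eh
 proof -
  let ?s = "((ef \<and> eg) \<noteq> (eg \<and> eh)) = (ef \<and> eh)"
  have "T f g h - second_variation N f g h eg eh \<in> dv (6 * N)"
   by (rule dv_mono[OF T_second_variation[OF f g h I]]) simp
  moreover have "sg ?s (T h g f - second_variation N h g f eg ef) \<in> dv (6 * N)"
   by (rule dv_sg, rule dv_mono[OF T_second_variation[OF h g f]]) (use I in auto)
  ultimately have "(T f g h - second_variation N f g h eg eh) -
    sg ?s (T h g f - second_variation N h g f eg ef) \<in> dv (6 * N)" by (rule dv_diff)
  moreover have "(X - sg s Y) - sg s (Z - Y) = X - sg s Z" for X Y Z :: 'r and s
   by (simp add: sg_def)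
  ultimately show ?thesis unfolding second_variation_symmetric[OF f g h] by simp
 qed
 have b1: "br f (br g h) - (T f g h + sg (eg \<or> eh) (T f h g)) \<in> dv (6 * N)"
  and b2: "br g (br h f) - (T g h f + sg (eh \<or> ef) (T g f h)) \<in> dv (6 * N)"
  and b3: "br h (br f g) - (T h f g + sg (ef \<or> eg) (T h g f)) \<in> dv (6 * N)"
  by (rule B[OF f g h I], rule B[OF g h f], use I in blast, rule B[OF h f g], use I in blast)
 have s1: "T f g h - sg (((ef \<and> eg) \<noteq> (eg \<and> eh)) = (ef \<and> eh)) (T h g f) \<in> dv (6 * N)"
  and s2: "T g h f - sg (((eg \<and> eh) \<noteq> (eh \<and> ef)) = (eg \<and> ef)) (T f h g) \<in> dv (6 * N)"
  and s3: "T h f g - sg (((eh \<and> ef) \<noteq> (ef \<and> eg)) = (eh \<and> eg)) (T g f h) \<in> dv (6 * N)"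
  by (rule S[OF f g h I], rule S[OF g h f], use I in blast, rule S[OF h f g], use I in blast)
 have "sg (\<not> ef \<and> \<not> eh) (br f (br g h)) + sg (\<not> ef \<and> \<not> eg) (br g (br h f)) +
   sg (\<not> eg \<and> \<not> eh) (br h (br f g)) =
  sg (\<not> ef \<and> \<not> eh) (br f (br g h) - (T f g h + sg (eg \<or> eh) (T f h g))) +
  sg (\<not> ef \<and> \<not> eg) (br g (br h f) - (T g h f + sg (eh \<or> ef) (T g f h))) +
  sg (\<not> eg \<and> \<not> eh) (br h (br f g) - (T h f g + sg (ef \<or> eg) (T h g f))) +
  (sg (\<not> ef \<and> \<not> eh) (T f g h - sg (((ef \<and> eg) \<noteq> (eg \<and> eh)) = (ef \<and> eh)) (T h g f)) +
  sg (\<not> ef \<and> \<not> eg) (T g h f - sg (((eg \<and> eh) \<noteq> (eh \<and> ef)) = (eg \<and> ef)) (T f h g)) +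
  sg (\<not> eg \<and> \<not> eh) (T h f g - sg (((eh \<and> ef) \<noteq> (ef \<and> eg)) = (eh \<and> eg)) (T g f h)))"
  by (cases ef; cases eg; cases eh) (simp_all add: sg_def)
 also have "\<dots> \<in> dv (6 * N)"
  by (intro dv_add dv_sg b1 b2 b3 s1 s2 s3)
 finally show ?thesis .
qed

end

section \<open>Jet coordinates\<close>

interpretation base: coordinate_flows "base_shift :: 'n::finite => real => real^'n => real^'n" "\<lambda>i x. x $ i"
proof
 fix c d :: 'n and s t and p :: "real^'n"
 show "base_shift c 0 p = p" by (simp add: base_shift_def)
 show "base_shift c s (base_shift c t p) = base_shift c (s + t) p"
  by (simp add: base_shift_def scaleR_add_left)
 show "base_shift c s (base_shift d t p) = base_shift d t (base_shift c s p)"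
  by (simp add: base_shift_def)
 show "continuous_on UNIV (\<lambda>(t, p). base_shift c t p)"
  unfolding base_shift_def case_prod_beta by (intro continuous_intros)
 show "base_shift c t p $ d = p $ d + (if d = c then t else 0)"
  by (simp add: base_shift_def axis_def)
qed

definition jet_coord :: "'n + ('n, 'm) jet_index => ('n::finite, 'm) jet => real" where
 "jet_coord c p = (case c of Inl i => fst p $ i | Inr a => snd p a)"

lemma jet_coord_simps [simp]: "jet_coord (Inl i) p = fst p $ i" "jet_coord (Inr a) p = snd p a"
 by (simp_all add: jet_coord_def)

lemma jet_shift_alt: "jet_shift (Inl i) t p = (base_shift i t (fst p), snd p)"
 "jet_shift (Inr a) t p = (fst p, (snd p)(a := snd p a + t))"
 by (cases p; simp)+

interpretation jet: coordinate_flows "jet_shift :: 'n + ('n, 'm) jet_index => real => ('n::finite, 'm) jet => _" jet_coord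
proof
 fix c d :: "'n + ('n, 'm) jet_index" and s t and p :: "('n, 'm) jet"
 show "jet_shift c 0 p = p" by (cases c) (simp_all add: jet_shift_alt)
 show "jet_shift c s (jet_shift c t p) = jet_shift c (s + t) p"
  by (cases c) (simp_all add: jet_shift_alt base.sh_add add.assoc add.commute)
 show "jet_shift c s (jet_shift d t p) = jet_shift d t (jet_shift c s p)"
  by (cases c; cases d) (auto simp: jet_shift_alt base.sh_commute fun_eq_iff)
 show "jet_coord d (jet_shift c t p) = jet_coord d p + (if d = c then t else 0)"
  by (cases c; cases d) (auto simp: jet_shift_alt base.co_sh)
 show "continuous_on UNIV (\<lambda>(t, p). jet_shift c t p :: ('n, 'm) jet)"
 proof (cases c)
  case (Inl i)
  show ?thesis unfolding Inl jet_shift_alt base_shift_def case_prod_beta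
   by (intro continuous_on_Pair continuous_on_add continuous_on_scaleR continuous_on_fst
     continuous_on_snd continuous_on_id continuous_on_const)
 next
  case (Inr a)
  have "continuous_on UNIV (\<lambda>x :: real \<times> ('n, 'm) jet. (snd (snd x))(a := snd (snd x) a + fst x))"
  proof (rule continuous_on_coordinatewise_then_product)
   fix b
   have q: "continuous_on UNIV (\<lambda>x :: real \<times> ('n, 'm) jet. snd (snd x) b)" for b
    by (rule continuous_on_product_then_coordinatewise[OF continuous_on_snd[OF continuous_on_snd[OF continuous_on_id]]])
   show "continuous_on UNIV (\<lambda>x :: real \<times> ('n, 'm) jet. ((snd (snd x))(a := snd (snd x) a + fst x)) b)"
    by (cases "b = a") (auto intro!: continuous_on_add continuous_on_fst continuous_on_id q)
  qed
  then show ?thesis unfolding Inr jet_shift_alt case_prod_beta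
   by (intro continuous_on_Pair continuous_on_fst continuous_on_snd continuous_on_id)
 qed
qed

definition jc :: "nat => ('n::finite + ('n, 'm::finite) jet_index) set" where
 "jc N = range Inl \<union> Inr ` idx N"

lemma finite_jc [simp]: "finite (jc N)" by (simp add: jc_def)

definition sreg :: "nat => (real^'n) set => (('n::finite, 'm::finite) jet => real) => bool" where
 "sreg N U F \<longleftrightarrow> smooth_along jet_shift (U \<times> UNIV) F \<and> jet.depends_on (jc N) (U \<times> UNIV) F"

definition oreg :: "nat => ('n::finite, 'm::finite) jet_index odd_poly => bool" where
 "oreg N w \<longleftrightarrow> alternating w \<and> (\<forall>l. (\<exists>a\<in>set l. mi_size (snd a) > N) \<longrightarrow> w l = 0)"

lemma depends_on_jc:
 fixes F :: "('n::finite, 'm::finite) jet => real"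
 shows "jet.depends_on (jc N) (U \<times> UNIV) F \<longleftrightarrow>
  (\<forall>x\<in>U. \<forall>q q'. (\<forall>a. mi_size (snd a) \<le> N \<longrightarrow> q a = q' a) \<longrightarrow> F (x, q) = F (x, q'))"
proof -
 have "(\<forall>k\<in>jc N. jet_coord k u = jet_coord k v) \<longleftrightarrow>
   fst u = fst v \<and> (\<forall>a. mi_size (snd a) \<le> N \<longrightarrow> snd u a = snd v a)" for u v :: "('n, 'm) jet"
  by (auto simp: jc_def idx_def vec_eq_iff ball_Un)
 then show ?thesis unfolding jet.depends_on_def by (auto; metis)
qed

lemma regular_density_iff: "regular_density N U f \<longleftrightarrow>
  (\<forall>l. sreg N U (\<lambda>p. f p l)) \<and> (\<forall>x\<in>U. \<forall>q. oreg N (f (x, q)))"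
proof -
 have "(\<forall>x\<in>U. \<forall>q q'. (\<forall>a. mi_size (snd a) \<le> N \<longrightarrow> q a = q' a) \<longrightarrow> f (x, q) = f (x, q')) \<longleftrightarrow>
   (\<forall>l. \<forall>x\<in>U. \<forall>q q'. (\<forall>a. mi_size (snd a) \<le> N \<longrightarrow> q a = q' a) \<longrightarrow> f (x, q) l = f (x, q') l)"
  by (auto simp: fun_eq_iff)
 then show ?thesis unfolding regular_density_def sreg_def oreg_def depends_on_jc by blast
qed

lemma open_jets: "open U ==> open (U \<times> (UNIV :: (('n, 'm) jet_index => real) set))"
 by (rule open_Times) auto

context
 fixes U :: "(real^'n::finite) set"
 assumes U: "open U"
begin

lemma open_U_jets: "open (U \<times> (UNIV :: (('n, 'm::finite) jet_index => real) set))" by (rule open_jets[OF U])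

lemma sreg_const [simp]: "sreg N U (\<lambda>p. k)" by (simp add: sreg_def jet.depends_on_def)

lemma sreg_add: "sreg N U F ==> sreg N U G ==> sreg N U (\<lambda>p. F p + G p)"
 unfolding sreg_def jet.depends_on_def using jet.smooth_add[OF open_U_jets, of F G]
 by (metis (no_types, lifting))

lemma sreg_mult: "sreg N U F ==> sreg N U G ==> sreg N U (\<lambda>p. F p * G p)"
 unfolding sreg_def jet.depends_on_def using jet.smooth_mult[OF open_U_jets, of F G]
 by (metis (no_types, lifting))

lemma sreg_minus: "sreg N U F ==> sreg N U (\<lambda>p. - F p)"
 using sreg_mult[of N "\<lambda>p. -1" F] by simp

lemma sreg_sum: "(\<And>k. k \<in> K ==> sreg N U (F k)) ==> sreg N U (\<lambda>p. \<Sum>k\<in>K. F k p)"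
 by (induction K rule: infinite_finite_induct) (auto intro: sreg_add)

lemma sreg_pder: "sreg N U F ==> sreg N U (pder jet_shift c F)"
 unfolding sreg_def by (intro conjI smooth_along_pder jet.depends_on_pder[OF open_U_jets]) auto

lemma sreg_mono: "sreg N U F ==> N \<le> M ==> sreg M U F"
 unfolding sreg_def jet.depends_on_def jc_def using idx_mono[of N M] by blast

lemma sreg_cong: "sreg N U F ==> (\<And>p. p \<in> U \<times> UNIV ==> F p = G p) ==> sreg N U G"
 unfolding sreg_def jet.depends_on_def using jet.smooth_along_cong[OF open_U_jets, of F G] by auto

lemma sreg_pder_0: "sreg N U F ==> N < mi_size (snd a) ==> p \<in> U \<times> UNIV ==> qder a F p = 0"
 unfolding sreg_def by (rule jet.pder_independent[OF open_U_jets, of "jc N"]) (auto simp: jc_def idx_def)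

lemma sreg_smooth: "sreg N U F ==> smooth_along jet_shift (U \<times> UNIV) F" by (simp add: sreg_def)

end

lemma pder_jet_fst:
 "pder jet_shift (Inl i) (\<lambda>p. u (fst p)) = (\<lambda>p. bder i u (fst p))"
 "qder a (\<lambda>p. u (fst p)) = (\<lambda>p. 0)"
 by (simp_all add: pder_def jet_shift_alt fun_eq_iff)

lemma smooth_base_jet:
 assumes U: "open U" and u: "base_smooth U u"
 shows "smooth_along jet_shift (U \<times> UNIV) (\<lambda>p. u (fst p))"
proof (rule jet.smooth_along_coinduct[OF open_jets[OF U],
   where X = "\<lambda>g. \<exists>u. base_smooth U u \<and> g = (\<lambda>p. u (fst p))"])
 show "\<exists>u'. base_smooth U u' \<and> (\<lambda>p. u (fst p)) = (\<lambda>p. u' (fst p))" using u by blast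
 fix g :: "('a, 'b) jet => real" and c
 assume "\<exists>u. base_smooth U u \<and> g = (\<lambda>p. u (fst p))"
 then obtain u where u: "base_smooth U u" and g: "g = (\<lambda>p. u (fst p))" by blast
 show "continuous_on (U \<times> UNIV) g" unfolding g
  by (rule continuous_on_compose2[OF smooth_along_continuous[OF u]]) (auto intro: continuous_intros)
 show "(\<lambda>t. g (jet_shift c t p)) field_differentiable at 0" if "p \<in> U \<times> UNIV" for p
  using that smooth_along_differentiable[OF u] by (cases c) (auto simp: g jet_shift_alt)
 show "\<exists>g'. (\<exists>u. base_smooth U u \<and> g' = (\<lambda>p. u (fst p))) \<and>
   (\<forall>p\<in>U \<times> UNIV. pder jet_shift c g p = g' p)"
 proof (cases c)
  case (Inl i)
  then show ?thesis using smooth_along_pder[OF u, of i] by (auto simp: g pder_jet_fst)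
 next
  case (Inr a)
  then show ?thesis
   by (intro exI[of _ "\<lambda>p. 0"] conjI exI[of _ "\<lambda>x. 0"]) (auto simp: g pder_jet_fst)
 qed
qed

lemma sreg_base: "open U ==> base_smooth U u ==> sreg N U (\<lambda>p. u (fst p))"
 unfolding sreg_def depends_on_jc using smooth_base_jet by auto

lemma pder_jet_coord: "pder jet_shift c (jet_coord d) = (\<lambda>p. if d = c then 1 else 0)"
proof
 fix p
 show "pder jet_shift c (jet_coord d) p = (if d = c then 1 else 0)"
  by (rule pderI) (auto simp: jet.co_sh intro!: derivative_eq_intros)
qed

lemma sreg_coord: "open U ==> mi_size (snd a) \<le> N ==> sreg N U (\<lambda>p. snd p a)"
proof -
 assume U: "open U" and a: "mi_size (snd a) \<le> N"
 have "smooth_along jet_shift (U \<times> UNIV) (\<lambda>p. jet_coord (Inr a) p)"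
 proof (rule jet.smooth_along_coinduct[OF open_jets[OF U],
   where X = "\<lambda>g. g = jet_coord (Inr a) \<or> (\<exists>k. g = (\<lambda>p. k))"])
  fix g :: "('a, 'b) jet => real" and c
  assume g: "g = jet_coord (Inr a) \<or> (\<exists>k. g = (\<lambda>p. k))"
  have q: "continuous_on (U \<times> UNIV) (\<lambda>p. snd p a)"
   by (rule continuous_on_product_then_coordinatewise[OF continuous_on_snd[OF continuous_on_id]])
  then show "continuous_on (U \<times> UNIV) g" using g by (auto simp: jet_coord_def[abs_def])
  have "(\<lambda>t. k + (if b then t else 0)) field_differentiable at 0" for k :: real and b
   by (cases b) (simp_all add: field_differentiable_add field_differentiable_const field_differentiable_ident)
  then show "(\<lambda>t. g (jet_shift c t p)) field_differentiable at 0" for p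
   using g by (auto simp: jet.co_sh)
  show "\<exists>g'. (g' = jet_coord (Inr a) \<or> (\<exists>k. g' = (\<lambda>p. k))) \<and> (\<forall>p\<in>U \<times> UNIV. pder jet_shift c g p = g' p)"
   using g by (auto simp: pder_jet_coord)
 next
  show "(\<lambda>p. jet_coord (Inr a) p) = jet_coord (Inr a) \<or> (\<exists>k. (\<lambda>p. jet_coord (Inr a) p) = (\<lambda>p. k))"
   by (rule disjI1) (rule refl)
 qed
 then show ?thesis using a by (cases a) (auto simp: sreg_def depends_on_jc)
qed

lemma pder_q: "pder jet_shift (Inl i) (\<lambda>p. snd p a) p = 0"
 "qder b (\<lambda>p. snd p a) p = (if a = b then 1 else 0)"
proof -
 have *: "jet_coord (Inr a) = (\<lambda>p. snd p a)" by (simp add: fun_eq_iff)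
 show "pder jet_shift (Inl i) (\<lambda>p. snd p a) p = 0"
  "qder b (\<lambda>p. snd p a) p = (if a = b then 1 else 0)"
  using fun_cong[OF pder_jet_coord[of "Inl i" "Inr a"], of p] fun_cong[OF pder_jet_coord[of "Inr b" "Inr a"], of p]
  unfolding * by simp_all
qed

section \<open>Odd polynomials\<close>

definition parity :: "'i odd_poly => 'i odd_poly" where
 "parity v = (\<lambda>l. (-1) ^ length l * v l)"

lemma odd_mult_Cons: "odd_mult v w (a # l) = odd_mult (lder a v) w l + odd_mult (parity v) (lder a w) l"
 by (simp add: parity_def)

lemma lder_odd_mult: "lder a (odd_mult v w) = odd_mult (lder a v) w + odd_mult (parity v) (lder a w)"
 by (simp add: lder_def parity_def fun_eq_iff)

lemma lder_add [simp]: "lder a (v + w) = lder a v + lder a w" and lder_0 [simp]: "lder a 0 = 0"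
 and lder_scale [simp]: "lder a (\<lambda>l. k * v l) = (\<lambda>l. k * lder a v l)"
 and lder_minus [simp]: "lder a (- v) = - lder a v"
 by (simp_all add: lder_def fun_eq_iff)

lemma parity_add [simp]: "parity (v + w) = parity v + parity w" and parity_0 [simp]: "parity 0 = 0"
 and parity_scale [simp]: "parity (\<lambda>l. k * v l) = (\<lambda>l. k * parity v l)"
 and parity_minus [simp]: "parity (- v) = - parity v"
 and lder_parity: "lder a (parity v) = - parity (lder a v)"
 and parity_parity [simp]: "parity (parity v) = v"
 by (auto simp: parity_def lder_def fun_eq_iff algebra_simps simp flip: power_mult_distrib mult.assoc)

lemma odd_mult_add_left: "odd_mult (u + v) w l = odd_mult u w l + odd_mult v w l"
 by (induction l arbitrary: u v w) (simp_all add: odd_mult_Cons algebra_simps del: odd_mult.simps(2))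

lemma odd_mult_add_right: "odd_mult w (u + v) l = odd_mult w u l + odd_mult w v l"
 by (induction l arbitrary: u v w) (simp_all add: odd_mult_Cons algebra_simps del: odd_mult.simps(2))

lemma odd_mult_scale_left: "odd_mult (\<lambda>l. k * v l) w l = k * odd_mult v w l"
 by (induction l arbitrary: v w) (simp_all add: odd_mult_Cons algebra_simps del: odd_mult.simps(2))

lemma odd_mult_scale_right: "odd_mult w (\<lambda>l. k * v l) l = k * odd_mult w v l"
 by (induction l arbitrary: v w) (simp_all add: odd_mult_Cons algebra_simps del: odd_mult.simps(2))

lemma odd_mult_minus_left: "odd_mult (- v) w l = - odd_mult v w l"
 and odd_mult_minus_right: "odd_mult w (- v) l = - odd_mult w v l"
 using odd_mult_scale_left[of "-1" v w l] odd_mult_scale_right[of w "-1" v l]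
 by (simp_all add: fun_Compl_def)

lemma odd_mult_0_left [simp]: "odd_mult 0 w l = 0" and odd_mult_0_right [simp]: "odd_mult w 0 l = 0"
 using odd_mult_add_left[of 0 0 w l] odd_mult_add_right[of w 0 0 l] by simp_all

lemma parity_odd_mult: "parity (odd_mult v w) = odd_mult (parity v) (parity w)"
proof
 fix l show "parity (odd_mult v w) l = odd_mult (parity v) (parity w) l"
 proof (induction l arbitrary: v w)
  case (Cons a l)
  have "parity (odd_mult v w) (a # l) = - (parity (odd_mult (lder a v) w) l + parity (odd_mult (parity v) (lder a w)) l)"
   by (simp add: parity_def algebra_simps)
  also have "\<dots> = odd_mult (parity v) (parity w) (a # l)"
   unfolding Cons odd_mult_Cons lder_parity by (simp add: odd_mult_minus_left odd_mult_minus_right)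
  finally show ?case .
 qed (simp add: parity_def)
qed

lemma odd_mult_assoc: "odd_mult (odd_mult u v) w l = odd_mult u (odd_mult v w) l"
proof (induction l arbitrary: u v w)
 case (Cons a l)
 then show ?case
  by (simp add: odd_mult_Cons lder_odd_mult parity_odd_mult odd_mult_add_left odd_mult_add_right
    del: odd_mult.simps(2))
qed simp

text \<open>Induction on the list of indices: by the Leibniz rule both sides have the same left derivatives.\<close>

lemma odd_mult_commute:
 "parity v = sg b v ==> parity w = sg c w ==> odd_mult w v l = sg (b \<and> c) (odd_mult v w l)"
proof (induction l arbitrary: v w b c)
 case (Cons a l)
 have "parity (lder a v) = - lder a (parity v)" "parity (lder a w) = - lder a (parity w)"
  by (simp_all add: lder_parity)
 then have v': "parity (lder a v) = sg (\<not> b) (lder a v)" and w': "parity (lder a w) = sg (\<not> c) (lder a w)"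
  unfolding Cons.prems by (cases b; cases c; simp)+
 show ?case
  unfolding odd_mult_Cons Cons.prems
  using Cons.IH[OF Cons.prems(1) w'] Cons.IH[OF v' Cons.prems(2)]
  by (cases b; cases c) (simp_all add: odd_mult_minus_left)
next
 case Nil
 have "v [] = 0" if b
  using fun_cong[OF Nil(1), of "[]"] that by (simp add: parity_def sg_def)
 moreover have "w [] = 0" if c
  using fun_cong[OF Nil(2), of "[]"] that by (simp add: parity_def sg_def)
 ultimately show ?case by (cases b; cases c) (simp_all add: sg_def)
qed

lemma alternatingD: "alternating w ==> w (u @ a # b # v) = - w (u @ b # a # v)"
 unfolding alternating_def by blast

lemma alternating_lder: "alternating w ==> alternating (lder a w)"
 unfolding alternating_def[of "\<lambda>l. w (a # l)"] lder_def
 by (intro allI) (rule alternatingD[where u = "a # _", unfolded append_Cons])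

lemma alternating_lder_lder:
 assumes "alternating w"
 shows "lder a (lder b w) = - lder b (lder a w)"
proof
 fix l show "lder a (lder b w) l = (- lder b (lder a w)) l"
  using alternatingD[OF assms, of "[]" b a l] by (simp only: lder_def append_Nil fun_Compl_def)
qed

lemma alternating_add: "alternating v ==> alternating w ==> alternating (v + w)"
 unfolding alternating_def plus_fun_apply minus_add_distrib by (metis (no_types))

lemma alternating_scale: "alternating v ==> alternating (\<lambda>l. k * v l)"
 unfolding alternating_def by (metis (no_types) mult_minus_right)

lemma alternating_parity:
 fixes v :: "'i odd_poly"
 assumes "alternating v"
 shows "alternating (parity v)"
 unfolding alternating_def
proof (intro allI)
 fix u l :: "'i list" and a b
 have "length (u @ a # b # l) = length (u @ b # a # l)" by simp
 then show "parity v (u @ a # b # l) = - parity v (u @ b # a # l)"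
  using alternatingD[OF assms, of u a b l] unfolding parity_def by (simp only: mult_minus_right)
qed

lemma alternating_odd_mult:
 assumes "alternating v" "alternating w"
 shows "alternating (odd_mult v w)"
 unfolding alternating_def
proof (intro allI)
 fix u a b l
 show "odd_mult v w (u @ a # b # l) = - odd_mult v w (u @ b # a # l)"
  using assms
 proof (induction u arbitrary: v w)
  case Nil
  have 1: "lder b (lder a v) = - lder a (lder b v)" "lder b (lder a w) = - lder a (lder b w)"
   by (rule alternating_lder_lder[OF Nil(1)], rule alternating_lder_lder[OF Nil(2)])
  show ?case
   unfolding append_Nil odd_mult_Cons lder_parity 1 parity_minus
   by (simp add: odd_mult_minus_left odd_mult_minus_right)
 next
  case (Cons c u)
  have "odd_mult (lder c v) w (u @ a # b # l) = - odd_mult (lder c v) w (u @ b # a # l)"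
   "odd_mult (parity v) (lder c w) (u @ a # b # l) = - odd_mult (parity v) (lder c w) (u @ b # a # l)"
   by (rule Cons.IH; intro alternating_lder alternating_parity Cons.prems)+
  then show ?case unfolding append_Cons odd_mult_Cons by linarith
 qed
qed

lemma odd_mult_order:
 assumes "\<And>l. \<exists>a\<in>set l. R a ==> v l = 0" "\<And>l. \<exists>a\<in>set l. R a ==> w l = 0" "\<exists>a\<in>set l. R a"
 shows "odd_mult v w l = 0"
 using assms
proof (induction l arbitrary: v w)
 case (Cons a l)
 show ?case
 proof (cases "R a")
  case True
  then have "lder a v = 0" "lder a w = 0" using Cons.prems by (auto simp: lder_def fun_eq_iff)
  then show ?thesis by (simp add: odd_mult_Cons del: odd_mult.simps(2))
 next
  case False
  have "odd_mult (lder a v) w l = 0" "odd_mult (parity v) (lder a w) l = 0"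
   using Cons.prems False by (intro Cons.IH; auto simp: lder_def parity_def)+
  then show ?thesis by (simp add: odd_mult_Cons del: odd_mult.simps(2))
 qed
qed simp

lemma oreg_mult: "oreg N v ==> oreg N w ==> oreg N (odd_mult v w)"
 unfolding oreg_def
 using alternating_odd_mult odd_mult_order[where R = "\<lambda>a. mi_size (snd a) > N"] by blast

lemma oreg_lder: "oreg N v ==> oreg N (lder a v)"
 unfolding oreg_def using alternating_lder by (auto simp: lder_def)

lemma oreg_add: "oreg N v ==> oreg N w ==> oreg N (v + w)"
 unfolding oreg_def using alternating_add[of v w] by auto

lemma oreg_0 [simp]: "oreg N 0" by (simp add: oreg_def alternating_def)

lemma oreg_scale: "oreg N v ==> oreg N (\<lambda>l. k * v l)"
 unfolding oreg_def using alternating_scale[of v k] by auto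

lemma oreg_parity: "oreg N v ==> oreg N (parity v)"
 unfolding oreg_def using alternating_parity by (auto simp: parity_def)

lemma oreg_mono: "oreg N v ==> N \<le> M ==> oreg M v"
 unfolding oreg_def using le_less_trans by blast

lemma oreg_lder_0: "oreg N v ==> N < mi_size (snd a) ==> lder a v = 0"
 unfolding oreg_def by (auto simp: lder_def fun_eq_iff)

lemma rder_eq: "alternating w ==> rder a w = parity (lder a w)"
proof
 fix l assume "alternating w"
 then show "rder a w l = parity (lder a w) l"
 proof (induction l arbitrary: w)
  case (Cons b l)
  have "rder a w (b # l) = rder a (lder b w) l" by (simp add: rder_def lder_def)
  also have "\<dots> = parity (lder a (lder b w)) l" by (rule Cons.IH) (rule alternating_lder[OF Cons.prems])
  also have "lder a (lder b w) = - lder b (lder a w)" by (rule alternating_lder_lder[OF Cons.prems])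
  also have "parity (- lder b (lder a w)) l = parity (lder a w) (b # l)"
   by (simp add: parity_def lder_def)
  finally show ?case .
 qed (simp add: rder_def lder_def parity_def)
qed

text \<open>The derivation \<open>\<Sum> b\<^bsub>raise i a\<^esub> \<partial>/\<partial>b\<^sub>a\<close>, in recursive form.\<close>

fun oddD :: "'n => ('n, 'm) jet_index odd_poly => ('n, 'm) jet_index odd_poly" where
 "oddD i w [] = 0"
| "oddD i w (c # l) = oddD i (lder c w) l + (if snd c i > 0 then w (lower i c # l) else 0)"

lemma lder_oddD: "lder c (oddD i w) = oddD i (lder c w) + (if snd c i > 0 then lder (lower i c) w else 0)"
 by (auto simp: lder_def fun_eq_iff)

lemma oddD_add [simp]: "oddD i (v + w) = oddD i v + oddD i w"
proof
 show "oddD i (v + w) l = (oddD i v + oddD i w) l" for l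
  by (induction l arbitrary: v w) auto
qed

lemma oddD_scale [simp]: "oddD i (\<lambda>l. k * v l) = (\<lambda>l. k * oddD i v l)"
proof
 show "oddD i (\<lambda>l. k * v l) l = k * oddD i v l" for l
  by (induction l arbitrary: v) (auto simp: algebra_simps)
qed

lemma oddD_0 [simp]: "oddD i 0 = 0" using oddD_add[of i 0 0] by simp
lemma oddD_minus [simp]: "oddD i (- v) = - oddD i v" using oddD_scale[of i "-1" v] by (simp add: fun_Compl_def)

lemma oddD_parity: "oddD i (parity v) = parity (oddD i v)"
proof
 show "oddD i (parity v) l = parity (oddD i v) l" for l
 proof (induction l arbitrary: v)
  case (Cons c l)
  have "oddD i (lder c (parity v)) l = - parity (oddD i (lder c v)) l"
   using Cons by (simp add: lder_parity)
  then show ?case by (simp add: parity_def algebra_simps)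
 qed (simp add: parity_def)
qed

lemma oddD_mult: "oddD i (odd_mult v w) l = odd_mult (oddD i v) w l + odd_mult v (oddD i w) l"
proof (induction l arbitrary: v w)
 case (Cons c l)
 have *: "odd_mult v w (lower i c # l) = odd_mult (lder (lower i c) v) w l + odd_mult (parity v) (lder (lower i c) w) l"
  by (rule odd_mult_Cons)
 have "odd_mult (oddD i v) w (c # l) = odd_mult (oddD i (lder c v)) w l +
   (if snd c i > 0 then odd_mult (lder (lower i c) v) w l else 0) + odd_mult (oddD i (parity v)) (lder c w) l"
  by (simp add: odd_mult_Cons lder_oddD odd_mult_add_left oddD_parity del: odd_mult.simps(2))
 moreover have "odd_mult v (oddD i w) (c # l) = odd_mult (lder c v) (oddD i w) l + odd_mult (parity v) (oddD i (lder c w)) l +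
   (if snd c i > 0 then odd_mult (parity v) (lder (lower i c) w) l else 0)"
  by (simp add: odd_mult_Cons lder_oddD odd_mult_add_right del: odd_mult.simps(2))
 ultimately show ?case using Cons
  by (simp add: lder_odd_mult * del: odd_mult.simps(2))
qed simp

lemma lower_commute: "snd c i > 0 \<and> snd (lower i c) j > 0 \<longleftrightarrow> snd c j > 0 \<and> snd (lower j c) i > 0"
 "snd c i > 0 ==> snd (lower i c) j > 0 ==> lower j (lower i c) = lower i (lower j c)"
 by (auto simp: lower_def down_def fun_upd_twist split: if_splits)

lemma oddD_commute: "oddD i (oddD j w) l = oddD j (oddD i w) l"
proof (induction l arbitrary: w)
 case (Cons c l)
 have 1: "oddD j w (lower i c # l) = oddD j (lder (lower i c) w) l +
   (if snd (lower i c) j > 0 then w (lower j (lower i c) # l) else 0)" for i j by simp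
 have 2: "oddD i (lder c (oddD j w)) l = oddD i (oddD j (lder c w)) l +
   (if snd c j > 0 then oddD i (lder (lower j c) w) l else 0)" for i j by (simp add: lder_oddD)
 show ?case unfolding oddD.simps(2)[of _ "oddD _ w"] 1 2 Cons
  using lower_commute(1)[of c i j] lower_commute(2)[of c i j] by auto
qed simp

lemma oddD_order:
 assumes "\<And>l. \<exists>a\<in>set l. mi_size (snd a) > N ==> w l = 0" "\<exists>a\<in>set l. mi_size (snd a) > Suc N"
 shows "oddD i w l = 0"
 using assms
proof (induction l arbitrary: w)
 case (Cons c l)
 show ?case
 proof (cases "mi_size (snd c) > Suc N")
  case True
  then have "lder c w = 0" using Cons.prems(1) by (auto simp: lder_def fun_eq_iff)
  moreover have "w (lower i c # l) = 0" if "snd c i > 0"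
   using that True mi_size_down[of "snd c" i] by (intro Cons.prems(1)) (auto simp: snd_lower)
  ultimately show ?thesis by simp
 next
  case False
  then have "oddD i (lder c w) l = 0"
   using Cons.prems by (intro Cons.IH) (auto simp: lder_def)
  moreover have "w (lower i c # l) = 0"
  proof (rule Cons.prems(1))
   obtain a where "a \<in> set l" "mi_size (snd a) > Suc N" using False Cons.prems(2) by auto
   then show "\<exists>a\<in>set (lower i c # l). mi_size (snd a) > N" by (intro bexI[of _ a]) auto
  qed
  ultimately show ?thesis by simp
 qed
qed simp

lemma alternating_oddD:
 assumes "alternating w"
 shows "alternating (oddD i w)"
 unfolding alternating_def
proof (intro allI)
 fix u a b l
 show "oddD i w (u @ a # b # l) = - oddD i w (u @ b # a # l)"
  using assms
 proof (induction u arbitrary: w)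
  case Nil
  have 1: "w (lower i a # b # l) = - w (b # lower i a # l)" "w (lower i b # a # l) = - w (a # lower i b # l)"
   by (rule alternatingD[OF Nil, of "[]", unfolded append_Nil])+
  have 2: "lder b (lder a w) = - lder a (lder b w)" by (rule alternating_lder_lder[OF Nil])
  have "oddD i (lder b (lder a w)) l = - oddD i (lder a (lder b w)) l" unfolding 2 by simp
  moreover have "lder a w (lower i b # l) = w (a # lower i b # l)"
   "lder b w (lower i a # l) = w (b # lower i a # l)" by (simp_all only: lder_def)
  ultimately show ?case unfolding append_Nil oddD.simps using 1
   by (cases "snd a i > 0"; cases "snd b i > 0"; simp only: if_True if_False; linarith)
 next
  case (Cons c u)
  have "w (lower i c # u @ a # b # l) = - w (lower i c # u @ b # a # l)"
   by (rule alternatingD[OF Cons.prems, of "lower i c # u", unfolded append_Cons])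
  moreover have "oddD i (lder c w) (u @ a # b # l) = - oddD i (lder c w) (u @ b # a # l)"
   by (rule Cons.IH[OF alternating_lder[OF Cons.prems]])
  ultimately show ?case unfolding append_Cons oddD.simps
   by (cases "snd c i > 0"; simp only: if_True if_False; linarith)
 qed
qed

lemma oreg_oddD: "oreg N w ==> oreg (Suc N) (oddD i w)"
 unfolding oreg_def by (intro conjI allI impI alternating_oddD oddD_order[of N w _ i]) blast+

text \<open>Both sides have the same left derivatives and vanish on the empty list.\<close>

lemma Sum_any_odd_var:
 fixes i :: "'n::finite" and w :: "('n, 'm::finite) jet_index odd_poly"
 assumes "oreg N w"
 shows "Sum_any (\<lambda>a. odd_mult (odd_var (raise i a)) (lder a w) l) = oddD i w l"
proof -
 have fin: "Sum_any (\<lambda>a. odd_mult (odd_var (raise i a)) (lder a w) l) =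
   (\<Sum>a\<in>idx N. odd_mult (odd_var (raise i a)) (lder a w) l)" if "oreg N w" for w l
 proof (rule Sum_any.expand_superset)
  show "{a. odd_mult (odd_var (raise i a)) (lder a w) l \<noteq> 0} \<subseteq> idx N"
  proof (rule subsetI, rule ccontr)
   fix a assume "a \<in> {a. odd_mult (odd_var (raise i a)) (lder a w) l \<noteq> 0}" "a \<notin> idx N"
   then show False using oreg_lder_0[OF that, of a] by (simp add: idx_def)
  qed
 qed simp
 have "(\<Sum>a\<in>idx N. odd_mult (odd_var (raise i a)) (lder a w) l) = oddD i w l"
  using assms
 proof (induction l arbitrary: w)
  case (Cons c l)
  have w: "alternating w" using Cons.prems by (simp add: oreg_def)
  let ?one = "\<lambda>l :: ('n, 'm) jet_index list. if l = [] then 1 else 0 :: real"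
  have one: "odd_mult ?one v l = v l" for v l
  proof (induction l arbitrary: v)
   case (Cons c l)
   have "lder c ?one = 0" "parity ?one = ?one"
    by (auto simp: lder_def parity_def fun_eq_iff)
   then show ?case unfolding odd_mult_Cons using Cons[of "lder c v"] by (simp add: lder_def)
  qed simp
  have lv: "lder c (odd_var d) = (if c = d then ?one else 0)" for d
   by (auto simp: lder_def odd_var_def fun_eq_iff)
  have pv: "parity (odd_var d) = - odd_var d" for d :: "('n, 'm) jet_index"
   by (auto simp: parity_def odd_var_def fun_eq_iff)
  have "odd_mult (odd_var (raise i a)) (lder a w) (c # l) =
    (if c = raise i a then w (a # l) else 0) + odd_mult (odd_var (raise i a)) (lder a (lder c w)) l" for a
   unfolding odd_mult_Cons lv pv alternating_lder_lder[OF w, of c a]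
   by (auto simp: one odd_mult_minus_left odd_mult_minus_right) (simp_all add: lder_def)
  moreover have "(\<Sum>a\<in>idx N. if c = raise i a then w (a # l) else 0) = (if snd c i > 0 then w (lower i c # l) else 0)"
  proof (cases "snd c i > 0")
   case True
   have "(\<Sum>a\<in>idx N. if c = raise i a then w (a # l) else 0) =
     (\<Sum>a\<in>idx N. if a = lower i c then w (a # l) else 0)"
    by (rule sum.cong) (use True in auto)
   also have "\<dots> = (if lower i c \<in> idx N then w (lower i c # l) else 0)" by simp
   also have "\<dots> = w (lower i c # l)" using Cons.prems by (auto simp: oreg_def idx_def)
   finally show ?thesis using True by simp
  next
   case False
   then have "c \<noteq> raise i a" for a by (metis raise_pos)
   with False show ?thesis by simp
  qed
  ultimately show ?case using Cons.IH[OF oreg_lder[OF Cons.prems]] by (simp add: sum.distrib)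
 qed (simp add: odd_var_def)
 with fin[OF assms] show ?thesis by simp
qed

section \<open>Densities on an open set as an instance\<close>

lemma sum_apply: "(\<Sum>k\<in>K. f k) x = (\<Sum>k\<in>K. f k x)"
 by (induction K rule: infinite_finite_induct) auto

text \<open>The even part of the total derivative, truncated to jet coordinates of order at most \<open>M\<close>.\<close>

definition vfield :: "nat => 'n => (('n::finite, 'm::finite) jet => real) => ('n, 'm) jet => real" where
 "vfield M i F p = pder jet_shift (Inl i) F p + (\<Sum>a\<in>idx M. snd p (raise i a) * qder a F p)"

lemma vfield_const [simp]: "vfield M i (\<lambda>p. k) p = 0" by (simp add: vfield_def)

context
 fixes U :: "(real^'n::finite) set"
 assumes U: "open U"
begin

lemma pder_cong_U:
 "p \<in> U \<times> UNIV ==> (\<And>p. p \<in> U \<times> UNIV ==> F p = G p) ==> pder jet_shift c F p = pder jet_shift c G p"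
 by (rule jet.pder_cong[OF open_jets[OF U]])

lemma vfield_cong:
 assumes "p \<in> U \<times> UNIV" "\<And>p. p \<in> U \<times> UNIV ==> F p = G p"
 shows "vfield M i F p = vfield M i G p"
 unfolding vfield_def using pder_cong_U[OF assms] by simp

lemma vfield_mono:
 assumes "sreg N U F" "N \<le> M" "p \<in> U \<times> UNIV"
 shows "vfield M i F p = vfield N i F p"
proof -
 have "(\<Sum>a\<in>idx N. snd p (raise i a) * qder a F p) =
   (\<Sum>a\<in>idx M. snd p (raise i a) * qder a F p)"
  by (rule sum.mono_neutral_left[OF finite_idx idx_mono[OF assms(2)]])
    (use sreg_pder_0[OF U assms(1) _ assms(3)] in \<open>auto simp: idx_def\<close>)
 then show ?thesis by (simp add: vfield_def)
qed

lemma vfield_add: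
 assumes "sreg N U F" "sreg N U G" "p \<in> U \<times> UNIV"
 shows "vfield M i (\<lambda>p. F p + G p) p = vfield M i F p + vfield M i G p"
 unfolding vfield_def
 by (simp add: jet.pder_add[OF sreg_smooth[OF U assms(1)] sreg_smooth[OF U assms(2)] assms(3)]
   algebra_simps sum.distrib)

lemma vfield_mult:
 assumes "sreg N U F" "sreg N U G" "p \<in> U \<times> UNIV"
 shows "vfield M i (\<lambda>p. F p * G p) p = vfield M i F p * G p + F p * vfield M i G p"
 unfolding vfield_def
 by (simp add: jet.pder_mult[OF sreg_smooth[OF U assms(1)] sreg_smooth[OF U assms(2)] assms(3)]
   algebra_simps sum.distrib sum_distrib_left)

lemma vfield_scale:
 "sreg N U F ==> p \<in> U \<times> UNIV ==> vfield M i (\<lambda>p. k * F p) p = k * vfield M i F p"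
 using vfield_mult[of N "\<lambda>p. k" F p M i] by (simp add: U)

lemma sreg_coord_raise: "a \<in> idx N ==> sreg (Suc N) U (\<lambda>p. snd p (raise i a))"
 by (rule sreg_coord[OF U]) (simp add: snd_raise idx_def)

lemma sreg_vfield: "sreg N U F ==> sreg (Suc N) U (vfield N i F)"
 unfolding vfield_def
 by (intro sreg_add[OF U] sreg_sum[OF U] sreg_mult[OF U] sreg_coord_raise)
   (auto intro: sreg_mono[OF U sreg_pder[OF U]])

lemma pder_vfield:
 assumes F: "sreg N U F" and p: "p \<in> U \<times> UNIV" and M: "N \<le> M"
 shows "qder a (vfield M i F) p = vfield M i (qder a F) p +
  (if snd a i > 0 then qder (lower i a) F p else 0)"
proof -
 have oS: "open (U \<times> (UNIV :: (('n, 'a) jet_index => real) set))" by (rule open_jets[OF U])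
 have F': "sreg M U F" using sreg_mono[OF U F M] .
 have s1: "smooth_along jet_shift (U \<times> UNIV) (pder jet_shift (Inl i) F)"
  by (rule sreg_smooth[OF U sreg_pder[OF U F]])
 have s2: "smooth_along jet_shift (U \<times> UNIV) (\<lambda>p. snd p (raise i b))" for b :: "('n, 'a) jet_index"
  by (rule sreg_smooth[OF U sreg_coord[OF U order_refl]])
 have s3: "smooth_along jet_shift (U \<times> UNIV) (pder jet_shift c F)" for c
  by (rule sreg_smooth[OF U sreg_pder[OF U F]])
 have com: "pder jet_shift c (pder jet_shift d F) p = pder jet_shift d (pder jet_shift c F) p" for c d
  by (rule jet.pder_commute[OF oS sreg_smooth[OF U F] p])
 have "qder a (vfield M i F) p = qder a (pder jet_shift (Inl i) F) p +
   (\<Sum>b\<in>idx M. qder a (\<lambda>p. snd p (raise i b) * qder b F p) p)"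
  unfolding vfield_def[abs_def]
  by (subst jet.pder_add[OF s1 jet.smooth_sum[OF oS] p], rule jet.smooth_mult[OF oS s2 s3],
    subst jet.pder_sum[OF oS _ p], rule jet.smooth_mult[OF oS s2 s3], simp)
 also have "\<dots> = pder jet_shift (Inl i) (qder a F) p +
   (\<Sum>b\<in>idx M. (if raise i b = a then qder b F p else 0) +
     snd p (raise i b) * qder b (qder a F) p)"
  unfolding jet.pder_mult[OF s2 s3 p] pder_q com[of "Inr a"]
  by (intro arg_cong2[where f = "(+)"] refl sum.cong) auto
 also have "\<dots> = vfield M i (qder a F) p +
   (\<Sum>b\<in>idx M. if raise i b = a then qder b F p else 0)"
  by (simp add: vfield_def sum.distrib)
 also have "(\<Sum>b\<in>idx M. if raise i b = a then qder b F p else 0) =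
   (if snd a i > 0 then qder (lower i a) F p else 0)"
 proof (cases "snd a i > 0")
  case True
  have "(\<Sum>b\<in>idx M. if raise i b = a then qder b F p else 0) =
    (\<Sum>b\<in>idx M. if b = lower i a then qder b F p else 0)"
   by (rule sum.cong) (use True in auto)
  also have "\<dots> = (if lower i a \<in> idx M then qder (lower i a) F p else 0)" by simp
  also have "\<dots> = qder (lower i a) F p"
   using sreg_pder_0[OF U F' _ p] by (auto simp: idx_def)
  finally show ?thesis using True by simp
 next
  case False
  then have "raise i b \<noteq> a" for b by (metis raise_pos)
  with False show ?thesis by simp
 qed
 finally show ?thesis .
qed

lemma vfield_vfield:
 assumes F: "sreg N U F" and p: "p \<in> U \<times> UNIV"
 shows "vfield (Suc N) i (vfield (Suc N) j F) p =
  pder jet_shift (Inl i) (pder jet_shift (Inl j) F) p +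
  (\<Sum>b\<in>idx (Suc N). snd p (raise j b) * pder jet_shift (Inl i) (qder b F) p) +
  (\<Sum>a\<in>idx (Suc N). snd p (raise i a) * pder jet_shift (Inl j) (qder a F) p) +
  (\<Sum>a\<in>idx (Suc N). \<Sum>b\<in>idx (Suc N). snd p (raise i a) * snd p (raise j b) *
    qder b (qder a F) p) +
  (\<Sum>a\<in>idx N. snd p (raise i (raise j a)) * qder a F p)"
proof -
 have oS: "open (U \<times> (UNIV :: (('n, 'a) jet_index => real) set))" by (rule open_jets[OF U])
 have s1: "smooth_along jet_shift (U \<times> UNIV) (pder jet_shift (Inl j) F)"
  by (rule sreg_smooth[OF U sreg_pder[OF U F]])
 have s2: "smooth_along jet_shift (U \<times> UNIV) (\<lambda>p. snd p (raise j b))" for b :: "('n, 'a) jet_index"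
  by (rule sreg_smooth[OF U sreg_coord[OF U order_refl]])
 have s3: "smooth_along jet_shift (U \<times> UNIV) (pder jet_shift c F)" for c
  by (rule sreg_smooth[OF U sreg_pder[OF U F]])
 have "pder jet_shift (Inl i) (vfield (Suc N) j F) p = pder jet_shift (Inl i) (pder jet_shift (Inl j) F) p +
   (\<Sum>b\<in>idx (Suc N). pder jet_shift (Inl i) (\<lambda>p. snd p (raise j b) * qder b F p) p)"
  unfolding vfield_def[abs_def]
  by (subst jet.pder_add[OF s1 jet.smooth_sum[OF oS] p], rule jet.smooth_mult[OF oS s2 s3],
    subst jet.pder_sum[OF oS _ p], rule jet.smooth_mult[OF oS s2 s3], simp)
 also have "\<dots> = pder jet_shift (Inl i) (pder jet_shift (Inl j) F) p +
   (\<Sum>b\<in>idx (Suc N). snd p (raise j b) * pder jet_shift (Inl i) (qder b F) p)"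
  unfolding jet.pder_mult[OF s2 s3 p] pder_q by simp
 finally have 1: "pder jet_shift (Inl i) (vfield (Suc N) j F) p = \<dots>" .
 have "(\<Sum>a\<in>idx (Suc N). snd p (raise i a) * qder a (vfield (Suc N) j F) p) =
   (\<Sum>a\<in>idx (Suc N). snd p (raise i a) * pder jet_shift (Inl j) (qder a F) p +
    (\<Sum>b\<in>idx (Suc N). snd p (raise i a) * snd p (raise j b) *
     qder b (qder a F) p) +
    (if snd a j > 0 then snd p (raise i a) * qder (lower j a) F p else 0))"
 proof (rule sum.cong[OF refl])
  fix a :: "('n, 'a) jet_index"
  have e: "qder a (vfield (Suc N) j F) p = vfield (Suc N) j (qder a F) p +
   (if snd a j > 0 then qder (lower j a) F p else 0)"
   by (rule pder_vfield[OF F p]) simp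
  show "snd p (raise i a) * qder a (vfield (Suc N) j F) p =
    snd p (raise i a) * pder jet_shift (Inl j) (qder a F) p +
    (\<Sum>b\<in>idx (Suc N). snd p (raise i a) * snd p (raise j b) *
     qder b (qder a F) p) +
    (if snd a j > 0 then snd p (raise i a) * qder (lower j a) F p else 0)"
   unfolding e vfield_def distrib_left sum_distrib_left mult.assoc by (cases "snd a j > 0") simp_all
 qed
 also have "\<dots> = (\<Sum>a\<in>idx (Suc N). snd p (raise i a) * pder jet_shift (Inl j) (qder a F) p) +
    (\<Sum>a\<in>idx (Suc N). \<Sum>b\<in>idx (Suc N). snd p (raise i a) * snd p (raise j b) *
     qder b (qder a F) p) +
    (\<Sum>a\<in>idx N. snd p (raise i (raise j a)) * qder a F p)"
  unfolding sum.distrib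
  by (subst sum_shift_idx[where F = "\<lambda>b a. snd p (raise i a) * qder b F p"]) simp
 finally show ?thesis using 1 by (simp add: vfield_def)
qed

lemma vfield_commute:
 assumes F: "sreg N U F" and p: "p \<in> U \<times> UNIV"
 shows "vfield (Suc N) i (vfield N j F) p = vfield (Suc N) j (vfield N i F) p"
proof -
 have oS: "open (U \<times> (UNIV :: (('n, 'a) jet_index => real) set))" by (rule open_jets[OF U])
 have com: "pder jet_shift c (pder jet_shift d F) p = pder jet_shift d (pder jet_shift c F) p" for c d
  by (rule jet.pder_commute[OF oS sreg_smooth[OF U F] p])
 have 1: "vfield (Suc N) i (vfield N j F) p = vfield (Suc N) i (vfield (Suc N) j F) p" for i j
  by (rule vfield_cong[OF p]) (rule vfield_mono[OF F, symmetric], simp_all)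
 have "(\<Sum>a\<in>idx (Suc N). \<Sum>b\<in>idx (Suc N). snd p (raise i a) * snd p (raise j b) *
    qder b (qder a F) p) =
   (\<Sum>a\<in>idx (Suc N). \<Sum>b\<in>idx (Suc N). snd p (raise j a) * snd p (raise i b) *
    qder b (qder a F) p)"
  by (subst sum.swap) (intro sum.cong refl, simp add: com)
 then show ?thesis unfolding 1 vfield_vfield[OF F p]
  by (simp add: raise_commute com[of "Inl i" "Inl j"])
qed

text \<open>The coefficients of a product are polynomials in those of the factors. The derivation is left
 abstract because partial derivatives and the even part of \<open>D\<^sub>i\<close> are both needed.\<close>

lemma odd_mult_derivation:
 fixes \<delta> :: "('p => real) => real"
 assumes add: "\<And>F G. S F ==> S G ==> \<delta> (\<lambda>p. F p + G p) = \<delta> F + \<delta> G"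
  and mult: "\<And>F G. S F ==> S G ==> \<delta> (\<lambda>p. F p * G p) = \<delta> F * G p0 + F p0 * \<delta> G"
  and const: "\<And>k. \<delta> (\<lambda>p. k) = 0"
  and S: "\<And>F G. S F ==> S G ==> S (\<lambda>p. F p + G p)" "\<And>F G. S F ==> S G ==> S (\<lambda>p. F p * G p)" "\<And>k. S (\<lambda>p. k)"
  and f: "\<And>l. S (\<lambda>p. f p l)" and g: "\<And>l. S (\<lambda>p. g p l)"
 shows "S (\<lambda>p. odd_mult (f p) (g p) l)"
  "\<delta> (\<lambda>p. odd_mult (f p) (g p) l) =
   odd_mult (\<lambda>l. \<delta> (\<lambda>p. f p l)) (g p0) l + odd_mult (f p0) (\<lambda>l. \<delta> (\<lambda>p. g p l)) l"
proof -
 have "S (\<lambda>p. odd_mult (f p) (g p) l) \<and> \<delta> (\<lambda>p. odd_mult (f p) (g p) l) =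
   odd_mult (\<lambda>l. \<delta> (\<lambda>p. f p l)) (g p0) l + odd_mult (f p0) (\<lambda>l. \<delta> (\<lambda>p. g p l)) l"
  using f g
 proof (induction l arbitrary: f g)
  case Nil
  then show ?case by (simp add: mult S)
 next
  case (Cons a l)
  have sc: "\<delta> (\<lambda>p. k * F p) = k * \<delta> F" if "S F" for k F
   using mult[OF S(3) that, of k] const by simp
  have 1: "S (\<lambda>p. lder a (h p) l)" "S (\<lambda>p. parity (h p) l)" if "\<And>l. S (\<lambda>p. h p l)" for h l
   using that S by (auto simp: lder_def parity_def)
  have 2: "(\<lambda>l. \<delta> (\<lambda>p. lder a (h p) l)) = lder a (\<lambda>l. \<delta> (\<lambda>p. h p l))" for h
   by (simp add: lder_def)
  have 3: "(\<lambda>l. \<delta> (\<lambda>p. parity (h p) l)) = parity (\<lambda>l. \<delta> (\<lambda>p. h p l))" if "\<And>l. S (\<lambda>p. h p l)" for h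
   using sc[OF that] by (simp add: parity_def)
  note IH1 = Cons.IH[of "\<lambda>p. lder a (f p)" g, OF 1(1)[OF Cons.prems(1)] Cons.prems(2)]
  note IH2 = Cons.IH[of "\<lambda>p. parity (f p)" "\<lambda>p. lder a (g p)", OF 1(2)[OF Cons.prems(1)] 1(1)[OF Cons.prems(2)]]
  show ?case
   unfolding odd_mult_Cons
   using S(1)[OF conjunct1[OF IH1] conjunct1[OF IH2]]
    add[OF conjunct1[OF IH1] conjunct1[OF IH2]] conjunct2[OF IH1] conjunct2[OF IH2]
   unfolding 2 3[OF Cons.prems(1)] by simp
 qed
 then show "S (\<lambda>p. odd_mult (f p) (g p) l)" "\<delta> (\<lambda>p. odd_mult (f p) (g p) l) =
   odd_mult (\<lambda>l. \<delta> (\<lambda>p. f p l)) (g p0) l + odd_mult (f p0) (\<lambda>l. \<delta> (\<lambda>p. g p l)) l" by auto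
qed

lemma sreg_odd_mult:
 assumes "\<And>l. sreg N U (\<lambda>p. f p l)" "\<And>l. sreg N U (\<lambda>p. g p l)"
 shows "sreg N U (\<lambda>p. odd_mult (f p) (g p) l)"
 by (rule odd_mult_derivation(1)[where \<delta> = "\<lambda>_. 0" and S = "sreg N U" and ?p0.0 = undefined])
   (auto intro: sreg_add[OF U] sreg_mult[OF U] assms simp: U)

lemma sreg_oddD: "(\<And>l. sreg N U (\<lambda>p. f p l)) ==> sreg N U (\<lambda>p. oddD i (f p) l)"
proof (induction l arbitrary: f)
 case (Cons c l)
 have "sreg N U (\<lambda>p. oddD i (lder c (f p)) l)"
  by (rule Cons.IH) (use Cons.prems in \<open>simp add: lder_def\<close>)
 then show ?case using Cons.prems by (cases "snd c i > 0") (auto intro: sreg_add[OF U])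
qed (simp add: U)

lemma oddD_derivation:
 fixes \<delta> :: "(('n, 'm::finite) jet => real) => real"
 assumes add: "\<And>F G. sreg N U F ==> sreg N U G ==> \<delta> (\<lambda>p. F p + G p) = \<delta> F + \<delta> G"
  and const: "\<And>k. \<delta> (\<lambda>p. k) = 0"
  and f: "\<And>l. sreg N U (\<lambda>p. f p l)"
 shows "\<delta> (\<lambda>p. oddD i (f p) l) = oddD i (\<lambda>l. \<delta> (\<lambda>p. f p l)) l"
 using f
proof (induction l arbitrary: f)
 case (Cons c l)
 have c: "sreg N U (\<lambda>p. lder c (f p) l)" for l using Cons.prems by (simp add: lder_def)
 have IH: "\<delta> (\<lambda>p. oddD i (lder c (f p)) l) = oddD i (lder c (\<lambda>l. \<delta> (\<lambda>p. f p l))) l"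
  using Cons.IH[of "\<lambda>p. lder c (f p)", OF c] by (simp add: lder_def)
 show ?case
 proof (cases "snd c i > 0")
  case True
  then show ?thesis using add[OF sreg_oddD[of N "\<lambda>p. lder c (f p)" i l, OF c] Cons.prems[of "lower i c # l"]] IH by simp
 qed (use IH in simp)
qed (simp add: const)

end

text \<open>Setting densities to zero off \<open>U\<close> turns statements over \<open>U\<close> into equations between densities.\<close>

definition cut :: "(real^'n) set => ('n::finite, 'm) density => ('n, 'm) density" where
 "cut U f = (\<lambda>p l. if fst p \<in> U then f p l else 0)"

definition dmul :: "('n, 'm) density => ('n, 'm) density => ('n, 'm) density" where
 "dmul f g = (\<lambda>p. odd_mult (f p) (g p))"

definition dpar :: "('n, 'm) density => ('n, 'm) density" where
 "dpar f = (\<lambda>p. parity (f p))"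

definition dD :: "(real^'n) set => 'n => ('n::finite, 'm::finite) density => ('n, 'm) density" where
 "dD U i f = cut U (total_der i f)"

definition dpd :: "(real^'n) set => bool => ('n, 'm) jet_index => ('n::finite, 'm::finite) density => ('n, 'm) density" where
 "dpd U k a f = (if k then (\<lambda>p. lder a (f p)) else cut U (q_der a f))"

definition dens :: "(real^'n) set => nat => ('n::finite, 'm::finite) density set" where
 "dens U N = {f. regular_density N U f \<and> (\<forall>p. fst p \<notin> U \<longrightarrow> f p = 0)}"

definition vanish :: "(real^'n) set => ('n::finite, 'm::finite) density set" where
 "vanish V = {f. \<forall>p. fst p \<in> V \<longrightarrow> f p = 0}"

lemma cut_in [simp]: "fst p \<in> U ==> cut U f p = f p" and cut_out [simp]: "fst p \<notin> U ==> cut U f p = 0"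
 by (simp_all add: cut_def fun_eq_iff)

lemma regular_density_cong:
 fixes f :: "('n::finite, 'm::finite) density"
 assumes "open U" "regular_density N U f" "\<And>p. fst p \<in> U ==> f p = g p"
 shows "regular_density N U g"
 unfolding regular_density_iff
proof (intro conjI allI ballI, goal_cases)
 case (1 l)
 show "sreg N U (\<lambda>p. g p l)"
  by (rule sreg_cong[OF assms(1), of N "\<lambda>p. f p l"]) (use assms in \<open>auto simp: regular_density_iff\<close>)
next
 case (2 x q)
 then show "oreg N (g (x, q))"
  using assms(2) assms(3)[of "(x, q)"] unfolding regular_density_iff by (metis fst_conv)
qed

lemma densI: "regular_density N U f ==> (\<And>p. fst p \<notin> U ==> f p = 0) ==> f \<in> dens U N"
 by (simp add: dens_def)

lemma cut_dens: "open U ==> regular_density N U f ==> cut U f \<in> dens U N"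
 by (rule densI) (auto intro: regular_density_cong[of U N f])

lemma densD:
 assumes "f \<in> dens U N"
 shows "sreg N U (\<lambda>p. f p l)" "oreg N (f p)" "fst p \<notin> U ==> f p = 0" "regular_density N U f"
proof -
 show 1: "sreg N U (\<lambda>p. f p l)" "regular_density N U f"
  using assms by (simp_all add: dens_def regular_density_iff)
 have 2: "fst p \<notin> U ==> f p = 0" for p
  using assms by (simp add: dens_def del: split_paired_All)
 then show "fst p \<notin> U ==> f p = 0" .
 show "oreg N (f p)"
 proof (cases "fst p \<in> U")
  case True
  then have "oreg N (f (fst p, snd p))" using 1(2) unfolding regular_density_iff by blast
  then show ?thesis by simp
 qed (simp add: 2)
qed

lemma densI':
 assumes "\<And>l. sreg N U (\<lambda>p. f p l)" "\<And>p. fst p \<in> U ==> oreg N (f p)" "\<And>p. fst p \<notin> U ==> f p = 0"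
 shows "f \<in> dens U N"
 using assms by (simp add: dens_def regular_density_iff)

lemma total_der_eq:
 assumes U: "open U" and f: "regular_density N U f" and M: "N \<le> M" and p: "fst p \<in> U"
 shows "total_der i f p l = vfield M i (\<lambda>p. f p l) p + oddD i (f p) l"
proof -
 have p': "p \<in> U \<times> UNIV" using p by (simp add: mem_Times_iff)
 have s: "sreg N U (\<lambda>p. f p l)" and o: "oreg N (f p)"
  using f p by (auto simp: regular_density_iff) (metis prod.collapse)
 have "Sum_any (\<lambda>a. snd p (raise i a) * q_der a f p l) =
   (\<Sum>a\<in>idx M. snd p (raise i a) * qder a (\<lambda>p. f p l) p)"
  unfolding q_der_def
 proof (rule Sum_any.expand_superset)
  show "{a. snd p (raise i a) * qder a (\<lambda>p. f p l) p \<noteq> 0} \<subseteq> idx M"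
  proof (rule subsetI, rule ccontr)
   fix a assume "a \<in> {a. snd p (raise i a) * qder a (\<lambda>p. f p l) p \<noteq> 0}" "a \<notin> idx M"
   then show False using sreg_pder_0[OF U s _ p', of a] M by (simp add: idx_def)
  qed
 qed simp
 then show ?thesis
  by (simp add: total_der_def vfield_def x_der_def Sum_any_odd_var[OF o])
qed

lemma dD_eq:
 "open U ==> f \<in> dens U N ==> N \<le> M ==> fst p \<in> U ==>
   dD U i f p l = vfield M i (\<lambda>p. f p l) p + oddD i (f p) l"
 unfolding dD_def by (simp add: total_der_eq[OF _ densD(4)])

lemma total_der_cong:
 assumes U: "open U" and p: "fst p \<in> U" and eq: "\<And>p. fst p \<in> U ==> f p = g p"
 shows "total_der i f p = total_der i g p"
proof
 fix l
 have p': "p \<in> U \<times> UNIV" using p by (simp add: mem_Times_iff)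
 have "pder jet_shift c (\<lambda>p. f p l) p = pder jet_shift c (\<lambda>p. g p l) p" for c
  by (rule pder_cong_U[OF U p']) (use eq in auto)
 then show "total_der i f p l = total_der i g p l"
  using eq[OF p] by (simp add: total_der_def x_der_def q_der_def)
qed

lemma q_der_cong:
 assumes U: "open U" and p: "fst p \<in> U" and eq: "\<And>p. fst p \<in> U ==> f p = g p"
 shows "q_der a f p = q_der a g p"
proof
 fix l
 have p': "p \<in> U \<times> UNIV" using p by (simp add: mem_Times_iff)
 have "pder jet_shift c (\<lambda>p. f p l) p = pder jet_shift c (\<lambda>p. g p l) p" for c
  by (rule pder_cong_U[OF U p']) (use eq in auto)
 then show "q_der a f p l = q_der a g p l" by (simp add: q_der_def)
qed

lemma dens_dD:
 fixes f :: "('n::finite, 'm::finite) density"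
 assumes U: "open U" and f: "f \<in> dens U N"
 shows "dD U i f \<in> dens U (Suc N)"
proof (rule densI')
 have eq: "dD U i f p l = vfield N i (\<lambda>p. f p l) p + oddD i (f p) l" if "p \<in> U \<times> UNIV" for p l
  using dD_eq[OF U f order_refl] that by auto
 have s: "sreg N U (\<lambda>p. f p l)" for l by (rule densD(1)[OF f])
 show "sreg (Suc N) U (\<lambda>p. dD U i f p l)" for l
  by (rule sreg_cong[OF U, of _ "\<lambda>p. vfield N i (\<lambda>p. f p l) p + oddD i (f p) l"])
    (auto intro!: sreg_add[OF U] sreg_vfield[OF U] sreg_mono[OF U sreg_oddD[OF U]] s simp: eq)
 show "fst p \<notin> U ==> dD U i f p = 0" for p by (simp add: dD_def)
 show "oreg (Suc N) (dD U i f p)" if p: "fst p \<in> U" for p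
 proof -
  have p': "p \<in> U \<times> UNIV" using p by (simp add: mem_Times_iff)
  have a: "alternating (f p)" if "fst p \<in> U" for p using densD(2)[OF f, of p] by (simp add: oreg_def)
  have "oreg (Suc N) (\<lambda>l. vfield N i (\<lambda>p. f p l) p)"
   unfolding oreg_def alternating_def
  proof (intro conjI allI impI)
   fix u a b v
   have "f p (u @ a # b # v) = -1 * f p (u @ b # a # v)" if "p \<in> U \<times> UNIV" for p
    using alternatingD[OF a, of p u a b v] that by (simp only: mult_minus1) auto
   then have "vfield N i (\<lambda>p. f p (u @ a # b # v)) p = vfield N i (\<lambda>p. -1 * f p (u @ b # a # v)) p"
    by (rule vfield_cong[OF U p'])
   also have "\<dots> = - vfield N i (\<lambda>p. f p (u @ b # a # v)) p"
    by (subst vfield_scale[OF U s p']) simp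
   finally show "vfield N i (\<lambda>p. f p (u @ a # b # v)) p = - vfield N i (\<lambda>p. f p (u @ b # a # v)) p" .
  next
   fix l :: "('n, 'm) jet_index list" assume "\<exists>a\<in>set l. Suc N < mi_size (snd a)"
   then have "\<exists>a\<in>set l. N < mi_size (snd a)" by force
   then have "vfield N i (\<lambda>p. f p l) p = vfield N i (\<lambda>p. 0) p"
    by (intro vfield_cong[OF U p']) (use densD(2)[OF f] in \<open>auto simp: oreg_def\<close>)
   then show "vfield N i (\<lambda>p. f p l) p = 0" using U by simp
  qed
  moreover have "oreg (Suc N) (oddD i (f p))" by (rule oreg_oddD[OF densD(2)[OF f]])
  moreover have "dD U i f p = (\<lambda>l. vfield N i (\<lambda>p. f p l) p) + oddD i (f p)"
   by (simp add: fun_eq_iff eq[OF p'])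
  ultimately show ?thesis using oreg_add by metis
 qed
qed

lemma dpd_False: "fst p \<in> U ==> dpd U False a f p l = qder a (\<lambda>p. f p l) p"
 by (simp add: dpd_def q_der_def)

lemma dpd_True: "dpd U True a f p = lder a (f p)" by (simp add: dpd_def)

lemma dpd_out: "f \<in> dens U N ==> fst p \<notin> U ==> dpd U k a f p = 0"
 using densD(3)[of f U N p] by (simp add: dpd_def)

lemma dens_dpd:
 fixes f :: "('n::finite, 'm::finite) density"
 assumes U: "open U" and f: "f \<in> dens U N"
 shows "dpd U k a f \<in> dens U N"
proof (cases k)
 case True
 show ?thesis
  by (rule densI') (use True densD[OF f] in \<open>auto simp: dpd_True oreg_lder\<close>, simp_all add: lder_def)
next
 case False
 have s: "sreg N U (\<lambda>p. f p l)" for l by (rule densD(1)[OF f])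
 show ?thesis
 proof (rule densI')
  show "sreg N U (\<lambda>p. dpd U k a f p l)" for l
   by (rule sreg_cong[OF U sreg_pder[OF U s[of l], of "Inr a"]]) (auto simp: False dpd_False)
  show "fst p \<notin> U ==> dpd U k a f p = 0" for p by (rule dpd_out[OF f])
  fix p :: "('n, 'm) jet" assume p: "fst p \<in> U"
  then have p': "p \<in> U \<times> UNIV" by (simp add: mem_Times_iff)
  show "oreg N (dpd U k a f p)"
   unfolding oreg_def alternating_def
  proof (intro conjI allI impI)
   fix u b c v
   have al: "alternating (f p)" for p using densD(2)[OF f, of p] by (simp add: oreg_def)
   have "qder a (\<lambda>p. f p (u @ b # c # v)) p = qder a (\<lambda>p. - f p (u @ c # b # v)) p"
    by (rule pder_cong_U[OF U p']) (rule alternatingD[OF al])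
   also have "\<dots> = - qder a (\<lambda>p. f p (u @ c # b # v)) p"
    by (rule jet.pder_minus[OF sreg_smooth[OF U s] p'])
   finally show "dpd U k a f p (u @ b # c # v) = - dpd U k a f p (u @ c # b # v)"
    by (simp add: False dpd_False p)
  next
   fix l :: "('n, 'm) jet_index list" assume "\<exists>a\<in>set l. N < mi_size (snd a)"
   then have "qder a (\<lambda>p. f p l) p = qder a (\<lambda>p. 0) p"
    by (intro pder_cong_U[OF U p']) (use densD(2)[OF f] in \<open>auto simp: oreg_def\<close>)
   then show "dpd U k a f p l = 0" by (simp add: False dpd_False p)
  qed
 qed
qed

lemma dens_ext:
 assumes "f \<in> dens U N" "g \<in> dens U M" "\<And>p l. fst p \<in> U ==> f p l = g p l"
 shows "f = g"
proof (intro ext)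
 fix p l show "f p l = g p l"
  using assms densD(3)[OF assms(1), of p] densD(3)[OF assms(2), of p] by (cases "fst p \<in> U") auto
qed

lemma dens_mono: "open U ==> f \<in> dens U N ==> N \<le> M ==> f \<in> dens U M"
 by (rule densI') (auto dest: densD intro: sreg_mono oreg_mono)

lemma dens_add: "open U ==> f \<in> dens U N ==> g \<in> dens U N ==> f + g \<in> dens U N"
 by (rule densI') (simp_all add: densD(1,2) sreg_add oreg_add, simp add: densD(3) fun_eq_iff)

lemma dens_zero: "0 \<in> dens U N"
 by (rule densI') (simp_all add: sreg_def jet.depends_on_def)

lemma dens_minus: "open U ==> f \<in> dens U N ==> - f \<in> dens U N"
proof (rule densI')
 assume U: "open U" and f: "f \<in> dens U N"
 show "sreg N U (\<lambda>p. (- f) p l)" for l using sreg_minus[OF U densD(1)[OF f]] by simp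
 show "oreg N ((- f) p)" for p using oreg_scale[OF densD(2)[OF f, of p], of "-1"] by (simp add: fun_Compl_def)
 show "fst p \<notin> U ==> (- f) p = 0" for p using densD(3)[OF f] by (simp add: fun_eq_iff)
qed

lemma dens_dmul: "open U ==> f \<in> dens U N ==> g \<in> dens U N ==> dmul f g \<in> dens U N"
proof (rule densI')
 assume U: "open U" and f: "f \<in> dens U N" and g: "g \<in> dens U N"
 show "sreg N U (\<lambda>p. dmul f g p l)" for l
  unfolding dmul_def by (rule sreg_odd_mult[OF U]) (rule densD(1)[OF f], rule densD(1)[OF g])
 show "oreg N (dmul f g p)" for p unfolding dmul_def by (rule oreg_mult) (rule densD(2)[OF f], rule densD(2)[OF g])
 show "fst p \<notin> U ==> dmul f g p = 0" for p by (simp add: dmul_def densD(3)[OF f] fun_eq_iff)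
qed

lemma dens_dpar: "open U ==> f \<in> dens U N ==> dpar f \<in> dens U N"
proof (rule densI')
 assume U: "open U" and f: "f \<in> dens U N"
 show "sreg N U (\<lambda>p. dpar f p l)" for l
  unfolding dpar_def parity_def by (intro sreg_mult[OF U] sreg_const[OF U] densD(1)[OF f])
 show "oreg N (dpar f p)" for p unfolding dpar_def by (rule oreg_parity[OF densD(2)[OF f]])
 show "fst p \<notin> U ==> dpar f p = 0" for p by (simp add: dpar_def densD(3)[OF f])
qed


lemma par_homogeneous: "dpar f = sg b f \<longleftrightarrow> (\<forall>p. parity (f p) = sg b (f p))"
 by (cases b) (auto simp: dpar_def fun_eq_iff)

lemma sg_funI: "(\<And>p l. F p l = sg b (G p l)) ==> F = sg b G"
 by (cases b) (simp_all add: fun_eq_iff sg_def)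

text \<open>The laws for the total derivative split into an even part, where they follow from the calculus of
 partial derivatives, and the derivation \<open>oddD\<close>. The ideal consists of the densities vanishing over
 \<open>V\<close>; openness of \<open>V\<close> makes it stable under differentiation.\<close>

lemma dens_superalgebra:
 fixes U V :: "(real^'n::finite) set"
 assumes U: "open U" and V: "open V"
 shows "jet_superalgebra (dens U :: nat => ('n, 'm::finite) density set) dmul dpar (dD U) (dpd U) (vanish V)"
proof
 have oS: "open (U \<times> (UNIV :: (('n, 'm) jet_index => real) set))" by (rule open_jets[OF U])
 have mem: "p \<in> U \<times> UNIV \<longleftrightarrow> fst p \<in> U" for p :: "('n, 'm) jet" by (auto simp: mem_Times_iff)
 fix N M :: nat and f g h :: "('n, 'm) density" and i j :: 'n and k k' :: bool
  and a a' :: "('n, 'm) jet_index" and b c :: bool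
 show "dens U N \<subseteq> (dens U M :: ('n, 'm) density set)" if "N \<le> M"
  using dens_mono[OF U _ that] by blast
 show "0 \<in> (dens U N :: ('n, 'm) density set)" by (rule dens_zero)
 show "f + g \<in> dens U N" if "f \<in> dens U N" "g \<in> dens U N" using that by (rule dens_add[OF U])
 show "- f \<in> dens U N" if "f \<in> dens U N" using that by (rule dens_minus[OF U])
 show "dmul f g \<in> dens U N" if "f \<in> dens U N" "g \<in> dens U N" using that by (rule dens_dmul[OF U])
 show "dpar f \<in> dens U N" if "f \<in> dens U N" using that by (rule dens_dpar[OF U])
 show "dD U i f \<in> dens U (Suc N)" if "f \<in> dens U N" using that by (rule dens_dD[OF U])
 show "dpd U k a f \<in> dens U N" if "f \<in> dens U N" using that by (rule dens_dpd[OF U])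
 show "dpd U k a f = 0" if f: "f \<in> dens U N" and a: "N < mi_size (snd a)"
 proof (rule dens_ext[OF dens_dpd[OF U f] dens_zero])
  fix p :: "('n, 'm) jet" and l assume "fst p \<in> U"
  then show "dpd U k a f p l = 0 p l"
   using oreg_lder_0[OF densD(2)[OF f, of p] a] sreg_pder_0[OF U densD(1)[OF f] a, of p l]
   by (cases k) (simp_all add: dpd_True dpd_False mem)
 qed
 show "dmul (f + g) h = dmul f h + dmul g h" "dmul f (g + h) = dmul f g + dmul f h"
  by (simp_all add: dmul_def fun_eq_iff odd_mult_add_left odd_mult_add_right)
 show "dmul (dmul f g) h = dmul f (dmul g h)"
  by (simp add: dmul_def fun_eq_iff odd_mult_assoc)
 show "dmul g f = sg (b \<and> c) (dmul f g)" if "dpar f = sg b f" "dpar g = sg c g"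
 proof (intro ext)
  fix p l
  have "odd_mult (g p) (f p) l = sg (b \<and> c) (odd_mult (f p) (g p) l)"
   by (rule odd_mult_commute) (use that in \<open>simp_all only: par_homogeneous\<close>)
  then show "dmul g f p l = sg (b \<and> c) (dmul f g) p l"
   by (cases b; cases c) (simp_all add: dmul_def sg_def)
 qed
 show "dpar (f + g) = dpar f + dpar g" by (simp add: dpar_def fun_eq_iff)
 show "dpar (dmul f g) = dmul (dpar f) (dpar g)" by (simp add: dpar_def dmul_def parity_odd_mult)
 show "dD U i (f + g) = dD U i f + dD U i g" if f: "f \<in> dens U N" and g: "g \<in> dens U N"
 proof (rule dens_ext[OF dens_dD[OF U dens_add[OF U f g]] dens_add[OF U dens_dD[OF U f] dens_dD[OF U g]]])
  fix p :: "('n, 'm) jet" and l assume p: "fst p \<in> U"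
  show "dD U i (f + g) p l = (dD U i f + dD U i g) p l"
   using vfield_add[OF U densD(1)[OF f, of l] densD(1)[OF g, of l], of p N i] p
   by (simp add: dD_eq[OF U f order_refl p] dD_eq[OF U g order_refl p] dD_eq[OF U dens_add[OF U f g] order_refl p] mem)
 qed
 show "dD U i (dmul f g) = dmul (dD U i f) g + dmul f (dD U i g)" if f: "f \<in> dens U N" and g: "g \<in> dens U N"
 proof (rule dens_ext[OF dens_dD[OF U dens_dmul[OF U f g]]
    dens_add[OF U dens_dmul[OF U dens_dD[OF U f] dens_mono[OF U g]] dens_dmul[OF U dens_mono[OF U f] dens_dD[OF U g]]]])
  fix p :: "('n, 'm) jet" and l assume p: "fst p \<in> U"
  have "vfield N i (\<lambda>p. odd_mult (f p) (g p) l) p =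
    odd_mult (\<lambda>l. vfield N i (\<lambda>p. f p l) p) (g p) l + odd_mult (f p) (\<lambda>l. vfield N i (\<lambda>p. g p l) p) l"
   by (rule odd_mult_derivation(2)[where \<delta> = "\<lambda>F. vfield N i F p" and S = "sreg N U"])
     (use p densD(1)[OF f] densD(1)[OF g] in
      \<open>auto intro: sreg_add[OF U] sreg_mult[OF U] vfield_add[OF U] vfield_mult[OF U] simp: mem U\<close>)
  moreover have "dD U i f p = (\<lambda>l. vfield N i (\<lambda>p. f p l) p) + oddD i (f p)"
   "dD U i g p = (\<lambda>l. vfield N i (\<lambda>p. g p l) p) + oddD i (g p)"
   by (simp_all add: fun_eq_iff dD_eq[OF U f order_refl p] dD_eq[OF U g order_refl p])
  moreover have "dD U i (dmul f g) p l = vfield N i (\<lambda>p. odd_mult (f p) (g p) l) p + oddD i (odd_mult (f p) (g p)) l"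
   using dD_eq[OF U dens_dmul[OF U f g] order_refl p, of i l] by (simp add: dmul_def)
  ultimately show "dD U i (dmul f g) p l = (dmul (dD U i f) g + dmul f (dD U i g)) p l"
   by (simp add: oddD_mult dmul_def odd_mult_add_left odd_mult_add_right)
 qed simp_all
 show "dD U i (dD U j f) = dD U j (dD U i f)" if f: "f \<in> dens U N"
 proof (rule dens_ext[OF dens_dD[OF U dens_dD[OF U f]] dens_dD[OF U dens_dD[OF U f]]])
  fix p :: "('n, 'm) jet" and l assume p: "fst p \<in> U"
  have s: "sreg N U (\<lambda>p. f p l)" for l by (rule densD(1)[OF f])
  have s2: "sreg (Suc N) U (\<lambda>p. vfield N i (\<lambda>p. f p l) p)" for i l by (rule sreg_vfield[OF U s])
  have s3: "sreg (Suc N) U (\<lambda>p. oddD i (f p) l)" for i l by (rule sreg_mono[OF U sreg_oddD[OF U s]]) simp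
  have *: "dD U i (dD U j f) p l = vfield (Suc N) i (vfield N j (\<lambda>p. f p l)) p +
   oddD j (\<lambda>l. vfield (Suc N) i (\<lambda>p. f p l) p) l + oddD i (\<lambda>l. vfield (Suc N) j (\<lambda>p. f p l) p) l +
   oddD i (oddD j (f p)) l" for i j
  proof -
   have "dD U i (dD U j f) p l = vfield (Suc N) i (\<lambda>p. dD U j f p l) p + oddD i (dD U j f p) l"
    by (rule dD_eq[OF U dens_dD[OF U f] order_refl p])
   also have "vfield (Suc N) i (\<lambda>p. dD U j f p l) p =
     vfield (Suc N) i (\<lambda>p. vfield N j (\<lambda>p. f p l) p + oddD j (f p) l) p"
    by (rule vfield_cong[OF U]) (use p dD_eq[OF U f order_refl] in \<open>auto simp: mem\<close>)
   also have "\<dots> = vfield (Suc N) i (vfield N j (\<lambda>p. f p l)) p + vfield (Suc N) i (\<lambda>p. oddD j (f p) l) p"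
    using p by (intro vfield_add[OF U s2 s3]) (simp add: mem)
   also have "vfield (Suc N) i (\<lambda>p. oddD j (f p) l) p = oddD j (\<lambda>l. vfield (Suc N) i (\<lambda>p. f p l) p) l"
    by (rule oddD_derivation[OF U, where \<delta> = "\<lambda>F. vfield (Suc N) i F p" and N = N])
      (use p s in \<open>auto intro: vfield_add[OF U] simp: mem U\<close>)
   also have "dD U j f p = (\<lambda>l. vfield (Suc N) j (\<lambda>p. f p l) p) + oddD j (f p)"
    by (simp add: fun_eq_iff dD_eq[OF U f _ p, of "Suc N"])
   finally show ?thesis unfolding oddD_add by (simp only: plus_fun_apply add.assoc)
  qed
  have "vfield (Suc N) i (vfield N j (\<lambda>p. f p l)) p = vfield (Suc N) j (vfield N i (\<lambda>p. f p l)) p"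
   by (rule vfield_commute[OF U s]) (simp add: mem p)
  then show "dD U i (dD U j f) p l = dD U j (dD U i f) p l"
   unfolding * using oddD_commute[of i j "f p" l] by simp
 qed
 show "dpar (dD U i f) = dD U i (dpar f)" if f: "f \<in> dens U N"
 proof (rule dens_ext[OF dens_dpar[OF U dens_dD[OF U f]] dens_dD[OF U dens_dpar[OF U f]]])
  fix p :: "('n, 'm) jet" and l assume p: "fst p \<in> U"
  have "vfield N i (\<lambda>p. parity (f p) l) p = (- 1) ^ length l * vfield N i (\<lambda>p. f p l) p"
   unfolding parity_def by (rule vfield_scale[OF U densD(1)[OF f]]) (simp add: mem p)
  then show "dpar (dD U i f) p l = dD U i (dpar f) p l"
   by (simp add: dD_eq[OF U dens_dpar[OF U f] order_refl p]) (simp add: dpar_def parity_def[of "dD U i f p"]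
    dD_eq[OF U f order_refl p] oddD_parity parity_def[of "oddD i (f p)"] algebra_simps)
 qed
 show "dpd U k a (f + g) = dpd U k a f + dpd U k a g" if f: "f \<in> dens U N" and g: "g \<in> dens U N"
 proof (rule dens_ext[OF dens_dpd[OF U dens_add[OF U f g]] dens_add[OF U dens_dpd[OF U f] dens_dpd[OF U g]]])
  fix p :: "('n, 'm) jet" and l assume p: "fst p \<in> U"
  have "qder a (\<lambda>p. f p l + g p l) p = qder a (\<lambda>p. f p l) p + qder a (\<lambda>p. g p l) p"
   by (rule jet.pder_add[OF sreg_smooth[OF U densD(1)[OF f]] sreg_smooth[OF U densD(1)[OF g]]]) (simp add: mem p)
  then show "dpd U k a (f + g) p l = (dpd U k a f + dpd U k a g) p l"
   using p by (cases k) (simp_all add: dpd_True dpd_False)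
 qed
 show "dpd U k a (dmul f g) = dmul (dpd U k a f) g + dmul (if k then dpar f else f) (dpd U k a g)"
  if f: "f \<in> dens U N" and g: "g \<in> dens U N"
 proof (cases k)
  case True
  then show ?thesis by (auto simp: fun_eq_iff dpd_True dmul_def dpar_def lder_odd_mult)
 next
  case False
  have "dpd U False a (dmul f g) = dmul (dpd U False a f) g + dmul f (dpd U False a g)"
  proof (rule dens_ext[OF dens_dpd[OF U dens_dmul[OF U f g]]
    dens_add[OF U dens_dmul[OF U dens_dpd[OF U f] g] dens_dmul[OF U f dens_dpd[OF U g]]]])
   fix p :: "('n, 'm) jet" and l assume p: "fst p \<in> U"
   have "qder a (\<lambda>p. odd_mult (f p) (g p) l) p =
     odd_mult (\<lambda>l. qder a (\<lambda>p. f p l) p) (g p) l +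
     odd_mult (f p) (\<lambda>l. qder a (\<lambda>p. g p l) p) l"
   proof (rule odd_mult_derivation(2)[where \<delta> = "\<lambda>F. qder a F p" and S = "sreg N U"])
    have p': "p \<in> U \<times> UNIV" by (simp add: mem p)
    fix F G :: "('n, 'm) jet => real" assume F: "sreg N U F" and G: "sreg N U G"
    show "qder a (\<lambda>p. F p + G p) p = qder a F p + qder a G p"
     by (rule jet.pder_add[OF sreg_smooth[OF U F] sreg_smooth[OF U G] p'])
    show "qder a (\<lambda>p. F p * G p) p = qder a F p * G p + F p * qder a G p"
     by (rule jet.pder_mult[OF sreg_smooth[OF U F] sreg_smooth[OF U G] p'])
    show "sreg N U (\<lambda>p. F p + G p)" "sreg N U (\<lambda>p. F p * G p)" using F G by (auto intro: sreg_add[OF U] sreg_mult[OF U])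
   qed (use densD(1)[OF f] densD(1)[OF g] in \<open>auto simp: U\<close>)
   moreover have "dpd U False a f p = (\<lambda>l. qder a (\<lambda>p. f p l) p)"
    "dpd U False a g p = (\<lambda>l. qder a (\<lambda>p. g p l) p)"
    using p by (simp_all add: fun_eq_iff dpd_False)
   ultimately show "dpd U False a (dmul f g) p l = (dmul (dpd U False a f) g + dmul f (dpd U False a g)) p l"
    using p by (simp add: dpd_False[of p U a "dmul f g"]) (simp add: dmul_def)
  qed
  with False show ?thesis by simp
 qed
 show "dpd U k a (dD U i f) = dD U i (dpd U k a f) + (if snd a i > 0 then dpd U k (lower i a) f else 0)"
  if f: "f \<in> dens U N"
 proof (rule dens_ext[OF dens_dpd[OF U dens_dD[OF U f]] dens_add[OF U dens_dD[OF U dens_dpd[OF U f]]]])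
  show "(if snd a i > 0 then dpd U k (lower i a) f else 0) \<in> dens U (Suc N)"
   using dens_mono[OF U dens_dpd[OF U f], of "Suc N"] dens_zero by auto
  fix p :: "('n, 'm) jet" and l assume p: "fst p \<in> U"
  have p': "p \<in> U \<times> UNIV" by (simp add: mem p)
  have s: "sreg N U (\<lambda>p. f p l)" for l by (rule densD(1)[OF f])
  show "dpd U k a (dD U i f) p l = (dD U i (dpd U k a f) + (if snd a i > 0 then dpd U k (lower i a) f else 0)) p l"
  proof (cases k)
   case True
   have "(\<lambda>p. dpd U True a f p l) = (\<lambda>p. f p (a # l))" by (simp add: dpd_True lder_def)
   then show ?thesis using True
    by (simp add: dpd_True lder_def dD_eq[OF U f order_refl p] dD_eq[OF U dens_dpd[OF U f] order_refl p])
  next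
   case False
   have 1: "dpd U False a (dD U i f) p l = qder a (\<lambda>p. vfield N i (\<lambda>p. f p l) p + oddD i (f p) l) p"
    unfolding dpd_False[OF p]
    by (rule pder_cong_U[OF U p']) (use dD_eq[OF U f order_refl] in \<open>auto simp: mem\<close>)
   also have "\<dots> = qder a (vfield N i (\<lambda>p. f p l)) p + qder a (\<lambda>p. oddD i (f p) l) p"
    by (rule jet.pder_add[OF sreg_smooth[OF U sreg_vfield[OF U s]] sreg_smooth[OF U sreg_oddD[OF U s]] p'])
   also have "qder a (vfield N i (\<lambda>p. f p l)) p = vfield N i (qder a (\<lambda>p. f p l)) p +
     (if snd a i > 0 then qder (lower i a) (\<lambda>p. f p l) p else 0)"
    by (rule pder_vfield[OF U s p' order_refl])
   also have "qder a (\<lambda>p. oddD i (f p) l) p = oddD i (\<lambda>l. qder a (\<lambda>p. f p l) p) l"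
    by (rule oddD_derivation[OF U, where \<delta> = "\<lambda>F. qder a F p" and N = N])
      (use s p' in \<open>auto intro: jet.pder_add sreg_smooth[OF U]\<close>)
   also have "(\<lambda>l. qder a (\<lambda>p. f p l) p) = dpd U False a f p"
    using p by (simp add: fun_eq_iff dpd_False)
   also have "vfield N i (qder a (\<lambda>p. f p l)) p = vfield N i (\<lambda>p. dpd U False a f p l) p"
    by (rule vfield_cong[OF U p']) (auto simp: dpd_False)
   finally have 2: "dpd U False a (dD U i f) p l = vfield N i (\<lambda>p. dpd U False a f p l) p +
     (if snd a i > 0 then qder (lower i a) (\<lambda>p. f p l) p else 0) +
     oddD i (dpd U False a f p) l" .
   have 3: "dpd U False a f p = (\<lambda>l. qder a (\<lambda>p. f p l) p)"
    using p by (simp add: fun_eq_iff dpd_False)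
   show ?thesis using False p 2
    by (simp add: dD_eq[OF U dens_dpd[OF U f] order_refl p] dpd_False 3)
  qed
 qed
 show "dpd U k a (dpd U k' a' f) = sg (k \<and> k') (dpd U k' a' (dpd U k a f))" if f: "f \<in> dens U N"
 proof -
  have "dpd U k a (dpd U k' a' f) p l = sg (k \<and> k') (dpd U k' a' (dpd U k a f) p l)" if p: "fst p \<in> U" for p :: "('n, 'm) jet" and l
  proof -
   have p': "p \<in> U \<times> UNIV" by (simp add: mem p)
   have s: "sreg N U (\<lambda>p. f p l)" for l by (rule densD(1)[OF f])
   consider "k" "k'" | "k" "\<not> k'" | "\<not> k" "k'" | "\<not> k" "\<not> k'" by blast
   then show ?thesis
   proof cases
    case 1
    have "alternating (f p)" using densD(2)[OF f, of p] by (simp add: oreg_def)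
    from alternating_lder_lder[OF this, of a a'] 1 show ?thesis by (simp add: dpd_True fun_eq_iff)
   next
    case 4
    have "qder a (\<lambda>p. dpd U False a' f p l) p =
      qder a (qder a' (\<lambda>p. f p l)) p" for a a'
     by (rule pder_cong_U[OF U p']) (auto simp: dpd_False)
    with 4 p jet.pder_commute[OF oS sreg_smooth[OF U s] p'] show ?thesis by (simp add: dpd_False)
   qed (use p in \<open>simp_all add: dpd_True dpd_False lder_def\<close>)
  qed
  moreover have "dpd U k a (dpd U k' a' f) p l = 0" "dpd U k' a' (dpd U k a f) p l = 0" if "fst p \<notin> U" for p :: "('n, 'm) jet" and l
   using dpd_out[OF dens_dpd[OF U f] that] by simp_all
  ultimately show ?thesis by (intro sg_funI) (metis (full_types) sg_simps(2))
 qed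
 show "dpar (dpd U k a f) = sg k (dpd U k a (dpar f))" if f: "f \<in> dens U N"
 proof -
  have "dpar (dpd U k a f) p l = sg k (dpd U k a (dpar f) p l)" if p: "fst p \<in> U" for p :: "('n, 'm) jet" and l
  proof (cases k)
   case True
   then show ?thesis using fun_cong[OF lder_parity[of a "f p"], of l] by (simp add: dpd_True dpar_def)
  next
   case False
   have "qder a (\<lambda>p. parity (f p) l) p = (-1) ^ length l * qder a (\<lambda>p. f p l) p"
    unfolding parity_def by (rule jet.pder_cmult[OF sreg_smooth[OF U densD(1)[OF f]]]) (simp add: mem p)
   with False p show ?thesis by (simp add: dpar_def dpd_False parity_def[of "dpd U False a f p"])
  qed
  moreover have "dpar (dpd U k a f) p l = 0" "dpd U k a (dpar f) p l = 0" if "fst p \<notin> U" for p :: "('n, 'm) jet" and l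
   using dpd_out[OF f that] dpd_out[OF dens_dpar[OF U f] that] by (simp_all add: dpar_def)
  ultimately show ?thesis by (intro sg_funI) (metis (full_types) sg_simps(2))
 qed
 show "0 \<in> (vanish V :: ('n, 'm) density set)" by (simp add: vanish_def)
 show "f + g \<in> vanish V" if "f \<in> vanish V" "g \<in> vanish V" using that by (simp add: vanish_def fun_eq_iff)
 show "- f \<in> vanish V" if "f \<in> vanish V" using that by (simp add: vanish_def fun_eq_iff)
 show "dmul f g \<in> vanish V" if "f \<in> vanish V \<or> g \<in> vanish V"
  using that by (auto simp: vanish_def dmul_def fun_eq_iff[of "odd_mult _ _"])
 show "dpar f \<in> vanish V" if "f \<in> vanish V" using that by (simp add: vanish_def dpar_def)
 show "dD U i f \<in> vanish V" if f: "f \<in> vanish V"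
 proof -
  have "total_der i f p = 0" if p: "fst p \<in> V" for p :: "('n, 'm) jet"
  proof -
   have "total_der i f p = total_der i 0 p"
    by (rule total_der_cong[OF V p]) (use f in \<open>auto simp: vanish_def\<close>)
   also have "\<dots> = 0" by (simp add: total_der_def x_der_def q_der_def fun_eq_iff)
   finally show ?thesis .
  qed
  then show ?thesis by (auto simp: vanish_def dD_def cut_def fun_eq_iff)
 qed
 show "dpd U k a f \<in> vanish V" if f: "f \<in> vanish V"
 proof -
  have "q_der a f p = 0" if p: "fst p \<in> V" for p :: "('n, 'm) jet"
  proof -
   have "q_der a f p = q_der a 0 p"
    by (rule q_der_cong[OF V p]) (use f in \<open>auto simp: vanish_def\<close>)
   also have "\<dots> = 0" by (simp add: q_der_def fun_eq_iff)
   finally show ?thesis .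
  qed
  moreover have "lder a (f p) = 0" if p: "fst p \<in> V" for p :: "('n, 'm) jet"
   using f p unfolding vanish_def by (metis (mono_tags) mem_Collect_eq lder_0)
  ultimately show ?thesis by (cases k) (auto simp: vanish_def dpd_def cut_def fun_eq_iff)
 qed
qed

section \<open>Variational derivatives and the bracket over an open set\<close>

abbreviation euler_op :: "(real^'n) set => bool => 'm => ('n::finite, 'm::finite) density => ('n, 'm) density" where
 "euler_op U \<equiv> jet_superalgebra.E (dD U) (dpd U)"

abbreviation bracket :: "(real^'n) set => ('n::finite, 'm::finite) density => ('n, 'm) density => ('n, 'm) density" where
 "bracket U \<equiv> jet_superalgebra.br dmul dpar (dD U) (dpd U)"

abbreviation adj :: "(real^'n) set => 'n multi_index => ('n::finite, 'm::finite) density => ('n, 'm) density" where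
 "adj U \<equiv> jet_superalgebra.ad (dD U)"

lemma (in jet_superalgebra) ad_Dm: "x \<in> CC ==> ad \<sigma> x = sg (odd (mi_size \<sigma>)) (Dm \<sigma> x)"
proof (induction \<sigma> rule: multi_index_induct)
 case (up i \<sigma>)
 then show ?case by (simp add: ad_up Dm_up sg_def D_minus' Dm_CC)
qed simp

text \<open>On densities of finite order the formal sum \<open>euler\<close> is the finite sum over multi-indices, and the operators
 cut off outside \<open>U\<close> compute the same values over \<open>U\<close>.\<close>

lemma euler_eq:
 fixes F :: "'n::finite multi_index => ('n, 'm::finite) density"
 assumes U: "open U" and G: "\<And>\<sigma>. G \<sigma> \<in> dens U N" and eq: "\<And>\<sigma> p. fst p \<in> U ==> F \<sigma> p = G \<sigma> p"
  and G0: "\<And>\<sigma>. N < mi_size \<sigma> ==> G \<sigma> = 0" and p: "fst p \<in> U"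
 shows "euler F p l = (\<Sum>\<sigma>\<in>mis N. adj U \<sigma> (G \<sigma>)) p l"
proof -
 interpret A: jet_superalgebra "dens U" dmul dpar "dD U" "dpd U :: _ => _ => ('n, 'm) density => _" "vanish {}"
  by (rule dens_superalgebra[OF U]) simp
 have "\<forall>p. fst p \<in> U \<longrightarrow> iter_mi total_der \<sigma> (F \<sigma>) p = A.Dm \<sigma> (G \<sigma>) p" for \<sigma>
  unfolding A.Dm_def
 proof (rule iter_mi_rel[where R = "\<lambda>x y. \<forall>p. fst p \<in> U \<longrightarrow> x p = y p"], intro allI impI)
  fix i and x y :: "('n, 'm) density" and p :: "('n, 'm) jet"
  assume xy: "\<forall>p. fst p \<in> U \<longrightarrow> x p = y p" and p: "fst p \<in> U"
  have "total_der i x p = total_der i y p" by (rule total_der_cong[OF U p]) (use xy in blast)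
  then show "total_der i x p = dD U i y p" using p by (simp add: dD_def)
 qed (use eq in blast)
 then have it: "iter_mi total_der \<sigma> (F \<sigma>) p = A.Dm \<sigma> (G \<sigma>) p" for \<sigma> using p by blast
 have sgn: "(-1) ^ mi_size \<sigma> * A.Dm \<sigma> (G \<sigma>) p l = adj U \<sigma> (G \<sigma>) p l" for \<sigma>
  by (simp add: A.ad_Dm[OF A.CC_I[OF G]] sg_def)
 have "euler F p l = (\<Sum>\<sigma>\<in>mis N. (-1) ^ mi_size \<sigma> * iter_mi total_der \<sigma> (F \<sigma>) p l)"
  unfolding euler_def
 proof (rule Sum_any.expand_superset)
  show "{\<sigma>. (-1) ^ mi_size \<sigma> * iter_mi total_der \<sigma> (F \<sigma>) p l \<noteq> 0} \<subseteq> mis N"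
  proof (rule subsetI, rule ccontr)
   fix \<sigma> assume "\<sigma> \<in> {\<sigma>. (-1) ^ mi_size \<sigma> * iter_mi total_der \<sigma> (F \<sigma>) p l \<noteq> 0}" "\<sigma> \<notin> mis N"
   then show False using G0[of \<sigma>] by (simp add: it mis_def)
  qed
 qed simp
 then show ?thesis by (simp add: it sgn sum_apply)
qed

lemma var_eqs:
 fixes f :: "('n::finite, 'm::finite) density"
 assumes U: "open U" and f: "regular_density N U f" and p: "fst p \<in> U"
 shows "var_q \<alpha> f p = euler_op U False \<alpha> (cut U f) p"
  and "var_b_left \<alpha> f p = euler_op U True \<alpha> (cut U f) p"
  and "var_b_right \<alpha> f p = dpar (euler_op U True \<alpha> (cut U f)) p"
proof -
 interpret A: jet_superalgebra "dens U" dmul dpar "dD U" "dpd U :: _ => _ => ('n, 'm) density => _" "vanish {}"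
  by (rule dens_superalgebra[OF U]) simp
 let ?f = "cut U f"
 have f': "?f \<in> dens U N" by (rule cut_dens[OF U f])
 have d: "dpd U k a ?f \<in> dens U N" for k a by (rule A.C_pd[OF f'])
 show "var_q \<alpha> f p = euler_op U False \<alpha> ?f p"
 proof
  fix l
  have "q_der a f p = dpd U False a ?f p" if "fst p \<in> U" for a and p :: "('n, 'm) jet"
   using that q_der_cong[OF U that, of f ?f a] by (simp add: dpd_def)
  then show "var_q \<alpha> f p l = euler_op U False \<alpha> ?f p l"
   unfolding var_q_def A.E_eq[OF f' order_refl]
   by (intro euler_eq[OF U d _ _ p]) (auto simp: A.pd_order[OF f'])
 qed
 show "var_b_left \<alpha> f p = euler_op U True \<alpha> ?f p"
 proof
  fix l
  show "var_b_left \<alpha> f p l = euler_op U True \<alpha> ?f p l"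
   unfolding var_b_left_def A.E_eq[OF f' order_refl]
   by (intro euler_eq[OF U d _ _ p]) (auto simp: A.pd_order[OF f'] dpd_True)
 qed
 show "var_b_right \<alpha> f p = dpar (euler_op U True \<alpha> ?f) p"
 proof
  fix l
  have "dpar (euler_op U True \<alpha> ?f) = (\<Sum>\<sigma>\<in>mis N. adj U \<sigma> (dpar (dpd U True (\<alpha>, \<sigma>) ?f)))"
   by (simp add: A.E_eq[OF f' order_refl] A.par_sum A.par_ad[OF A.CC_I[OF d]])
  moreover have "rder a (f p) = dpar (dpd U True a ?f) p" if "fst p \<in> U" for a and p :: "('n, 'm) jet"
  proof -
   have "alternating (?f p)" using densD(2)[OF f', of p] by (simp add: oreg_def)
   then show ?thesis using that rder_eq[of "f p" a] by (simp add: dpar_def dpd_True)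
  qed
  ultimately show "var_b_right \<alpha> f p l = dpar (euler_op U True \<alpha> ?f) p l"
   unfolding var_b_right_def
   by (simp only:) (intro euler_eq[OF U A.C_par[OF d] _ _ p], auto simp: A.pd_order[OF f'])
 qed
qed

lemma schouten_density_eq:
 fixes f g :: "('n::finite, 'm::finite) density"
 assumes U: "open U" and f: "regular_density N U f" and g: "regular_density M U g" and p: "fst p \<in> U"
 shows "schouten_density f g p = bracket U (cut U f) (cut U g) p"
proof
 fix l
 interpret A: jet_superalgebra "dens U" dmul dpar "dD U" "dpd U :: _ => _ => ('n, 'm) density => _" "vanish {}"
  by (rule dens_superalgebra[OF U]) simp
 show "schouten_density f g p l = bracket U (cut U f) (cut U g) p l"
  unfolding schouten_density_def A.br_def
  by (simp add: var_eqs[OF U f p] var_eqs[OF U g p] sum_apply UNIV_bool A.chr_def)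
    (simp add: dmul_def odd_mult_minus_left[of "dpar _ _"] sum_subtractf)
qed

lemma bracket_dens:
 fixes f g :: "('n::finite, 'm::finite) density"
 assumes U: "open U" and f: "f \<in> dens U N" and g: "g \<in> dens U N"
 shows "bracket U f g \<in> dens U (N + N)"
proof -
 interpret A: jet_superalgebra "dens U" dmul dpar "dD U" "dpd U :: _ => _ => ('n, 'm) density => _" "vanish {}"
  by (rule dens_superalgebra[OF U]) simp
 show ?thesis by (rule A.C_br[OF f g])
qed

lemma regular_density_mono:
 fixes f :: "('n::finite, 'm::finite) density"
 shows "open U ==> regular_density N U f ==> N \<le> M ==> regular_density M U f"
 unfolding regular_density_iff using sreg_mono oreg_mono by blast

lemma regular_density_subset:
 "regular_density N U f ==> W \<subseteq> U ==> regular_density N W f"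
 unfolding regular_density_def by (meson Sigma_mono order_refl smooth_along_subset subsetD)

lemma regular_schouten_density:
 fixes f g :: "('n::finite, 'm::finite) density"
 assumes U: "open U" and f: "regular_density N U f" and g: "regular_density N U g"
 shows "regular_density (N + N) U (schouten_density f g)"
 by (rule regular_density_cong[OF U densD(4)[OF bracket_dens[OF U cut_dens[OF U f] cut_dens[OF U g]]]])
   (simp add: schouten_density_eq[OF U f g])

lemma cut_schouten:
 fixes f g :: "('n::finite, 'm::finite) density"
 assumes U: "open U" and f: "regular_density N U f" and g: "regular_density N U g"
 shows "cut U (schouten_density f g) = bracket U (cut U f) (cut U g)"
 by (rule dens_ext[OF cut_dens[OF U regular_schouten_density[OF U f g]] bracket_dens[OF U cut_dens[OF U f] cut_dens[OF U g]]])
  (simp add: schouten_density_eq[OF U f g])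

definition base_fun :: "(real^'n) set => (real^'n => real) => ('n::finite, 'm::finite) density" where
 "base_fun U u = (\<lambda>p l. if l = [] \<and> fst p \<in> U then u (fst p) else 0)"

lemma base_fun_dens:
 assumes U: "open U" and u: "base_smooth U u"
 shows "(base_fun U u :: ('n::finite, 'm::finite) density) \<in> dens U N"
proof (rule densI')
 show "sreg N U (\<lambda>p. base_fun U u p l)" for l :: "('n, 'm) jet_index list"
 proof (cases "l = []")
  case True
  then show ?thesis
   by (intro sreg_cong[OF U sreg_base[OF U u, of N]]) (auto simp: base_fun_def)
 qed (simp add: base_fun_def U)
 show "oreg N (base_fun U u p)" for p :: "('n, 'm) jet"
  by (auto simp: oreg_def alternating_def base_fun_def)
 show "fst p \<notin> U ==> base_fun U u p = 0" for p :: "('n, 'm) jet" by (simp add: base_fun_def fun_eq_iff)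
qed

lemma odd_mult_const: "(\<And>l. l \<noteq> [] ==> v l = 0) ==> odd_mult v w l = v [] * w l"
proof (induction l arbitrary: v w)
 case (Cons a l)
 have 1: "lder a v = 0" using Cons.prems by (auto simp: lder_def fun_eq_iff)
 have "parity v l = v l" for l
  using Cons.prems[of l] by (cases "l = []") (simp_all add: parity_def)
 then have 2: "parity v = v" by (simp add: fun_eq_iff)
 show ?case unfolding odd_mult_Cons 1 2 using Cons.IH[of v "lder a w", OF Cons.prems]
  by (simp add: lder_def)
qed simp

lemma dmul_base_fun: "dmul (base_fun U u) f p l = (if fst p \<in> U then u (fst p) * f p l else 0)"
 unfolding dmul_def by (subst odd_mult_const) (auto simp: base_fun_def)

lemma dpar_base_fun: "dpar (base_fun U u) = base_fun U u"
 by (auto simp: dpar_def parity_def base_fun_def fun_eq_iff)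

lemma dpd_base_fun:
 assumes U: "open U"
 shows "dpd U k a (base_fun U u) = (0 :: ('n::finite, 'm::finite) density)"
proof (intro ext)
 fix p :: "('n, 'm) jet" and l
 show "dpd U k a (base_fun U u) p l = 0 p l"
 proof (cases "k \<or> fst p \<notin> U")
  case True
  then show ?thesis by (auto simp: dpd_def base_fun_def lder_def cut_def)
 next
  case False
  have "qder a (\<lambda>p. base_fun U u p l) p = qder a (\<lambda>p. if l = [] then u (fst p) else 0) p"
   by (rule pder_cong_U[OF U]) (use False in \<open>auto simp: base_fun_def mem_Times_iff\<close>)
  also have "\<dots> = 0"
   using fun_cong[OF pder_jet_fst(2)[of a "\<lambda>x. if l = [] then u x else 0"], of p] by simp
  finally show ?thesis using False by (simp add: dpd_False)
 qed
qed

lemma dD_base_fun: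
 assumes U: "open U" and u: "base_smooth U u"
 shows "dD U i (base_fun U u) = (base_fun U (bder i u) :: ('n::finite, 'm::finite) density)"
proof (rule dens_ext[OF dens_dD[OF U base_fun_dens[OF U u]] base_fun_dens[OF U smooth_along_pder[OF u]]])
 fix p :: "('n, 'm) jet" and l assume p: "fst p \<in> U"
 have p': "p \<in> U \<times> UNIV" using p by (simp add: mem_Times_iff)
 have "dD U i (base_fun U u) p l = vfield 0 i (\<lambda>p. base_fun U u p l) p + oddD i (base_fun U u p) l"
  by (rule dD_eq[OF U base_fun_dens[OF U u] order_refl p])
 also have "oddD i (base_fun U u p) l = 0"
 proof (cases l)
  case (Cons c l')
  have "lder c (base_fun U u p) = 0" by (simp add: lder_def base_fun_def fun_eq_iff)
  then show ?thesis using Cons by (simp add: base_fun_def)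
 qed simp
 also have "vfield 0 i (\<lambda>p. base_fun U u p l) p = vfield 0 i (\<lambda>p. (if l = [] then u (fst p) else 0)) p"
  by (rule vfield_cong[OF U p']) (auto simp: base_fun_def)
 also have "\<dots> = base_fun U (bder i u) p l"
  using fun_cong[OF pder_jet_fst(1)[of i "\<lambda>x. if l = [] then u x else 0"], of p]
   fun_cong[OF pder_jet_fst(2)[of _ "\<lambda>x. if l = [] then u x else 0"], of _ p] p
  by (auto simp: vfield_def base_fun_def)
 finally show "dD U i (base_fun U u) p l = base_fun U (bder i u) p l" by simp
qed

section \<open>Coordinate changes and their prolongations\<close>

context commuting_flows
begin

lemma iter_pder:
 fixes \<kappa> :: "'n::finite => 'c"
 assumes S: "open S" and f: "smooth_along sh S f"
 defines "it \<equiv> \<lambda>\<sigma>. iter_mi (\<lambda>i. pder sh (\<kappa> i)) \<sigma>"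
 shows "smooth_along sh S (it \<sigma> f)"
  and "p \<in> S ==> it (up j \<sigma>) f p = pder sh (\<kappa> j) (it \<sigma> f) p"
  and "p \<in> S ==> pder sh c (it \<sigma> f) p = it \<sigma> (pder sh c f) p"
proof -
 define ct where "ct g = (\<lambda>p. if p \<in> S then g p else (0::real))" for g
 define E where "E i g = ct (pder sh (\<kappa> i) g)" for i g
 define C where "C = {g. smooth_along sh S g \<and> ct g = g}"
 have ctS: "p \<in> S ==> ct g p = g p" for g p by (simp add: ct_def)
 have ctct: "ct (ct g) = ct g" for g by (auto simp: ct_def)
 have sct: "smooth_along sh S (ct g)" if "smooth_along sh S g" for g
  by (rule smooth_along_cong[OF S that]) (simp add: ct_def)
 have ctC: "ct g \<in> C" if "smooth_along sh S g" for g using sct[OF that] ctct by (simp add: C_def)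
 have EC: "E i g \<in> C" if "g \<in> C" for i g
  using that unfolding E_def by (intro ctC smooth_along_pder) (simp add: C_def)
 have com: "ct (pder sh c (ct (pder sh d g))) = ct (pder sh d (ct (pder sh c g)))" if "g \<in> C" for c d g
 proof
  fix p
  show "ct (pder sh c (ct (pder sh d g))) p = ct (pder sh d (ct (pder sh c g))) p"
  proof (cases "p \<in> S")
   case True
   have "pder sh c (ct (pder sh d g)) p = pder sh c (pder sh d g) p"
    "pder sh d (ct (pder sh c g)) p = pder sh d (pder sh c g) p"
    by (rule pder_cong[OF S True], simp add: ctS)+
   then show ?thesis using pder_commute[OF S _ True, of g c d] that by (simp add: ctS True C_def)
  qed (simp add: ct_def)
 qed
 have rel: "\<forall>p\<in>S. it \<sigma> g p = iter_mi E \<sigma> (ct g) p" for \<sigma> g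
  unfolding it_def
 proof (rule iter_mi_rel[where R = "\<lambda>x y. \<forall>p\<in>S. x p = y p"])
  show "\<forall>p\<in>S. pder sh (\<kappa> i) x p = E i y p" if "\<forall>p\<in>S. x p = y p" for i x y
   using pder_cong[OF S, of _ x y "\<kappa> i"] that by (auto simp: E_def ctS)
 qed (simp add: ctS)
 have itC: "iter_mi E \<sigma> g \<in> C" if "g \<in> C" for \<sigma> g by (rule iter_mi_closed[of C E, OF EC that])
 show sm: "smooth_along sh S (it \<sigma> f)" for \<sigma>
  by (rule smooth_along_cong[OF S, of "iter_mi E \<sigma> (ct f)"])
    (use itC[OF ctC[OF f]] rel in \<open>auto simp: C_def\<close>)
 show "it (up j \<sigma>) f p = pder sh (\<kappa> j) (it \<sigma> f) p" if p: "p \<in> S"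
 proof -
  have "iter_mi E (up j \<sigma>) (ct f) = E j (iter_mi E \<sigma> (ct f))"
  proof (rule iter_mi_up[of C E])
   show "E i (E j x) = E j (E i x)" if "x \<in> C" for i j x
    using com[OF that] by (simp add: E_def)
  qed (use EC ctC[OF f] in auto)
  moreover have "pder sh (\<kappa> j) (it \<sigma> f) p = pder sh (\<kappa> j) (iter_mi E \<sigma> (ct f)) p"
   by (rule pder_cong[OF S p]) (use rel in blast)
  ultimately show ?thesis using rel[of "up j \<sigma>" f] p by (simp add: E_def ctS)
 qed
 show "pder sh c (it \<sigma> f) p = it \<sigma> (pder sh c f) p" if p: "p \<in> S"
 proof -
  have "ct (pder sh c (iter_mi E \<sigma> (ct f))) = iter_mi E \<sigma> (ct (pder sh c (ct f)))"
  proof (rule iter_mi_commute[where C = C and T = "\<lambda>g. ct (pder sh c g)"])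
   show "ct (pder sh c (E i x)) = E i (ct (pder sh c x))" if "x \<in> C" for i x
    unfolding E_def by (rule com[OF that])
  qed (use EC ctC[OF f] in auto)
  moreover have "pder sh c (it \<sigma> f) p = pder sh c (iter_mi E \<sigma> (ct f)) p"
   by (rule pder_cong[OF S p]) (use rel in blast)
  moreover have "ct (pder sh c (ct f)) = ct (pder sh c f)"
  proof
   fix q show "ct (pder sh c (ct f)) q = ct (pder sh c f) q"
    using pder_cong[OF S, of q "ct f" f c] by (cases "q \<in> S") (simp_all add: ct_def)
  qed
  ultimately show ?thesis using rel[of \<sigma> "pder sh c f"] p by (metis ctS)
 qed
qed

end

text \<open>The entries of \<open>prolong\<close> are iterated derivatives in \<open>y\<close> of functions with parameter \<open>x\<close>, taken at
 \<open>y = base_trans c d x\<close>. Differentiating them in \<open>x\<close> requires functions of the pair.\<close>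

definition pair_shift :: "'n + 'n => real => (real^'n::finite) \<times> (real^'n) => (real^'n) \<times> (real^'n)" where
 "pair_shift c t p = (case c of Inl i => (base_shift i t (fst p), snd p) | Inr i => (fst p, base_shift i t (snd p)))"

definition pair_coord :: "'n + 'n => (real^'n::finite) \<times> (real^'n) => real" where
 "pair_coord c p = (case c of Inl i => fst p $ i | Inr i => snd p $ i)"

interpretation pair: coordinate_flows "pair_shift :: 'n::finite + 'n => _" pair_coord
proof
 fix c d :: "'n + 'n" and s t and p :: "(real^'n) \<times> (real^'n)"
 show "pair_shift c 0 p = p" by (cases c) (simp_all add: pair_shift_def)
 show "pair_shift c s (pair_shift c t p) = pair_shift c (s + t) p"
  by (cases c) (simp_all add: pair_shift_def base.sh_add)
 show "pair_shift c s (pair_shift d t p) = pair_shift d t (pair_shift c s p)"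
  by (cases c; cases d) (simp_all add: pair_shift_def base.sh_commute)
 show "pair_coord d (pair_shift c t p) = pair_coord d p + (if d = c then t else 0)"
  by (cases c; cases d) (auto simp: pair_shift_def pair_coord_def base.co_sh)
 show "continuous_on UNIV (\<lambda>(t, p). pair_shift c t p)"
  unfolding case_prod_beta pair_shift_def base_shift_def by (cases c) (auto intro!: continuous_intros)
qed

lemma base_depends_UNIV: "base.depends_on UNIV S f"
 by (simp add: base.depends_on_def vec_eq_iff[symmetric])

lemma pair_depends_UNIV: "pair.depends_on UNIV S f"
proof -
 have "(\<forall>k. pair_coord k u = pair_coord k v) ==> u = v" for u v :: "(real^'a) \<times> (real^'a)"
 proof -
  assume *: "\<forall>k. pair_coord k u = pair_coord k v"
  have "fst u $ i = fst v $ i" "snd u $ i = snd v $ i" for i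
   using *[rule_format, of "Inl i"] *[rule_format, of "Inr i"] by (simp_all add: pair_coord_def)
  then show "u = v" by (simp add: prod_eq_iff vec_eq_iff)
 qed
 then show ?thesis unfolding pair.depends_on_def by blast
qed

lemma pder_base_coord: "bder c (\<lambda>x. x $ d) = (\<lambda>x. if d = c then 1 else 0)"
proof
 fix x show "bder c (\<lambda>x. x $ d) x = (if d = c then 1 else 0)"
  by (rule pderI) (auto simp: base.co_sh intro!: derivative_eq_intros)
qed

lemma (in coordinate_flows) smooth_coordI:
 assumes S: "open S" and cont: "continuous_on S (co d)"
 shows "smooth_along sh S (co d)"
proof (rule smooth_along_coinduct[OF S, where X = "\<lambda>g. g = co d \<or> (\<exists>k. g = (\<lambda>p. k))"])
 fix g c assume g: "g = co d \<or> (\<exists>k. g = (\<lambda>p. k))"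
 then show "continuous_on S g" using cont by auto
 have "(\<lambda>t. k + (if b then t else 0)) field_differentiable at 0" for k :: real and b
  by (cases b) (simp_all add: field_differentiable_add field_differentiable_const field_differentiable_ident)
 then show "(\<lambda>t. g (sh c t p)) field_differentiable at 0" for p
  using g by (auto simp: co_sh)
 have "pder sh c (co d) = (\<lambda>p. if d = c then 1 else 0)"
 proof
  fix p show "pder sh c (co d) p = (if d = c then 1 else 0)"
   by (rule pderI) (auto simp: co_sh intro!: derivative_eq_intros)
 qed
 then show "\<exists>g'. (g' = co d \<or> (\<exists>k. g' = (\<lambda>p. k))) \<and> (\<forall>p\<in>S. pder sh c g p = g' p)"
  using g by auto
qed simp

lemma smooth_base_coord: "open S ==> base_smooth S (\<lambda>x. x $ i)"
 by (rule base.smooth_coordI) (auto intro: continuous_intros)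

lemma smooth_pair_coord: "open S ==> smooth_along pair_shift S (pair_coord d)"
proof (rule pair.smooth_coordI)
 have "pair_coord (Inl i) = (\<lambda>p. fst p $ i)" "pair_coord (Inr i) = (\<lambda>p. snd p $ i)" for i :: 'a
  by (simp_all add: pair_coord_def fun_eq_iff)
 then show "continuous_on S (pair_coord d)"
  by (cases d) (auto intro!: continuous_intros)
qed

lemma smooth_pair_snd:
 assumes "open S" "base_smooth S u"
 shows "smooth_along pair_shift (UNIV \<times> S) (\<lambda>p. u (snd p))"
proof (rule base.smooth_compose[OF pair.commuting_flows_axioms _ assms(1) _ assms(2) base_depends_UNIV])
 show "open (UNIV \<times> S)" using assms by (simp add: open_Times)
 then show "smooth_along pair_shift (UNIV \<times> S) (\<lambda>p. snd p $ k)" for k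
  using smooth_pair_coord[of "UNIV \<times> S" "Inr k"] by (simp add: pair_coord_def[abs_def])
qed (auto intro: continuous_intros)

lemma smooth_det:
 assumes S: "open S" and A: "\<And>i j. base_smooth S (\<lambda>x. A x $ i $ j)"
 shows "base_smooth S (\<lambda>x. det (A x :: real^'n::finite^'n))"
 unfolding det_def
 by (intro base.smooth_sum[OF S] base.smooth_cmult[OF S] base.smooth_prod[OF S] A)

lemma continuous_on_vec_components:
 "(\<And>i. continuous_on S (\<lambda>x. f x $ i)) ==> continuous_on S (f :: _ => real^'n::finite)"
 using continuous_on_vec_lambda[of S "\<lambda>i x. f x $ i"] by simp

locale oriented_bundle =
 fixes B :: "('a, 'e, 'n::finite, 'm::finite) vector_bundle"
 assumes oriented: "oriented_vector_bundle B"
begin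

lemma chart_facts:
 assumes "c \<in> charts B"
 shows "openin (base B) (chart_dom c)" "open (base_image c)"
  "homeomorphic_map (subtopology (base B) (chart_dom c)) (top_of_set (base_image c)) (base_coord c)"
  "homeomorphic_map (subtopology (total B) (total_over B (chart_dom c)))
     (prod_topology (subtopology (base B) (chart_dom c)) euclidean)
     (\<lambda>e. (proj B e, fibre_coord c e))"
 using oriented assms unfolding oriented_vector_bundle_def by auto

lemma chart_dom_sub: "c \<in> charts B ==> chart_dom c \<subseteq> topspace (base B)"
 by (rule openin_subset[OF chart_facts(1)])

lemma chart_inj: "c \<in> charts B ==> inj_on (base_coord c) (chart_dom c)"
 using homeomorphic_imp_injective_map[OF chart_facts(3)] chart_dom_sub
 by (simp add: Int_absorb1)

lemma chart_inv_coord [simp]: "c \<in> charts B ==> u \<in> chart_dom c ==> chart_inv c (base_coord c u) = u"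
 unfolding chart_inv_def by (rule inv_into_f_f[OF chart_inj])

lemma chart_inv_in: "x \<in> base_image c ==> chart_inv c x \<in> chart_dom c"
 unfolding chart_inv_def base_image_def by (rule inv_into_into)

lemma coord_chart_inv [simp]: "x \<in> base_image c ==> base_coord c (chart_inv c x) = x"
 unfolding chart_inv_def base_image_def by (rule f_inv_into_f)

lemma open_coord_image:
 assumes c: "c \<in> charts B" and S: "openin (base B) S"
 shows "open (base_coord c ` (chart_dom c \<inter> S))"
proof -
 have "open_map (subtopology (base B) (chart_dom c)) (top_of_set (base_image c)) (base_coord c)"
  using homeomorphic_imp_open_map[OF chart_facts(3)[OF c]] .
 moreover have "openin (subtopology (base B) (chart_dom c)) (chart_dom c \<inter> S)"
  by (rule openin_subtopology_Int2[OF S])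
 ultimately have "openin (top_of_set (base_image c)) (base_coord c ` (chart_dom c \<inter> S))"
  unfolding open_map_def by (elim allE impE)
 then show ?thesis by (rule openin_open_trans[OF _ chart_facts(2)[OF c]])
qed

lemma coord_image_iff:
 "c \<in> charts B ==> x \<in> base_coord c ` (chart_dom c \<inter> S) \<longleftrightarrow> x \<in> base_image c \<and> chart_inv c x \<in> S"
proof
 assume c: "c \<in> charts B"
 show "x \<in> base_coord c ` (chart_dom c \<inter> S) ==> x \<in> base_image c \<and> chart_inv c x \<in> S"
  using c by (auto simp: base_image_def)
 show "x \<in> base_image c \<and> chart_inv c x \<in> S ==> x \<in> base_coord c ` (chart_dom c \<inter> S)"
  using chart_inv_in[of x c] coord_chart_inv[of x c] by (metis IntI imageI)
qed

lemma overlap_iff: "c \<in> charts B ==> x \<in> overlap c d \<longleftrightarrow> x \<in> base_image c \<and> chart_inv c x \<in> chart_dom d"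
 unfolding overlap_def by (rule coord_image_iff)

lemma open_overlap: "c \<in> charts B ==> d \<in> charts B ==> open (overlap c d)"
 unfolding overlap_def by (rule open_coord_image) (auto intro: chart_facts)

lemma overlap_self: "overlap c c = base_image c" by (simp add: overlap_def base_image_def)

lemma trans_facts:
 assumes c: "c \<in> charts B" and d: "d \<in> charts B" and x: "x \<in> overlap c d"
 shows "base_trans c d x \<in> overlap d c" "chart_inv d (base_trans c d x) = chart_inv c x"
  "base_trans d c (base_trans c d x) = x" "base_trans d e (base_trans c d x) = base_trans c e x"
proof -
 have u: "chart_inv c x \<in> chart_dom c" "chart_inv c x \<in> chart_dom d" "x \<in> base_image c"
  using x overlap_iff[OF c] chart_inv_in by auto
 show 1: "chart_inv d (base_trans c d x) = chart_inv c x" by (simp add: base_trans_def d u)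
 show "base_trans c d x \<in> overlap d c" unfolding overlap_def base_trans_def using u by auto
 show "base_trans d c (base_trans c d x) = x" "base_trans d e (base_trans c d x) = base_trans c e x"
  unfolding base_trans_def[of d] 1 using u by (simp_all add: base_trans_def)
qed

lemma trans_self: "c \<in> charts B ==> x \<in> base_image c ==> base_trans c c x = x"
 by (simp add: base_trans_def)

lemma trans_smooth: "c \<in> charts B ==> d \<in> charts B ==> base_smooth (overlap c d) (\<lambda>x. base_trans c d x $ j)"
 using oriented unfolding oriented_vector_bundle_def by blast

lemma det_pos: "c \<in> charts B ==> d \<in> charts B ==> x \<in> overlap c d ==> det (jacobian c d x) > 0"
 using oriented unfolding oriented_vector_bundle_def by blast

lemma trans_continuous: "c \<in> charts B ==> d \<in> charts B ==> continuous_on (overlap c d) (base_trans c d)"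
 by (intro continuous_on_vec_components smooth_along_continuous[OF trans_smooth])

lemma jacobian_entry: "jacobian c d x $ j $ i = bder i (\<lambda>x. base_trans c d x $ j) x"
 by (simp add: base_jacobian_def)

lemma jacobian_smooth: "c \<in> charts B ==> d \<in> charts B ==> base_smooth (overlap c d) (\<lambda>x. jacobian c d x $ j $ i)"
 unfolding jacobian_entry by (intro smooth_along_pder trans_smooth)

lemma compose_trans:
 assumes c: "c \<in> charts B" and d: "d \<in> charts B" and W: "open W" "W \<subseteq> overlap c d"
  and W': "open W'" "base_trans c d ` W \<subseteq> W'" and u: "base_smooth W' u"
 shows "base_smooth W (\<lambda>x. u (base_trans c d x))"
  and "x \<in> W ==> bder i (\<lambda>x. u (base_trans c d x)) x =
   (\<Sum>j\<in>UNIV. jacobian c d x $ j $ i * bder j u (base_trans c d x))"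
proof -
 have s: "base_smooth W (\<lambda>x. base_trans c d x $ j)" for j
  by (rule smooth_along_subset[OF trans_smooth[OF c d] W(2)])
 show "base_smooth W (\<lambda>x. u (base_trans c d x))"
  by (rule base.smooth_compose[OF base.commuting_flows_axioms W(1) W' u base_depends_UNIV _ s])
    (auto intro: continuous_on_subset[OF trans_continuous[OF c d] W(2)])
 show "bder i (\<lambda>x. u (base_trans c d x)) x =
   (\<Sum>j\<in>UNIV. jacobian c d x $ j $ i * bder j u (base_trans c d x))" if "x \<in> W"
  unfolding jacobian_entry
  by (rule base.chain_rule[OF base.commuting_flows_axioms W(1) that W' u base_depends_UNIV _ s]) simp
qed

definition triple :: "('a, 'e, 'n, 'm) bundle_chart => ('a, 'e, 'n, 'm) bundle_chart => ('a, 'e, 'n, 'm) bundle_chart => (real^'n) set" where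
 "triple c d e = overlap c d \<inter> overlap c e"

lemma triple_facts:
 assumes c: "c \<in> charts B" and d: "d \<in> charts B" and e: "e \<in> charts B"
 shows "open (triple c d e)" "triple c d e \<subseteq> overlap c d" "triple c d e \<subseteq> overlap c e"
  "base_trans c d ` triple c d e \<subseteq> overlap d e"
proof -
 show "open (triple c d e)" unfolding triple_def by (intro open_Int open_overlap assms)
 show "triple c d e \<subseteq> overlap c d" "triple c d e \<subseteq> overlap c e" by (auto simp: triple_def)
 show "base_trans c d ` triple c d e \<subseteq> overlap d e"
 proof
  fix y assume "y \<in> base_trans c d ` triple c d e"
  then obtain x where x: "x \<in> overlap c d" "x \<in> overlap c e" "y = base_trans c d x" by (auto simp: triple_def)
  then show "y \<in> overlap d e"
   using trans_facts(1,2)[OF c d x(1)] overlap_iff[OF c] overlap_iff[OF d] by auto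
 qed
qed

lemma jacobian_cocycle:
 assumes c: "c \<in> charts B" and d: "d \<in> charts B" and e: "e \<in> charts B" and x: "x \<in> triple c d e"
 shows "jacobian d e (base_trans c d x) ** jacobian c d x = jacobian c e x"
proof -
 note T = triple_facts[OF c d e]
 have "(\<Sum>k\<in>UNIV. jacobian d e (base_trans c d x) $ j $ k * jacobian c d x $ k $ i) = jacobian c e x $ j $ i" for i j
 proof -
  have "jacobian c e x $ j $ i = bder i (\<lambda>x. base_trans d e (base_trans c d x) $ j) x"
   unfolding jacobian_entry
   by (rule base.pder_cong[OF T(1) x]) (use trans_facts(4)[OF c d] T(2) in auto)
  also have "\<dots> = (\<Sum>k\<in>UNIV. jacobian c d x $ k $ i * bder k (\<lambda>y. base_trans d e y $ j) (base_trans c d x))"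
   by (rule compose_trans(2)[OF c d T(1,2) open_overlap[OF d e] T(4) trans_smooth[OF d e] x])
  finally show ?thesis by (simp add: jacobian_entry mult.commute)
 qed
 then show ?thesis by (simp add: matrix_matrix_mult_def vec_eq_iff)
qed

lemma jacobian_self:
 assumes c: "c \<in> charts B" and x: "x \<in> base_image c"
 shows "jacobian c c x = mat 1"
proof -
 have "bder i (\<lambda>x. base_trans c c x $ j) x = bder i (\<lambda>x. x $ j) x" for i j
  by (rule base.pder_cong[OF chart_facts(2)[OF c] x]) (simp add: trans_self[OF c])
 then show ?thesis by (simp add: vec_eq_iff jacobian_entry pder_base_coord mat_def)
qed

lemma triple_self: "x \<in> overlap c d ==> c \<in> charts B ==> x \<in> triple c d c"
 using overlap_iff[of c x] by (auto simp: triple_def overlap_self)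

lemma jacobian_inverse:
 assumes c: "c \<in> charts B" and d: "d \<in> charts B" and x: "x \<in> overlap c d"
 shows "jacobian d c (base_trans c d x) ** jacobian c d x = mat 1"
  and "jacobian c d x ** jacobian d c (base_trans c d x) = mat 1"
proof -
 show 1: "jacobian d c (base_trans c d x) ** jacobian c d x = mat 1"
  using jacobian_cocycle[OF c d c triple_self[OF x c]] jacobian_self[OF c] x overlap_iff[OF c] by auto
 show "jacobian c d x ** jacobian d c (base_trans c d x) = mat 1"
  using 1 matrix_left_right_inverse by blast
qed

lemma jacobian_inverse_sum:
 assumes c: "c \<in> charts B" and d: "d \<in> charts B" and x: "x \<in> overlap c d"
 shows "(\<Sum>i\<in>UNIV. jacobian c d x $ k $ i * jacobian d c (base_trans c d x) $ i $ j) = (if k = j then 1 else 0)"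
  and "(\<Sum>i\<in>UNIV. jacobian d c (base_trans c d x) $ k $ i * jacobian c d x $ i $ j) = (if k = j then 1 else 0)"
 using jacobian_inverse[OF assms] by (simp_all add: matrix_matrix_mult_def mat_def vec_eq_iff)

lemma det_inverse:
 assumes c: "c \<in> charts B" and d: "d \<in> charts B" and x: "x \<in> overlap c d"
 shows "det (jacobian d c (base_trans c d x)) * det (jacobian c d x) = 1"
 using jacobian_inverse(1)[OF assms] det_mul by (metis det_I)

lemma fibre_trans_cocycle:
 assumes c: "c \<in> charts B" and d: "d \<in> charts B" and e: "e \<in> charts B" and x: "x \<in> triple c d e"
 shows "fibre_trans B d e (base_trans c d x) (fibre_trans B c d x v) = fibre_trans B c e x v"
  and "fibre_trans B c c x v = v"
proof -
 have xx: "x \<in> overlap c d" "x \<in> overlap c e" using x by (auto simp: triple_def)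
 define u where "u = chart_inv c x"
 have u: "u \<in> chart_dom c" "u \<in> chart_dom d" "u \<in> chart_dom e"
  using xx overlap_iff[OF c] chart_inv_in by (auto simp: u_def)
 have fp: "fibre_point B c u v \<in> total_over B {u} \<and> fibre_coord c (fibre_point B c u v) = v"
  "\<And>e. e \<in> total_over B {u} ==> fibre_point B c u (fibre_coord c e) = e"
  if c: "c \<in> charts B" and u: "u \<in> chart_dom c" for c v
 proof -
  let ?X = "subtopology (total B) (total_over B (chart_dom c))"
  let ?Y = "prod_topology (subtopology (base B) (chart_dom c)) (euclidean :: (real^'m) topology)"
  have X: "topspace ?X = total_over B (chart_dom c)" by (auto simp: total_over_def)
  have Y: "topspace ?Y = chart_dom c \<times> UNIV" using chart_dom_sub[OF c] by auto
  have inj: "inj_on (\<lambda>e. (proj B e, fibre_coord c e)) (total_over B (chart_dom c))"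
   using homeomorphic_imp_injective_map[OF chart_facts(4)[OF c]] X by simp
  have sur: "(\<lambda>e. (proj B e, fibre_coord c e)) ` total_over B (chart_dom c) = chart_dom c \<times> UNIV"
   using homeomorphic_imp_surjective_map[OF chart_facts(4)[OF c]] X Y by simp
  have ex: "\<exists>!e. e \<in> total_over B {u} \<and> fibre_coord c e = v" for v
  proof -
   have "(u, v) \<in> (\<lambda>e. (proj B e, fibre_coord c e)) ` total_over B (chart_dom c)" using sur u by auto
   then obtain e where e: "e \<in> total_over B (chart_dom c)" "proj B e = u" "fibre_coord c e = v" by auto
   show ?thesis
   proof (rule ex1I[of _ e])
    show "e \<in> total_over B {u} \<and> fibre_coord c e = v" using e by (auto simp: total_over_def)
    fix e' assume e': "e' \<in> total_over B {u} \<and> fibre_coord c e' = v"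
    then show "e' = e" using e u by (intro inj_onD[OF inj]) (auto simp: total_over_def)
   qed
  qed
  show "fibre_point B c u v \<in> total_over B {u} \<and> fibre_coord c (fibre_point B c u v) = v"
   unfolding fibre_point_def by (rule theI'[OF ex])
  show "fibre_point B c u (fibre_coord c e) = e" if "e \<in> total_over B {u}" for e
   unfolding fibre_point_def by (rule the1_equality[OF ex]) (use that in simp)
 qed
 have "chart_inv d (base_trans c d x) = u" using trans_facts(2)[OF c d xx(1)] by (simp add: u_def)
 then show "fibre_trans B d e (base_trans c d x) (fibre_trans B c d x v) = fibre_trans B c e x v"
  using fp(1)[OF c u(1), of v] fp(2)[OF d u(2)] by (simp add: fibre_trans_def u_def[symmetric])
 show "fibre_trans B c c x v = v"
  using fp(1)[OF c u(1), of v] by (simp add: fibre_trans_def u_def[symmetric])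
qed

lemma bundle_matrix_smooth:
 "c \<in> charts B ==> d \<in> charts B ==> base_smooth (overlap c d) (\<lambda>x. bundle_matrix B c d x $ \<beta> $ \<alpha>)"
 using oriented unfolding oriented_vector_bundle_def bundle_matrix_def by blast

lemma fibre_trans_linear: "c \<in> charts B ==> d \<in> charts B ==> x \<in> overlap c d ==> linear (fibre_trans B c d x)"
 using oriented unfolding oriented_vector_bundle_def by blast

lemma bundle_matrix_cocycle:
 assumes c: "c \<in> charts B" and d: "d \<in> charts B" and e: "e \<in> charts B" and x: "x \<in> triple c d e"
 shows "bundle_matrix B d e (base_trans c d x) ** bundle_matrix B c d x = bundle_matrix B c e x"
proof -
 have "linear (fibre_trans B d e (base_trans c d x))" "linear (fibre_trans B c d x)"
  using x triple_facts[OF c d e] by (auto intro!: fibre_trans_linear c d e)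
 then have "bundle_matrix B d e (base_trans c d x) ** bundle_matrix B c d x =
   matrix (fibre_trans B d e (base_trans c d x) \<circ> fibre_trans B c d x)"
  unfolding bundle_matrix_def by (simp add: matrix_compose)
 also have "fibre_trans B d e (base_trans c d x) \<circ> fibre_trans B c d x = fibre_trans B c e x"
  using fibre_trans_cocycle(1)[OF c d e x] by (simp add: fun_eq_iff)
 finally show ?thesis by (simp add: bundle_matrix_def)
qed

lemma bundle_matrix_self:
 assumes c: "c \<in> charts B" and x: "x \<in> base_image c"
 shows "bundle_matrix B c c x = mat 1"
proof -
 have "x \<in> triple c c c" using x by (simp add: triple_def overlap_self)
 then have "fibre_trans B c c x = id" using fibre_trans_cocycle(2)[OF c c c] by (simp add: fun_eq_iff)
 then show ?thesis by (simp add: bundle_matrix_def matrix_id_mat_1)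
qed

lemma codensity_matrix_eq:
 assumes c: "c \<in> charts B" and d: "d \<in> charts B" and x: "x \<in> overlap c d"
 shows "codensity_matrix B c d x = det (jacobian d c (base_trans c d x)) *\<^sub>R
   transpose (bundle_matrix B d c (base_trans c d x))"
proof -
 have 1: "bundle_matrix B d c (base_trans c d x) ** bundle_matrix B c d x = mat 1"
  using bundle_matrix_cocycle[OF c d c triple_self[OF x c]] bundle_matrix_self[OF c] x overlap_iff[OF c] by auto
 then have 2: "bundle_matrix B c d x ** bundle_matrix B d c (base_trans c d x) = mat 1"
  using matrix_left_right_inverse by blast
 have "matrix_inv (bundle_matrix B c d x) ** bundle_matrix B c d x = mat 1"
  unfolding matrix_inv_def using someI[of "\<lambda>X. bundle_matrix B c d x ** X = mat 1 \<and> X ** bundle_matrix B c d x = mat 1"] 1 2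
  by blast
 then have "matrix_inv (bundle_matrix B c d x) = bundle_matrix B d c (base_trans c d x)"
  using 2 by (metis matrix_mul_assoc matrix_mul_lid matrix_mul_rid)
 moreover have "1 / det (jacobian c d x) = det (jacobian d c (base_trans c d x))"
  using det_inverse[OF c d x] det_pos[OF c d x] by (simp add: field_simps)
 ultimately show ?thesis by (simp add: codensity_matrix_def)
qed

lemma codensity_matrix_smooth:
 assumes c: "c \<in> charts B" and d: "d \<in> charts B"
 shows "base_smooth (overlap c d) (\<lambda>x. codensity_matrix B c d x $ \<beta> $ \<alpha>)"
proof -
 have W: "open (overlap c d)" "open (overlap d c)" by (auto intro: open_overlap c d)
 have T: "base_trans c d ` overlap c d \<subseteq> overlap d c" using trans_facts(1)[OF c d] by blast
 have "base_smooth (overlap c d) (\<lambda>x. det (jacobian d c (base_trans c d x)) *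
   bundle_matrix B d c (base_trans c d x) $ \<alpha> $ \<beta>)"
 proof (rule base.smooth_mult[OF W(1)])
  show "base_smooth (overlap c d) (\<lambda>x. det (jacobian d c (base_trans c d x)))"
   using compose_trans(1)[OF c d W(1) order_refl W(2) T smooth_det[OF W(2) jacobian_smooth[OF d c]]] .
  show "base_smooth (overlap c d) (\<lambda>x. bundle_matrix B d c (base_trans c d x) $ \<alpha> $ \<beta>)"
   using compose_trans(1)[OF c d W(1) order_refl W(2) T bundle_matrix_smooth[OF d c]] .
 qed
 then show ?thesis
  by (rule base.smooth_along_cong[OF W(1)]) (simp add: codensity_matrix_eq[OF c d] transpose_def)
qed

lemma codensity_matrix_cocycle:
 assumes c: "c \<in> charts B" and d: "d \<in> charts B" and e: "e \<in> charts B" and x: "x \<in> triple c d e"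
 shows "codensity_matrix B d e (base_trans c d x) ** codensity_matrix B c d x = codensity_matrix B c e x"
proof -
 define y where "y = base_trans c e x"
 have xx: "x \<in> overlap c d" "x \<in> overlap c e" using x by (auto simp: triple_def)
 have Tx: "base_trans c d x \<in> overlap d e" using triple_facts(4)[OF c d e] x by blast
 have y: "base_trans d e (base_trans c d x) = y" using trans_facts(4)[OF c d xx(1)] by (simp add: y_def)
 have yt: "y \<in> triple e d c"
  using trans_facts(1)[OF d e Tx] trans_facts(1)[OF c e xx(2)] y by (auto simp: y_def triple_def)
 have yd: "base_trans e d y = base_trans c d x" using trans_facts(3)[OF d e Tx] y by simp
 have M: "bundle_matrix B d c (base_trans c d x) ** bundle_matrix B e d y = bundle_matrix B e c y"
  using bundle_matrix_cocycle[OF e d c yt] yd by simp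
 have J: "jacobian d c (base_trans c d x) ** jacobian e d y = jacobian e c y"
  using jacobian_cocycle[OF e d c yt] yd by simp
 show ?thesis
  unfolding codensity_matrix_eq[OF c d xx(1)] codensity_matrix_eq[OF d e Tx] codensity_matrix_eq[OF c e xx(2)]
   y y_def[symmetric] M[symmetric] J[symmetric]
  by (simp add: matrix_transpose_mul det_mul scalar_matrix_assoc matrix_scalar_ac mult.commute)
qed

end

context oriented_bundle
begin

lemma jacobian_cancel:
 assumes c: "c \<in> charts B" and d: "d \<in> charts B" and x: "x \<in> overlap c d"
  and eq: "\<And>i. (\<Sum>j\<in>UNIV. jacobian c d x $ j $ i * X j) = (\<Sum>j\<in>UNIV. jacobian c d x $ j $ i * Y j)"
 shows "X j = Y j"
proof -
 let ?J = "jacobian c d x" and ?K = "jacobian d c (base_trans c d x)"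
 have *: "(\<Sum>i\<in>UNIV. ?K $ i $ j * (\<Sum>k\<in>UNIV. ?J $ k $ i * Z k)) = Z j" for Z :: "'n => real"
 proof -
  have "(\<Sum>i\<in>UNIV. ?K $ i $ j * (\<Sum>k\<in>UNIV. ?J $ k $ i * Z k)) =
    (\<Sum>i\<in>UNIV. \<Sum>k\<in>UNIV. ?J $ k $ i * ?K $ i $ j * Z k)"
   unfolding sum_distrib_left by (intro sum.cong refl) (simp only: mult_ac)
  also have "\<dots> = (\<Sum>k\<in>UNIV. \<Sum>i\<in>UNIV. ?J $ k $ i * ?K $ i $ j * Z k)" by (rule sum.swap)
  also have "\<dots> = (\<Sum>k\<in>UNIV. (\<Sum>i\<in>UNIV. ?J $ k $ i * ?K $ i $ j) * Z k)"
   by (simp only: sum_distrib_right)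
  also have "\<dots> = Z j"
   unfolding jacobian_inverse_sum(1)[OF c d x]
   by (simp add: if_distrib[of "\<lambda>t. t * _"] sum.delta cong: if_cong)
  finally show ?thesis .
 qed
 show ?thesis using *[of X] *[of Y] eq by simp
qed

end

locale jet_cocycle = oriented_bundle B for B :: "('a, 'e, 'n::finite, 'm::finite) vector_bundle" +
 fixes G :: "('a, 'e, 'n, 'm) bundle_chart => ('a, 'e, 'n, 'm) bundle_chart => real^'n => real^'m^'m"
 assumes G_smooth: "\<lbrakk>c \<in> charts B; d \<in> charts B\<rbrakk> \<Longrightarrow> base_smooth (overlap c d) (\<lambda>x. G c d x $ \<beta> $ \<alpha>)"
  and G_cocycle: "\<lbrakk>c \<in> charts B; d \<in> charts B; e \<in> charts B; x \<in> triple c d e\<rbrakk> \<Longrightarrow>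
   G d e (base_trans c d x) ** G c d x = G c e x"
begin

abbreviation Pr where "Pr c d x b a \<equiv> prolong c d (G c d) x b a"

text \<open>The function differentiated in the definition of \<open>prolong\<close>, as a function of \<open>x\<close> and \<open>y\<close>.\<close>

definition HH :: "('a, 'e, 'n, 'm) bundle_chart => ('a, 'e, 'n, 'm) bundle_chart => 'm => ('n, 'm) jet_index
  => (real^'n) \<times> (real^'n) => real" where
 "HH c d \<beta> a p = G c d (base_trans d c (snd p)) $ \<beta> $ fst a *
   (\<Prod>i\<in>UNIV. (base_trans d c (snd p) $ i - fst p $ i) ^ snd a i / fact (snd a i))"

lemma prolong_HH: "Pr c d x b a = iter_mi (\<lambda>j. pder pair_shift (Inr j)) (snd b) (HH c d (fst b) a) (x, base_trans c d x)"
proof -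
 define u where "u = (\<lambda>y. let z = base_trans d c y in
     G c d z $ fst b $ fst a * (\<Prod>i\<in>UNIV. (z $ i - x $ i) ^ snd a i / fact (snd a i)))"
 have "\<forall>y. iter_mi bder (snd b) u y = iter_mi (\<lambda>j. pder pair_shift (Inr j)) (snd b) (HH c d (fst b) a) (x, y)"
 proof (rule iter_mi_rel[where R = "\<lambda>u v. \<forall>y. u y = v (x, y)"])
  show "\<forall>y. bder i u y = pder pair_shift (Inr i) v (x, y)" if "\<forall>y. u y = v (x, y)" for i u v
   using that by (simp add: pder_def pair_shift_def)
  show "\<forall>y. u y = HH c d (fst b) a (x, y)" by (simp add: u_def HH_def Let_def)
 qed
 then show ?thesis unfolding prolong_def u_def by blast
qed

lemma HH_smooth:
 assumes c: "c \<in> charts B" and d: "d \<in> charts B"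
 shows "smooth_along pair_shift (UNIV \<times> overlap d c) (HH c d \<beta> a)"
proof -
 have W: "open (overlap d c)" "open (overlap c d)" by (auto intro: open_overlap c d)
 have S: "open ((UNIV :: (real^'n) set) \<times> overlap d c)" by (intro open_Times W) simp
 have T: "base_trans d c ` overlap d c \<subseteq> overlap c d" using trans_facts(1)[OF d c] by blast
 have "base_smooth (overlap d c) (\<lambda>y. G c d (base_trans d c y) $ \<beta> $ fst a)"
  by (rule compose_trans(1)[OF d c W(1) order_refl W(2) T G_smooth[OF c d]])
 then have 1: "smooth_along pair_shift (UNIV \<times> overlap d c) (\<lambda>p. G c d (base_trans d c (snd p)) $ \<beta> $ fst a)"
  by (rule smooth_pair_snd[OF W(1)])
 have 2: "smooth_along pair_shift (UNIV \<times> overlap d c) (\<lambda>p. base_trans d c (snd p) $ i)" for i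
  by (rule smooth_pair_snd[OF W(1) trans_smooth[OF d c]])
 have 3: "smooth_along pair_shift (UNIV \<times> overlap d c) (\<lambda>p. fst p $ i)" for i
  using smooth_pair_coord[OF S, of "Inl i"] by (simp add: pair_coord_def[abs_def])
 have 4: "smooth_along pair_shift (UNIV \<times> overlap d c)
   (\<lambda>p. (1 / fact (snd a i)) * (base_trans d c (snd p) $ i - fst p $ i) ^ snd a i)" for i
  by (intro pair.smooth_cmult[OF S] pair.smooth_power[OF S] pair.smooth_diff[OF S] 2 3)
 show ?thesis unfolding HH_def[abs_def]
  by (intro pair.smooth_mult[OF S] pair.smooth_prod[OF S] 1) (use 4 in simp)
qed

text \<open>The parameter \<open>x\<close> enters through the monomial \<open>(z - x)\<^sup>\<sigma> / \<sigma>!\<close>, which differentiation lowers.\<close>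

lemma pder_HH:
 "pder pair_shift (Inl i) (HH c d \<beta> a) = (\<lambda>p. - (if snd a i > 0 then HH c d \<beta> (lower i a) p else 0))"
proof
 fix p :: "(real^'n) \<times> (real^'n)"
 define g where "g = G c d (base_trans d c (snd p)) $ \<beta> $ fst a"
 define w where "w k = base_trans d c (snd p) $ k - fst p $ k" for k
 define R where "R = (\<Prod>k\<in>UNIV - {i}. w k ^ snd a k / fact (snd a k))"
 let ?s = "snd a i"
 have sh: "HH c d \<beta> a (pair_shift (Inl i) t p) = g * ((w i - t) ^ ?s / fact ?s * R)" for t
 proof -
  have "HH c d \<beta> a (pair_shift (Inl i) t p) =
    g * (\<Prod>k\<in>UNIV. (w k - (if k = i then t else 0)) ^ snd a k / fact (snd a k))"
   by (simp add: HH_def pair_shift_def g_def w_def base.co_sh algebra_simps)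
  also have "(\<Prod>k\<in>UNIV. (w k - (if k = i then t else 0)) ^ snd a k / fact (snd a k)) =
    (w i - t) ^ ?s / fact ?s * R"
   unfolding R_def by (subst prod.remove[of UNIV i]) (auto intro!: prod.cong)
  finally show ?thesis .
 qed
 show "pder pair_shift (Inl i) (HH c d \<beta> a) p = - (if ?s > 0 then HH c d \<beta> (lower i a) p else 0)"
 proof (cases ?s)
  case 0
  show ?thesis by (rule pderI) (simp add: sh 0)
 next
  case (Suc s)
  have "HH c d \<beta> (lower i a) p = g * (\<Prod>k\<in>UNIV. w k ^ down i (snd a) k / fact (down i (snd a) k))"
   by (simp add: HH_def g_def w_def snd_lower)
  also have "(\<Prod>k\<in>UNIV. w k ^ down i (snd a) k / fact (down i (snd a) k)) = w i ^ s / fact s * R"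
   unfolding R_def by (subst prod.remove[of UNIV i]) (auto intro!: prod.cong simp: down_def Suc)
  finally have low: "HH c d \<beta> (lower i a) p = g * (w i ^ s / fact s * R)" .
  have "((\<lambda>t. w i - t) has_real_derivative -1) (at 0)" by (auto intro!: derivative_eq_intros)
  from DERIV_cmult[OF DERIV_cmult_right[OF DERIV_cdivide[OF DERIV_power_Suc[OF this, of s], of "fact ?s"], of R], of g]
  have "((\<lambda>t. g * ((w i - t) ^ ?s / fact ?s * R)) has_real_derivative
    g * ((1 + real s) * (-1 * (w i - 0) ^ s) / fact ?s * R)) (at 0)" unfolding Suc by (simp only: of_nat_Suc)
  moreover have "g * ((1 + real s) * (-1 * (w i - 0) ^ s) / fact ?s * R) = - (g * (w i ^ s / fact s * R))"
  proof -
   define K where "K = 1 + real s"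
   have "(fact ?s :: real) = K * fact s" by (simp add: Suc K_def)
   moreover have "K \<noteq> 0" unfolding K_def by linarith
   ultimately show ?thesis unfolding K_def[symmetric] by simp
  qed
  ultimately show ?thesis using Suc low by (intro pderI) (simp add: sh)
 qed
qed

lemma iter_minus_HH:
 assumes c: "c \<in> charts B" and d: "d \<in> charts B" and p: "p \<in> UNIV \<times> overlap d c"
 shows "iter_mi (\<lambda>j. pder pair_shift (Inr j)) \<sigma> (\<lambda>p. - HH c d \<beta> a p) p =
  - iter_mi (\<lambda>j. pder pair_shift (Inr j)) \<sigma> (HH c d \<beta> a) p"
proof -
 let ?S = "(UNIV :: (real^'n) set) \<times> overlap d c"
 have S: "open ?S" by (intro open_Times open_overlap c d) simp
 have "(\<forall>p\<in>?S. iter_mi (\<lambda>j. pder pair_shift (Inr j)) \<sigma> (\<lambda>p. - HH c d \<beta> a p) p =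
   - iter_mi (\<lambda>j. pder pair_shift (Inr j)) \<sigma> (HH c d \<beta> a) p) \<and>
   smooth_along pair_shift ?S (iter_mi (\<lambda>j. pder pair_shift (Inr j)) \<sigma> (HH c d \<beta> a))"
 proof (rule iter_mi_rel[where R = "\<lambda>u v. (\<forall>p\<in>?S. u p = - v p) \<and> smooth_along pair_shift ?S v"])
  fix i u v assume uv: "(\<forall>p\<in>?S. u p = - v p) \<and> smooth_along pair_shift ?S v"
  have "pder pair_shift (Inr i) u p = - pder pair_shift (Inr i) v p" if p: "p \<in> ?S" for p
  proof -
   have "pder pair_shift (Inr i) u p = pder pair_shift (Inr i) (\<lambda>p. - v p) p"
    by (rule pair.pder_cong[OF S p]) (use uv in blast)
   then show ?thesis using pair.pder_minus[OF conjunct2[OF uv] p] by simp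
  qed
  moreover have "smooth_along pair_shift ?S (pder pair_shift (Inr i) v)"
   by (rule smooth_along_pder[OF conjunct2[OF uv]])
  ultimately show "(\<forall>p\<in>?S. pder pair_shift (Inr i) u p = - pder pair_shift (Inr i) v p) \<and>
   smooth_along pair_shift ?S (pder pair_shift (Inr i) v)" by blast
 qed (use HH_smooth[OF c d] in auto)
 with p show ?thesis by blast
qed

lemma iter_0: "iter_mi (\<lambda>j. pder sh (\<kappa> j)) \<sigma> (\<lambda>p. 0) = (\<lambda>p. 0)"
 using iter_mi_closed[of "{\<lambda>p. 0}" "\<lambda>j. pder sh (\<kappa> j)" "\<lambda>p. 0" \<sigma>] by simp

text \<open>The chain rule along \<open>y = base_trans c d x\<close>: the derivative in \<open>y\<close> raises the row index of the
 matrix, the one in \<open>x\<close> lowers the column index.\<close>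

lemma prolong_smooth:
 assumes c: "c \<in> charts B" and d: "d \<in> charts B"
 shows "base_smooth (overlap c d) (\<lambda>x. Pr c d x b a)"
  and prolong_pder: "x \<in> overlap c d ==> bder i (\<lambda>x. Pr c d x b a) x =
   (\<Sum>j\<in>UNIV. jacobian c d x $ j $ i * Pr c d x (raise j b) a) -
   (if snd a i > 0 then Pr c d x b (lower i a) else 0)"
proof -
 let ?S = "(UNIV :: (real^'n) set) \<times> overlap d c"
 have W: "open (overlap c d)" by (intro open_overlap c d)
 have S: "open ?S" by (intro open_Times open_overlap c d) simp
 let ?it = "iter_mi (\<lambda>j. pder pair_shift (Inr j))"
 let ?\<phi> = "\<lambda>x. (x, base_trans c d x)"
 have \<phi>: "?\<phi> ` overlap c d \<subseteq> ?S" using trans_facts(1)[OF c d] by auto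
 note it = pair.iter_pder[OF S HH_smooth[OF c d], where \<kappa> = Inr]
 have co: "base_smooth (overlap c d) (\<lambda>x. pair_coord k (?\<phi> x))" for k
 proof (cases k)
  case (Inl i)
  then show ?thesis using smooth_base_coord[OF W, of i] by (simp add: pair_coord_def)
 next
  case (Inr i)
  then show ?thesis using trans_smooth[OF c d, of i] by (simp add: pair_coord_def)
 qed
 show "base_smooth (overlap c d) (\<lambda>x. Pr c d x b a)"
  unfolding prolong_HH
  by (rule pair.smooth_compose[OF base.commuting_flows_axioms W S \<phi> it(1) pair_depends_UNIV _ co])
    (auto intro!: continuous_intros trans_continuous c d)
 show "bder i (\<lambda>x. Pr c d x b a) x =
   (\<Sum>j\<in>UNIV. jacobian c d x $ j $ i * Pr c d x (raise j b) a) -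
   (if snd a i > 0 then Pr c d x b (lower i a) else 0)" if x: "x \<in> overlap c d"
 proof -
  have \<phi>x: "?\<phi> x \<in> ?S" using \<phi> x by blast
  have "bder i (\<lambda>x. Pr c d x b a) x = (\<Sum>k\<in>UNIV. bder i (\<lambda>x. pair_coord k (?\<phi> x)) x *
    pder pair_shift k (?it (snd b) (HH c d (fst b) a)) (?\<phi> x))"
   unfolding prolong_HH
   by (rule pair.chain_rule[OF base.commuting_flows_axioms W x S \<phi> it(1) pair_depends_UNIV _ co]) simp
  also have "\<dots> = (\<Sum>k\<in>UNIV. (if k = i then 1 else 0) * pder pair_shift (Inl k) (?it (snd b) (HH c d (fst b) a)) (?\<phi> x)) +
    (\<Sum>j\<in>UNIV. jacobian c d x $ j $ i * pder pair_shift (Inr j) (?it (snd b) (HH c d (fst b) a)) (?\<phi> x))"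
   unfolding UNIV_sum
   by (subst sum.union_disjoint) (auto simp: sum.reindex pair_coord_def pder_base_coord jacobian_entry)
  also have "(\<Sum>k\<in>UNIV. (if k = i then 1 else 0) * pder pair_shift (Inl k) (?it (snd b) (HH c d (fst b) a)) (?\<phi> x)) =
    pder pair_shift (Inl i) (?it (snd b) (HH c d (fst b) a)) (?\<phi> x)"
   by (simp add: if_distrib[of "\<lambda>t. t * _"] cong: if_cong)
  also have "\<dots> = ?it (snd b) (\<lambda>p. - (if snd a i > 0 then HH c d (fst b) (lower i a) p else 0)) (?\<phi> x)"
   using it(3)[OF \<phi>x, of "Inl i" "snd b"] pder_HH by simp
  also have "\<dots> = - (if snd a i > 0 then Pr c d x b (lower i a) else 0)"
  proof (cases "snd a i > 0")
   case True
   then show ?thesis using iter_minus_HH[OF c d \<phi>x] by (simp add: prolong_HH)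
  qed (simp add: iter_0)
  also have "(\<Sum>j\<in>UNIV. jacobian c d x $ j $ i * pder pair_shift (Inr j) (?it (snd b) (HH c d (fst b) a)) (?\<phi> x)) =
    (\<Sum>j\<in>UNIV. jacobian c d x $ j $ i * Pr c d x (raise j b) a)"
   using it(2)[OF \<phi>x] by (simp add: prolong_HH snd_raise)
  finally show ?thesis by simp
 qed
qed

lemma prolong_0:
 assumes c: "c \<in> charts B" and d: "d \<in> charts B" and x: "x \<in> overlap c d"
 shows "Pr c d x (\<beta>, \<lambda>_. 0) a = (if snd a = (\<lambda>_. 0) then G c d x $ \<beta> $ fst a else 0)"
proof -
 have "Pr c d x (\<beta>, \<lambda>_. 0) a = G c d x $ \<beta> $ fst a * (\<Prod>i\<in>UNIV. 0 ^ snd a i / fact (snd a i))"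
  using trans_facts(3)[OF c d x] by (simp add: prolong_HH HH_def)
 also have "(\<Prod>i\<in>UNIV. 0 ^ snd a i / fact (snd a i)) = (if snd a = (\<lambda>_. 0) then 1 else 0 :: real)"
 proof (cases "snd a = (\<lambda>_. 0)")
  case False
  then obtain i where "snd a i \<noteq> 0" by auto
  then have "(\<Prod>i\<in>UNIV. 0 ^ snd a i / fact (snd a i)) = (0::real)"
   by (intro prod_zero) auto
  with False show ?thesis by simp
 qed simp
 finally show ?thesis by simp
qed

lemma prolong_raise:
 assumes c: "c \<in> charts B" and d: "d \<in> charts B" and x: "x \<in> overlap c d"
 shows "(\<Sum>j\<in>UNIV. jacobian c d x $ j $ i * Pr c d x (raise j b) a) =
  bder i (\<lambda>x. Pr c d x b a) x + (if snd a i > 0 then Pr c d x b (lower i a) else 0)"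
 using prolong_pder[OF c d x] by simp

text \<open>The recursion of \<open>prolong_raise\<close> determines all entries from those with \<open>\<tau> = 0\<close>, as the Jacobian is invertible.\<close>

lemma prolong_order:
 assumes c: "c \<in> charts B" and d: "d \<in> charts B"
 shows "mi_size \<tau> < mi_size (snd a) ==> x \<in> overlap c d ==> Pr c d x (\<beta>, \<tau>) a = 0"
proof (induction \<tau> arbitrary: a x rule: multi_index_induct)
 case zero
 then have "snd a \<noteq> (\<lambda>_. 0)" by auto
 then show ?case using prolong_0[OF c d zero(2)] by simp
next
 case (up j \<tau>)
 have "Pr c d x (raise k (\<beta>, \<tau>)) a = (\<lambda>_. 0) k" for k
 proof (rule jacobian_cancel[OF c d up.prems(2)])
  fix i
  have "bder i (\<lambda>x. Pr c d x (\<beta>, \<tau>) a) x = bder i (\<lambda>x. 0) x"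
   by (rule base.pder_cong[OF open_overlap[OF c d] up.prems(2)]) (use up in auto)
  moreover have "Pr c d x (\<beta>, \<tau>) (lower i a) = 0" if "snd a i > 0"
   using up.prems that mi_size_down[of "snd a" i] by (intro up.IH) (auto simp: snd_lower)
  ultimately show "(\<Sum>k\<in>UNIV. jacobian c d x $ k $ i * Pr c d x (raise k (\<beta>, \<tau>)) a) =
    (\<Sum>k\<in>UNIV. jacobian c d x $ k $ i * (\<lambda>_. 0) k)"
   unfolding prolong_raise[OF c d up.prems(2)] by simp
 qed
 from this[of j] show ?case by (simp add: raise_up)
qed

lemma prolong_order':
 "\<lbrakk>c \<in> charts B; d \<in> charts B; x \<in> overlap c d; mi_size (snd b) < mi_size (snd a)\<rbrakk> \<Longrightarrow> Pr c d x b a = 0"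
 using prolong_order[of c d "snd b" a x "fst b"] by simp

text \<open>Both sides obey the recursion of \<open>prolong_raise\<close> in \<open>\<tau>\<close>, with the same initial values by the cocycle
 property of \<open>G\<close>, and the recursion determines them by \<open>jacobian_cancel\<close>.\<close>

lemma prolong_cocycle:
 assumes c: "c \<in> charts B" and d: "d \<in> charts B" and e: "e \<in> charts B"
 shows "mi_size \<tau> \<le> N ==> x \<in> triple c d e ==>
  Pr c e x (\<beta>, \<tau>) a = (\<Sum>m\<in>idx N. Pr d e (base_trans c d x) (\<beta>, \<tau>) m * Pr c d x m a)"
proof (induction \<tau> arbitrary: a x N rule: multi_index_induct)
 case zero
 note T = triple_facts[OF c d e]
 have x: "x \<in> overlap c d" "x \<in> overlap c e" "base_trans c d x \<in> overlap d e" using zero T by auto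
 have "(\<Sum>m\<in>idx N. Pr d e (base_trans c d x) (\<beta>, \<lambda>_. 0) m * Pr c d x m a) =
   (\<Sum>\<gamma>\<in>UNIV. \<Sum>\<sigma>\<in>mis N. if \<sigma> = (\<lambda>_ :: 'n. 0) then G d e (base_trans c d x) $ \<beta> $ \<gamma> * Pr c d x (\<gamma>, \<lambda>_. 0) a else 0)"
  unfolding sum_idx by (rule sum.cong[OF refl], rule sum.cong[OF refl]) (simp add: prolong_0[OF d e x(3)])
 also have "\<dots> = (\<Sum>\<gamma>\<in>UNIV. G d e (base_trans c d x) $ \<beta> $ \<gamma> * Pr c d x (\<gamma>, \<lambda>_. 0) a)"
 proof -
  have "(\<lambda>_ :: 'n. 0) \<in> mis N" by (simp add: mis_def)
  then show ?thesis by simp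
 qed
 also have "\<dots> = Pr c e x (\<beta>, \<lambda>_. 0) a"
  using G_cocycle[OF c d e zero(2)]
  by (simp add: prolong_0[OF c d x(1)] prolong_0[OF c e x(2)] matrix_matrix_mult_def vec_eq_iff)
 finally show ?case by simp
next
 case (up j \<tau>)
 note T = triple_facts[OF c d e]
 obtain M where N: "N = Suc M" using up.prems by (cases N) auto
 have \<tau>: "mi_size \<tau> \<le> M" using up.prems N by simp
 let ?y = "base_trans c d x"
 have x: "x \<in> overlap c d" "x \<in> overlap c e" "?y \<in> overlap d e" using up.prems T by auto
 let ?J = "jacobian c d x" and ?K = "jacobian d e ?y" and ?L = "jacobian c e x"
 define X where "X k = (\<Sum>m\<in>idx N. Pr d e ?y (raise k (\<beta>, \<tau>)) m * Pr c d x m a)" for k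
 have "Pr c e x (raise k (\<beta>, \<tau>)) a = X k" for k
 proof (rule jacobian_cancel[OF c e x(2)])
  fix i
  let ?P = "\<lambda>m. Pr d e ?y (\<beta>, \<tau>) m"
  have sm: "base_smooth (triple c d e) (\<lambda>x. Pr d e (base_trans c d x) (\<beta>, \<tau>) m)" for m
   by (rule compose_trans(1)[OF c d T(1,2) open_overlap[OF d e] T(4) prolong_smooth(1)[OF d e]])
  have sm': "base_smooth (triple c d e) (\<lambda>x. Pr c d x m a)" for m
   by (rule smooth_along_subset[OF prolong_smooth(1)[OF c d] T(2)])
  have "bder i (\<lambda>x. Pr c e x (\<beta>, \<tau>) a) x =
    bder i (\<lambda>x. \<Sum>m\<in>idx M. Pr d e (base_trans c d x) (\<beta>, \<tau>) m * Pr c d x m a) x"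
   by (rule base.pder_cong[OF T(1) up.prems(2)]) (rule up.IH[OF \<tau>])
  also have "\<dots> = (\<Sum>m\<in>idx M. (\<Sum>k\<in>UNIV. ?J $ k $ i * bder k (\<lambda>y. Pr d e y (\<beta>, \<tau>) m) ?y) * Pr c d x m a +
    ?P m * bder i (\<lambda>x. Pr c d x m a) x)"
   by (simp add: base.pder_sum[OF T(1) base.smooth_mult[OF T(1) sm sm'] up.prems(2)]
     base.pder_mult[OF sm sm' up.prems(2)]
     compose_trans(2)[OF c d T(1,2) open_overlap[OF d e] T(4) prolong_smooth(1)[OF d e] up.prems(2)])
  finally have 1: "bder i (\<lambda>x. Pr c e x (\<beta>, \<tau>) a) x + (if snd a i > 0 then Pr c e x (\<beta>, \<tau>) (lower i a) else 0) =
    (\<Sum>m\<in>idx M. (\<Sum>k\<in>UNIV. ?J $ k $ i * bder k (\<lambda>y. Pr d e y (\<beta>, \<tau>) m) ?y) * Pr c d x m a +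
    ?P m * (bder i (\<lambda>x. Pr c d x m a) x + (if snd a i > 0 then Pr c d x m (lower i a) else 0)))"
   using up.IH[OF \<tau> up.prems(2), of "lower i a"] by (simp add: distrib_left sum.distrib)
  have "(\<Sum>k\<in>UNIV. ?L $ k $ i * Pr c e x (raise k (\<beta>, \<tau>)) a) =
    (\<Sum>m\<in>idx M. (\<Sum>k\<in>UNIV. ?J $ k $ i * bder k (\<lambda>y. Pr d e y (\<beta>, \<tau>) m) ?y) * Pr c d x m a +
    ?P m * (\<Sum>k\<in>UNIV. ?J $ k $ i * Pr c d x (raise k m) a))"
   unfolding prolong_raise[OF c e x(2)] prolong_raise[OF c d x(1)] by (rule 1)
  also have "\<dots> = (\<Sum>k\<in>UNIV. ?J $ k $ i * ((\<Sum>m\<in>idx M. bder k (\<lambda>y. Pr d e y (\<beta>, \<tau>) m) ?y * Pr c d x m a) +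
    (\<Sum>m\<in>idx M. ?P m * Pr c d x (raise k m) a)))"
   by (simp add: sum.distrib sum_distrib_left sum_distrib_right distrib_left mult_ac sum.swap[of _ "idx M"])
  also have "\<dots> = (\<Sum>k\<in>UNIV. ?J $ k $ i * (\<Sum>m\<in>idx N. (\<Sum>l\<in>UNIV. ?K $ l $ k * Pr d e ?y (raise l (\<beta>, \<tau>)) m) * Pr c d x m a))"
  proof (rule sum.cong[OF refl])
   fix k :: 'n
   have "(\<Sum>m\<in>idx M. bder k (\<lambda>y. Pr d e y (\<beta>, \<tau>) m) ?y * Pr c d x m a) =
     (\<Sum>m\<in>idx N. bder k (\<lambda>y. Pr d e y (\<beta>, \<tau>) m) ?y * Pr c d x m a)"
   proof (rule sum.mono_neutral_left[OF finite_idx idx_mono])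
    show "\<forall>m\<in>idx N - idx M. bder k (\<lambda>y. Pr d e y (\<beta>, \<tau>) m) ?y * Pr c d x m a = 0"
    proof
     fix m :: "('n, 'm) jet_index" assume "m \<in> idx N - idx M"
     then have "bder k (\<lambda>y. Pr d e y (\<beta>, \<tau>) m) ?y = bder k (\<lambda>y. 0) ?y"
      using \<tau> by (intro base.pder_cong[OF open_overlap[OF d e] x(3)] prolong_order'[OF d e]) (auto simp: idx_def)
     then show "bder k (\<lambda>y. Pr d e y (\<beta>, \<tau>) m) ?y * Pr c d x m a = 0" by simp
    qed
   qed (simp add: N)
   moreover have "(\<Sum>m\<in>idx M. ?P m * Pr c d x (raise k m) a) =
     (\<Sum>m\<in>idx N. (if snd m k > 0 then ?P (lower k m) else 0) * Pr c d x m a)"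
    unfolding N sum_shift_idx[where F = "\<lambda>m' m. ?P m' * Pr c d x m a", symmetric]
    by (rule sum.cong) auto
   ultimately show "?J $ k $ i * ((\<Sum>m\<in>idx M. bder k (\<lambda>y. Pr d e y (\<beta>, \<tau>) m) ?y * Pr c d x m a) +
     (\<Sum>m\<in>idx M. ?P m * Pr c d x (raise k m) a)) =
     ?J $ k $ i * (\<Sum>m\<in>idx N. (\<Sum>l\<in>UNIV. ?K $ l $ k * Pr d e ?y (raise l (\<beta>, \<tau>)) m) * Pr c d x m a)"
    unfolding prolong_raise[OF d e x(3)] by (simp add: sum.distrib distrib_right)
  qed
  also have "\<dots> = (\<Sum>l\<in>UNIV. (\<Sum>k\<in>UNIV. ?K $ l $ k * ?J $ k $ i) * X l)"
  proof -
   have "(\<Sum>m\<in>idx N. (\<Sum>l\<in>UNIV. ?K $ l $ k * Pr d e ?y (raise l (\<beta>, \<tau>)) m) * Pr c d x m a) = (\<Sum>l\<in>UNIV. ?K $ l $ k * X l)" for k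
    unfolding X_def sum_distrib_left sum_distrib_right by (subst sum.swap) (simp add: mult.assoc)
   then show ?thesis
    by (simp add: sum_distrib_left sum_distrib_right mult_ac) (rule sum.swap)
  qed
  also have "\<dots> = (\<Sum>l\<in>UNIV. ?L $ l $ i * X l)"
   using jacobian_cocycle[OF c d e up.prems(2)] by (simp add: matrix_matrix_mult_def vec_eq_iff)
  finally show "(\<Sum>k\<in>UNIV. ?L $ k $ i * Pr c e x (raise k (\<beta>, \<tau>)) a) = (\<Sum>l\<in>UNIV. ?L $ l $ i * X l)" .
 qed
 from this[of j] show ?case by (simp add: X_def raise_up)
qed

end

sublocale oriented_bundle \<subseteq> q: jet_cocycle B "bundle_matrix B"
 by unfold_locales (auto intro: bundle_matrix_smooth bundle_matrix_cocycle)

sublocale oriented_bundle \<subseteq> b: jet_cocycle B "codensity_matrix B"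
 by unfold_locales (auto intro: codensity_matrix_smooth codensity_matrix_cocycle)

section \<open>Linear substitutions in odd polynomials\<close>

text \<open>The linear substitution by recursion on the list of new variables. On polynomials of bounded
 order it agrees with \<open>odd_subst\<close>, and it is better suited to induction.\<close>

primrec sub :: "nat => (('n::finite, 'm::finite) jet_index => ('n, 'm) jet_index => real) => ('n, 'm) jet_index list
  => ('n, 'm) jet_index odd_poly => real" where
 "sub N T [] w = w []"
| "sub N T (c # l) w = (\<Sum>b\<in>idx N. T b c * sub N T l (lder b w))"

lemma odd_subst_sub:
 fixes w :: "('n::finite, 'm::finite) jet_index odd_poly"
 assumes "oreg N w"
 shows "odd_subst T w l = sub N T l w"
proof -
 let ?L = "\<lambda>n. {l' :: ('n, 'm) jet_index list. set l' \<subseteq> idx N \<and> length l' = n}"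
 have "odd_subst T w l = (\<Sum>l'\<in>?L (length l). if length l' = length l then w l' * (\<Prod>k<length l. T (l' ! k) (l ! k)) else 0)"
  unfolding odd_subst_def
 proof (rule Sum_any.expand_superset)
  show "finite (?L (length l))" by (intro finite_lists_length_eq finite_idx)
  show "{l'. (if length l' = length l then w l' * (\<Prod>k<length l. T (l' ! k) (l ! k)) else 0) \<noteq> 0} \<subseteq> ?L (length l)"
   using assms unfolding oreg_def idx_def by (auto simp: not_le split: if_splits) force
 qed
 also have "\<dots> = (\<Sum>l'\<in>?L (length l). w l' * (\<Prod>k<length l. T (l' ! k) (l ! k)))"
  by (rule sum.cong) auto
 also have "\<dots> = sub N T l w"
  using assms
 proof (induction l arbitrary: w)
  case Nil
  have "?L 0 = {[]}" by auto
  then show ?case by simp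
 next
  case (Cons c l)
  have L: "?L (Suc (length l)) = (\<lambda>(xs, n). n # xs) ` (?L (length l) \<times> idx N)"
   by (rule lists_length_Suc_eq)
  have inj: "inj_on (\<lambda>(xs, n). n # xs) (?L (length l) \<times> idx N)" by (auto simp: inj_on_def)
  have "(\<Sum>l'\<in>?L (length (c # l)). w l' * (\<Prod>k<length (c # l). T (l' ! k) ((c # l) ! k))) =
    (\<Sum>(l', b)\<in>?L (length l) \<times> idx N. T b c * (lder b w l' * (\<Prod>k<length l. T (l' ! k) (l ! k))))"
   unfolding list.size(4) add_Suc_right add_0_right L sum.reindex[OF inj]
   by (rule sum.cong) (auto simp: lder_def prod.lessThan_Suc_shift mult_ac simp del: prod.lessThan_Suc)
  also have "\<dots> = (\<Sum>b\<in>idx N. T b c * (\<Sum>l'\<in>?L (length l). lder b w l' * (\<Prod>k<length l. T (l' ! k) (l ! k))))"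
   by (subst sum.cartesian_product[symmetric], subst sum.swap) (simp add: sum_distrib_left)
  also have "\<dots> = sub N T (c # l) w" using Cons.IH[OF oreg_lder[OF Cons.prems]] by simp
  finally show ?case .
 qed
 finally show ?thesis .
qed

lemma sub_add: "sub N T l (v + w) = sub N T l v + sub N T l w"
 by (induction l arbitrary: v w) (simp_all add: distrib_left sum.distrib)

lemma sub_scale: "sub N T l (\<lambda>l. k * w l) = k * sub N T l w"
 by (induction l arbitrary: w) (simp_all add: sum_distrib_left mult_ac)

lemma sub_0 [simp]: "sub N T l 0 = 0" using sub_add[of N T l 0 0] by simp

lemma sub_minus: "sub N T l (- w) = - sub N T l w"
 using sub_scale[of N T l "-1" w] by (simp add: fun_Compl_def)

lemma sub_sum: "sub N T l (\<Sum>k\<in>K. f k) = (\<Sum>k\<in>K. sub N T l (f k))"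
 by (induction K rule: infinite_finite_induct)
   (simp_all only: simp_thms sum.infinite sum.empty sum.insert sub_add sub_0)

lemma sub_parity: "sub N T l (parity w) = (-1) ^ length l * sub N T l w"
proof (induction l arbitrary: w)
 case Nil
 show ?case by (simp add: parity_def)
next
 case (Cons c l)
 then show ?case by (simp add: lder_parity sub_minus sum_negf sum_distrib_left mult_ac)
qed

lemma lder_sub: "lder c (\<lambda>l. sub N T l w) = (\<Sum>b\<in>idx N. (\<lambda>l. T b c * sub N T l (lder b w)))"
 by (simp add: lder_def fun_eq_iff sum_apply)

lemma odd_mult_sum_left: "odd_mult (\<Sum>k\<in>K. f k) w l = (\<Sum>k\<in>K. odd_mult (f k) w l)"
 by (induction K rule: infinite_finite_induct)
   (simp_all only: simp_thms sum.infinite sum.empty sum.insert odd_mult_add_left odd_mult_0_left)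

lemma odd_mult_sum_right: "odd_mult w (\<Sum>k\<in>K. f k) l = (\<Sum>k\<in>K. odd_mult w (f k) l)"
 by (induction K rule: infinite_finite_induct)
   (simp_all only: simp_thms sum.infinite sum.empty sum.insert odd_mult_add_right odd_mult_0_right)

lemma sub_odd_mult: "sub N T l (odd_mult v w) = odd_mult (\<lambda>l. sub N T l v) (\<lambda>l. sub N T l w) l"
proof (induction l arbitrary: v w)
 case (Cons c l)
 have "parity (\<lambda>l. sub N T l v) = (\<lambda>l. sub N T l (parity v))"
  by (simp add: fun_eq_iff sub_parity parity_def[of "\<lambda>l. sub N T l v"])
 then show ?case
  by (simp add: odd_mult_Cons lder_sub odd_mult_sum_left odd_mult_sum_right odd_mult_scale_left
    odd_mult_scale_right lder_odd_mult sub_add Cons distrib_left sum.distrib del: odd_mult.simps(2))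
qed simp

lemma alternating_sub:
 assumes "alternating w"
 shows "alternating (\<lambda>l. sub N T l w)"
 unfolding alternating_def
proof (intro allI)
 fix u a b l
 show "sub N T (u @ a # b # l) w = - sub N T (u @ b # a # l) w"
  using assms
 proof (induction u arbitrary: w)
  case Nil
  have "(\<Sum>x\<in>idx N. \<Sum>y\<in>idx N. T x a * (T y b * sub N T l (lder y (lder x w)))) =
    (\<Sum>x\<in>idx N. \<Sum>y\<in>idx N. - (T y b * (T x a * sub N T l (lder x (lder y w)))))"
  proof (rule sum.cong[OF refl], rule sum.cong[OF refl])
   fix x y
   show "T x a * (T y b * sub N T l (lder y (lder x w))) = - (T y b * (T x a * sub N T l (lder x (lder y w))))"
    unfolding alternating_lder_lder[OF Nil, of y x] sub_minus by simp
  qed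
  also have "\<dots> = - (\<Sum>y\<in>idx N. \<Sum>x\<in>idx N. T y b * (T x a * sub N T l (lder x (lder y w))))"
   unfolding sum_negf by (subst sum.swap) (rule refl)
  finally show ?case by (simp add: sum_distrib_left)
 next
  case (Cons c u)
  have "sub N T (u @ a # b # l) (lder x w) = - sub N T (u @ b # a # l) (lder x w)" for x
   by (rule Cons.IH[OF alternating_lder[OF Cons.prems]])
  then have "(\<Sum>x\<in>idx N. T x c * sub N T (u @ a # b # l) (lder x w)) =
    (\<Sum>x\<in>idx N. - (T x c * sub N T (u @ b # a # l) (lder x w)))"
   by (intro sum.cong refl) simp
  then show ?case by (simp add: sum_negf)
 qed
qed

lemma sub_order:
 assumes T: "\<And>b c. b \<in> idx N ==> N < mi_size (snd c) ==> T b c = 0"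
 shows "\<exists>c\<in>set l. N < mi_size (snd c) ==> sub N T l w = 0"
proof (induction l arbitrary: w)
 case (Cons c l)
 show ?case
 proof (cases "N < mi_size (snd c)")
  case True
  then show ?thesis using T by simp
 next
  case False
  then have "sub N T l v = 0" for v using Cons by auto
  then show ?thesis by simp
 qed
qed simp

lemma oreg_sub:
 assumes "oreg N w" "\<And>b c. b \<in> idx N ==> N < mi_size (snd c) ==> T b c = 0"
 shows "oreg N (\<lambda>l. sub N T l w)"
 using assms alternating_sub sub_order unfolding oreg_def by blast

lemma sub_sub:
 assumes R: "\<And>b c. b \<in> idx N ==> R b c = (\<Sum>m\<in>idx N. S b m * T m c)"
 shows "sub N T l (\<lambda>l. sub N S l w) = sub N R l w"
proof (induction l arbitrary: w)
 case (Cons c l)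
 have "sub N T (c # l) (\<lambda>l. sub N S l w) = (\<Sum>m\<in>idx N. \<Sum>b\<in>idx N. T m c * (S b m * sub N R l (lder b w)))"
  by (simp add: lder_sub sub_sum sub_scale Cons sum_distrib_left)
 also have "\<dots> = (\<Sum>b\<in>idx N. R b c * sub N R l (lder b w))"
  by (subst sum.swap, rule sum.cong[OF refl], simp add: R sum_distrib_left mult_ac)
 finally show ?case by simp
qed simp

lemma odd_mult_const_right: "(\<And>l. l \<noteq> [] ==> v l = 0) ==> odd_mult w v l = w l * v []"
proof (induction l arbitrary: v w)
 case (Cons a l)
 have 1: "lder a v = 0" using Cons.prems by (auto simp: lder_def fun_eq_iff)
 show ?case unfolding odd_mult_Cons 1 using Cons.IH[of v "lder a w", OF Cons.prems]
  by (simp add: lder_def)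
qed simp

section \<open>The Piola identity\<close>

lemma DERIV_prod_sum:
 fixes f :: "'i => real => real"
 assumes "finite K" "\<And>k. k \<in> K ==> (f k has_real_derivative f' k) (at x)"
 shows "((\<lambda>t. \<Prod>k\<in>K. f k t) has_real_derivative (\<Sum>k\<in>K. f' k * (\<Prod>j\<in>K - {k}. f j x))) (at x)"
 using assms
proof (induction K rule: finite_induct)
 case (insert a K)
 have "((\<lambda>t. f a t * (\<Prod>k\<in>K. f k t)) has_real_derivative
   f' a * (\<Prod>k\<in>K. f k x) + (\<Sum>k\<in>K. f' k * (\<Prod>j\<in>K - {k}. f j x)) * f a x) (at x)"
  by (rule DERIV_mult) (use insert in auto)
 moreover have "(\<Sum>k\<in>K. f' k * (\<Prod>j\<in>K - {k}. f j x)) * f a x = (\<Sum>k\<in>K. f' k * (\<Prod>j\<in>insert a K - {k}. f j x))"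
  unfolding sum_distrib_right
 proof (rule sum.cong[OF refl])
  fix k assume k: "k \<in> K"
  then have "insert a K - {k} = insert a (K - {k})" using insert by auto
  then show "f' k * (\<Prod>j\<in>K - {k}. f j x) * f a x = f' k * (\<Prod>j\<in>insert a K - {k}. f j x)"
   using insert k by simp
 qed
 ultimately show ?case using insert by simp
qed simp

lemma DERIV_det:
 fixes A :: "real => real^'n::finite^'n" and A' K :: "real^'n^'n"
 assumes A: "\<And>i j. ((\<lambda>t. A t $ i $ j) has_real_derivative A' $ i $ j) (at x)"
  and K: "K ** A x = mat 1"
 shows "((\<lambda>t. det (A t)) has_real_derivative (det (A x) * (\<Sum>r\<in>UNIV. \<Sum>k\<in>UNIV. A' $ r $ k * K $ k $ r))) (at x)"
proof -
 have "((\<lambda>t. det (A t)) has_real_derivative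
   (\<Sum>p\<in>{p. p permutes UNIV}. of_int (sign p) * (\<Sum>r\<in>UNIV. A' $ r $ p r * (\<Prod>i\<in>UNIV - {r}. A x $ i $ p i)))) (at x)"
  unfolding det_def by (intro DERIV_sum DERIV_cmult DERIV_prod_sum A) simp
 moreover have "(\<Sum>p\<in>{p. p permutes UNIV}. of_int (sign p) * (\<Sum>r\<in>UNIV. A' $ r $ p r * (\<Prod>i\<in>UNIV - {r}. A x $ i $ p i))) =
   (\<Sum>r\<in>UNIV. det (\<chi> i. if i = r then row r A' else row i (A x)))"
 proof -
  have "(\<Prod>i\<in>UNIV. (\<chi> i. if i = r then row r A' else row i (A x)) $ i $ p i) =
    A' $ r $ p r * (\<Prod>i\<in>UNIV - {r}. A x $ i $ p i)" for r p
   by (subst prod.remove[of UNIV r]) (auto simp: row_def intro!: prod.cong)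
  then show ?thesis unfolding det_def
   by (simp only: sum_distrib_left) (rule sum.swap)
 qed
 moreover have "det (\<chi> i. if i = r then row r A' else row i (A x)) = (\<Sum>k\<in>UNIV. A' $ r $ k * K $ k $ r) * det (A x)" for r
 proof -
  define v where "v = (\<chi> j. \<Sum>k\<in>UNIV. A' $ r $ k * K $ k $ j)"
  have rv: "row r A' = (\<Sum>j\<in>UNIV. v $ j *s row j (A x))"
  proof -
   have "(\<Sum>j\<in>UNIV. v $ j * A x $ j $ l) = A' $ r $ l" for l
   proof -
    have "(\<Sum>j\<in>UNIV. v $ j * A x $ j $ l) = (\<Sum>k\<in>UNIV. A' $ r $ k * (\<Sum>j\<in>UNIV. K $ k $ j * A x $ j $ l))"
     unfolding v_def by (simp add: sum_distrib_left sum_distrib_right mult.assoc) (rule sum.swap)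
    also have "\<dots> = (\<Sum>k\<in>UNIV. A' $ r $ k * (mat 1 :: real^'n^'n) $ k $ l)"
     unfolding K[symmetric] by (simp add: matrix_matrix_mult_def)
    also have "\<dots> = A' $ r $ l" by (simp add: mat_def if_distrib[of "\<lambda>t. _ * t"] cong: if_cong)
    finally show ?thesis .
   qed
   then show ?thesis by (simp add: vec_eq_iff row_def sum_component)
  qed
  show ?thesis unfolding rv cramer_lemma_transpose by (simp add: v_def)
 qed
 ultimately show ?thesis by (simp add: sum_distrib_left mult.commute)
qed

context oriented_bundle
begin

definition jac_inv :: "('a, 'e, 'n, 'm) bundle_chart => ('a, 'e, 'n, 'm) bundle_chart => real^'n => real^'n^'n" where
 "jac_inv c d x = jacobian d c (base_trans c d x)"

lemma trans_image: "c \<in> charts B ==> d \<in> charts B ==> base_trans c d ` overlap c d \<subseteq> overlap d c"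
 using trans_facts(1) by blast

lemma jac_inv_smooth:
 "c \<in> charts B ==> d \<in> charts B ==> base_smooth (overlap c d) (\<lambda>x. jac_inv c d x $ i $ j)"
 unfolding jac_inv_def
 using compose_trans(1)[OF _ _ open_overlap order_refl open_overlap trans_image jacobian_smooth] by blast

text \<open>Jacobi's formula for the derivative of a determinant, the derivative of the inverse matrix, and
 the symmetry of the second derivatives of the change of coordinates.\<close>

lemma piola:
 assumes c: "c \<in> charts B" and d: "d \<in> charts B" and x: "x \<in> overlap c d"
 shows "(\<Sum>i\<in>UNIV. bder i (\<lambda>x. jac_inv c d x $ i $ j * det (jacobian c d x)) x) = 0"
proof -
 let ?W = "overlap c d" and ?J = "jacobian c d" and ?K = "jac_inv c d"
 have W: "open ?W" by (rule open_overlap[OF c d])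
 define H where "H l k i = bder i (\<lambda>x. ?J x $ l $ k) x" for l k i
 have Hsym: "H l k i = H l i k" for l k i
  unfolding H_def jacobian_entry by (rule base.pder_commute[OF W trans_smooth[OF c d] x])
 have KJ: "(\<Sum>l\<in>UNIV. ?K y $ i $ l * ?J y $ l $ k) = (if i = k then 1 else 0)" if "y \<in> ?W" for y i k
  unfolding jac_inv_def by (rule jacobian_inverse_sum(2)[OF c d that])
 have JK: "(\<Sum>k\<in>UNIV. ?J x $ l $ k * ?K x $ k $ j) = (if l = j then 1 else 0)" for l j
  unfolding jac_inv_def by (rule jacobian_inverse_sum(1)[OF c d x])
 have dK: "bder m (\<lambda>x. ?K x $ i $ j) x = - (\<Sum>k\<in>UNIV. \<Sum>l\<in>UNIV. ?K x $ i $ l * H l k m * ?K x $ k $ j)" for m i j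
 proof -
  have "(\<Sum>l\<in>UNIV. bder m (\<lambda>x. ?K x $ i $ l) x * ?J x $ l $ k) = - (\<Sum>l\<in>UNIV. ?K x $ i $ l * H l k m)" for k
  proof -
   have "bder m (\<lambda>x. \<Sum>l\<in>UNIV. ?K x $ i $ l * ?J x $ l $ k) x = bder m (\<lambda>x. if i = k then 1 else 0) x"
    by (rule base.pder_cong[OF W x]) (rule KJ)
   moreover have "bder m (\<lambda>x. \<Sum>l\<in>UNIV. ?K x $ i $ l * ?J x $ l $ k) x =
     (\<Sum>l\<in>UNIV. bder m (\<lambda>x. ?K x $ i $ l) x * ?J x $ l $ k + ?K x $ i $ l * H l k m)"
    by (simp add: base.pder_sum[OF W base.smooth_mult[OF W jac_inv_smooth[OF c d] jacobian_smooth[OF c d]] x]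
      base.pder_mult[OF jac_inv_smooth[OF c d] jacobian_smooth[OF c d] x] H_def)
   ultimately show ?thesis by (simp add: sum.distrib eq_neg_iff_add_eq_0)
  qed
  then have "(\<Sum>k\<in>UNIV. (\<Sum>l\<in>UNIV. bder m (\<lambda>x. ?K x $ i $ l) x * ?J x $ l $ k) * ?K x $ k $ j) =
    - (\<Sum>k\<in>UNIV. \<Sum>l\<in>UNIV. ?K x $ i $ l * H l k m * ?K x $ k $ j)"
   by (simp add: sum_distrib_right sum_negf)
  moreover have "(\<Sum>k\<in>UNIV. (\<Sum>l\<in>UNIV. bder m (\<lambda>x. ?K x $ i $ l) x * ?J x $ l $ k) * ?K x $ k $ j) =
    (\<Sum>l\<in>UNIV. bder m (\<lambda>x. ?K x $ i $ l) x * (\<Sum>k\<in>UNIV. ?J x $ l $ k * ?K x $ k $ j))"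
   unfolding sum_distrib_left sum_distrib_right mult.assoc by (rule sum.swap)
  moreover have "\<dots> = bder m (\<lambda>x. ?K x $ i $ j) x"
   by (simp add: JK if_distrib[of "\<lambda>t. _ * t"] cong: if_cong)
  ultimately show ?thesis by simp
 qed
 have sdet: "base_smooth ?W (\<lambda>x. det (?J x))" by (rule smooth_det[OF W jacobian_smooth[OF c d]])
 have ddet: "bder i (\<lambda>x. det (?J x)) x = det (?J x) * (\<Sum>l\<in>UNIV. \<Sum>k\<in>UNIV. H l k i * ?K x $ k $ l)" for i
 proof (rule pderI)
  have "((\<lambda>t. det (?J (base_shift i t x))) has_real_derivative
    det (?J (base_shift i 0 x)) * (\<Sum>r\<in>UNIV. \<Sum>k\<in>UNIV. (\<chi> l k. H l k i) $ r $ k * ?K x $ k $ r)) (at 0)"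
  proof (rule DERIV_det)
   show "((\<lambda>t. ?J (base_shift i t x) $ l $ k) has_real_derivative (\<chi> l k. H l k i) $ l $ k) (at 0)" for l k
    using base.smooth_DERIV[OF jacobian_smooth[OF c d] x] by (simp add: H_def)
   show "?K x ** ?J (base_shift i 0 x) = mat 1"
    unfolding jac_inv_def base.sh_0 by (rule jacobian_inverse(1)[OF c d x])
  qed
  then show "((\<lambda>t. det (?J (base_shift i t x))) has_real_derivative
    det (?J x) * (\<Sum>l\<in>UNIV. \<Sum>k\<in>UNIV. H l k i * ?K x $ k $ l)) (at 0)" by simp
 qed
 have "(\<Sum>i\<in>UNIV. bder i (\<lambda>x. ?K x $ i $ j * det (?J x)) x) =
   (\<Sum>i\<in>UNIV. bder i (\<lambda>x. ?K x $ i $ j) x * det (?J x) + ?K x $ i $ j * bder i (\<lambda>x. det (?J x)) x)"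
  by (simp add: base.pder_mult[OF jac_inv_smooth[OF c d] sdet x])
 also have "\<dots> = det (?J x) * ((\<Sum>i\<in>UNIV. \<Sum>l\<in>UNIV. \<Sum>k\<in>UNIV. ?K x $ i $ j * H l k i * ?K x $ k $ l) -
   (\<Sum>i\<in>UNIV. \<Sum>k\<in>UNIV. \<Sum>l\<in>UNIV. ?K x $ i $ l * H l k i * ?K x $ k $ j))"
  unfolding dK ddet by (simp add: sum.distrib sum_distrib_left sum_negf sum_subtractf algebra_simps)
 also have "(\<Sum>i\<in>UNIV. \<Sum>l\<in>UNIV. \<Sum>k\<in>UNIV. ?K x $ i $ j * H l k i * ?K x $ k $ l) =
   (\<Sum>i\<in>UNIV. \<Sum>k\<in>UNIV. \<Sum>l\<in>UNIV. ?K x $ k $ l * H l i k * ?K x $ i $ j)"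
 proof (rule sum.cong[OF refl])
  fix i :: 'n
  have "(\<Sum>l\<in>UNIV. \<Sum>k\<in>UNIV. ?K x $ i $ j * H l k i * ?K x $ k $ l) =
    (\<Sum>k\<in>UNIV. \<Sum>l\<in>UNIV. ?K x $ i $ j * H l k i * ?K x $ k $ l)" by (rule sum.swap)
  also have "\<dots> = (\<Sum>k\<in>UNIV. \<Sum>l\<in>UNIV. ?K x $ k $ l * H l i k * ?K x $ i $ j)"
  proof (rule sum.cong[OF refl], rule sum.cong[OF refl])
   fix k l :: 'n
   show "?K x $ i $ j * H l k i * ?K x $ k $ l = ?K x $ k $ l * H l i k * ?K x $ i $ j"
    unfolding Hsym[of l k i] by (simp only: mult_ac)
  qed
  finally show "(\<Sum>l\<in>UNIV. \<Sum>k\<in>UNIV. ?K x $ i $ j * H l k i * ?K x $ k $ l) =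
    (\<Sum>k\<in>UNIV. \<Sum>l\<in>UNIV. ?K x $ k $ l * H l i k * ?K x $ i $ j)" .
 qed
 also have "\<dots> = (\<Sum>k\<in>UNIV. \<Sum>i\<in>UNIV. \<Sum>l\<in>UNIV. ?K x $ k $ l * H l i k * ?K x $ i $ j)"
  by (rule sum.swap)
 finally show ?thesis by simp
qed

end

section \<open>Densities under coordinate changes\<close>

lemma sum_jc: "(\<Sum>k\<in>jc N. F k) = (\<Sum>j\<in>UNIV. F (Inl j)) + (\<Sum>b\<in>idx N. F (Inr b))"
 unfolding jc_def by (subst sum.union_disjoint) (auto simp: sum.reindex)

lemma base_fun_cong: "(\<And>x. x \<in> U ==> u x = v x) ==> base_fun U u = base_fun U v"
 by (auto simp: base_fun_def fun_eq_iff)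

lemma dmul_base_fun_right: "dmul f (base_fun U u) p l = (if fst p \<in> U then f p l * u (fst p) else 0)"
 unfolding dmul_def by (subst odd_mult_const_right) (auto simp: base_fun_def)

lemma dmul_base_base: "dmul (base_fun U u) (dmul (base_fun U v) f) = dmul (base_fun U (\<lambda>x. u x * v x)) f"
 by (auto simp: fun_eq_iff dmul_base_fun)

lemma dmul_base_commute: "dmul f (dmul (base_fun U u) g) = dmul (base_fun U u) (dmul f g)"
proof (intro ext)
 fix p l
 have "dmul f (dmul (base_fun U u) g) p l = dmul (dmul f (base_fun U u)) g p l"
  by (simp add: dmul_def odd_mult_assoc)
 also have "dmul f (base_fun U u) = dmul (base_fun U u) f"
  by (simp add: fun_eq_iff dmul_base_fun dmul_base_fun_right)
 finally show "dmul f (dmul (base_fun U u) g) p l = dmul (base_fun U u) (dmul f g) p l"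
  by (simp add: dmul_def odd_mult_assoc)
qed

lemma dmul_base_assoc: "dmul (dmul (base_fun U u) f) g = dmul (base_fun U u) (dmul f g)"
 by (simp add: dmul_def fun_eq_iff odd_mult_assoc)

context oriented_bundle
begin

text \<open>The even variables (\<open>k = False\<close>) and the odd ones (\<open>k = True\<close>) transform by the same rule, with the cocycles of
 \<open>E\<close> and of \<open>E\<^sup>* \<otimes> \<Lambda>\<^sup>n\<close>; treating them uniformly halves the computations.\<close>

definition fibre_matrix :: "bool => ('a, 'e, 'n, 'm) bundle_chart => ('a, 'e, 'n, 'm) bundle_chart => real^'n => real^'m^'m" where
 "fibre_matrix k = (if k then codensity_matrix B else bundle_matrix B)"

definition PP :: "bool => ('a, 'e, 'n, 'm) bundle_chart => ('a, 'e, 'n, 'm) bundle_chart => real^'n => ('n, 'm) jet_index => ('n, 'm) jet_index => real" where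
 "PP k c d = prolong c d (fibre_matrix k c d)"

lemma PP_facts:
 assumes "c \<in> charts B" "d \<in> charts B"
 shows PP_smooth: "base_smooth (overlap c d) (\<lambda>x. PP k c d x b a)"
  and PP_raise: "x \<in> overlap c d ==> (\<Sum>j\<in>UNIV. jacobian c d x $ j $ i * PP k c d x (raise j b) a) =
   bder i (\<lambda>x. PP k c d x b a) x + (if snd a i > 0 then PP k c d x b (lower i a) else 0)"
  and PP_order: "x \<in> overlap c d ==> mi_size (snd b) < mi_size (snd a) ==> PP k c d x b a = 0"
  and PP_0: "x \<in> overlap c d ==> PP k c d x (\<beta>, \<lambda>_. 0) a = (if snd a = (\<lambda>_. 0) then fibre_matrix k c d x $ \<beta> $ fst a else 0)"
 using q.prolong_smooth(1)[OF assms, of b a] b.prolong_smooth(1)[OF assms, of b a]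
  q.prolong_raise[OF assms, of x i b a] b.prolong_raise[OF assms, of x i b a]
  q.prolong_order'[OF assms, of x b a] b.prolong_order'[OF assms, of x b a]
  q.prolong_0[OF assms, of x \<beta> a] b.prolong_0[OF assms, of x \<beta> a]
 by (cases k; simp add: PP_def fibre_matrix_def)+

lemma fst_jet_trans [simp]: "fst (jet_trans B c d p) = base_trans c d (fst p)"
 by (simp add: jet_trans_def)

lemma snd_jet_trans:
 assumes c: "c \<in> charts B" and d: "d \<in> charts B" and p: "fst p \<in> overlap c d" and b: "mi_size (snd b) \<le> N"
 shows "snd (jet_trans B c d p) b = (\<Sum>a\<in>idx N. PP False c d (fst p) b a * snd p a)"
 unfolding jet_trans_def snd_conv PP_def fibre_matrix_def if_False
proof (rule Sum_any.expand_superset)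
 show "{a. prolong c d (bundle_matrix B c d) (fst p) b a * snd p a \<noteq> 0} \<subseteq> idx N"
  using q.prolong_order'[OF c d p, of b] b by (auto simp: idx_def) (meson le_less_trans not_le)
qed simp

definition Phi :: "('a, 'e, 'n, 'm) bundle_chart => ('a, 'e, 'n, 'm) bundle_chart => ('n, 'm) density => ('n, 'm) density" where
 "Phi c d f = cut (overlap c d) (pull_density B c d f)"

lemma Phi_out: "fst p \<notin> overlap c d ==> Phi c d f p = 0" by (simp add: Phi_def)

end

locale chart_pair = oriented_bundle B for B :: "('a, 'e, 'n::finite, 'm::finite) vector_bundle" +
 fixes c d :: "('a, 'e, 'n, 'm) bundle_chart"
 assumes c: "c \<in> charts B" and d: "d \<in> charts B"
begin

abbreviation "W \<equiv> overlap c d"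
abbreviation "W' \<equiv> overlap d c"
abbreviation "J \<equiv> jacobian c d"
abbreviation "jt \<equiv> jet_trans B c d"
abbreviation "\<Phi> \<equiv> Phi c d"
abbreviation "bs \<equiv> base_fun W :: (real^'n => real) => ('n, 'm) density"

lemma W: "open W" and W': "open W'" by (auto intro: open_overlap c d)
lemma T_W: "x \<in> W ==> base_trans c d x \<in> W'" by (rule trans_facts(1)[OF c d])

sublocale A: jet_superalgebra "dens W" dmul dpar "dD W" "dpd W :: _ => _ => ('n, 'm) density => _" "vanish {}"
 by (rule dens_superalgebra[OF W]) simp

sublocale A': jet_superalgebra "dens W'" dmul dpar "dD W'" "dpd W' :: _ => _ => ('n, 'm) density => _" "vanish {}"
 by (rule dens_superalgebra[OF W']) simp

lemma Phi_eq:
 assumes f: "f \<in> dens W' N" and p: "fst p \<in> W"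
 shows "\<Phi> f p l = sub N (PP True c d (fst p)) l (f (jt p))"
 using p by (simp add: Phi_def pull_density_def odd_subst_sub[OF densD(2)[OF f]] PP_def fibre_matrix_def)

lemma Phi_Cons:
 assumes f: "f \<in> dens W' N" and p: "fst p \<in> W"
 shows "\<Phi> f p (a # l) = (\<Sum>b\<in>idx N. PP True c d (fst p) b a * \<Phi> (dpd W' True b f) p l)"
 using f p by (simp add: Phi_eq[OF f p] Phi_eq[OF A'.C_pd[OF f] p] dpd_True)

lemma jt_smooth: "smooth_along jet_shift (W \<times> UNIV) (\<lambda>p. jet_coord k (jt p))"
proof (cases k)
 case (Inl i)
 then show ?thesis using smooth_base_jet[OF W trans_smooth[OF c d, of i]] by simp
next
 case (Inr b)
 let ?N = "mi_size (snd b)"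
 have "smooth_along jet_shift (W \<times> UNIV) (\<lambda>p. \<Sum>a\<in>idx ?N. PP False c d (fst p) b a * snd p a)"
  by (intro jet.smooth_sum jet.smooth_mult open_jets[OF W] smooth_base_jet[OF W PP_smooth[OF c d]]
    sreg_smooth[OF W sreg_coord[OF W]]) (rule order_refl)
 then show ?thesis
  by (rule jet.smooth_along_cong[OF open_jets[OF W]])
    (use Inr snd_jet_trans[OF c d _ order_refl, of _ b] in auto)
qed

lemma jt_continuous: "continuous_on (W \<times> UNIV) jt"
proof -
 have "continuous_on (W \<times> UNIV) (\<lambda>p. fst (jt p))"
  by (rule continuous_on_vec_components)
    (use smooth_along_continuous[OF jt_smooth[of "Inl _"]] in simp)
 moreover have "continuous_on (W \<times> UNIV) (\<lambda>p. snd (jt p))"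
  by (rule continuous_on_coordinatewise_then_product)
    (use smooth_along_continuous[OF jt_smooth[of "Inr _"]] in simp)
 ultimately have "continuous_on (W \<times> UNIV) (\<lambda>p. (fst (jt p), snd (jt p)))" by (rule continuous_on_Pair)
 then show ?thesis by (simp only: prod.collapse)
qed

lemma jt_in: "jt ` (W \<times> UNIV) \<subseteq> W' \<times> UNIV"
proof (rule image_subsetI)
 fix p :: "('n, 'm) jet" assume "p \<in> W \<times> UNIV"
 then show "jt p \<in> W' \<times> UNIV" using T_W[of "fst p"] by (simp add: mem_Times_iff)
qed

lemma sreg_jt:
 assumes F: "sreg N W' F"
 shows "sreg N W (\<lambda>p. F (jt p))"
  and "fst p \<in> W ==> pder jet_shift k (\<lambda>p. F (jt p)) p =
   (\<Sum>j\<in>UNIV. pder jet_shift k (\<lambda>p. base_trans c d (fst p) $ j) p * pder jet_shift (Inl j) F (jt p)) +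
   (\<Sum>b\<in>idx N. pder jet_shift k (\<lambda>p. snd (jt p) b) p * qder b F (jt p))"
proof -
 have F1: "smooth_along jet_shift (W' \<times> UNIV) F" and F2: "jet.depends_on (jc N) (W' \<times> UNIV) F"
  using F by (auto simp: sreg_def)
 have "smooth_along jet_shift (W \<times> UNIV) (\<lambda>p. F (jt p))"
  by (rule jet.smooth_compose[OF jet.commuting_flows_axioms open_jets[OF W] open_jets[OF W'] jt_in F1 F2
     finite_jc jt_smooth jt_continuous])
 moreover have "F (jt (x, q)) = F (jt (x, q'))"
  if x: "x \<in> W" and q: "\<forall>a. mi_size (snd a) \<le> N \<longrightarrow> q a = q' a" for x q q'
 proof -
  have "snd (jt (x, q)) b = snd (jt (x, q')) b" if "mi_size (snd b) \<le> N" for b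
   using snd_jet_trans[OF c d _ that, of "(x, q)"] snd_jet_trans[OF c d _ that, of "(x, q')"] x q
   by (simp add: idx_def)
  moreover have "fst (jt (x, q)) = base_trans c d x" "fst (jt (x, q')) = base_trans c d x" by simp_all
  ultimately show ?thesis using F2[unfolded depends_on_jc] T_W[OF x] by (metis prod.collapse)
 qed
 ultimately show "sreg N W (\<lambda>p. F (jt p))" unfolding sreg_def depends_on_jc by blast
 show "pder jet_shift k (\<lambda>p. F (jt p)) p =
   (\<Sum>j\<in>UNIV. pder jet_shift k (\<lambda>p. base_trans c d (fst p) $ j) p * pder jet_shift (Inl j) F (jt p)) +
   (\<Sum>b\<in>idx N. pder jet_shift k (\<lambda>p. snd (jt p) b) p * qder b F (jt p))" if p: "fst p \<in> W"
 proof -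
  have "p \<in> W \<times> UNIV" using p by (simp add: mem_Times_iff)
  from jet.chain_rule[OF jet.commuting_flows_axioms open_jets[OF W] this open_jets[OF W'] jt_in F1 F2 finite_jc jt_smooth, of k]
  show ?thesis unfolding sum_jc by simp
 qed
qed

lemma pder_jt:
 assumes p: "fst p \<in> W"
 shows "qder a (\<lambda>p. snd (jt p) b) p = PP False c d (fst p) b a"
  and "mi_size (snd b) \<le> N ==> vfield N i (\<lambda>p. snd (jt p) b) p = (\<Sum>j\<in>UNIV. J (fst p) $ j $ i * snd (jt p) (raise j b))"
proof -
 have p': "p \<in> W \<times> UNIV" using p by (simp add: mem_Times_iff)
 have oW: "open (W \<times> (UNIV :: (('n, 'm) jet_index => real) set))" by (rule open_jets[OF W])
 have s1: "smooth_along jet_shift (W \<times> UNIV) (\<lambda>p. PP False c d (fst p) b a)" for a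
  by (rule smooth_base_jet[OF W PP_smooth[OF c d]])
 have s2: "smooth_along jet_shift (W \<times> UNIV) (\<lambda>p. snd p a)" for a :: "('n, 'm) jet_index"
  by (rule sreg_smooth[OF W sreg_coord[OF W order_refl]])
 have D: "pder jet_shift k (\<lambda>p. snd (jt p) b) p = (\<Sum>a\<in>idx N.
   pder jet_shift k (\<lambda>p. PP False c d (fst p) b a) p * snd p a +
   PP False c d (fst p) b a * pder jet_shift k (\<lambda>p. snd p a) p)" if "mi_size (snd b) \<le> N" for k N
 proof -
  have "pder jet_shift k (\<lambda>p. snd (jt p) b) p = pder jet_shift k (\<lambda>p. \<Sum>a\<in>idx N. PP False c d (fst p) b a * snd p a) p"
   by (rule pder_cong_U[OF W p']) (rule snd_jet_trans[OF c d _ that], auto)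
  then show ?thesis by (simp add: jet.pder_sum[OF oW jet.smooth_mult[OF oW s1 s2] p'] jet.pder_mult[OF s1 s2 p'])
 qed
 have fa: "qder a (\<lambda>p. PP False c d (fst p) b a') p = 0" for a a'
  using fun_cong[OF pder_jet_fst(2)[of a "\<lambda>x. PP False c d x b a'"], of p] by simp
 have fi: "pder jet_shift (Inl i) (\<lambda>p. PP False c d (fst p) b a') p = bder i (\<lambda>x. PP False c d x b a') (fst p)" for a'
  using fun_cong[OF pder_jet_fst(1)[of i "\<lambda>x. PP False c d x b a'"], of p] by simp
 have q: "qder a (\<lambda>p. snd (jt p) b) p = PP False c d (fst p) b a" for a
 proof -
  let ?N = "mi_size (snd b)"
  have "qder a (\<lambda>p. snd (jt p) b) p = (\<Sum>a'\<in>idx ?N. if a' = a then PP False c d (fst p) b a else 0)"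
   unfolding D[OF order_refl] fa pder_q by (rule sum.cong) auto
  also have "\<dots> = (if a \<in> idx ?N then PP False c d (fst p) b a else 0)" by simp
  also have "\<dots> = PP False c d (fst p) b a" using PP_order[OF c d p, of b a False] by (auto simp: idx_def)
  finally show ?thesis .
 qed
 then show "qder a (\<lambda>p. snd (jt p) b) p = PP False c d (fst p) b a" .
 show "vfield N i (\<lambda>p. snd (jt p) b) p = (\<Sum>j\<in>UNIV. J (fst p) $ j $ i * snd (jt p) (raise j b))" if b: "mi_size (snd b) \<le> N"
 proof -
  have 1: "pder jet_shift (Inl i) (\<lambda>p. snd (jt p) b) p = (\<Sum>a\<in>idx (Suc N). bder i (\<lambda>x. PP False c d x b a) (fst p) * snd p a)"
   using b by (subst D[of "Suc N"]) (simp_all add: fi pder_q)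
  have 2: "(\<Sum>a\<in>idx N. snd p (raise i a) * qder a (\<lambda>p. snd (jt p) b) p) =
    (\<Sum>a\<in>idx (Suc N). (if snd a i > 0 then PP False c d (fst p) b (lower i a) else 0) * snd p a)"
   unfolding q
   by (subst sum_shift_idx[where F = "\<lambda>a' a. snd p a * PP False c d (fst p) b a'", symmetric])
     (auto intro!: sum.cong)
  have "vfield N i (\<lambda>p. snd (jt p) b) p = (\<Sum>a\<in>idx (Suc N).
    (\<Sum>j\<in>UNIV. J (fst p) $ j $ i * PP False c d (fst p) (raise j b) a) * snd p a)"
   unfolding vfield_def 1 2 PP_raise[OF c d p] by (simp add: sum.distrib distrib_right)
  also have "\<dots> = (\<Sum>j\<in>UNIV. J (fst p) $ j $ i * (\<Sum>a\<in>idx (Suc N). PP False c d (fst p) (raise j b) a * snd p a))"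
   unfolding sum_distrib_left sum_distrib_right mult.assoc by (rule sum.swap)
  also have "\<dots> = (\<Sum>j\<in>UNIV. J (fst p) $ j $ i * snd (jt p) (raise j b))"
   using b by (simp add: snd_jet_trans[OF c d p, of _ "Suc N"] snd_raise)
  finally show ?thesis .
 qed
qed

lemma vfield_jt:
 assumes F: "sreg N W' F" and p: "fst p \<in> W"
 shows "vfield N i (\<lambda>p. F (jt p)) p = (\<Sum>j\<in>UNIV. J (fst p) $ j $ i * vfield N j F (jt p))"
proof -
 have Tq: "qder a (\<lambda>p. base_trans c d (fst p) $ j) p = 0" for a j
  using fun_cong[OF pder_jet_fst(2)[of a "\<lambda>x. base_trans c d x $ j"], of p] by simp
 have Tx: "pder jet_shift (Inl i) (\<lambda>p. base_trans c d (fst p) $ j) p = J (fst p) $ j $ i" for j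
  using fun_cong[OF pder_jet_fst(1)[of i "\<lambda>x. base_trans c d x $ j"], of p] by (simp add: jacobian_entry)
 let ?G = "\<lambda>b. qder b F (jt p)"
 have "vfield N i (\<lambda>p. F (jt p)) p = (\<Sum>j\<in>UNIV. J (fst p) $ j $ i * pder jet_shift (Inl j) F (jt p)) +
   ((\<Sum>b\<in>idx N. pder jet_shift (Inl i) (\<lambda>p. snd (jt p) b) p * ?G b) +
   (\<Sum>a\<in>idx N. \<Sum>b\<in>idx N. snd p (raise i a) * (qder a (\<lambda>p. snd (jt p) b) p * ?G b)))"
  unfolding vfield_def sreg_jt(2)[OF F p] Tx Tq by (simp add: sum_distrib_left)
 also have "(\<Sum>a\<in>idx N. \<Sum>b\<in>idx N. snd p (raise i a) * (qder a (\<lambda>p. snd (jt p) b) p * ?G b)) =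
   (\<Sum>b\<in>idx N. (\<Sum>a\<in>idx N. snd p (raise i a) * qder a (\<lambda>p. snd (jt p) b) p) * ?G b)"
  by (subst sum.swap) (simp add: sum_distrib_right mult.assoc)
 also have "(\<Sum>b\<in>idx N. pder jet_shift (Inl i) (\<lambda>p. snd (jt p) b) p * ?G b) + \<dots> =
   (\<Sum>b\<in>idx N. vfield N i (\<lambda>p. snd (jt p) b) p * ?G b)"
  by (simp add: vfield_def distrib_right sum.distrib)
 also have "\<dots> = (\<Sum>b\<in>idx N. (\<Sum>j\<in>UNIV. J (fst p) $ j $ i * snd (jt p) (raise j b)) * ?G b)"
  by (rule sum.cong[OF refl]) (simp add: pder_jt(2)[OF p] idx_def)
 also have "\<dots> = (\<Sum>j\<in>UNIV. J (fst p) $ j $ i * (\<Sum>b\<in>idx N. snd (jt p) (raise j b) * ?G b))"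
  unfolding sum_distrib_left sum_distrib_right mult.assoc by (rule sum.swap)
 finally show ?thesis by (simp add: vfield_def distrib_left sum.distrib)
qed

lemma Phi_dens:
 assumes f: "f \<in> dens W' N"
 shows "\<Phi> f \<in> dens W N"
proof (rule densI')
 show "sreg N W (\<lambda>p. \<Phi> f p l)" for l
  using f
 proof (induction l arbitrary: f)
  case Nil
  show ?case
   by (rule sreg_cong[OF W sreg_jt(1)[OF densD(1)[OF Nil, of "[]"]]]) (auto simp: Phi_eq[OF Nil])
 next
  case (Cons a l)
  have "sreg N W (\<lambda>p. \<Sum>b\<in>idx N. PP True c d (fst p) b a * \<Phi> (dpd W' True b f) p l)"
   by (intro sreg_sum[OF W] sreg_mult[OF W] sreg_base[OF W PP_smooth[OF c d]] Cons.IH A'.C_pd[OF Cons.prems])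
  then show ?case by (rule sreg_cong[OF W]) (auto simp: Phi_Cons[OF Cons.prems])
 qed
 show "oreg N (\<Phi> f p)" if p: "fst p \<in> W" for p
 proof -
  have "oreg N (\<lambda>l. sub N (PP True c d (fst p)) l (f (jt p)))"
   by (rule oreg_sub[OF densD(2)[OF f]]) (auto simp: idx_def intro!: PP_order[OF c d p])
  moreover have "\<Phi> f p = (\<lambda>l. sub N (PP True c d (fst p)) l (f (jt p)))" using Phi_eq[OF f p] by auto
  ultimately show ?thesis by simp
 qed
qed (rule Phi_out)

lemma Phi_ext:
 assumes "f \<in> dens W N" "g \<in> dens W M" "\<And>p l. fst p \<in> W ==> f p l = g p l"
 shows "f = g"
 using dens_ext[OF assms] .

lemma Phi_add: "f \<in> dens W' N ==> g \<in> dens W' N ==> \<Phi> (f + g) = \<Phi> f + \<Phi> g"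
proof (intro ext)
 fix p l assume f: "f \<in> dens W' N" and g: "g \<in> dens W' N"
 then show "\<Phi> (f + g) p l = (\<Phi> f + \<Phi> g) p l"
  by (cases "fst p \<in> W") (simp_all add: Phi_eq[OF f] Phi_eq[OF g] Phi_eq[OF A'.C_add[OF f g]] sub_add Phi_out)
qed

lemma Phi_0 [simp]: "\<Phi> 0 = 0" using Phi_add[of 0 0 0] A'.C_zero by simp

lemma Phi_minus: "f \<in> dens W' N ==> \<Phi> (- f) = - \<Phi> f"
 using Phi_add[of "- f" N f] A'.C_minus[of f N] by (simp add: eq_neg_iff_add_eq_0)

lemma Phi_sum: "(\<And>k. k \<in> K ==> F k \<in> dens W' N) ==> \<Phi> (sum F K) = (\<Sum>k\<in>K. \<Phi> (F k))"
proof (induction K rule: infinite_finite_induct)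
 case (insert k K)
 have "F k \<in> dens W' N" "sum F K \<in> dens W' N" using insert.prems by (auto intro: A'.C_sum)
 then have "\<Phi> (F k + sum F K) = \<Phi> (F k) + \<Phi> (sum F K)" by (rule Phi_add)
 then show ?case using insert by (simp only: sum.insert[OF insert.hyps]) simp
qed simp_all

lemma Phi_mul: "f \<in> dens W' N ==> g \<in> dens W' N ==> \<Phi> (dmul f g) = dmul (\<Phi> f) (\<Phi> g)"
proof (intro ext)
 fix p l assume f: "f \<in> dens W' N" and g: "g \<in> dens W' N"
 show "\<Phi> (dmul f g) p l = dmul (\<Phi> f) (\<Phi> g) p l"
 proof (cases "fst p \<in> W")
  case True
  have "\<Phi> f p = (\<lambda>l. sub N (PP True c d (fst p)) l (f (jt p)))"
   "\<Phi> g p = (\<lambda>l. sub N (PP True c d (fst p)) l (g (jt p)))" using Phi_eq[OF f True] Phi_eq[OF g True] by auto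
  then show ?thesis using Phi_eq[OF A'.C_mul[OF f g] True, of l] by (simp add: dmul_def sub_odd_mult)
 qed (simp add: Phi_out dmul_def)
qed

lemma Phi_par: "f \<in> dens W' N ==> \<Phi> (dpar f) = dpar (\<Phi> f)"
proof (intro ext)
 fix p l assume f: "f \<in> dens W' N"
 show "\<Phi> (dpar f) p l = dpar (\<Phi> f) p l"
 proof (cases "fst p \<in> W")
  case True
  have "\<Phi> (dpar f) p l = sub N (PP True c d (fst p)) l (parity (f (jt p)))"
   using Phi_eq[OF A'.C_par[OF f] True, of l] by (simp add: dpar_def)
  then show ?thesis by (simp add: sub_parity dpar_def parity_def[of "\<Phi> f p"] Phi_eq[OF f True])
 qed (simp add: Phi_out dpar_def)
qed

lemma bs_dens: "base_smooth W u ==> bs u \<in> dens W N" by (rule base_fun_dens[OF W])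
lemma PP_dens: "bs (\<lambda>x. PP k c d x b a) \<in> dens W N" by (rule bs_dens[OF PP_smooth[OF c d]])

lemma bs_mul_in: "fst p \<in> W ==> dmul (bs u) f p l = u (fst p) * f p l" by (simp add: dmul_base_fun)

text \<open>The chain rule: both kinds of fibre variables transform linearly.\<close>

lemma Phi_dpd:
 assumes f: "f \<in> dens W' N"
 shows "dpd W k a (\<Phi> f) = (\<Sum>b\<in>idx N. dmul (bs (\<lambda>x. PP k c d x b a)) (\<Phi> (dpd W' k b f)))"
proof (rule Phi_ext[OF A.C_pd[OF Phi_dens[OF f]] A.C_sum])
 show "dmul (bs (\<lambda>x. PP k c d x b a)) (\<Phi> (dpd W' k b f)) \<in> dens W N" for b
  by (intro A.C_mul PP_dens Phi_dens A'.C_pd f)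
 have T: "dpd W True a (\<Phi> f) = (\<Sum>b\<in>idx N. dmul (bs (\<lambda>x. PP True c d x b a)) (\<Phi> (dpd W' True b f)))"
  if f: "f \<in> dens W' N" for f N a
 proof (rule Phi_ext[OF A.C_pd[OF Phi_dens[OF f]] A.C_sum])
  show "dmul (bs (\<lambda>x. PP True c d x b a)) (\<Phi> (dpd W' True b f)) \<in> dens W N" for b
   by (intro A.C_mul PP_dens Phi_dens A'.C_pd f)
  show "dpd W True a (\<Phi> f) p l = (\<Sum>b\<in>idx N. dmul (bs (\<lambda>x. PP True c d x b a)) (\<Phi> (dpd W' True b f))) p l"
   if "fst p \<in> W" for p l
   using Phi_Cons[OF f that] by (simp add: dpd_True lder_def sum_apply bs_mul_in[OF that])
 qed
 fix p :: "('n, 'm) jet" and l assume p: "fst p \<in> W"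
 have p': "p \<in> W \<times> UNIV" using p by (simp add: mem_Times_iff)
 have "dpd W False a (\<Phi> f) p l = (\<Sum>b\<in>idx N. PP False c d (fst p) b a * \<Phi> (dpd W' False b f) p l)"
  using f
 proof (induction l arbitrary: f)
  case Nil
  have s: "sreg N W' (\<lambda>p. f p [])" by (rule densD(1)[OF Nil])
  have Tq: "qder a (\<lambda>p. base_trans c d (fst p) $ j) p = 0" for j
   using fun_cong[OF pder_jet_fst(2)[of a "\<lambda>x. base_trans c d x $ j"], of p] by simp
  have "dpd W False a (\<Phi> f) p [] = qder a (\<lambda>p. f (jt p) []) p"
   unfolding dpd_False[OF p] by (rule pder_cong_U[OF W p']) (auto simp: Phi_eq[OF Nil])
  also have "\<dots> = (\<Sum>b\<in>idx N. PP False c d (fst p) b a * qder b (\<lambda>p. f p []) (jt p))"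
   unfolding sreg_jt(2)[OF s p] Tq pder_jt(1)[OF p] by simp
  finally show ?case
   using T_W[OF p] by (simp add: Phi_eq[OF A'.C_pd[OF Nil] p] dpd_False)
 next
  case (Cons e l)
  note f = Cons.prems
  have "dpd W False a (\<Phi> f) p (e # l) = dpd W True e (dpd W False a (\<Phi> f)) p l"
   by (simp add: dpd_True lder_def)
  also have "dpd W True e (dpd W False a (\<Phi> f)) = dpd W False a (dpd W True e (\<Phi> f))"
   using A.pd_pd[OF Phi_dens[OF f], of True e False a] by simp
  also have "\<dots> = (\<Sum>b\<in>idx N. dmul (bs (\<lambda>x. PP True c d x b e)) (dpd W False a (\<Phi> (dpd W' True b f))))"
  proof -
   have "dmul (bs (\<lambda>x. PP True c d x b e)) (\<Phi> (dpd W' True b f)) \<in> dens W N" for b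
    by (intro A.C_mul PP_dens Phi_dens A'.C_pd f)
   then show ?thesis unfolding T[OF f]
    by (simp add: A.pd_sum[where N = N] A.pd_mul[OF PP_dens Phi_dens[OF A'.C_pd[OF f]]] dpd_base_fun[OF W])
  qed
  also have "\<dots> p l = (\<Sum>b\<in>idx N. \<Sum>b'\<in>idx N. PP True c d (fst p) b e * (PP False c d (fst p) b' a * \<Phi> (dpd W' False b' (dpd W' True b f)) p l))"
   by (simp add: sum_apply bs_mul_in[OF p] Cons.IH[OF A'.C_pd[OF f]] sum_distrib_left)
  also have "\<dots> = (\<Sum>b'\<in>idx N. PP False c d (fst p) b' a * (\<Sum>b\<in>idx N. PP True c d (fst p) b e * \<Phi> (dpd W' True b (dpd W' False b' f)) p l))"
   using A'.pd_pd[OF f, of True _ False] by (subst sum.swap) (simp add: sum_distrib_left mult_ac)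
  also have "\<dots> = (\<Sum>b'\<in>idx N. PP False c d (fst p) b' a * \<Phi> (dpd W' False b' f) p (e # l))"
   by (simp add: Phi_Cons[OF A'.C_pd[OF f] p])
  finally show ?case .
 qed
 then show "dpd W k a (\<Phi> f) p l = (\<Sum>b\<in>idx N. dmul (bs (\<lambda>x. PP k c d x b a)) (\<Phi> (dpd W' k b f))) p l"
  using T[OF f] by (cases k) (simp_all add: sum_apply bs_mul_in[OF p])
qed

text \<open>In both kinds of fibre variables the recursion of \<open>prolong\<close> says that \<open>D\<^sub>i\<close> of a transformed variable
 is the Jacobian applied to the raised variables, which is the chain rule for total derivatives.\<close>

lemma Phi_dD:
 assumes f: "f \<in> dens W' N"
 shows "dD W i (\<Phi> f) = (\<Sum>j\<in>UNIV. dmul (bs (\<lambda>x. J x $ j $ i)) (\<Phi> (dD W' j f)))"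
proof (rule Phi_ext[OF A.C_D[OF Phi_dens[OF f]] A.C_sum])
 show "dmul (bs (\<lambda>x. J x $ j $ i)) (\<Phi> (dD W' j f)) \<in> dens W (Suc N)" for j
  by (intro A.C_mul bs_dens Phi_dens A'.C_D f jacobian_smooth c d)
 fix p :: "('n, 'm) jet" and l assume p: "fst p \<in> W"
 have p': "p \<in> W \<times> UNIV" using p by (simp add: mem_Times_iff)
 have jp: "fst (jt p) \<in> W'" using T_W[OF p] by simp
 have "dD W i (\<Phi> f) p l = (\<Sum>j\<in>UNIV. J (fst p) $ j $ i * \<Phi> (dD W' j f) p l)"
  using f
 proof (induction l arbitrary: f)
  case Nil
  have s: "sreg N W' (\<lambda>p. f p [])" by (rule densD(1)[OF Nil])
  have "dD W i (\<Phi> f) p [] = vfield N i (\<lambda>p. \<Phi> f p []) p"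
   by (simp add: dD_eq[OF W Phi_dens[OF Nil] order_refl p])
  also have "\<dots> = vfield N i (\<lambda>p. f (jt p) []) p"
   by (rule vfield_cong[OF W p']) (auto simp: Phi_eq[OF Nil])
  also have "\<dots> = (\<Sum>j\<in>UNIV. J (fst p) $ j $ i * vfield N j (\<lambda>p. f p []) (jt p))" by (rule vfield_jt[OF s p])
  finally show ?case
   by (simp add: Phi_eq[OF A'.C_D[OF Nil] p] dD_eq[OF W' Nil order_refl jp])
 next
  case (Cons e l)
  note f = Cons.prems
  let ?P = "\<lambda>b a. PP True c d (fst p) b a" and ?f = "\<lambda>b. dpd W' True b f"
  have fb: "?f b \<in> dens W' N" for b by (rule A'.C_pd[OF f])
  have "dD W i (\<Phi> f) p (e # l) = dpd W True e (dD W i (\<Phi> f)) p l"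
   by (simp add: dpd_True lder_def)
  also have "dpd W True e (dD W i (\<Phi> f)) = dD W i (dpd W True e (\<Phi> f)) + (if snd e i > 0 then dpd W True (lower i e) (\<Phi> f) else 0)"
   by (rule A.pd_D[OF Phi_dens[OF f]])
  also have "\<dots> p l = dD W i (dpd W True e (\<Phi> f)) p l + (if snd e i > 0 then dpd W True (lower i e) (\<Phi> f) p l else 0)"
   by simp
  also have "dD W i (dpd W True e (\<Phi> f)) p l = (\<Sum>b\<in>idx N. bder i (\<lambda>x. PP True c d x b e) (fst p) * \<Phi> (?f b) p l +
    ?P b e * dD W i (\<Phi> (?f b)) p l)"
  proof -
   have m: "dmul (bs (\<lambda>x. PP True c d x b e)) (\<Phi> (?f b)) \<in> dens W N" for b
    by (intro A.C_mul PP_dens Phi_dens fb)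
   have "dD W i (dpd W True e (\<Phi> f)) = (\<Sum>b\<in>idx N. dD W i (dmul (bs (\<lambda>x. PP True c d x b e)) (\<Phi> (?f b))))"
    unfolding Phi_dpd[OF f] by (rule A.D_sum[OF m])
   also have "\<dots> = (\<Sum>b\<in>idx N. dmul (bs (bder i (\<lambda>x. PP True c d x b e))) (\<Phi> (?f b)) +
     dmul (bs (\<lambda>x. PP True c d x b e)) (dD W i (\<Phi> (?f b))))"
    by (simp add: A.D_mul[OF PP_dens Phi_dens[OF fb]] dD_base_fun[OF W PP_smooth[OF c d]])
   finally show ?thesis by (simp add: sum_apply bs_mul_in[OF p])
  qed
  also have "(if snd e i > 0 then dpd W True (lower i e) (\<Phi> f) p l else 0) =
    (\<Sum>b\<in>idx N. (if snd e i > 0 then ?P b (lower i e) else 0) * \<Phi> (?f b) p l)"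
   unfolding Phi_dpd[OF f] by (simp add: sum_apply bs_mul_in[OF p])
  also have "(\<Sum>b\<in>idx N. bder i (\<lambda>x. PP True c d x b e) (fst p) * \<Phi> (?f b) p l + ?P b e * dD W i (\<Phi> (?f b)) p l) + \<dots> =
    (\<Sum>b\<in>idx N. (\<Sum>j\<in>UNIV. J (fst p) $ j $ i * ?P (raise j b) e) * \<Phi> (?f b) p l +
     ?P b e * (\<Sum>j\<in>UNIV. J (fst p) $ j $ i * \<Phi> (dD W' j (?f b)) p l))"
   unfolding PP_raise[OF c d p] Cons.IH[OF fb] by (simp add: sum.distrib distrib_right)
  also have "\<dots> = (\<Sum>b\<in>idx N. \<Sum>j\<in>UNIV. J (fst p) $ j $ i * (?P (raise j b) e * \<Phi> (?f b) p l + ?P b e * \<Phi> (dD W' j (?f b)) p l))"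
   by (simp add: sum.distrib distrib_left sum_distrib_left sum_distrib_right mult_ac)
  also have "\<dots> = (\<Sum>j\<in>UNIV. J (fst p) $ j $ i * (\<Sum>b\<in>idx N. ?P (raise j b) e * \<Phi> (?f b) p l + ?P b e * \<Phi> (dD W' j (?f b)) p l))"
   by (subst sum.swap) (simp add: sum_distrib_left)
  also have "\<dots> = (\<Sum>j\<in>UNIV. J (fst p) $ j $ i * \<Phi> (dD W' j f) p (e # l))"
  proof (rule sum.cong[OF refl])
   fix j :: 'n
   have low: "(if snd b j > 0 then ?f (lower j b) else 0) \<in> dens W' (Suc N)" for b
    using A'.C_le[OF fb, of "Suc N"] by simp
   have "\<Phi> (dD W' j f) p (e # l) = (\<Sum>b\<in>idx (Suc N). ?P b e * \<Phi> (dpd W' True b (dD W' j f)) p l)"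
    by (rule Phi_Cons[OF A'.C_D[OF f] p])
   also have "\<dots> = (\<Sum>b\<in>idx (Suc N). ?P b e * \<Phi> (dD W' j (?f b)) p l) +
     (\<Sum>b\<in>idx (Suc N). if snd b j > 0 then ?P b e * \<Phi> (?f (lower j b)) p l else 0)"
    unfolding sum.distrib[symmetric] A'.pd_D[OF f] Phi_add[OF A'.C_D[OF fb] low]
    by (rule sum.cong) (auto simp: distrib_left)
   also have "(\<Sum>b\<in>idx (Suc N). ?P b e * \<Phi> (dD W' j (?f b)) p l) = (\<Sum>b\<in>idx N. ?P b e * \<Phi> (dD W' j (?f b)) p l)"
   proof (rule sum.mono_neutral_right[OF finite_idx idx_mono])
    show "\<forall>b\<in>idx (Suc N) - idx N. ?P b e * \<Phi> (dD W' j (?f b)) p l = 0"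
    proof
     fix b :: "('n, 'm) jet_index" assume "b \<in> idx (Suc N) - idx N"
     then have "?f b = 0" by (intro A'.pd_order[OF f]) (simp add: idx_def)
     then show "?P b e * \<Phi> (dD W' j (?f b)) p l = 0" by simp
    qed
   qed simp
   also have "(\<Sum>b\<in>idx (Suc N). if snd b j > 0 then ?P b e * \<Phi> (?f (lower j b)) p l else 0) =
     (\<Sum>b\<in>idx N. ?P (raise j b) e * \<Phi> (?f b) p l)"
    by (rule sum_shift_idx)
   finally show "J (fst p) $ j $ i * (\<Sum>b\<in>idx N. ?P (raise j b) e * \<Phi> (?f b) p l + ?P b e * \<Phi> (dD W' j (?f b)) p l) =
     J (fst p) $ j $ i * \<Phi> (dD W' j f) p (e # l)" by (simp add: sum.distrib)
  qed
  finally show ?case .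
 qed
 then show "dD W i (\<Phi> f) p l = (\<Sum>j\<in>UNIV. dmul (bs (\<lambda>x. J x $ j $ i)) (\<Phi> (dD W' j f))) p l"
  by (simp add: sum_apply bs_mul_in[OF p])
qed

end

section \<open>Invariance of the Euler operators and of the bracket\<close>

lemma base_fun_0 [simp]: "base_fun U (\<lambda>x. 0) = 0" by (auto simp: base_fun_def fun_eq_iff)
lemma dmul_0 [simp]: "dmul 0 f = 0" "dmul f 0 = 0" by (simp_all add: dmul_def fun_eq_iff)

context chart_pair
begin

abbreviation "dt \<equiv> \<lambda>x. det (J x)"
abbreviation "bd \<equiv> bs (\<lambda>x. det (J x))"

lemma dt_smooth: "base_smooth W dt" by (rule smooth_det[OF W jacobian_smooth[OF c d]])
lemma bd_dens: "bd \<in> dens W N" by (rule bs_dens[OF dt_smooth])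
lemma ji_smooth: "base_smooth W (\<lambda>x. jac_inv c d x $ i $ j)" by (rule jac_inv_smooth[OF c d])
lemma ji_dens: "bs (\<lambda>x. jac_inv c d x $ i $ j) \<in> dens W N" by (rule bs_dens[OF ji_smooth])

lemma bs_commute: "dmul (bs u) (dmul (bs v) f) = dmul (bs v) (dmul (bs u) f)"
 by (simp add: dmul_base_base mult.commute)

lemma D_bs:
 "base_smooth W u ==> f \<in> dens W N ==>
   dD W i (dmul (bs u) f) = dmul (bs (bder i u)) f + dmul (bs u) (dD W i f)"
 by (simp add: A.D_mul[OF bs_dens] dD_base_fun[OF W])

text \<open>Horizontal \<open>(n-1)\<close>-forms transform so that their differentials do: the derivatives of the coefficients
 add up to zero by the Piola identity.\<close>

lemma piola_Phi:
 assumes F: "F \<in> dens W' N"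
 shows "(\<Sum>i\<in>UNIV. dD W i (dmul (bs (\<lambda>x. jac_inv c d x $ i $ j)) (dmul bd (\<Phi> F)))) = dmul bd (\<Phi> (dD W' j F))"
proof (rule Phi_ext[OF A.C_sum])
 show "dD W i (dmul (bs (\<lambda>x. jac_inv c d x $ i $ j)) (dmul bd (\<Phi> F))) \<in> dens W (Suc N)" for i
  by (intro A.C_D A.C_mul ji_dens bd_dens Phi_dens F)
 show "dmul bd (\<Phi> (dD W' j F)) \<in> dens W (Suc N)" by (intro A.C_mul bd_dens Phi_dens A'.C_D F)
 fix p :: "('n, 'm) jet" and l assume p: "fst p \<in> W"
 let ?u = "\<lambda>i x. jac_inv c d x $ i $ j * dt x"
 have u: "base_smooth W (?u i)" for i
  by (intro base.smooth_mult[OF W] ji_smooth dt_smooth)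
 have "dD W i (dmul (bs (\<lambda>x. jac_inv c d x $ i $ j)) (dmul bd (\<Phi> F))) p l =
   bder i (?u i) (fst p) * \<Phi> F p l +
   ?u i (fst p) * (\<Sum>k\<in>UNIV. J (fst p) $ k $ i * \<Phi> (dD W' k F) p l)" for i
  unfolding dmul_base_base D_bs[OF u Phi_dens[OF F]] Phi_dD[OF F]
  by (simp add: bs_mul_in[OF p] sum_apply)
 then have "(\<Sum>i\<in>UNIV. dD W i (dmul (bs (\<lambda>x. jac_inv c d x $ i $ j)) (dmul bd (\<Phi> F)))) p l =
   (\<Sum>i\<in>UNIV. bder i (?u i) (fst p)) * \<Phi> F p l +
   (\<Sum>i\<in>UNIV. \<Sum>k\<in>UNIV. ?u i (fst p) * (J (fst p) $ k $ i * \<Phi> (dD W' k F) p l))"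
  by (simp add: sum_apply sum.distrib sum_distrib_right sum_distrib_left)
 also have "(\<Sum>i\<in>UNIV. bder i (?u i) (fst p)) = 0" by (rule piola[OF c d p])
 also have "(\<Sum>i\<in>UNIV. \<Sum>k\<in>UNIV. ?u i (fst p) * (J (fst p) $ k $ i * \<Phi> (dD W' k F) p l)) =
   (\<Sum>k\<in>UNIV. (\<Sum>i\<in>UNIV. J (fst p) $ k $ i * jac_inv c d (fst p) $ i $ j) * (dt (fst p) * \<Phi> (dD W' k F) p l))"
  unfolding sum_distrib_right by (subst sum.swap) (simp add: mult_ac)
 also have "\<dots> = dt (fst p) * \<Phi> (dD W' j F) p l"
  unfolding jac_inv_def jacobian_inverse_sum(1)[OF c d p]
  by (simp add: if_distrib[of "\<lambda>t. t * _"] cong: if_cong)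
 finally show "(\<Sum>i\<in>UNIV. dD W i (dmul (bs (\<lambda>x. jac_inv c d x $ i $ j)) (dmul bd (\<Phi> F)))) p l = dmul bd (\<Phi> (dD W' j F)) p l"
  by (simp add: bs_mul_in[OF p])
qed

text \<open>The Euler operator of a pulled back density is a sum of these operators applied to the pulled
 back derivatives.\<close>

definition tsum :: "bool => 'm => nat => ('n, 'm) jet_index => ('n, 'm) density => ('n, 'm) density" where
 "tsum k \<alpha> N b X = (\<Sum>\<sigma>\<in>mis N. adj W \<sigma> (dmul (bs (\<lambda>x. PP k c d x b (\<alpha>, \<sigma>))) X))"

lemma tsum_add:
 assumes "X \<in> dens W M" "Y \<in> dens W M"
 shows "tsum k \<alpha> N b (X + Y) = tsum k \<alpha> N b X + tsum k \<alpha> N b Y"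
 unfolding tsum_def A.mul_add_right
 by (simp only: A.ad_add[OF A.CC_I[OF A.C_mul[OF PP_dens assms(1)]] A.CC_I[OF A.C_mul[OF PP_dens assms(2)]]] sum.distrib)

lemma tsum_0: "tsum k \<alpha> N b 0 = 0" by (simp add: tsum_def)

lemma tsum_sum: "(\<And>i. i \<in> K ==> X i \<in> dens W M) ==> tsum k \<alpha> N b (\<Sum>i\<in>K. X i) = (\<Sum>i\<in>K. tsum k \<alpha> N b (X i))"
proof (induction K rule: infinite_finite_induct)
 case (insert a K)
 have "X a \<in> dens W M" "sum X K \<in> dens W M" using insert.prems by (auto intro: A.C_sum)
 then have "tsum k \<alpha> N b (X a + sum X K) = tsum k \<alpha> N b (X a) + tsum k \<alpha> N b (sum X K)" by (rule tsum_add)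
 then show ?case using insert by (simp only: sum.insert[OF insert.hyps]) simp
qed (simp_all add: tsum_0)

text \<open>The recursion of \<open>prolong\<close>, solved for the raised entry with the inverse Jacobian; the lowered
 terms are absorbed by summation by parts.\<close>

lemma tsum_raise:
 assumes X: "X \<in> dens W M" and b: "mi_size (snd b) < N"
 shows "tsum k \<alpha> N (raise j b) X = - tsum k \<alpha> N b (\<Sum>i\<in>UNIV. dD W i (dmul (bs (\<lambda>x. jac_inv c d x $ i $ j)) X))"
proof -
 let ?P = "\<lambda>\<sigma> x. PP k c d x b (\<alpha>, \<sigma>)"
 define Xi where "Xi i = dmul (bs (\<lambda>x. jac_inv c d x $ i $ j)) X" for i
 have Xi: "Xi i \<in> dens W M" for i unfolding Xi_def by (intro A.C_mul ji_dens X)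
 define Y where "Y i \<sigma> = dmul (bs (?P \<sigma>)) (Xi i)" for i \<sigma>
 have Y: "Y i \<sigma> \<in> dens W M" for i \<sigma> unfolding Y_def by (intro A.C_mul PP_dens Xi)
 have Y0: "Y i \<sigma> = 0" if "mi_size \<sigma> \<ge> N" for i \<sigma>
 proof -
  have "bs (?P \<sigma>) = bs (\<lambda>x. 0)"
   by (rule base_fun_cong) (use that b PP_order[OF c d, of _ b "(\<alpha>, \<sigma>)" k] in simp)
  then show ?thesis by (simp add: Y_def)
 qed
 have dY: "dmul (bs (bder i (?P \<sigma>))) (Xi i) \<in> dens W M" for i \<sigma>
  by (intro A.C_mul bs_dens smooth_along_pder PP_smooth c d Xi)
 let ?A = "\<lambda>i \<sigma>. dmul (bs (bder i (?P \<sigma>))) (Xi i)" let ?L = "\<lambda>i \<sigma>. if \<sigma> i > 0 then Y i (down i \<sigma>) else 0"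
 have low: "(?L i \<sigma>) \<in> dens W M" for i \<sigma> using Y A.C_zero by simp
 have split: "dmul (bs (\<lambda>x. PP k c d x (raise j b) (\<alpha>, \<sigma>))) X = (\<Sum>i\<in>UNIV.
   ?A i \<sigma> + (?L i \<sigma>))" for \<sigma>
 proof (rule Phi_ext[OF A.C_mul[OF PP_dens X] A.C_sum])
  show "?A i \<sigma> + (?L i \<sigma>) \<in> dens W M" for i
   by (intro A.C_add dY low)
  fix p :: "('n, 'm) jet" and l assume p: "fst p \<in> W"
  have "PP k c d (fst p) (raise j b) (\<alpha>, \<sigma>) =
    (\<Sum>i\<in>UNIV. jac_inv c d (fst p) $ i $ j * (\<Sum>m\<in>UNIV. J (fst p) $ m $ i * PP k c d (fst p) (raise m b) (\<alpha>, \<sigma>)))"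
  proof -
   have "(\<Sum>i\<in>UNIV. jac_inv c d (fst p) $ i $ j * (\<Sum>m\<in>UNIV. J (fst p) $ m $ i * PP k c d (fst p) (raise m b) (\<alpha>, \<sigma>))) =
     (\<Sum>m\<in>UNIV. (\<Sum>i\<in>UNIV. J (fst p) $ m $ i * jac_inv c d (fst p) $ i $ j) * PP k c d (fst p) (raise m b) (\<alpha>, \<sigma>))"
    unfolding sum_distrib_left sum_distrib_right by (subst sum.swap) (simp add: mult_ac)
   then show ?thesis unfolding jac_inv_def jacobian_inverse_sum(1)[OF c d p]
    by (simp add: if_distrib[of "\<lambda>t. t * _"] cong: if_cong)
  qed
  then have e: "PP k c d (fst p) (raise j b) (\<alpha>, \<sigma>) = (\<Sum>i\<in>UNIV. jac_inv c d (fst p) $ i $ j *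
    (bder i (?P \<sigma>) (fst p) + (if \<sigma> i > 0 then ?P (down i \<sigma>) (fst p) else 0)))"
   unfolding PP_raise[OF c d p] lower_def fst_conv snd_conv .
  show "dmul (bs (\<lambda>x. PP k c d x (raise j b) (\<alpha>, \<sigma>))) X p l = (\<Sum>i\<in>UNIV.
   ?A i \<sigma> + (?L i \<sigma>)) p l"
   unfolding bs_mul_in[OF p] e sum_apply sum_distrib_right plus_fun_apply Y_def Xi_def
   by (rule sum.cong[OF refl]) (auto simp: bs_mul_in[OF p] algebra_simps)
 qed
 have "tsum k \<alpha> N (raise j b) X = (\<Sum>\<sigma>\<in>mis N. \<Sum>i\<in>UNIV.
   adj W \<sigma> (?A i \<sigma>) + adj W \<sigma> (?L i \<sigma>))"
  unfolding tsum_def split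
 proof (rule sum.cong[OF refl])
  fix \<sigma> :: "'n multi_index"
  show "adj W \<sigma> (\<Sum>i\<in>UNIV. ?A i \<sigma> + (?L i \<sigma>)) =
    (\<Sum>i\<in>UNIV. adj W \<sigma> (?A i \<sigma>) + adj W \<sigma> (?L i \<sigma>))"
   by (subst A.ad_sum[where N = M], rule A.C_add[OF dY low])
    (rule sum.cong[OF refl], rule A.ad_add[OF A.CC_I[OF dY] A.CC_I[OF low]])
 qed
 also have "\<dots> = (\<Sum>i\<in>UNIV. (\<Sum>\<sigma>\<in>mis N. adj W \<sigma> (?A i \<sigma>)) +
   (\<Sum>\<sigma>\<in>mis N. adj W \<sigma> (?L i \<sigma>)))"
  by (subst sum.swap) (simp only: sum.distrib)
 also have "\<dots> = (\<Sum>i\<in>UNIV. - tsum k \<alpha> N b (dD W i (Xi i)))"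
 proof (rule sum.cong[OF refl])
  fix i :: 'n
  have "(\<Sum>\<sigma>\<in>mis N. adj W \<sigma> (?L i \<sigma>)) = - (\<Sum>\<sigma>\<in>mis N. dD W i (adj W \<sigma> (Y i \<sigma>)))"
   by (rule A.sum_ad_shift[OF A.CC_I[OF Y] Y0])
  also have "(\<Sum>\<sigma>\<in>mis N. dD W i (adj W \<sigma> (Y i \<sigma>))) = (\<Sum>\<sigma>\<in>mis N. adj W \<sigma> (?A i \<sigma>) +
    adj W \<sigma> (dmul (bs (?P \<sigma>)) (dD W i (Xi i))))"
  proof (rule sum.cong[OF refl])
   fix \<sigma> :: "'n multi_index"
   have "dmul (bs (?P \<sigma>)) (dD W i (Xi i)) \<in> dens W (Suc M)" by (intro A.C_mul PP_dens A.C_D Xi)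
   moreover have "dD W i (Y i \<sigma>) = ?A i \<sigma> + dmul (bs (?P \<sigma>)) (dD W i (Xi i))"
    unfolding Y_def by (rule D_bs[OF PP_smooth[OF c d] Xi])
   ultimately show "dD W i (adj W \<sigma> (Y i \<sigma>)) = adj W \<sigma> (?A i \<sigma>) +
     adj W \<sigma> (dmul (bs (?P \<sigma>)) (dD W i (Xi i)))"
    using A.ad_D[OF A.CC_I[OF Y], of \<sigma> i] A.ad_add[OF A.CC_I[OF dY] A.CC_I] by metis
  qed
  finally show "(\<Sum>\<sigma>\<in>mis N. adj W \<sigma> (?A i \<sigma>)) +
   (\<Sum>\<sigma>\<in>mis N. adj W \<sigma> (?L i \<sigma>)) = - tsum k \<alpha> N b (dD W i (Xi i))"
   by (simp only: sum.distrib tsum_def minus_add_distrib add_minus_cancel)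
 qed
 also have "\<dots> = - tsum k \<alpha> N b (\<Sum>i\<in>UNIV. dD W i (Xi i))"
  by (simp only: sum_negf tsum_sum[OF A.C_D[OF Xi]])
 finally show ?thesis by (simp add: Xi_def)
qed

text \<open>Each step of the recursion of \<open>tsum_raise\<close> has the form of \<open>piola_Phi\<close>, so the total derivatives
 pass through the pull-back one at a time, and only the fibre matrix remains.\<close>

lemma tsum_det:
 "F \<in> A'.CC ==> mi_size \<tau> \<le> N ==> tsum k \<alpha> N (\<beta>, \<tau>) (dmul bd (\<Phi> F)) =
   dmul bd (dmul (bs (\<lambda>x. fibre_matrix k c d x $ \<beta> $ \<alpha>)) (\<Phi> (adj W' \<tau> F)))"
proof (induction \<tau> arbitrary: F rule: multi_index_induct)
 case zero
 have "adj W \<sigma> (dmul (bs (\<lambda>x. PP k c d x (\<beta>, \<lambda>_. 0) (\<alpha>, \<sigma>))) (dmul bd (\<Phi> F))) =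
   (if \<sigma> = (\<lambda>_. 0) then dmul (bs (\<lambda>x. fibre_matrix k c d x $ \<beta> $ \<alpha>)) (dmul bd (\<Phi> F)) else 0)" for \<sigma>
 proof -
  have "bs (\<lambda>x. PP k c d x (\<beta>, \<lambda>_. 0) (\<alpha>, \<sigma>)) = bs (\<lambda>x. if \<sigma> = (\<lambda>_. 0) then fibre_matrix k c d x $ \<beta> $ \<alpha> else 0)"
   by (rule base_fun_cong) (simp add: PP_0[OF c d])
  then show ?thesis by (cases "\<sigma> = (\<lambda>_. 0)") simp_all
 qed
 moreover have "(\<lambda>_ :: 'n. 0) \<in> mis N" by (simp add: mis_def)
 ultimately show ?case by (simp add: tsum_def bs_commute)
next
 case (up j \<tau>)
 obtain M where F: "F \<in> dens W' M" using up.prems by (auto simp: A'.CC_def)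
 have "tsum k \<alpha> N (\<beta>, up j \<tau>) (dmul bd (\<Phi> F)) = - tsum k \<alpha> N (\<beta>, \<tau>) (dmul bd (\<Phi> (dD W' j F)))"
  using tsum_raise[OF A.C_mul[OF bd_dens Phi_dens[OF F]], of "(\<beta>, \<tau>)" N k \<alpha> j] up.prems
  unfolding piola_Phi[OF F] by (simp add: raise_up)
 also have "tsum k \<alpha> N (\<beta>, \<tau>) (dmul bd (\<Phi> (dD W' j F))) =
   dmul bd (dmul (bs (\<lambda>x. fibre_matrix k c d x $ \<beta> $ \<alpha>)) (\<Phi> (adj W' \<tau> (dD W' j F))))"
  using up.prems by (intro up.IH A'.D_CC) auto
 also have "adj W' \<tau> (dD W' j F) = - adj W' (up j \<tau>) F"
  by (simp add: A'.ad_D[OF A'.CC_I[OF F]] A'.ad_up[OF A'.CC_I[OF F]])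
 also have "\<Phi> (- adj W' (up j \<tau>) F) = - \<Phi> (adj W' (up j \<tau>) F)"
  by (rule Phi_minus[OF A'.C_ad[OF F]])
 finally show ?case by (simp only: A.mul_minus_right minus_minus)
qed

lemma euler_Phi:
 assumes f: "f \<in> dens W' N"
 shows "euler_op W k \<alpha> (dmul bd (\<Phi> f)) =
  (\<Sum>\<beta>\<in>UNIV. dmul bd (dmul (bs (\<lambda>x. fibre_matrix k c d x $ \<beta> $ \<alpha>)) (\<Phi> (euler_op W' k \<beta> f))))"
proof -
 have X: "dmul bd (\<Phi> f) \<in> dens W N" by (intro A.C_mul bd_dens Phi_dens f)
 have fb: "dpd W' k b f \<in> dens W' N" for b by (rule A'.C_pd[OF f])
 have m: "dmul (bs (\<lambda>x. PP k c d x b a)) (dmul bd (\<Phi> (dpd W' k b f))) \<in> dens W N" for a b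
  by (intro A.C_mul PP_dens bd_dens Phi_dens fb)
 have pd: "dpd W k a (dmul bd (\<Phi> f)) = (\<Sum>b\<in>idx N. dmul (bs (\<lambda>x. PP k c d x b a)) (dmul bd (\<Phi> (dpd W' k b f))))" for a
 proof -
  have "dpd W k a (dmul bd (\<Phi> f)) = dmul bd (dpd W k a (\<Phi> f))"
   by (simp add: A.pd_mul[OF bd_dens Phi_dens[OF f]] dpd_base_fun[OF W] dpar_base_fun)
  then show ?thesis unfolding Phi_dpd[OF f] A.mul_sum_right by (simp only: bs_commute)
 qed
 have "euler_op W k \<alpha> (dmul bd (\<Phi> f)) = (\<Sum>b\<in>idx N. tsum k \<alpha> N b (dmul bd (\<Phi> (dpd W' k b f))))"
  unfolding A.E_eq[OF X order_refl] pd tsum_def A.ad_sum[OF m] by (rule sum.swap)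
 also have "\<dots> = (\<Sum>\<beta>\<in>UNIV. \<Sum>\<tau>\<in>mis N. dmul bd (dmul (bs (\<lambda>x. fibre_matrix k c d x $ \<beta> $ \<alpha>)) (\<Phi> (adj W' \<tau> (dpd W' k (\<beta>, \<tau>) f)))))"
  unfolding sum_idx
  by (rule sum.cong[OF refl], rule sum.cong[OF refl]) (simp add: tsum_det[OF A'.CC_I[OF fb]] mis_def)
 also have "\<dots> = (\<Sum>\<beta>\<in>UNIV. dmul bd (dmul (bs (\<lambda>x. fibre_matrix k c d x $ \<beta> $ \<alpha>)) (\<Phi> (euler_op W' k \<beta> f))))"
 proof (rule sum.cong[OF refl])
  fix \<beta> :: 'm
  have "\<Phi> (euler_op W' k \<beta> f) = (\<Sum>\<tau>\<in>mis N. \<Phi> (adj W' \<tau> (dpd W' k (\<beta>, \<tau>) f)))"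
   unfolding A'.E_eq[OF f order_refl]
   by (rule Phi_sum[where N = "N + N"], rule A'.C_le[OF A'.C_ad[OF fb]]) (simp add: mis_def)
  then show "(\<Sum>\<tau>\<in>mis N. dmul bd (dmul (bs (\<lambda>x. fibre_matrix k c d x $ \<beta> $ \<alpha>)) (\<Phi> (adj W' \<tau> (dpd W' k (\<beta>, \<tau>) f))))) =
    dmul bd (dmul (bs (\<lambda>x. fibre_matrix k c d x $ \<beta> $ \<alpha>)) (\<Phi> (euler_op W' k \<beta> f)))"
   by (simp only: A.mul_sum_right)
 qed
 finally show ?thesis .
qed

lemma chr_Phi:
 assumes f: "f \<in> dens W' N"
 shows "A.chr (dmul bd (\<Phi> f)) k \<alpha> =
  (\<Sum>\<beta>\<in>UNIV. dmul bd (dmul (bs (\<lambda>x. fibre_matrix (\<not> k) c d x $ \<beta> $ \<alpha>)) (\<Phi> (A'.chr f k \<beta>))))"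
proof (cases k)
 case True
 then show ?thesis by (simp add: A.chr_def A'.chr_def euler_Phi[OF f])
next
 case False
 have "\<Phi> (- dpar (euler_op W' True \<beta> f)) = - dpar (\<Phi> (euler_op W' True \<beta> f))" for \<beta>
  by (simp only: Phi_minus[OF A'.C_par[OF A'.C_E[OF f]]] Phi_par[OF A'.C_E[OF f]])
 then show ?thesis using False
  by (simp add: A.chr_def A'.chr_def euler_Phi[OF f] A.par_sum A.par_mul dpar_base_fun sum_negf)
qed

lemma fibre_matrix_dual:
 assumes x: "x \<in> W"
 shows "(\<Sum>\<alpha>\<in>UNIV. dt x * fibre_matrix (\<not> k) c d x $ \<beta> $ \<alpha> * fibre_matrix k c d x $ \<beta>' $ \<alpha>) = (if \<beta> = \<beta>' then 1 else 0)"
proof -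
 let ?M = "bundle_matrix B c d x" and ?N = "bundle_matrix B d c (base_trans c d x)"
 have "?N ** ?M = mat 1"
  using bundle_matrix_cocycle[OF c d c triple_self[OF x c]] bundle_matrix_self[OF c] x overlap_iff[OF c] by auto
 then have "?M ** ?N = mat 1" using matrix_left_right_inverse by blast
 then have MN: "(\<Sum>\<alpha>\<in>UNIV. ?M $ \<beta> $ \<alpha> * ?N $ \<alpha> $ \<beta>') = (if \<beta> = \<beta>' then 1 else 0)" for \<beta> \<beta>'
  by (simp add: matrix_matrix_mult_def mat_def vec_eq_iff)
 have C: "dt x * codensity_matrix B c d x $ \<beta> $ \<alpha> = ?N $ \<alpha> $ \<beta>" for \<beta> \<alpha>
  using det_inverse[OF c d x] by (simp add: codensity_matrix_eq[OF c d x] transpose_def)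
    (metis mult.assoc mult.commute mult_1)
 have C': "dt x * a * codensity_matrix B c d x $ \<beta> $ \<alpha> = a * ?N $ \<alpha> $ \<beta>" for \<beta> \<alpha> a
  using C[of \<beta> \<alpha>] by (metis mult.assoc mult.commute)
 show ?thesis
 proof (cases k)
  case True
  then show ?thesis using MN[of \<beta> \<beta>'] by (simp add: fibre_matrix_def C')
 next
  case False
  have "(\<Sum>\<alpha>\<in>UNIV. ?N $ \<alpha> $ \<beta> * ?M $ \<beta>' $ \<alpha>) = (if \<beta> = \<beta>' then 1 else 0)"
   using MN[of \<beta>' \<beta>] by (simp add: mult.commute eq_commute)
  then show ?thesis using False by (simp add: fibre_matrix_def C)
 qed
qed

lemma dmul_sum_bs:
 assumes p: "fst p \<in> W"
 shows "dmul (\<Sum>\<beta>\<in>UNIV. dmul bd (dmul (bs (u \<beta>)) (y \<beta>))) (\<Sum>\<beta>'\<in>UNIV. dmul bd (dmul (bs (v \<beta>')) (z \<beta>'))) p l =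
  (\<Sum>\<beta>\<in>UNIV. \<Sum>\<beta>'\<in>UNIV. dt (fst p) * (dt (fst p) * u \<beta> (fst p) * v \<beta>' (fst p)) * dmul (y \<beta>) (z \<beta>') p l)"
proof -
 have "dmul (dmul bd (dmul (bs u) y)) (dmul bd (dmul (bs v) z)) p l =
   dt (fst p) * (dt (fst p) * u (fst p) * v (fst p)) * dmul y z p l" for u v y z
  by (simp only: dmul_base_assoc dmul_base_commute[of y] bs_mul_in[OF p] mult_ac)
 then show ?thesis by (simp add: A.mul_sum_left A.mul_sum_right sum_apply) (rule sum.swap)
qed

text \<open>Both factors of the bracket carry \<open>det J\<close>. The two fibre matrices are inverse to each other up to one
 factor \<open>det J\<close> (\<open>fibre_matrix_dual\<close>), which leaves the single one of an \<open>n\<close>-form.\<close>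

theorem bracket_Phi:
 assumes f: "f \<in> dens W' N" and g: "g \<in> dens W' N"
 shows "bracket W (dmul bd (\<Phi> f)) (dmul bd (\<Phi> g)) = dmul bd (\<Phi> (bracket W' f g))"
proof (rule Phi_ext)
 show "bracket W (dmul bd (\<Phi> f)) (dmul bd (\<Phi> g)) \<in> dens W (N + N)"
  by (intro A.C_br A.C_mul bd_dens Phi_dens f g)
 show "dmul bd (\<Phi> (bracket W' f g)) \<in> dens W (N + N)"
  by (intro A.C_mul bd_dens Phi_dens A'.C_br f g)
 fix p :: "('n, 'm) jet" and l assume p: "fst p \<in> W"
 let ?z = "\<lambda>k \<beta> \<beta>'. dmul (\<Phi> (A'.chr f k \<beta>)) (\<Phi> (euler_op W' k \<beta>' g)) p l"
 have "bracket W (dmul bd (\<Phi> f)) (dmul bd (\<Phi> g)) p l = (\<Sum>\<alpha>\<in>UNIV. \<Sum>k\<in>UNIV. \<Sum>\<beta>\<in>UNIV. \<Sum>\<beta>'\<in>UNIV.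
   dt (fst p) * (dt (fst p) * fibre_matrix (\<not> k) c d (fst p) $ \<beta> $ \<alpha> * fibre_matrix k c d (fst p) $ \<beta>' $ \<alpha>) * ?z k \<beta> \<beta>')"
  unfolding A.br_def chr_Phi[OF f] euler_Phi[OF g] sum_apply dmul_sum_bs[OF p] ..
 also have "\<dots> = (\<Sum>k\<in>UNIV. \<Sum>\<beta>\<in>UNIV. \<Sum>\<beta>'\<in>UNIV. \<Sum>\<alpha>\<in>UNIV.
   dt (fst p) * (dt (fst p) * fibre_matrix (\<not> k) c d (fst p) $ \<beta> $ \<alpha> * fibre_matrix k c d (fst p) $ \<beta>' $ \<alpha>) * ?z k \<beta> \<beta>')"
  by (subst sum.swap, rule sum.cong[OF refl], subst sum.swap, rule sum.cong[OF refl], rule sum.swap)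
 also have "\<dots> = (\<Sum>k\<in>UNIV. \<Sum>\<beta>\<in>UNIV. \<Sum>\<beta>'\<in>UNIV. dt (fst p) * (if \<beta> = \<beta>' then 1 else 0) * ?z k \<beta> \<beta>')"
 proof (rule sum.cong[OF refl], rule sum.cong[OF refl], rule sum.cong[OF refl])
  fix k :: bool and \<beta> \<beta>' :: 'm
  have "(\<Sum>\<alpha>\<in>UNIV. dt (fst p) * (dt (fst p) * fibre_matrix (\<not> k) c d (fst p) $ \<beta> $ \<alpha> * fibre_matrix k c d (fst p) $ \<beta>' $ \<alpha>) * ?z k \<beta> \<beta>') =
    dt (fst p) * (\<Sum>\<alpha>\<in>UNIV. dt (fst p) * fibre_matrix (\<not> k) c d (fst p) $ \<beta> $ \<alpha> * fibre_matrix k c d (fst p) $ \<beta>' $ \<alpha>) * ?z k \<beta> \<beta>'"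
   by (simp only: sum_distrib_left sum_distrib_right)
  then show "(\<Sum>\<alpha>\<in>UNIV. dt (fst p) * (dt (fst p) * fibre_matrix (\<not> k) c d (fst p) $ \<beta> $ \<alpha> * fibre_matrix k c d (fst p) $ \<beta>' $ \<alpha>) * ?z k \<beta> \<beta>') =
    dt (fst p) * (if \<beta> = \<beta>' then 1 else 0) * ?z k \<beta> \<beta>'"
   unfolding fibre_matrix_dual[OF p] .
 qed
 also have "\<dots> = dt (fst p) * (\<Sum>k\<in>UNIV. \<Sum>\<beta>\<in>UNIV. ?z k \<beta> \<beta>)"
 proof -
  have "(\<Sum>\<beta>'\<in>UNIV. dt (fst p) * (if \<beta> = \<beta>' then 1 else 0) * ?z k \<beta> \<beta>') = dt (fst p) * ?z k \<beta> \<beta>" for k \<beta>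
   by (simp add: if_distrib[of "\<lambda>t. _ * t"] if_distrib[of "\<lambda>t. t * _"] cong: if_cong)
  then show ?thesis by (simp add: sum_distrib_left)
 qed
 also have "(\<Sum>k\<in>UNIV. \<Sum>\<beta>\<in>UNIV. ?z k \<beta> \<beta>) = \<Phi> (bracket W' f g) p l"
 proof -
  have m: "dmul (A'.chr f k \<beta>) (euler_op W' k \<beta> g) \<in> dens W' (N + N)" for k \<beta>
   by (intro A'.C_mul A'.C_chr A'.C_E f g)
  have "\<Phi> (bracket W' f g) = (\<Sum>\<beta>\<in>UNIV. \<Sum>k\<in>UNIV. \<Phi> (dmul (A'.chr f k \<beta>) (euler_op W' k \<beta> g)))"
   unfolding A'.br_def by (simp only: Phi_sum[OF A'.C_sum[OF m]] Phi_sum[OF m])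
  then show ?thesis
   by (simp only: sum_apply Phi_mul[OF A'.C_chr[OF f] A'.C_E[OF g]]) (rule sum.swap)
 qed
 finally show "bracket W (dmul bd (\<Phi> f)) (dmul bd (\<Phi> g)) p l = dmul bd (\<Phi> (bracket W' f g)) p l"
  by (simp add: bs_mul_in[OF p])
qed

end

context oriented_bundle
begin

lemma chart_pairI: "c \<in> charts B ==> d \<in> charts B ==> chart_pair B c d"
 by unfold_locales

lemma top_form_iff: "top_form B \<omega> \<longleftrightarrow> (\<exists>N. \<forall>c\<in>charts B. regular_density N (base_image c) (\<omega> c)) \<and>
  (\<forall>c\<in>charts B. \<forall>d\<in>charts B. cut (overlap c d) (\<omega> c) =
   dmul (base_fun (overlap c d) (\<lambda>x. det (jacobian c d x))) (Phi c d (cut (overlap d c) (\<omega> d))))"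
proof -
 have "(\<forall>x\<in>overlap c d. \<forall>q l. \<omega> c (x, q) l = det (jacobian c d x) * pull_density B c d (\<omega> d) (x, q) l) \<longleftrightarrow>
   cut (overlap c d) (\<omega> c) =
   dmul (base_fun (overlap c d) (\<lambda>x. det (jacobian c d x))) (Phi c d (cut (overlap d c) (\<omega> d)))"
  if c: "c \<in> charts B" and d: "d \<in> charts B" for c d
 proof -
  have e: "pull_density B c d (cut (overlap d c) (\<omega> d)) p = pull_density B c d (\<omega> d) p" if "fst p \<in> overlap c d" for p
   using trans_facts(1)[OF c d that] by (simp add: pull_density_def)
  show ?thesis
  proof
   assume L: "\<forall>x\<in>overlap c d. \<forall>q l. \<omega> c (x, q) l = det (jacobian c d x) * pull_density B c d (\<omega> d) (x, q) l"
   show "cut (overlap c d) (\<omega> c) =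
    dmul (base_fun (overlap c d) (\<lambda>x. det (jacobian c d x))) (Phi c d (cut (overlap d c) (\<omega> d)))"
   proof (intro ext)
    fix p l
    show "cut (overlap c d) (\<omega> c) p l =
     dmul (base_fun (overlap c d) (\<lambda>x. det (jacobian c d x))) (Phi c d (cut (overlap d c) (\<omega> d))) p l"
     using L e[of p] by (cases p) (simp add: dmul_base_fun Phi_def cut_def)
   qed
  next
   assume R: "cut (overlap c d) (\<omega> c) =
    dmul (base_fun (overlap c d) (\<lambda>x. det (jacobian c d x))) (Phi c d (cut (overlap d c) (\<omega> d)))"
   show "\<forall>x\<in>overlap c d. \<forall>q l. \<omega> c (x, q) l = det (jacobian c d x) * pull_density B c d (\<omega> d) (x, q) l"
   proof (intro ballI allI)
    fix x q l assume x: "x \<in> overlap c d"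
    from fun_cong[OF fun_cong[OF R, of "(x, q)"], of l] x e[of "(x, q)"]
    show "\<omega> c (x, q) l = det (jacobian c d x) * pull_density B c d (\<omega> d) (x, q) l"
     by (simp add: dmul_base_fun Phi_def cut_def)
   qed
  qed
 qed
 then show ?thesis unfolding top_form_def by blast
qed

lemma overlap_sub: "overlap c d \<subseteq> base_image c" by (auto simp: overlap_def base_image_def)

lemma top_form_order:
 assumes "top_form B f" "top_form B g"
 obtains N where "\<And>c. c \<in> charts B ==> regular_density N (base_image c) (f c)"
  "\<And>c. c \<in> charts B ==> regular_density N (base_image c) (g c)"
proof -
 obtain N1 N2 where "\<And>c. c \<in> charts B ==> regular_density N1 (base_image c) (f c)"
  "\<And>c. c \<in> charts B ==> regular_density N2 (base_image c) (g c)"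
  using assms unfolding top_form_iff by blast
 note N = this and R = regular_density_mono[OF chart_facts(2)]
 show ?thesis
  by (rule that[of "max N1 N2"])
   (rule R[OF _ N(1) max.cobounded1], assumption+, rule R[OF _ N(2) max.cobounded2], assumption+)
qed

theorem top_form_schouten:
 assumes f: "top_form B f" and g: "top_form B g"
 shows "top_form B (\<lambda>c. schouten_density (f c) (g c))"
proof -
 obtain N where N: "\<And>c. c \<in> charts B ==> regular_density N (base_image c) (f c)"
  "\<And>c. c \<in> charts B ==> regular_density N (base_image c) (g c)" by (rule top_form_order[OF f g]) blast
 have o: "regular_density N (overlap c d) (f c)" "regular_density N (overlap c d) (g c)" if c: "c \<in> charts B" for c d
  by (rule regular_density_subset[OF N(1)[OF c] overlap_sub], rule regular_density_subset[OF N(2)[OF c] overlap_sub])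
 have "regular_density (N + N) (base_image c) (schouten_density (f c) (g c))" if "c \<in> charts B" for c
  by (rule regular_schouten_density[OF chart_facts(2)[OF that] N[OF that]])
 moreover have "cut (overlap c d) (schouten_density (f c) (g c)) =
   dmul (base_fun (overlap c d) (\<lambda>x. det (jacobian c d x))) (Phi c d (cut (overlap d c) (schouten_density (f d) (g d))))"
  if c: "c \<in> charts B" and d: "d \<in> charts B" for c d
 proof -
  interpret chart_pair B c d by (rule chart_pairI[OF c d])
  have "cut W (f c) = dmul bd (\<Phi> (cut W' (f d)))" "cut W (g c) = dmul bd (\<Phi> (cut W' (g d)))"
   using f g c d unfolding top_form_iff by blast+
  then show ?thesis unfolding cut_schouten[OF W o[OF c]] cut_schouten[OF W' o[OF d]]
   using bracket_Phi[OF cut_dens[OF W' o(1)[OF d]] cut_dens[OF W' o(2)[OF d]]] by simp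
 qed
 ultimately show ?thesis unfolding top_form_iff by blast
qed

end

section \<open>Smooth cut-off functions on the base\<close>

text \<open>The functions \<open>p(1/t) exp(-1/t)\<close>, extended by zero; they are flat at the origin and closed under
 differentiation.\<close>

definition flat :: "real poly => real => real" where
 "flat p t = (if 0 < t then poly p (1 / t) * exp (- (1 / t)) else 0)"

lemma poly_exp_tendsto: "((\<lambda>x. poly q x * exp (- x)) \<longlongrightarrow> 0) (at_top :: real filter)"
proof -
 have "((\<lambda>x. \<Sum>i\<le>degree q. coeff q i * (x ^ i / exp x)) \<longlongrightarrow> (\<Sum>i\<le>degree q. coeff q i * 0)) (at_top :: real filter)"
  by (intro tendsto_intros tendsto_power_div_exp_0)
 then show ?thesis by (simp add: poly_altdef sum_distrib_right exp_minus divide_inverse mult.assoc)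
qed

lemma flat_deriv: "(flat p has_real_derivative flat ([:0, 0, 1:] * (p - pderiv p)) t) (at t)"
proof -
 consider "t > 0" | "t < 0" | "t = 0" by linarith
 then show ?thesis
 proof cases
  case 1
  have i: "((\<lambda>t. 1 / t) has_real_derivative - (1 / t * (1 / t))) (at t)"
   using 1 by (auto intro!: derivative_eq_intros simp: field_simps)
  have "((\<lambda>t. poly p (1 / t) * exp (- (1 / t))) has_real_derivative
    poly (pderiv p) (1 / t) * - (1 / t * (1 / t)) * exp (- (1 / t)) +
    exp (- (1 / t)) * - (- (1 / t * (1 / t))) * poly p (1 / t)) (at t)"
   by (rule DERIV_mult[OF DERIV_chain2[OF poly_DERIV i] DERIV_chain2[OF DERIV_exp DERIV_minus[OF i]]])
  then have "((\<lambda>t. poly p (1 / t) * exp (- (1 / t))) has_real_derivative flat ([:0, 0, 1:] * (p - pderiv p)) t) (at t)"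
   by (rule DERIV_cong) (use 1 in \<open>simp add: flat_def algebra_simps\<close>)
  then show ?thesis
   by (rule has_field_derivative_transform_within_open[where S = "{0<..}"]) (use 1 in \<open>auto simp: flat_def\<close>)
 next
  case 2
  have "((\<lambda>t. 0) has_real_derivative flat ([:0, 0, 1:] * (p - pderiv p)) t) (at t)" using 2 by (simp add: flat_def)
  then show ?thesis
   by (rule has_field_derivative_transform_within_open[where S = "{..<0}"]) (use 2 in \<open>auto simp: flat_def\<close>)
 next
  case 3
  have "((\<lambda>h. (flat p h - flat p 0) / h) \<longlongrightarrow> 0) (at 0)"
  proof (rule filterlim_split_at)
   show "((\<lambda>h. (flat p h - flat p 0) / h) \<longlongrightarrow> 0) (at_left 0)"
    by (rule tendsto_eventually) (auto simp: eventually_at_filter flat_def)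
   have "((\<lambda>h. poly (pCons 0 p) (inverse h) * exp (- inverse h)) \<longlongrightarrow> 0) (at_right (0::real))"
    by (rule filterlim_compose[OF poly_exp_tendsto filterlim_inverse_at_top_right])
   then show "((\<lambda>h. (flat p h - flat p 0) / h) \<longlongrightarrow> 0) (at_right 0)"
    by (rule Lim_transform_eventually) (auto simp: eventually_at_filter flat_def field_simps)
  qed
  then show ?thesis using 3 by (simp add: has_field_derivative_iff flat_def)
 qed
qed

lemma smooth_flat:
 fixes S :: "(real^'n::finite) set"
 assumes S: "open S"
 shows "base_smooth S (\<lambda>y. flat p (a + b * y $ i))"
proof (rule base.smooth_along_coinduct[OF S, where X = "\<lambda>g. \<exists>r p. g = (\<lambda>y. r * flat p (a + b * y $ i))"])
 show "\<exists>r q. (\<lambda>y. flat p (a + b * y $ i)) = (\<lambda>y. r * flat q (a + b * y $ i))"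
  by (intro exI[of _ 1] exI[of _ p]) simp
 fix g :: "real^'n => real" assume "\<exists>r p. g = (\<lambda>y. r * flat p (a + b * y $ i))"
 then obtain r p where g: "g = (\<lambda>y. r * flat p (a + b * y $ i))" by blast
 have "continuous_on UNIV (flat p)" by (rule DERIV_continuous_on[OF has_field_derivative_at_within[OF flat_deriv]])
 then show "continuous_on S g" unfolding g
  by (intro continuous_on_mult[OF continuous_on_const] continuous_on_compose2[of UNIV "flat p" S "\<lambda>y. a + b * y $ i"])
   (auto intro!: continuous_intros)
 have D: "((\<lambda>t. g (base_shift c t y)) has_real_derivative
   r * (flat ([:0, 0, 1:] * (p - pderiv p)) (a + b * y $ i) * (b * (if i = c then 1 else 0)))) (at 0)" for c y
 proof -
  have "((\<lambda>t. a + b * base_shift c t y $ i) has_real_derivative b * (if i = c then 1 else 0)) (at 0)"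
   unfolding base.co_sh by (auto intro!: derivative_eq_intros)
  from DERIV_cmult[OF DERIV_chain2[OF flat_deriv this, of p], of r]
  show ?thesis unfolding g by (simp only: base.sh_0)
 qed
 show "(\<lambda>t. g (base_shift c t y)) field_differentiable at 0" for c y
  using D field_differentiable_def by blast
 show "\<exists>g'. (\<exists>r p. g' = (\<lambda>y. r * flat p (a + b * y $ i))) \<and> (\<forall>y\<in>S. bder c g y = g' y)" for c
  by (intro exI[of _ "\<lambda>y. (r * (b * (if i = c then 1 else 0))) * flat ([:0, 0, 1:] * (p - pderiv p)) (a + b * y $ i)"] conjI)
   (blast, rule ballI, rule pderI, rule DERIV_cong[OF D], simp)
qed

text \<open>The quotients by powers of \<open>g\<close> are closed under partial derivatives.\<close>

lemma (in commuting_flows) smooth_divide: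
 assumes S: "open S" and f: "smooth_along sh S f" and g: "smooth_along sh S g" and g0: "\<And>p. p \<in> S ==> g p \<noteq> 0"
 shows "smooth_along sh S (\<lambda>p. f p / g p)"
proof (rule smooth_along_coinduct[OF S, where X = "\<lambda>h. \<exists>F k. smooth_along sh S F \<and> h = (\<lambda>p. F p / g p ^ k)"])
 show "\<exists>F k. smooth_along sh S F \<and> (\<lambda>p. f p / g p) = (\<lambda>p. F p / g p ^ k)"
  by (intro exI[of _ f] exI[of _ 1]) (simp add: f)
 fix h assume "\<exists>F k. smooth_along sh S F \<and> h = (\<lambda>p. F p / g p ^ k)"
 then obtain F k where F: "smooth_along sh S F" and h: "h = (\<lambda>p. F p / g p ^ k)" by blast
 show "continuous_on S h" unfolding h
  by (intro continuous_intros smooth_along_continuous[OF F] smooth_along_continuous[OF g]) (use g0 in auto)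
 have D: "((\<lambda>t. h (sh c t p)) has_real_derivative
   (pder sh c F p * g p - real k * F p * pder sh c g p) / g p ^ Suc k) (at 0)" if p: "p \<in> S" for c p
  unfolding h
  by (rule DERIV_cong[OF DERIV_divide[OF smooth_DERIV[OF F p] DERIV_power[OF smooth_DERIV[OF g p]]]])
   (use g0[OF p] in \<open>cases k; simp add: field_simps\<close>)+
 show "(\<lambda>t. h (sh c t p)) field_differentiable at 0" if "p \<in> S" for c p
  using D[OF that] field_differentiable_def by blast
 have num: "smooth_along sh S (\<lambda>p. pder sh c F p * g p - real k * F p * pder sh c g p)" for c
  by (intro smooth_diff smooth_mult smooth_along_pder smooth_const S F g)
 show "\<exists>h'. (\<exists>F k. smooth_along sh S F \<and> h' = (\<lambda>p. F p / g p ^ k)) \<and> (\<forall>p\<in>S. pder sh c h p = h' p)" for c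
 proof (rule exI[of _ "\<lambda>p. (pder sh c F p * g p - real k * F p * pder sh c g p) / g p ^ Suc k"], intro conjI ballI)
  show "\<exists>G k'. smooth_along sh S G \<and> (\<lambda>p. (pder sh c F p * g p - real k * F p * pder sh c g p) / g p ^ Suc k) = (\<lambda>p. G p / g p ^ k')"
   using num by blast
  show "pder sh c h p = (pder sh c F p * g p - real k * F p * pder sh c g p) / g p ^ Suc k" if "p \<in> S" for p
   by (rule pderI) (rule D[OF that])
 qed
qed

lemma smooth_bump:
 fixes x :: "real^'n::finite"
 assumes e: "\<epsilon> > 0"
 obtains b \<eta> where "base_smooth UNIV b" "\<eta> > 0" "\<And>y. y \<in> ball x \<eta> ==> b y = 1"
  "\<And>y. y \<notin> cball x \<epsilon> ==> b y = (0::real)"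
proof -
 \<comment> \<open>the cube of half-width \<open>2 * \<eta>\<close> lies in the ball of radius \<open>\<epsilon>\<close> by comparison with the sum norm\<close>
 define \<eta> where "\<eta> = \<epsilon> / (2 * real CARD('n))"
 have \<eta>: "\<eta> > 0" and card: "real CARD('n) * (2 * \<eta>) = \<epsilon>" using e by (simp_all add: \<eta>_def)
 \<comment> \<open>\<open>N\<close> is positive exactly inside the cube of half-width \<open>2 * \<eta>\<close>, \<open>D\<close> exactly off the closed one of half-width \<open>\<eta>\<close>\<close>
 define N where "N = (\<lambda>y. \<Prod>i\<in>UNIV. flat 1 ((2 * \<eta> - x $ i) + 1 * y $ i) * flat 1 ((2 * \<eta> + x $ i) + (-1) * y $ i))"
 define D where "D = (\<lambda>y. \<Sum>i\<in>UNIV. flat 1 ((- \<eta> - x $ i) + 1 * y $ i) + flat 1 ((x $ i - \<eta>) + (-1) * y $ i))"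
 have smooth: "base_smooth UNIV N" "base_smooth UNIV D" unfolding N_def D_def
  by (intro base.smooth_prod base.smooth_sum base.smooth_mult base.smooth_add smooth_flat open_UNIV)+
 have f0: "flat 1 t \<ge> 0" and f2: "flat 1 t = 0 \<longleftrightarrow> t \<le> 0" for t by (auto simp: flat_def)
 have N0: "N y \<ge> 0" and D0: "D y \<ge> 0" for y unfolding N_def D_def by (intro prod_nonneg sum_nonneg add_nonneg_nonneg mult_nonneg_nonneg ballI f0)+
 have N1: "N y = 0 \<longleftrightarrow> (\<exists>i. \<bar>y $ i - x $ i\<bar> \<ge> 2 * \<eta>)" for y
 proof -
  have "flat 1 ((2 * \<eta> - x $ i) + 1 * y $ i) * flat 1 ((2 * \<eta> + x $ i) + (-1) * y $ i) = 0 \<longleftrightarrow> \<bar>y $ i - x $ i\<bar> \<ge> 2 * \<eta>" for i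
   unfolding mult_eq_0_iff f2 by arith
  then show ?thesis unfolding N_def prod_zero_iff[OF finite] by blast
 qed
 have D1: "D y = 0 \<longleftrightarrow> (\<forall>i. \<bar>y $ i - x $ i\<bar> \<le> \<eta>)" for y
 proof -
  have "flat 1 ((- \<eta> - x $ i) + 1 * y $ i) + flat 1 ((x $ i - \<eta>) + (-1) * y $ i) = 0 \<longleftrightarrow> \<bar>y $ i - x $ i\<bar> \<le> \<eta>" for i
   unfolding add_nonneg_eq_0_iff[OF f0 f0] f2 by arith
  then show ?thesis unfolding D_def sum_nonneg_eq_0_iff[OF finite add_nonneg_nonneg[OF f0 f0]] by blast
 qed
 have pos: "N y + D y \<noteq> 0" for y
 proof
  assume "N y + D y = 0"
  then have "N y = 0" "D y = 0" using N0[of y] D0[of y] by auto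
  then obtain i where "\<bar>y $ i - x $ i\<bar> \<ge> 2 * \<eta>" "\<bar>y $ i - x $ i\<bar> \<le> \<eta>" unfolding N1 D1 by blast
  then show False using \<eta> by simp
 qed
 show ?thesis
 proof (rule that[of "\<lambda>y. N y / (N y + D y)" \<eta>])
  show "base_smooth UNIV (\<lambda>y. N y / (N y + D y))"
   by (intro base.smooth_divide base.smooth_add smooth pos open_UNIV)
  show "N y / (N y + D y) = 1" if "y \<in> ball x \<eta>" for y
  proof -
   have "\<bar>y $ i - x $ i\<bar> \<le> \<eta>" for i
    using component_le_norm_cart[of "y - x" i] that by (simp add: dist_norm norm_minus_commute)
   then show ?thesis using D1[of y] pos[of y] by auto
  qed
  show "N y / (N y + D y) = 0" if "y \<notin> cball x \<epsilon>" for y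
  proof (rule ccontr)
   assume "N y / (N y + D y) \<noteq> 0"
   then have "\<bar>y $ i - x $ i\<bar> \<le> 2 * \<eta>" for i using N1[of y] by (metis div_0 linear)
   then have "norm (y - x) \<le> (\<Sum>i\<in>(UNIV::'n set). 2 * \<eta>)"
    by (intro order_trans[OF norm_le_l1_cart] sum_mono) simp
   then show False using that card by (simp add: dist_norm norm_minus_commute)
  qed
 qed (rule \<eta>)
qed

context oriented_bundle
begin

abbreviation M :: "'a set" where "M \<equiv> topspace (base B)"

definition smooth_base :: "('a => real) => bool" where
 "smooth_base \<rho> \<longleftrightarrow> (\<forall>c\<in>charts B. base_smooth (base_image c) (\<lambda>x. \<rho> (chart_inv c x)))"

lemma smooth_base_intros:
 shows "smooth_base (\<lambda>u. k)"
  and "smooth_base \<rho> ==> smooth_base \<rho>' ==> smooth_base (\<lambda>u. \<rho> u - \<rho>' u)"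
  and "smooth_base \<rho> ==> smooth_base \<rho>' ==> smooth_base (\<lambda>u. \<rho> u * \<rho>' u)"
  and "(\<And>k. k \<in> K ==> smooth_base (F k)) ==> smooth_base (\<lambda>u. \<Prod>k\<in>K. F k u)"
 unfolding smooth_base_def using chart_facts(2)
 by (auto intro!: base.smooth_diff base.smooth_mult base.smooth_prod)

lemma covers: "u \<in> M ==> \<exists>c\<in>charts B. u \<in> chart_dom c"
 using oriented unfolding oriented_vector_bundle_def by blast

text \<open>A bump function in a chart extends by zero: its support is compact, hence closed as the base is
 a Hausdorff space.\<close>

lemma chart_bump:
 assumes u: "u \<in> M"
 obtains c \<phi> V W where "c \<in> charts B" "smooth_base \<phi>" "openin (base B) V" "M \<subseteq> V \<union> chart_dom c"
  "\<And>v. v \<in> V ==> \<phi> v = 0" "openin (base B) W" "u \<in> W" "\<And>v. v \<in> W ==> \<phi> v = 1"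
proof -
 obtain c where c: "c \<in> charts B" "u \<in> chart_dom c" using covers[OF u] by blast
 have "base_coord c u \<in> base_image c" using c by (auto simp: base_image_def)
 then obtain \<epsilon> where \<epsilon>: "\<epsilon> > 0" "cball (base_coord c u) \<epsilon> \<subseteq> base_image c"
  using chart_facts(2)[OF c(1)] open_contains_cball by blast
 obtain b \<eta> where b: "base_smooth UNIV b" "\<eta> > 0" "\<And>y. y \<in> ball (base_coord c u) \<eta> ==> b y = 1"
  "\<And>y. y \<notin> cball (base_coord c u) \<epsilon> ==> b y = (0::real)" by (rule smooth_bump[OF \<epsilon>(1)]) blast
 define K where "K = chart_inv c ` cball (base_coord c u) \<epsilon>"
 define \<phi> where "\<phi> v = (if v \<in> chart_dom c then b (base_coord c v) else 0)" for v
 have top: "topspace (subtopology (base B) (chart_dom c)) = chart_dom c"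
  using chart_dom_sub[OF c(1)] by (simp add: Int_absorb1)
 have cont: "continuous_map (subtopology (base B) (chart_dom c)) euclidean (base_coord c)"
  using homeomorphic_imp_continuous_map[OF chart_facts(3)[OF c(1)]] continuous_map_in_subtopology by blast
 have "continuous_map (top_of_set (base_image c)) (subtopology (base B) (chart_dom c)) (chart_inv c)"
 proof -
  obtain g where g: "homeomorphic_maps (subtopology (base B) (chart_dom c)) (top_of_set (base_image c)) (base_coord c) g"
   using chart_facts(3)[OF c(1)] homeomorphic_map_maps by blast
  have "g x = chart_inv c x" if x: "x \<in> base_image c" for x
   using g chart_inv_in[OF x] coord_chart_inv[OF x] unfolding homeomorphic_maps_def top by metis
  moreover have "continuous_map (top_of_set (base_image c)) (subtopology (base B) (chart_dom c)) g"
   using g unfolding homeomorphic_maps_def by blast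
  ultimately show ?thesis by (rule continuous_map_eq[rotated]) simp
 qed
 then have "compactin (base B) K" unfolding K_def
  by (intro image_compactin[of "top_of_set (base_image c)"])
   (use \<epsilon>(2) in \<open>auto simp: continuous_map_in_subtopology compactin_subtopology\<close>)
 then have K: "closedin (base B) K"
  using oriented compactin_imp_closedin unfolding oriented_vector_bundle_def by blast
 have Kc: "K \<subseteq> chart_dom c" unfolding K_def using \<epsilon>(2) chart_inv_in by auto
 define V where "V = M - K"
 have V: "openin (base B) V" unfolding V_def using K by auto
 have \<phi>0: "\<phi> v = 0" if "v \<in> V" for v
 proof -
  have "base_coord c v \<notin> cball (base_coord c u) \<epsilon>" if "v \<in> chart_dom c"
  proof
   assume "base_coord c v \<in> cball (base_coord c u) \<epsilon>"
   then have "v \<in> K" unfolding K_def using that c(1) by (metis chart_inv_coord image_eqI)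
   then show False using \<open>v \<in> V\<close> by (simp add: V_def)
  qed
  then show ?thesis using b(4) by (simp add: \<phi>_def)
 qed
 define W where "W = {v \<in> chart_dom c. base_coord c v \<in> ball (base_coord c u) \<eta>}"
 have W: "openin (base B) W"
  using openin_continuous_map_preimage[OF cont, of "ball (base_coord c u) \<eta>"] openin_trans_full chart_facts(1)[OF c(1)]
  unfolding top W_def by auto
 have "smooth_base \<phi>" unfolding smooth_base_def
 proof (intro ballI smooth_along_local)
  fix d x assume d: "d \<in> charts B" and x: "x \<in> base_image d"
  show "\<exists>T. open T \<and> x \<in> T \<and> base_smooth T (\<lambda>x. \<phi> (chart_inv d x))"
  proof (cases "chart_inv d x \<in> chart_dom c")
   case True
   have "base_smooth (overlap d c) (\<lambda>x. b (base_trans d c x))"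
    by (rule compose_trans(1)[OF d c(1) open_overlap[OF d c(1)] order_refl open_UNIV _ b(1)]) simp
   then have "base_smooth (overlap d c) (\<lambda>x. \<phi> (chart_inv d x))"
    by (rule base.smooth_along_cong[OF open_overlap[OF d c(1)]]) (simp add: overlap_iff[OF d] \<phi>_def base_trans_def)
   then show ?thesis using True x open_overlap[OF d c(1)] overlap_iff[OF d] by blast
  next
   case False
   let ?T = "base_coord d ` (chart_dom d \<inter> V)"
   have "chart_inv d x \<in> V" using False Kc chart_inv_in[OF x] chart_dom_sub[OF d] by (auto simp: V_def)
   then have "x \<in> ?T" using x coord_image_iff[OF d] by blast
   moreover have "base_smooth ?T (\<lambda>x. \<phi> (chart_inv d x))"
    by (rule base.smooth_along_cong[OF open_coord_image[OF d V] base.smooth_const[of _ 0]])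
     (simp_all add: coord_image_iff[OF d] \<phi>0)
   ultimately show ?thesis using open_coord_image[OF d V] by blast
  qed
 qed
 then show ?thesis
  by (rule that[OF c(1) _ V _ \<phi>0 W]) (use Kc b c in \<open>auto simp: V_def W_def \<phi>_def\<close>)
qed

text \<open>Countably many cut-off functions suffice, as the base is a Lindelof space.\<close>

lemma bump_sequence:
 assumes "M \<noteq> {}"
 obtains c \<phi> V W where "\<And>k::nat. c k \<in> charts B" "\<And>k. smooth_base (\<phi> k)" "\<And>k. openin (base B) (V k)"
  "\<And>k. M \<subseteq> V k \<union> chart_dom (c k)" "\<And>k v. v \<in> V k ==> \<phi> k v = 0" "\<And>k. openin (base B) (W k)"
  "\<And>k v. v \<in> W k ==> \<phi> k v = 1" "\<And>u. u \<in> M ==> \<exists>k. u \<in> W k"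
proof -
 define good where "good W c \<phi> V \<longleftrightarrow> c \<in> charts B \<and> smooth_base \<phi> \<and> openin (base B) V \<and>
  M \<subseteq> V \<union> chart_dom c \<and> (\<forall>v\<in>V. \<phi> v = 0) \<and> openin (base B) W \<and> (\<forall>v\<in>W. \<phi> v = 1)" for W c \<phi> V
 define \<U> where "\<U> = {W. \<exists>c \<phi> V. good W c \<phi> V}"
 have "\<forall>W\<in>\<U>. openin (base B) W" by (auto simp: \<U>_def good_def)
 moreover have "M \<subseteq> \<Union>\<U>"
 proof
  fix u assume "u \<in> M"
  then show "u \<in> \<Union>\<U>"
  proof (rule chart_bump)
   fix c \<phi> V W
   assume "c \<in> charts B" "smooth_base \<phi>" "openin (base B) V" "M \<subseteq> V \<union> chart_dom c"
    "\<And>v. v \<in> V ==> \<phi> v = 0" "openin (base B) W" "u \<in> W" "\<And>v. v \<in> W ==> \<phi> v = 1"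
   then have "good W c \<phi> V" "u \<in> W" by (auto simp: good_def)
   then show ?thesis unfolding \<U>_def by blast
  qed
 qed
 moreover have "Lindelof_space (base B)"
  using oriented second_countable_imp_Lindelof_space unfolding oriented_vector_bundle_def by blast
 ultimately obtain \<V> where \<V>: "countable \<V>" "\<V> \<subseteq> \<U>" "M \<subseteq> \<Union>\<V>"
  unfolding Lindelof_space_alt by (metis (no_types, lifting))
 have "\<V> \<noteq> {}" using \<V>(3) assms by auto
 define W where "W = from_nat_into \<V>"
 have WV: "range W = \<V>" unfolding W_def by (rule range_from_nat_into[OF \<open>\<V> \<noteq> {}\<close> \<V>(1)])
 then have "\<exists>c \<phi> V. good (W k) c \<phi> V" for k using \<V>(2) unfolding \<U>_def by blast
 then obtain c \<phi> V where "\<And>k. good (W k) (c k) (\<phi> k) (V k)" by metis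
 then show ?thesis
  by (intro that[of c \<phi> V W]) (use \<V>(3) WV in \<open>auto simp: good_def\<close>)
qed

end

section \<open>Local and global primitives\<close>

lemma regular_density_local:
 fixes f :: "('n::finite, 'm) density"
 assumes "\<And>x. x \<in> U ==> \<exists>T. open T \<and> x \<in> T \<and> regular_density N T f"
 shows "regular_density N U f"
proof -
 have "smooth_along jet_shift (U \<times> UNIV) (\<lambda>p. f p l)" for l
 proof (rule smooth_along_local)
  fix p :: "('n, 'm) jet" assume "p \<in> U \<times> UNIV"
  then have "fst p \<in> U" by auto
  then obtain T where "open T" "fst p \<in> T" "regular_density N T f" using assms by blast
  then show "\<exists>T. open T \<and> p \<in> T \<and> smooth_along jet_shift T (\<lambda>p. f p l)"
   by (intro exI[of _ "T \<times> UNIV"]) (auto simp: regular_density_def open_Times mem_Times_iff)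
 qed
 then show ?thesis unfolding regular_density_def
 proof (intro conjI allI ballI impI)
  fix x and q q' :: "('n, 'm) jet_index => real" assume "x \<in> U" "\<forall>a. mi_size (snd a) \<le> N \<longrightarrow> q a = q' a"
  then show "f (x, q) = f (x, q')" using assms[OF \<open>x \<in> U\<close>] unfolding regular_density_def by blast
 next
  fix x and q :: "('n, 'm) jet_index => real" and l :: "('n, 'm) jet_index list" assume "x \<in> U" "\<exists>a\<in>set l. N < mi_size (snd a)"
  then show "f (x, q) l = 0" using assms[OF \<open>x \<in> U\<close>] unfolding regular_density_def by blast
 next
  fix x and q :: "('n, 'm) jet_index => real" assume "x \<in> U"
  then show "alternating (f (x, q))" using assms[OF \<open>x \<in> U\<close>] unfolding regular_density_def by blast
 qed
qed

lemma oreg_lin: "oreg N v ==> oreg N w ==> oreg N (\<lambda>l. a * v l + b * w l)"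
 using oreg_add[OF oreg_scale oreg_scale, of N v w a b] by (simp add: plus_fun_def)

lemma regular_density_lin:
 fixes f g :: "('n::finite, 'm::finite) density"
 assumes U: "open U"
 shows "regular_density N U f ==> regular_density N U g ==> regular_density N U (\<lambda>p l. a * f p l + b * g p l)"
 unfolding regular_density_iff by (auto intro!: sreg_add[OF U] sreg_mult[OF U] sreg_const[OF U] oreg_lin)

lemma total_der_lin:
 fixes f g :: "('n::finite, 'm::finite) density"
 assumes U: "open U" and f: "regular_density N U f" and g: "regular_density N U g" and p: "fst p \<in> U"
 shows "total_der i (\<lambda>p l. a * f p l + b * g p l) p l = a * total_der i f p l + b * total_der i g p l"
proof -
 have s: "sreg N U (\<lambda>p. f p l)" "sreg N U (\<lambda>p. g p l)" and p': "p \<in> U \<times> UNIV"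
  using f g p by (auto simp: regular_density_iff mem_Times_iff)
 have m: "sreg N U (\<lambda>p. a * f p l)" "sreg N U (\<lambda>p. b * g p l)" by (intro sreg_mult[OF U] sreg_const[OF U] s)+
 have "(\<lambda>l. a * f p l + b * g p l) = (\<lambda>l. a * f p l) + (\<lambda>l. b * g p l)" by (simp add: fun_eq_iff)
 then have "oddD i (\<lambda>l. a * f p l + b * g p l) l = a * oddD i (f p) l + b * oddD i (g p) l"
  by (simp only: oddD_add oddD_scale plus_fun_apply)
 moreover have "vfield N i (\<lambda>p. a * f p l + b * g p l) p = a * vfield N i (\<lambda>p. f p l) p + b * vfield N i (\<lambda>p. g p l) p"
  by (simp only: vfield_add[OF U m p'] vfield_scale[OF U s(1) p'] vfield_scale[OF U s(2) p'])
 ultimately show ?thesis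
  by (simp add: total_der_eq[OF U regular_density_lin[OF U f g] order_refl p] total_der_eq[OF U f order_refl p]
   total_der_eq[OF U g order_refl p] algebra_simps)
qed

context oriented_bundle
begin

definition img :: "('a, 'e, 'n, 'm) bundle_chart => 'a set => (real^'n) set" where
 "img c S = base_coord c ` (chart_dom c \<inter> S)"

lemma img_iff: "c \<in> charts B ==> x \<in> img c S \<longleftrightarrow> x \<in> base_image c \<and> chart_inv c x \<in> S"
 unfolding img_def by (rule coord_image_iff)
lemma open_img: "c \<in> charts B ==> openin (base B) S ==> open (img c S)" unfolding img_def by (rule open_coord_image)
lemma img_M: "c \<in> charts B ==> img c M = base_image c" using chart_dom_sub[of c] by (simp add: img_def base_image_def Int_absorb2)
lemma img_dom: "img c (chart_dom d) = overlap c d" by (simp add: img_def overlap_def)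
lemma img_trans:
 "c \<in> charts B ==> d \<in> charts B ==> x \<in> overlap c d ==> x \<in> img c S ==> base_trans c d x \<in> img d S"
 using trans_facts(1,2)[of c d x] by (simp add: img_iff overlap_iff)

lemma pull_eq:
 "oreg N (f (jet_trans B c d p)) ==>
   pull_density B c d f p l = sub N (PP True c d (fst p)) l (f (jet_trans B c d p))"
 by (simp add: pull_density_def odd_subst_sub PP_def fibre_matrix_def)

lemma pull_local: "f (jet_trans B c d p) = g (jet_trans B c d p) ==> pull_density B c d f p = pull_density B c d g p"
 by (simp add: pull_density_def)

lemma pull_sum:
 assumes F: "\<And>k. k \<in> K ==> oreg N (F k (jet_trans B c d p))"
 shows "pull_density B c d (\<lambda>p l. e p * (\<Sum>k\<in>K. a k p * F k p l)) p l =
  e (jet_trans B c d p) * (\<Sum>k\<in>K. a k (jet_trans B c d p) * pull_density B c d (F k) p l)"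
proof -
 let ?q = "jet_trans B c d p" let ?S = "\<Sum>k\<in>K. (\<lambda>l. a k ?q * F k ?q l)"
 have o: "oreg N ?S" using F
 proof (induction K rule: infinite_finite_induct)
  case (insert x K)
  show ?case unfolding sum.insert[OF insert.hyps]
   by (intro oreg_add oreg_scale insert.IH insert.prems) simp_all
 qed simp_all
 have "pull_density B c d (\<lambda>p l. e p * (\<Sum>k\<in>K. a k p * F k p l)) p = pull_density B c d (\<lambda>_ l. e ?q * ?S l) p"
  by (rule pull_local) (simp add: sum_apply)
 then have "pull_density B c d (\<lambda>p l. e p * (\<Sum>k\<in>K. a k p * F k p l)) p l = pull_density B c d (\<lambda>_ l. e ?q * ?S l) p l"
  by simp
 also have "\<dots> = sub N (PP True c d (fst p)) l (\<lambda>l. e ?q * ?S l)"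
  by (rule pull_eq[of N "\<lambda>_ l. e ?q * ?S l" c d p, OF oreg_scale[OF o]])
 also have "\<dots> = e ?q * (\<Sum>k\<in>K. a k ?q * sub N (PP True c d (fst p)) l (F k ?q))"
  by (simp only: sub_scale sub_sum)
 also have "\<dots> = e ?q * (\<Sum>k\<in>K. a k ?q * pull_density B c d (F k) p l)"
  using pull_eq[of N "F _" c d p, OF F] by simp
 finally show ?thesis .
qed

lemma pull_lin:
 assumes "oreg N (f (jet_trans B c d p))" "oreg N (g (jet_trans B c d p))"
 shows "pull_density B c d (\<lambda>p l. a * f p l + b * g p l) p l = a * pull_density B c d f p l + b * pull_density B c d g p l"
 using pull_sum[where K = UNIV and F = "\<lambda>k. if k then f else g" and a = "\<lambda>k _. if k then a else b" and e = "\<lambda>_. 1" and N = N and p = p and c = c and d = d] assms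
 by (simp add: UNIV_bool add.commute)

lemma PP_cocycle:
 assumes "c \<in> charts B" "d \<in> charts B" "e \<in> charts B" "x \<in> triple c d e" "mi_size (snd b) \<le> N"
 shows "PP k c e x b a = (\<Sum>m\<in>idx N. PP k d e (base_trans c d x) b m * PP k c d x m a)"
 using q.prolong_cocycle[OF assms(1-3) _ assms(4), of "snd b" N "fst b" a]
  b.prolong_cocycle[OF assms(1-3) _ assms(4), of "snd b" N "fst b" a] assms(5)
 by (cases k) (simp_all add: PP_def fibre_matrix_def)

text \<open>Only finitely many jet coordinates enter each component, so the matrix cocycle applies.\<close>

lemma jet_trans_cocycle:
 assumes c: "c \<in> charts B" and d: "d \<in> charts B" and e: "e \<in> charts B" and x: "fst p \<in> triple c d e"
 shows "jet_trans B d e (jet_trans B c d p) = jet_trans B c e p"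
proof (rule prod_eqI)
 note T = triple_facts[OF c d e]
 have X: "fst p \<in> overlap c d" "fst p \<in> overlap c e" "base_trans c d (fst p) \<in> overlap d e" using x T by auto
 show "fst (jet_trans B d e (jet_trans B c d p)) = fst (jet_trans B c e p)" by (simp add: trans_facts(4)[OF c d X(1)])
 show "snd (jet_trans B d e (jet_trans B c d p)) = snd (jet_trans B c e p)"
 proof
  fix b :: "('n, 'm) jet_index"
  let ?N = "mi_size (snd b)" let ?y = "base_trans c d (fst p)"
  have "snd (jet_trans B d e (jet_trans B c d p)) b = (\<Sum>m\<in>idx ?N. PP False d e ?y b m * (\<Sum>a\<in>idx ?N. PP False c d (fst p) m a * snd p a))"
  proof (subst snd_jet_trans[OF d e _ order_refl])
   show "(\<Sum>m\<in>idx ?N. PP False d e (fst (jet_trans B c d p)) b m * snd (jet_trans B c d p) m) =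
     (\<Sum>m\<in>idx ?N. PP False d e ?y b m * (\<Sum>a\<in>idx ?N. PP False c d (fst p) m a * snd p a))"
    by (rule sum.cong[OF refl], subst snd_jet_trans[OF c d X(1), of _ ?N]) (simp_all add: idx_def)
  qed (simp add: X(3))
  also have "\<dots> = (\<Sum>a\<in>idx ?N. (\<Sum>m\<in>idx ?N. PP False d e ?y b m * PP False c d (fst p) m a) * snd p a)"
   unfolding sum_distrib_left sum_distrib_right by (subst sum.swap) (simp add: mult_ac)
  also have "\<dots> = snd (jet_trans B c e p) b"
   by (simp add: snd_jet_trans[OF c e X(2) order_refl] PP_cocycle[OF c d e x order_refl])
  finally show "snd (jet_trans B d e (jet_trans B c d p)) b = snd (jet_trans B c e p) b" .
 qed
qed

lemma pull_pull:
 assumes c: "c \<in> charts B" and d: "d \<in> charts B" and e: "e \<in> charts B" and x: "fst p \<in> triple c d e"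
  and f: "oreg N (f (jet_trans B c e p))"
 shows "pull_density B c d (pull_density B d e f) p l = pull_density B c e f p l"
  and "oreg N (pull_density B d e f (jet_trans B c d p))"
proof -
 note j = jet_trans_cocycle[OF c d e x]
 let ?w = "f (jet_trans B c e p)" let ?T = "PP True d e (base_trans c d (fst p))"
 have y: "base_trans c d (fst p) \<in> overlap d e" using x triple_facts(4)[OF c d e] by blast
 have i: "pull_density B d e f (jet_trans B c d p) = (\<lambda>l. sub N ?T l ?w)"
  using pull_eq[of N f d e "jet_trans B c d p"] f by (simp add: j fun_eq_iff)
 show o: "oreg N (pull_density B d e f (jet_trans B c d p))" unfolding i
  by (rule oreg_sub[OF f]) (rule PP_order[OF d e y], auto simp: idx_def)
 show "pull_density B c d (pull_density B d e f) p l = pull_density B c e f p l"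
  unfolding pull_eq[of N "pull_density B d e f" c d p, OF o] i pull_eq[of N f c e p, OF f]
  by (rule sub_sub) (rule PP_cocycle[OF c d e x], simp add: idx_def)
qed

definition law :: "(('a, 'e, 'n, 'm) bundle_chart => 'n => ('n, 'm) density) => ('a, 'e, 'n, 'm) bundle_chart =>
  ('a, 'e, 'n, 'm) bundle_chart => real^'n => bool" where
 "law \<gamma> c d x \<longleftrightarrow> (\<forall>q l i. \<gamma> c i (x, q) l = det (jacobian c d x) *
   (\<Sum>j\<in>UNIV. jacobian d c (base_trans c d x) $ i $ j * pull_density B c d (\<gamma> d j) (x, q) l))"

text \<open>\<open>\<gamma>\<close> is a primitive of the horizontal \<open>n\<close>-form \<open>\<omega>\<close> over the part \<open>S\<close> of the base. The bound on the order
 is kept explicit because it has to be uniform in infinite, locally finite sums.\<close>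

definition prim :: "nat => 'a set => ('a, 'e, 'n, 'm) density_family =>
  (('a, 'e, 'n, 'm) bundle_chart => 'n => ('n, 'm) density) => bool" where
 "prim N S \<omega> \<gamma> \<longleftrightarrow> (\<forall>c\<in>charts B. (\<forall>i. regular_density N (img c S) (\<gamma> c i)) \<and>
   (\<forall>x\<in>img c S. (\<forall>d\<in>charts B. x \<in> overlap c d \<longrightarrow> law \<gamma> c d x) \<and>
    (\<forall>q l. \<omega> c (x, q) l = (\<Sum>i\<in>UNIV. total_der i (\<gamma> c i) (x, q) l))))"

lemma cohomologous_iff: "cohomologous B \<omega> \<omega>' \<longleftrightarrow> (\<exists>N \<gamma>. prim N M (\<lambda>c p l. \<omega> c p l - \<omega>' c p l) \<gamma>)"
proof
 assume "cohomologous B \<omega> \<omega>'"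
 then obtain \<gamma> N where "\<forall>c\<in>charts B. \<forall>i. regular_density N (base_image c) (\<gamma> c i)"
  "\<forall>c\<in>charts B. \<forall>d\<in>charts B. \<forall>x\<in>overlap c d. law \<gamma> c d x"
  "\<forall>c\<in>charts B. \<forall>x\<in>base_image c. \<forall>q l. \<omega> c (x, q) l = \<omega>' c (x, q) l + (\<Sum>i\<in>UNIV. total_der i (\<gamma> c i) (x, q) l)"
  unfolding cohomologous_def subtop_form_def law_def by blast
 then show "\<exists>N \<gamma>. prim N M (\<lambda>c p l. \<omega> c p l - \<omega>' c p l) \<gamma>"
  by (intro exI[of _ N] exI[of _ \<gamma>]) (simp add: prim_def img_M)
next
 assume "\<exists>N \<gamma>. prim N M (\<lambda>c p l. \<omega> c p l - \<omega>' c p l) \<gamma>"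
 then obtain N \<gamma> where P: "prim N M (\<lambda>c p l. \<omega> c p l - \<omega>' c p l) \<gamma>" by blast
 have "subtop_form B \<gamma>" unfolding subtop_form_def law_def[symmetric]
 proof (intro conjI exI[of _ N] ballI allI)
  fix c d x assume "c \<in> charts B" "d \<in> charts B" "x \<in> overlap c d"
  then show "law \<gamma> c d x" using P overlap_iff[of c x d] by (simp add: prim_def img_M)
 qed (use P in \<open>simp add: prim_def img_M\<close>)
 moreover have "\<omega> c (x, q) l = \<omega>' c (x, q) l + (\<Sum>i\<in>UNIV. total_der i (\<gamma> c i) (x, q) l)"
  if "c \<in> charts B" "x \<in> base_image c" for c x q l
 proof -
  have "\<omega> c (x, q) l - \<omega>' c (x, q) l = (\<Sum>i\<in>UNIV. total_der i (\<gamma> c i) (x, q) l)"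
   using P that unfolding prim_def by (simp add: img_M)
  then show ?thesis by simp
 qed
 ultimately show "cohomologous B \<omega> \<omega>'" unfolding cohomologous_def by blast
qed

lemma prim_cong:
 assumes P: "prim N S \<omega> \<gamma>" and S: "openin (base B) S"
  and eq: "\<And>c p. c \<in> charts B ==> fst p \<in> img c S ==> \<omega>' c p = \<omega> c p \<and> (\<forall>i. \<gamma>' c i p = \<gamma> c i p)"
 shows "prim N S \<omega>' \<gamma>'"
 unfolding prim_def
proof (intro ballI conjI allI impI)
 fix c assume c: "c \<in> charts B"
 note U = open_img[OF c S]
 show "regular_density N (img c S) (\<gamma>' c i)" for i
  by (rule regular_density_cong[OF U, of N "\<gamma> c i"]) (use P c in \<open>simp add: prim_def\<close>, simp add: eq[OF c])
 fix x assume x: "x \<in> img c S"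
 show "law \<gamma>' c d x" if d: "d \<in> charts B" and o: "x \<in> overlap c d" for d
 proof -
  have "law \<gamma> c d x" using P c x d o by (simp add: prim_def)
  moreover have "pull_density B c d (\<gamma>' d j) (x, q) = pull_density B c d (\<gamma> d j) (x, q)" for j q
   by (rule pull_local) (use eq[OF d, of "jet_trans B c d (x, q)"] img_trans[OF c d o x] in simp)
  ultimately show ?thesis by (simp add: law_def eq[OF c] x)
 qed
 show "\<omega>' c (x, q) l = (\<Sum>i\<in>UNIV. total_der i (\<gamma>' c i) (x, q) l)" for q l
 proof -
  have "total_der i (\<gamma>' c i) (x, q) = total_der i (\<gamma> c i) (x, q)" for i
   by (rule total_der_cong[OF U]) (simp_all add: x eq[OF c])
  then show ?thesis using P c x by (simp add: prim_def eq[OF c])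
 qed
qed

lemma prim_lin:
 assumes P: "prim N S \<omega> \<gamma>" and P': "prim N S \<omega>' \<gamma>'" and S: "openin (base B) S"
 shows "prim N S (\<lambda>c p l. a * \<omega> c p l + b * \<omega>' c p l) (\<lambda>c i p l. a * \<gamma> c i p l + b * \<gamma>' c i p l)"
 unfolding prim_def
proof (intro ballI conjI allI impI)
 fix c assume c: "c \<in> charts B"
 note U = open_img[OF c S]
 have r: "regular_density N (img c S) (\<gamma> c i)" "regular_density N (img c S) (\<gamma>' c i)" if "c \<in> charts B" for c i
  using P P' that by (auto simp: prim_def)
 show "regular_density N (img c S) (\<lambda>p l. a * \<gamma> c i p l + b * \<gamma>' c i p l)" for i
  by (rule regular_density_lin[OF U r[OF c]])
 fix x assume x: "x \<in> img c S"
 show "law (\<lambda>c i p l. a * \<gamma> c i p l + b * \<gamma>' c i p l) c d x" if d: "d \<in> charts B" and o: "x \<in> overlap c d" for d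
 proof -
  have L: "law \<gamma> c d x" "law \<gamma>' c d x" using P P' c x d o by (auto simp: prim_def)
  have "oreg N (\<gamma> d j (jet_trans B c d (x, q)))" "oreg N (\<gamma>' d j (jet_trans B c d (x, q)))" for j q
   using r[OF d, of j] img_trans[OF c d o x] unfolding regular_density_iff jet_trans_def by auto
  note o = this
  show ?thesis unfolding law_def
  proof (intro allI)
   fix q l i
   show "a * \<gamma> c i (x, q) l + b * \<gamma>' c i (x, q) l = det (jacobian c d x) * (\<Sum>j\<in>UNIV. jacobian d c (base_trans c d x) $ i $ j *
     pull_density B c d (\<lambda>p l. a * \<gamma> d j p l + b * \<gamma>' d j p l) (x, q) l)"
    unfolding pull_lin[of N "\<gamma> d _" c d "(x, q)" "\<gamma>' d _", OF o] L[unfolded law_def, rule_format]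
    by (simp add: sum_distrib_left sum.distrib algebra_simps)
  qed
 qed
 show "a * \<omega> c (x, q) l + b * \<omega>' c (x, q) l = (\<Sum>i\<in>UNIV. total_der i (\<lambda>p l. a * \<gamma> c i p l + b * \<gamma>' c i p l) (x, q) l)" for q l
  using P P' c x by (simp add: prim_def total_der_lin[OF U r[OF c]] sum.distrib sum_distrib_left)
qed

lemma prim_zero: "prim N S (\<lambda>_ _ _. 0) (\<lambda>_ _ _ _. 0)"
proof -
 have "regular_density N U ((\<lambda>p l. 0) :: ('n, 'm) density)" for U
  using regular_density_subset[OF densD(4)[OF dens_zero[of UNIV N]], of U] by (simp add: zero_fun_def)
 moreover have "pull_density B c d (\<lambda>p l. 0) p l = 0" for c d p l
  using pull_sum[where K = "{}" and e = "\<lambda>_. 1" and c = c and d = d and p = p and l = l] by simp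
 moreover have "total_der i (\<lambda>p l. 0) p l = (0 :: real)" for i and p :: "('n, 'm) jet" and l
 proof -
  have "lder a (\<lambda>l. 0) = 0" for a :: "('n, 'm) jet_index" by (simp add: lder_def fun_eq_iff)
  then show ?thesis by (simp add: total_der_def x_der_def q_der_def pder_def)
 qed
 ultimately show ?thesis by (simp add: prim_def law_def)
qed

lemma prim_subset: "prim N S \<omega> \<gamma> ==> T \<subseteq> S ==> prim N T \<omega> \<gamma>"
 unfolding prim_def img_def by (blast intro: regular_density_subset)

lemma prim_mono: "prim N S \<omega> \<gamma> ==> openin (base B) S ==> N \<le> N' ==> prim N' S \<omega> \<gamma>"
 unfolding prim_def using regular_density_mono[OF open_img] by blast

text \<open>This is the sheaf property by which primitives are glued.\<close>

lemma prim_local: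
 assumes T: "\<And>u. u \<in> S ==> \<exists>T. openin (base B) T \<and> u \<in> T \<and> prim N T \<omega> \<gamma>"
 shows "prim N S \<omega> \<gamma>"
 unfolding prim_def
proof (intro ballI conjI allI impI)
 fix c assume c: "c \<in> charts B"
 have *: "\<exists>T. openin (base B) T \<and> x \<in> img c T \<and> prim N T \<omega> \<gamma>" if "x \<in> img c S" for x
  using T[of "chart_inv c x"] that unfolding img_iff[OF c] by blast
 show "regular_density N (img c S) (\<gamma> c i)" for i
 proof (rule regular_density_local)
  fix x assume "x \<in> img c S"
  then obtain T where "openin (base B) T" "x \<in> img c T" "prim N T \<omega> \<gamma>" using * by blast
  then show "\<exists>T. open T \<and> x \<in> T \<and> regular_density N T (\<gamma> c i)"
   by (intro exI[of _ "img c T"]) (simp add: open_img[OF c] prim_def c)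
 qed
 fix x assume "x \<in> img c S"
 then obtain T where x: "x \<in> img c T" "prim N T \<omega> \<gamma>" using * by blast
 then show "law \<gamma> c d x" if "d \<in> charts B" "x \<in> overlap c d" for d using c that by (simp add: prim_def)
 show "\<omega> c (x, q) l = (\<Sum>i\<in>UNIV. total_der i (\<gamma> c i) (x, q) l)" for q l using x c by (simp add: prim_def)
qed

end

context chart_pair
begin

definition tr :: "('n => ('n, 'm) density) => 'n => ('n, 'm) density" where
 "tr \<gamma> i = (\<Sum>j\<in>UNIV. dmul (bs (\<lambda>x. jac_inv c d x $ i $ j)) (dmul bd (\<Phi> (cut W' (\<gamma> j)))))"

context
 fixes \<gamma> :: "'n => ('n, 'm) density" and N
 assumes \<gamma>: "\<And>j. regular_density N (base_image d) (\<gamma> j)"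
begin

lemma cut_\<gamma>: "cut W' (\<gamma> j) \<in> dens W' N"
 by (rule cut_dens[OF W' regular_density_subset[OF \<gamma> overlap_sub]])

lemma tr_dens: "tr \<gamma> i \<in> dens W N" unfolding tr_def
 by (intro A.C_sum A.C_mul ji_dens bd_dens Phi_dens cut_\<gamma>)

lemma tr_eq:
 assumes p: "fst p \<in> W"
 shows "tr \<gamma> i p l = det (J (fst p)) *
  (\<Sum>j\<in>UNIV. jacobian d c (base_trans c d (fst p)) $ i $ j * pull_density B c d (\<gamma> j) p l)"
proof -
 have "\<Phi> (cut W' (\<gamma> j)) p l = pull_density B c d (\<gamma> j) p l" for j
  using p fun_cong[OF pull_local[of "cut W' (\<gamma> j)" c d p "\<gamma> j"], of l] T_W by (simp add: Phi_def)
 then show ?thesis by (simp add: tr_def sum_apply bs_mul_in[OF p] jac_inv_def sum_distrib_left mult_ac)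
qed

lemma tr_div: "(\<Sum>i\<in>UNIV. dD W i (tr \<gamma> i)) = dmul bd (\<Phi> (\<Sum>j\<in>UNIV. dD W' j (cut W' (\<gamma> j))))"
proof -
 have "dmul (bs (\<lambda>x. jac_inv c d x $ i $ j)) (dmul bd (\<Phi> (cut W' (\<gamma> j)))) \<in> dens W N" for i j
  by (intro A.C_mul ji_dens bd_dens Phi_dens cut_\<gamma>)
 then have "(\<Sum>i\<in>UNIV. dD W i (tr \<gamma> i)) =
   (\<Sum>i\<in>UNIV. \<Sum>j\<in>UNIV. dD W i (dmul (bs (\<lambda>x. jac_inv c d x $ i $ j)) (dmul bd (\<Phi> (cut W' (\<gamma> j))))))"
  unfolding tr_def by (intro sum.cong[OF refl] A.D_sum)
 also have "\<dots> = (\<Sum>j\<in>UNIV. dmul bd (\<Phi> (dD W' j (cut W' (\<gamma> j)))))"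
  by (subst sum.swap) (rule sum.cong[OF refl], rule piola_Phi[OF cut_\<gamma>])
 also have "\<dots> = dmul bd (\<Phi> (\<Sum>j\<in>UNIV. dD W' j (cut W' (\<gamma> j))))"
  unfolding A.mul_sum_right[symmetric] by (subst Phi_sum[OF A'.C_D[OF cut_\<gamma>]]) simp
 finally show ?thesis .
qed

end

end

context oriented_bundle
begin

text \<open>The components in the chart \<open>c\<close> of the horizontal \<open>(n-1)\<close>-form with components \<open>\<gamma>\<close> in the chart \<open>e\<close>.\<close>

definition transport :: "('a, 'e, 'n, 'm) bundle_chart => ('n => ('n, 'm) density) =>
  ('a, 'e, 'n, 'm) bundle_chart => 'n => ('n, 'm) density" where
 "transport e \<gamma> c i = (\<lambda>p l. det (jacobian c e (fst p)) *
   (\<Sum>j\<in>UNIV. jacobian e c (base_trans c e (fst p)) $ i $ j * pull_density B c e (\<gamma> j) p l))"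

lemma law_transport:
 assumes c: "c \<in> charts B" and d: "d \<in> charts B" and e: "e \<in> charts B" and x: "x \<in> triple c d e"
  and \<gamma>: "\<And>j. regular_density N (base_image e) (\<gamma> j)"
 shows "law (transport e \<gamma>) c d x"
 unfolding law_def
proof (intro allI)
 fix q l i
 note T = triple_facts[OF c d e]
 have X: "x \<in> overlap c d" "x \<in> overlap c e" "base_trans c d x \<in> overlap d e" using x T by auto
 have Te: "base_trans d e (base_trans c d x) = base_trans c e x" by (rule trans_facts(4)[OF c d X(1)])
 have "base_trans c e x \<in> overlap e c" by (rule trans_facts(1)[OF c e X(2)])
 moreover have "base_trans c e x \<in> overlap e d" unfolding Te[symmetric] by (rule trans_facts(1)[OF d e X(3)])
 ultimately have y: "base_trans c e x \<in> triple e d c" by (simp add: triple_def)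
 have Td: "base_trans e d (base_trans c e x) = base_trans c d x" by (rule trans_facts(4)[OF c e X(2)])
 have o: "oreg N (\<gamma> j (jet_trans B c e (x, q)))" for j
  using \<gamma>[of j] subsetD[OF overlap_sub trans_facts(1)[OF c e X(2)]] unfolding regular_density_iff jet_trans_def by simp
 have pp: "pull_density B c d (pull_density B d e (\<gamma> j)) (x, q) l = pull_density B c e (\<gamma> j) (x, q) l"
  "oreg N (pull_density B d e (\<gamma> j) (jet_trans B c d (x, q)))" for j
  by (rule pull_pull[of c d e "(x, q)" N "\<gamma> j"]; use c d e x o[of j] in simp)+
 let ?P = "\<lambda>j. pull_density B c e (\<gamma> j) (x, q) l"
 let ?A = "jacobian d c (base_trans c d x)" let ?C = "jacobian e d (base_trans c e x)"
 have "pull_density B c d (transport e \<gamma> d k) (x, q) l = det (jacobian d e (base_trans c d x)) * (\<Sum>j\<in>UNIV. ?C $ k $ j * ?P j)" for k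
  unfolding transport_def
  by (subst pull_sum[where N = N], rule pp(2)) (simp add: pp(1) Te)
 moreover have "det (jacobian c e x) = det (jacobian c d x) * det (jacobian d e (base_trans c d x))"
  using jacobian_cocycle[OF c d e x] by (metis det_mul mult.commute)
 moreover have "jacobian e c (base_trans c e x) $ i $ j = (\<Sum>k\<in>UNIV. ?A $ i $ k * ?C $ k $ j)" for j
  unfolding jacobian_cocycle[OF e d c y, symmetric] Td by (simp add: matrix_matrix_mult_def)
 moreover have "(\<Sum>j\<in>UNIV. (\<Sum>k\<in>UNIV. ?A $ i $ k * ?C $ k $ j) * ?P j) = (\<Sum>k\<in>UNIV. ?A $ i $ k * (\<Sum>j\<in>UNIV. ?C $ k $ j * ?P j))"
  unfolding sum_distrib_left sum_distrib_right by (subst sum.swap) (simp only: mult.assoc)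
 moreover have "(\<Sum>k\<in>UNIV. ?A $ i $ k * (r * G k)) = r * (\<Sum>k\<in>UNIV. ?A $ i $ k * G k)" for r G
  by (simp add: sum_distrib_left mult_ac)
 ultimately show "transport e \<gamma> c i (x, q) l = det (jacobian c d x) *
   (\<Sum>k\<in>UNIV. ?A $ i $ k * pull_density B c d (transport e \<gamma> d k) (x, q) l)"
  by (simp only: transport_def fst_conv mult.assoc)
qed

lemma prim_transport:
 assumes e: "e \<in> charts B" and \<gamma>: "\<And>j. regular_density N (base_image e) (\<gamma> j)"
  and top: "\<And>c x q l. c \<in> charts B ==> x \<in> overlap c e ==>
   \<omega> c (x, q) l = det (jacobian c e x) * pull_density B c e (\<omega> e) (x, q) l"
  and div: "\<And>p l. fst p \<in> base_image e ==> \<omega> e p l = (\<Sum>i\<in>UNIV. total_der i (\<gamma> i) p l)"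
 shows "prim N (chart_dom e) \<omega> (transport e \<gamma>)"
 unfolding prim_def img_dom
proof (intro ballI conjI allI impI)
 fix c assume c: "c \<in> charts B"
 interpret chart_pair B c e by (rule chart_pairI[OF c e])
 have t: "fst p \<in> W ==> tr \<gamma> i p = transport e \<gamma> c i p" for i p
  using tr_eq[OF \<gamma>] by (simp add: transport_def fun_eq_iff)
 show "regular_density N (overlap c e) (transport e \<gamma> c i)" for i
  by (rule regular_density_cong[OF W densD(4)[OF tr_dens[OF \<gamma>]] t])
 fix x assume x: "x \<in> overlap c e"
 show "law (transport e \<gamma>) c d x" if "d \<in> charts B" "x \<in> overlap c d" for d
  by (rule law_transport[OF c that(1) e _ \<gamma>]) (use that x in \<open>simp add: triple_def\<close>)
 fix q l
 let ?G = "\<Sum>j\<in>UNIV. dD W' j (cut W' (\<gamma> j))"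
 have "total_der i (transport e \<gamma> c i) (x, q) l = dD W i (tr \<gamma> i) (x, q) l" for i
  using total_der_cong[OF W, of "(x, q)" "transport e \<gamma> c i" "tr \<gamma> i" i] x t by (simp add: dD_def)
 then have "(\<Sum>i\<in>UNIV. total_der i (transport e \<gamma> c i) (x, q) l) = (\<Sum>i\<in>UNIV. dD W i (tr \<gamma> i)) (x, q) l"
  by (simp add: sum_apply)
 also have "\<dots> = det (J x) * pull_density B c e ?G (x, q) l"
  unfolding tr_div[OF \<gamma>] using x by (simp add: dmul_base_fun Phi_def)
 also have "pull_density B c e ?G (x, q) = pull_density B c e (\<omega> e) (x, q)"
 proof (rule pull_local)
  let ?p = "jet_trans B c e (x, q)"
  have p: "fst ?p \<in> W'" "fst ?p \<in> base_image e" using T_W[OF x] overlap_sub by auto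
  have "total_der j (cut W' (\<gamma> j)) ?p = total_der j (\<gamma> j) ?p" for j
   by (rule total_der_cong[OF W' p(1)]) simp
  then show "?G ?p = \<omega> e ?p" using p by (simp add: fun_eq_iff sum_apply dD_def div[OF p(2)])
 qed
 finally show "\<omega> c (x, q) l = (\<Sum>i\<in>UNIV. total_der i (transport e \<gamma> c i) (x, q) l)"
  using top[OF c x] by simp
qed

text \<open>A primitive over a chart domain that vanishes over \<open>V\<close> is extended by zero to the rest of the base,
 which \<open>V\<close> covers.\<close>

lemma prim_extend:
 assumes e: "e \<in> charts B" and V: "openin (base B) V" "M \<subseteq> V \<union> chart_dom e"
  and \<gamma>: "\<And>j. regular_density N (base_image e) (\<gamma> j)" "\<And>j p. fst p \<in> img e V ==> \<gamma> j p = 0"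
  and top: "\<And>c x q l. c \<in> charts B ==> x \<in> overlap c e ==>
   \<omega> c (x, q) l = det (jacobian c e x) * pull_density B c e (\<omega> e) (x, q) l"
  and div: "\<And>p l. fst p \<in> base_image e ==> \<omega> e p l = (\<Sum>i\<in>UNIV. total_der i (\<gamma> i) p l)"
  and \<omega>: "\<And>c p. c \<in> charts B ==> fst p \<in> img c V ==> \<omega> c p = 0"
 obtains \<gamma>' where "prim N M \<omega> \<gamma>'" "\<And>c i p. c \<in> charts B ==> fst p \<in> img c V ==> \<gamma>' c i p = 0"
proof
 let ?\<gamma> = "\<lambda>c i. cut (overlap c e) (transport e \<gamma> c i)"
 have z: "pull_density B c e f p = 0" if "f (jet_trans B c e p) = 0" for f c p
 proof -
  have "pull_density B c e f p = pull_density B c e (\<lambda>_ _. 0) p"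
   by (rule pull_local) (use that in \<open>simp add: zero_fun_def\<close>)
  also have "\<dots> = 0" using pull_sum[where K = "{}" and e = "\<lambda>_. 1" and c = c and d = e and p = p] by (auto simp: fun_eq_iff)
  finally show ?thesis .
 qed
 show 0: "?\<gamma> c i p = 0" if c: "c \<in> charts B" and p: "fst p \<in> img c V" for c i p
 proof (cases "fst p \<in> overlap c e")
  case True
  then have "pull_density B c e (\<gamma> j) p = 0" for j
   by (intro z \<gamma>(2)) (simp add: img_trans[OF c e True p])
  then show ?thesis by (simp add: cut_def transport_def fun_eq_iff)
 qed simp
 show "prim N M \<omega> ?\<gamma>"
 proof (rule prim_local)
  fix u assume "u \<in> M"
  then consider "u \<in> V" | "u \<in> chart_dom e" using V(2) by auto
  then show "\<exists>T. openin (base B) T \<and> u \<in> T \<and> prim N T \<omega> ?\<gamma>"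
  proof cases
   case 1
   have "prim N V \<omega> ?\<gamma>"
    by (rule prim_cong[OF prim_zero V(1)]) (use 0 \<omega> in \<open>simp add: zero_fun_def\<close>)
   then show ?thesis using 1 V(1) by blast
  next
   case 2
   have "prim N (chart_dom e) \<omega> ?\<gamma>"
    by (rule prim_cong[OF prim_transport[OF e \<gamma>(1) top div] chart_facts(1)[OF e]]) (simp_all add: img_dom)
   then show ?thesis using 2 chart_facts(1)[OF e] by blast
  qed
 qed
qed

end

section \<open>Exactness of the Jacobiator\<close>

context jet_superalgebra
begin

lemma br_add_left: "x \<in> C N ==> y \<in> C N ==> br (x + y) z = br x z + br y z"
proof -
 assume xy: "x \<in> C N" "y \<in> C N"
 have "chr (x + y) k \<alpha> = chr x k \<alpha> + chr y k \<alpha>" for k \<alpha>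
  by (simp add: chr_def E_add[OF xy] par_add)
 then show ?thesis by (simp add: br_def mul_add_left sum.distrib)
qed

lemma br_add_right: "x \<in> C N ==> y \<in> C N ==> br z (x + y) = br z x + br z y"
 by (simp add: br_def E_add mul_add_right sum.distrib)

text \<open>Adding a divergence does not change the Euler operators, and hence not the bracket.\<close>

lemma E_div:
 assumes f: "f \<in> C N" and \<gamma>: "\<And>i. \<gamma> i \<in> C N"
 shows "E k \<alpha> (f + (\<Sum>i\<in>UNIV. D i (\<gamma> i))) = E k \<alpha> f"
proof -
 have "f \<in> C (Suc N)" by (rule C_le[OF f]) simp
 moreover have "(\<Sum>i\<in>UNIV. D i (\<gamma> i)) \<in> C (Suc N)" by (intro C_sum C_D \<gamma>)
 ultimately show ?thesis by (simp add: E_add E_sum[OF C_D[OF \<gamma>]] E_D[OF \<gamma>])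
qed

lemma br_div:
 assumes "f \<in> C N" "\<And>i. \<gamma> i \<in> C N"
 shows "br (f + (\<Sum>i\<in>UNIV. D i (\<gamma> i))) g = br f g" "br g (f + (\<Sum>i\<in>UNIV. D i (\<gamma> i))) = br g f"
 unfolding br_def chr_def E_div[of f N \<gamma>, OF assms] by simp_all

definition jacobiator :: "bool => bool => bool => 'r => 'r => 'r => 'r" where
 "jacobiator ef eg eh f g h = sg (\<not> ef \<and> \<not> eh) (br f (br g h)) + sg (\<not> ef \<and> \<not> eg) (br g (br h f)) +
   sg (\<not> eg \<and> \<not> eh) (br h (br f g))"

lemma jacobiator_add:
 assumes f: "f \<in> C N" and g: "g \<in> C N" and h: "h \<in> C N" "h' \<in> C N"
 shows "jacobiator ef eg eh f g (h + h') = jacobiator ef eg eh f g h + jacobiator ef eg eh f g h'"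
proof -
 show ?thesis
  unfolding jacobiator_def br_add_left[OF h] br_add_right[OF h] br_add_right[OF C_br[OF g h(1)] C_br[OF g h(2)]]
   br_add_right[OF C_br[OF h(1) f] C_br[OF h(2) f]] sg_add by (simp only: ac_simps)
qed

lemma I_jacobiator:
 assumes f: "f \<in> C N" and g: "g \<in> C N" and h: "h \<in> C N" "h \<in> I"
 shows "jacobiator ef eg eh f g h \<in> I"
proof -
 have le: "x \<in> C N ==> x \<in> C (N + N)" for x by (erule C_le) simp
 have "br f (br g h) \<in> I" using I_br[OF le[OF f] C_br[OF g h(1)]] I_br[OF g h(1)] h(2) by blast
 moreover have "br g (br h f) \<in> I" using I_br[OF le[OF g] C_br[OF h(1) f]] I_br[OF h(1) f] h(2) by blast
 moreover have "br h (br f g) \<in> I" using I_br[OF le[OF h(1)] C_br[OF f g]] h(2) by blast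
 ultimately show ?thesis unfolding jacobiator_def by (intro I_add I_sg)
qed

end

abbreviation jacobiator_on :: "(real^'n) set => bool => bool => bool => ('n::finite, 'm::finite) density =>
  ('n, 'm) density => ('n, 'm) density => ('n, 'm) density" where
 "jacobiator_on U \<equiv> jet_superalgebra.jacobiator dmul dpar (dD U) (dpd U)"

definition jac_sign :: "nat => nat => real" where
 "jac_sign r t = (-1) powi ((int r - 1) * (int t - 1))"

definition jac :: "nat => nat => nat => ('n::finite, 'm::finite) density => ('n, 'm) density => ('n, 'm) density => ('n, 'm) density" where
 "jac r s t f g h = (\<lambda>p l. jac_sign r t * schouten_density f (schouten_density g h) p l +
   jac_sign r s * schouten_density g (schouten_density h f) p l +
   jac_sign s t * schouten_density h (schouten_density f g) p l)"

lemma jac_sign_eq: "jac_sign r t * X p l = sg (\<not> odd r \<and> \<not> odd t) X p l"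
 by (simp add: jac_sign_def sg_def power_int_minus_left)

lemma jac_eq:
 fixes f g h :: "('n::finite, 'm::finite) density"
 assumes U: "open U" and f: "regular_density N U f" and g: "regular_density N U g" and h: "regular_density N U h"
  and p: "fst p \<in> U"
 shows "jac r s t f g h p = jacobiator_on U (odd r) (odd s) (odd t) (cut U f) (cut U g) (cut U h) p"
proof -
 interpret A: jet_superalgebra "dens U" dmul dpar "dD U" "dpd U :: _ => _ => ('n, 'm) density => _" "vanish {}"
  by (rule dens_superalgebra[OF U]) simp
 have s: "schouten_density u (schouten_density v w) p = bracket U (cut U u) (bracket U (cut U v) (cut U w)) p"
  if "regular_density N U u" "regular_density N U v" "regular_density N U w" for u v w
  using schouten_density_eq[OF U that(1) regular_schouten_density[OF U that(2,3)] p] cut_schouten[OF U that(2,3)] by simp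
 have s': "sg b (schouten_density u (schouten_density v w)) p = sg b (bracket U (cut U u) (bracket U (cut U v) (cut U w))) p"
  if "regular_density N U u" "regular_density N U v" "regular_density N U w" for b u v w
  using s[OF that] by (simp add: sg_def)
 show ?thesis unfolding jac_def A.jacobiator_def jac_sign_eq s'[OF f g h] s'[OF g h f] s'[OF h f g] plus_fun_def ..
qed

context oriented_bundle
begin

lemma top_form_lin:
 assumes f: "top_form B f" and g: "top_form B g"
 shows "top_form B (\<lambda>c p l. a * f c p l + b * g c p l)"
proof -
 obtain N where N: "\<And>c. c \<in> charts B ==> regular_density N (base_image c) (f c)"
  "\<And>c. c \<in> charts B ==> regular_density N (base_image c) (g c)" by (rule top_form_order[OF f g]) blast
 have law: "f c (x, q) l = det (jacobian c d x) * pull_density B c d (f d) (x, q) l"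
  "g c (x, q) l = det (jacobian c d x) * pull_density B c d (g d) (x, q) l"
  if "c \<in> charts B" "d \<in> charts B" "x \<in> overlap c d" for c d x q l
  using f g that unfolding top_form_def by blast+
 show ?thesis unfolding top_form_def
 proof (intro conjI exI[of _ "N"] ballI allI)
  show "regular_density N (base_image c) (\<lambda>p l. a * f c p l + b * g c p l)" if "c \<in> charts B" for c
   by (rule regular_density_lin[OF chart_facts(2)[OF that] N[OF that]])
  fix c d x q l assume c: "c \<in> charts B" and d: "d \<in> charts B" and x: "x \<in> overlap c d"
  have "base_trans c d x \<in> base_image d" using trans_facts(1)[OF c d x] overlap_sub by blast
  then have "oreg N (f d (jet_trans B c d (x, q)))" "oreg N (g d (jet_trans B c d (x, q)))"
   using N[OF d] unfolding regular_density_iff jet_trans_def by simp_all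
  then show "a * f c (x, q) l + b * g c (x, q) l =
    det (jacobian c d x) * pull_density B c d (\<lambda>p l. a * f d p l + b * g d p l) (x, q) l"
   by (subst pull_lin[where N = N]) (simp_all add: law[OF c d x] algebra_simps)
 qed
qed

definition mlt :: "('a => real) => ('a, 'e, 'n, 'm) density_family => ('a, 'e, 'n, 'm) density_family" where
 "mlt \<rho> h c = (\<lambda>p l. \<rho> (chart_inv c (fst p)) * h c p l)"

lemma regular_mlt:
 assumes c: "c \<in> charts B" and \<rho>: "smooth_base \<rho>" and h: "regular_density N (base_image c) (h c)"
 shows "regular_density N (base_image c) (mlt \<rho> h c)"
proof -
 have "base_smooth (base_image c) (\<lambda>x. \<rho> (chart_inv c x))" using \<rho> c by (simp add: smooth_base_def)
 from sreg_base[OF chart_facts(2)[OF c] this]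
 have "sreg N (base_image c) (\<lambda>p. \<rho> (chart_inv c (fst p)) * h c p l)" for l
  using h unfolding regular_density_iff by (intro sreg_mult[OF chart_facts(2)[OF c]]) auto
 then show ?thesis using h unfolding regular_density_iff mlt_def by (simp add: oreg_scale)
qed

lemma top_form_mlt:
 assumes \<rho>: "smooth_base \<rho>" and h: "top_form B h"
 shows "top_form B (mlt \<rho> h)"
proof -
 obtain N where N: "\<And>c. c \<in> charts B ==> regular_density N (base_image c) (h c)"
  using h unfolding top_form_def by blast
 show ?thesis unfolding top_form_def
 proof (intro conjI exI[of _ N] ballI allI)
  show "regular_density N (base_image c) (mlt \<rho> h c)" if "c \<in> charts B" for c
   by (rule regular_mlt[where h = h, OF that \<rho> N[OF that]])
  fix c d x q l assume c: "c \<in> charts B" and d: "d \<in> charts B" and x: "x \<in> overlap c d"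
  have "base_trans c d x \<in> base_image d" using trans_facts(1)[OF c d x] overlap_sub by blast
  then have o: "oreg N (h d (jet_trans B c d (x, q)))"
   using N[OF d] unfolding regular_density_iff jet_trans_def by simp
  have "pull_density B c d (mlt \<rho> h d) (x, q) = pull_density B c d (\<lambda>p l. \<rho> (chart_inv c x) * h d p l + 0 * h d p l) (x, q)"
   by (rule pull_local) (simp add: mlt_def trans_facts(2)[OF c d x])
  then show "mlt \<rho> h c (x, q) l = det (jacobian c d x) * pull_density B c d (mlt \<rho> h d) (x, q) l"
   using h c d x pull_lin[of N "h d" c d "(x, q)" "h d", OF o o, where l = l and a = "\<rho> (chart_inv c x)" and b = 0] unfolding top_form_def by (simp add: mlt_def)
 qed
qed

lemma par_homogeneous_density:
 assumes "homogeneous B k f" "c \<in> charts B"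
 shows "dpar (cut (base_image c) (f c)) = sg (odd k) (cut (base_image c) (f c))"
proof (rule sg_funI)
 fix p :: "('n, 'm) jet" and l
 have "fst p \<in> base_image c ==> length l \<noteq> k ==> f c p l = 0"
  using assms unfolding homogeneous_def by (cases p) simp
 then show "dpar (cut (base_image c) (f c)) p l = sg (odd k) (cut (base_image c) (f c) p l)"
  by (cases "length l = k") (auto simp: dpar_def parity_def sg_def cut_def)
qed

lemma top_form_jac:
 assumes "top_form B f" "top_form B g" "top_form B h"
 shows "top_form B (\<lambda>c. jac r s t (f c) (g c) (h c))"
proof -
 have S: "top_form B (\<lambda>c. schouten_density (u c) (schouten_density (v c) (w c)))"
  if "top_form B u" "top_form B v" "top_form B w" for u v w
  by (rule top_form_schouten[OF that(1) top_form_schouten[OF that(2,3)]])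
 note 1 = top_form_lin[OF S[OF assms] S[OF assms(2,3,1)], where a = "jac_sign r t" and b = "jac_sign r s"]
 from top_form_lin[OF 1 S[OF assms(3,1,2)], where a = 1 and b = "jac_sign s t"]
 show ?thesis by (simp add: jac_def)
qed

lemma jac_vanish:
 fixes N :: nat and f g h :: "('n, 'm) density"
 assumes c: "c \<in> charts B" and V: "openin (base B) V" and p: "fst p \<in> img c V"
  and f: "regular_density N (base_image c) f" "regular_density N (base_image c) g" "regular_density N (base_image c) h"
  and h: "\<And>p. fst p \<in> img c V ==> h p = 0"
 shows "jac r s t f g h p = 0"
proof -
 let ?U = "base_image c"
 have pU: "fst p \<in> ?U" using p img_iff[OF c] by simp
 note U = chart_facts(2)[OF c]
 interpret A: jet_superalgebra "dens ?U" dmul dpar "dD ?U" "dpd ?U :: _ => _ => ('n, 'm) density => _" "vanish (img c V)"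
  by (rule dens_superalgebra[OF U open_img[OF c V]])
 have "cut ?U h \<in> vanish (img c V)" using h by (simp add: vanish_def cut_def fun_eq_iff)
 then have "A.jacobiator (odd r) (odd s) (odd t) (cut ?U f) (cut ?U g) (cut ?U h) \<in> vanish (img c V)"
  by (intro A.I_jacobiator[of _ N] cut_dens[OF U] f)
 then show ?thesis using p unfolding jac_eq[OF U f pU] vanish_def by blast
qed

text \<open>The formal Jacobi identity in the chart \<open>e\<close>, with the ideal of densities vanishing over \<open>V\<close>,
 gives a primitive to which \<open>prim_extend\<close> applies.\<close>

lemma jac_exact_local:
 fixes N :: nat
 assumes top: "top_form B f" "top_form B g" "top_form B h"
  and hom: "homogeneous B r f" "homogeneous B s g" "homogeneous B t h"
  and reg: "\<And>c. c \<in> charts B ==> regular_density N (base_image c) (f c)"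
   "\<And>c. c \<in> charts B ==> regular_density N (base_image c) (g c)"
   "\<And>c. c \<in> charts B ==> regular_density N (base_image c) (h c)"
  and e: "e \<in> charts B" and V: "openin (base B) V" "M \<subseteq> V \<union> chart_dom e"
  and h: "\<And>c p. c \<in> charts B ==> fst p \<in> img c V ==> h c p = 0"
 shows "\<exists>\<gamma>. prim (6 * N) M (\<lambda>c. jac r s t (f c) (g c) (h c)) \<gamma> \<and>
  (\<forall>c\<in>charts B. \<forall>i p. fst p \<in> img c V \<longrightarrow> \<gamma> c i p = 0)"
proof -
 let ?U = "base_image e"
 note U = chart_facts(2)[OF e]
 interpret A: jet_superalgebra "dens ?U" dmul dpar "dD ?U" "dpd ?U :: _ => _ => ('n, 'm) density => _" "vanish (img e V)"
  by (rule dens_superalgebra[OF U open_img[OF e V(1)]])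
 have "cut ?U (h e) \<in> vanish (img e V)" using h[OF e] by (simp add: vanish_def cut_def fun_eq_iff)
 then have "A.jacobiator (odd r) (odd s) (odd t) (cut ?U (f e)) (cut ?U (g e)) (cut ?U (h e)) \<in> A.dv (6 * N)"
  unfolding A.jacobiator_def
  by (intro A.jacobi_dv cut_dens[OF U] reg[OF e] par_homogeneous_density hom e disjI2)
 then obtain \<gamma> where \<gamma>: "\<And>i. \<gamma> i \<in> dens ?U (6 * N)" "\<And>i. \<gamma> i \<in> vanish (img e V)"
  "A.jacobiator (odd r) (odd s) (odd t) (cut ?U (f e)) (cut ?U (g e)) (cut ?U (h e)) = (\<Sum>i\<in>UNIV. dD ?U i (\<gamma> i))"
  unfolding A.dv_def by blast
 have div: "jac r s t (f e) (g e) (h e) p l = (\<Sum>i\<in>UNIV. total_der i (\<gamma> i) p l)" if "fst p \<in> ?U" for p l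
  unfolding jac_eq[OF U reg(1)[OF e] reg(2)[OF e] reg(3)[OF e] that] \<gamma>(3) using that by (simp add: sum_apply dD_def)
 have law: "jac r s t (f c) (g c) (h c) (x, q) l = det (jacobian c e x) * pull_density B c e (jac r s t (f e) (g e) (h e)) (x, q) l"
  if "c \<in> charts B" "x \<in> overlap c e" for c x q l
  using top_form_jac[OF top, of r s t] that e unfolding top_form_def by blast
 show ?thesis
 proof (rule prim_extend[OF e V densD(4)[OF \<gamma>(1)] _ law div])
  show "\<gamma> j p = 0" if "fst p \<in> img e V" for j p using \<gamma>(2)[of j] that unfolding vanish_def by blast
  show "jac r s t (f c) (g c) (h c) p = 0" if "c \<in> charts B" "fst p \<in> img c V" for c p
   by (rule jac_vanish[OF that(1) V(1) that(2) reg(1)[OF that(1)] reg(2)[OF that(1)] reg(3)[OF that(1)] h[OF that(1)]])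
 qed blast+
qed

lemma prim_sum:
 assumes "\<And>k. prim N M (\<omega> k) (\<gamma> k)"
 shows "prim N M (\<lambda>c p l. \<Sum>k<m. \<omega> k c p l) (\<lambda>c i p l. \<Sum>k<(m::nat). \<gamma> k c i p l)"
proof (induction m)
 case 0
 show ?case using prim_zero[of N M] by simp
next
 case (Suc m)
 show ?case using prim_lin[OF Suc assms[of m] openin_topspace, of 1 1] by simp
qed

text \<open>A partition of unity \<open>\<rho>\<^sub>k\<close> splits \<open>h\<close>; the primitives belonging to the \<open>\<rho>\<^sub>k h\<close> are summed. All
 of them have order at most \<open>6 * N\<close>, since multiplication by a function on the base does not raise orders.\<close>

theorem jac_exact:
 assumes top: "top_form B f" "top_form B g" "top_form B h"
  and hom: "homogeneous B r f" "homogeneous B s g" "homogeneous B t h"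
 shows "\<exists>N \<gamma>. prim N M (\<lambda>c. jac r s t (f c) (g c) (h c)) \<gamma>"
proof (cases "M = {}")
 case True
 then show ?thesis by (intro exI prim_local) simp
next
 case False
 obtain e \<phi> V W where e: "\<And>k::nat. e k \<in> charts B" and \<phi>: "\<And>k. smooth_base (\<phi> k)" and V: "\<And>k. openin (base B) (V k)"
  "\<And>k. M \<subseteq> V k \<union> chart_dom (e k)" "\<And>k v. v \<in> V k ==> \<phi> k v = 0" and W: "\<And>k. openin (base B) (W k)"
  "\<And>k v. v \<in> W k ==> \<phi> k v = 1" "\<And>u. u \<in> M ==> \<exists>k. u \<in> W k"
  by (rule bump_sequence[OF False]) blast
 obtain N1 N2 where N12: "\<And>c. c \<in> charts B ==> regular_density N1 (base_image c) (f c)"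
  "\<And>c. c \<in> charts B ==> regular_density N1 (base_image c) (g c)" "\<And>c. c \<in> charts B ==> regular_density N2 (base_image c) (h c)"
  by (rule top_form_order[OF top(1,2)], rule top_form_order[OF top(3,3)]) blast
 define N where "N = max N1 N2"
 have reg: "regular_density N (base_image c) (f c)" "regular_density N (base_image c) (g c)" "regular_density N (base_image c) (h c)"
  if "c \<in> charts B" for c
  by (rule regular_density_mono[OF chart_facts(2)[OF that] N12(1)[OF that]], simp add: N_def,
   rule regular_density_mono[OF chart_facts(2)[OF that] N12(2)[OF that]], simp add: N_def,
   rule regular_density_mono[OF chart_facts(2)[OF that] N12(3)[OF that]], simp add: N_def)
 \<comment> \<open>\<open>\<rho> k = P k - P (Suc k)\<close>, and \<open>P k\<close> vanishes on \<open>W j\<close> for \<open>j < k\<close>, so on \<open>W j\<close> the functions \<open>\<rho> 0, \<dots>, \<rho> j\<close> add up to 1\<close>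
 define P where "P k u = (\<Prod>j<k. 1 - \<phi> j u)" for k u
 define \<rho> where "\<rho> k u = P k u * \<phi> k u" for k u
 have P: "smooth_base (P k)" for k unfolding P_def[abs_def] by (intro smooth_base_intros \<phi>)
 have \<rho>: "smooth_base (\<rho> k)" for k unfolding \<rho>_def[abs_def] by (intro smooth_base_intros P \<phi>)
 have P0: "P k u = 0" if "u \<in> W j" "j < k" for j k u
  using that W(2)[OF that(1)] by (auto simp: P_def intro!: prod_zero)
 define V' where "V' k = V k \<union> (\<Union>j<k. W j)" for k
 have V': "openin (base B) (V' k)" for k unfolding V'_def by (intro openin_Un openin_Union V) (auto simp: W)
 have "\<exists>\<gamma>. prim (6 * N) M (\<lambda>c. jac r s t (f c) (g c) (mlt (\<rho> k) h c)) \<gamma> \<and>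
   (\<forall>c\<in>charts B. \<forall>i p. fst p \<in> img c (V' k) \<longrightarrow> \<gamma> c i p = 0)" for k
 proof (rule jac_exact_local[OF top(1,2) top_form_mlt[OF \<rho> top(3)] hom(1,2) _ reg(1,2) regular_mlt[where N = N and h = h, OF _ \<rho> reg(3)] e V'])
  show "homogeneous B t (mlt (\<rho> k) h)" using hom(3) by (simp add: homogeneous_def mlt_def)
  show "M \<subseteq> V' k \<union> chart_dom (e k)" using V(2)[of k] by (auto simp: V'_def)
  fix c and p :: "('n, 'm) jet" assume c: "c \<in> charts B" and p: "fst p \<in> img c (V' k)"
  then consider "chart_inv c (fst p) \<in> V k" | j where "j < k" "chart_inv c (fst p) \<in> W j"
   unfolding img_iff[OF c] V'_def by blast
  then have "\<rho> k (chart_inv c (fst p)) = 0" by cases (simp_all add: \<rho>_def V(3) P0)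
  then show "mlt (\<rho> k) h c p = 0" by (simp add: mlt_def fun_eq_iff)
 qed
 from choice[OF allI[OF this]] obtain \<gamma> where "\<forall>k. prim (6 * N) M (\<lambda>c. jac r s t (f c) (g c) (mlt (\<rho> k) h c)) (\<gamma> k) \<and>
   (\<forall>c\<in>charts B. \<forall>i p. fst p \<in> img c (V' k) \<longrightarrow> \<gamma> k c i p = 0)" ..
 then have \<gamma>: "\<And>k. prim (6 * N) M (\<lambda>c. jac r s t (f c) (g c) (mlt (\<rho> k) h c)) (\<gamma> k)"
  "\<And>k c i p. c \<in> charts B ==> fst p \<in> img c (V' k) ==> \<gamma> k c i p = 0" by blast+
 have tele: "jac r s t (f c) (g c) (h c) p l =
   (\<Sum>k<m. jac r s t (f c) (g c) (mlt (\<rho> k) h c) p l) + jac r s t (f c) (g c) (mlt (P m) h c) p l"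
  if c: "c \<in> charts B" and p: "fst p \<in> base_image c" for c p l m
 proof (induction m)
  case 0
  have "mlt (P 0) h c = h c" by (simp add: mlt_def P_def)
  then show ?case by simp
 next
  case (Suc m)
  let ?U = "base_image c"
  note U = chart_facts(2)[OF c]
  interpret A: jet_superalgebra "dens ?U" dmul dpar "dD ?U" "dpd ?U :: _ => _ => ('n, 'm) density => _" "vanish {}"
   by (rule dens_superalgebra[OF U]) simp
  note mr = regular_mlt[where h = h, OF c _ reg(3)[OF c]]
  have "mlt (P m) h c = mlt (\<rho> m) h c + mlt (P (Suc m)) h c"
   by (simp add: mlt_def \<rho>_def P_def fun_eq_iff algebra_simps)
  then have "cut ?U (mlt (P m) h c) = cut ?U (mlt (\<rho> m) h c) + cut ?U (mlt (P (Suc m)) h c)"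
   by (simp add: cut_def fun_eq_iff)
  then have "jac r s t (f c) (g c) (mlt (P m) h c) p = jac r s t (f c) (g c) (mlt (\<rho> m) h c) p + jac r s t (f c) (g c) (mlt (P (Suc m)) h c) p"
   unfolding jac_eq[OF U reg(1)[OF c] reg(2)[OF c] mr[OF P] p] jac_eq[OF U reg(1)[OF c] reg(2)[OF c] mr[OF \<rho>] p]
   by (simp only: A.jacobiator_add[OF cut_dens[OF U reg(1)[OF c]] cut_dens[OF U reg(2)[OF c]]
    cut_dens[OF U mr[OF \<rho>]] cut_dens[OF U mr[OF P]]] plus_fun_apply)
  then show ?case using Suc by simp
 qed
 \<comment> \<open>At a point of \<open>W (\<kappa> u)\<close> all later primitives vanish, so the sum up to \<open>\<kappa> u\<close> is near each point a sum over a fixed range.\<close>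
 define \<kappa> where "\<kappa> u = (LEAST j. u \<in> W j)" for u
 let ?\<Gamma> = "\<lambda>c i p l. \<Sum>k<Suc (\<kappa> (chart_inv c (fst p))). \<gamma> k c i p l"
 have "prim (6 * N) M (\<lambda>c. jac r s t (f c) (g c) (h c)) ?\<Gamma>"
 proof (rule prim_local)
  fix u assume "u \<in> M"
  then obtain j where j: "u \<in> W j" using W(3) by blast
  have "prim (6 * N) (W j) (\<lambda>c. jac r s t (f c) (g c) (h c)) ?\<Gamma>"
  proof (rule prim_cong[OF prim_subset[OF prim_sum[where m = "Suc j", OF \<gamma>(1)] openin_subset[OF W(1)]] W(1)], intro conjI allI)
   fix c and p :: "('n, 'm) jet" assume c: "c \<in> charts B" and p: "fst p \<in> img c (W j)"
   have u: "fst p \<in> base_image c" "chart_inv c (fst p) \<in> W j" using p unfolding img_iff[OF c] by auto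
   have "mlt (P (Suc j)) h c q = 0" if "fst q \<in> img c (W j)" for q
    using that P0[of _ j "Suc j"] unfolding img_iff[OF c] by (simp add: mlt_def fun_eq_iff)
   then have "jac r s t (f c) (g c) (mlt (P (Suc j)) h c) p = 0"
    by (intro jac_vanish[OF c W(1) p reg(1)[OF c] reg(2)[OF c] regular_mlt[where h = h, OF c P reg(3)[OF c]]])
   then show "jac r s t (f c) (g c) (h c) p = (\<lambda>l. \<Sum>k<Suc j. jac r s t (f c) (g c) (mlt (\<rho> k) h c) p l)"
    using tele[OF c u(1), of _ "Suc j"] by (simp add: fun_eq_iff)
   let ?k = "\<kappa> (chart_inv c (fst p))"
   have k: "chart_inv c (fst p) \<in> W ?k" "?k \<le> j" unfolding \<kappa>_def by (rule LeastI[of _ j], rule u(2)) (rule Least_le, rule u(2))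
   have "\<gamma> k c i p = 0" if "?k < k" for k i
    by (rule \<gamma>(2)[OF c]) (use that k(1) u(1) in \<open>auto simp: img_iff[OF c] V'_def\<close>)
   then have "(\<Sum>k<Suc ?k. \<gamma> k c i p l) = (\<Sum>k<Suc j. \<gamma> k c i p l)" for i l
    by (intro sum.mono_neutral_left) (use k(2) in \<open>auto simp: not_less\<close>)
   then show "(\<lambda>l. \<Sum>k<Suc ?k. \<gamma> k c i p l) = (\<lambda>l. \<Sum>k<Suc j. \<gamma> k c i p l)" for i by simp
  qed
  then show "\<exists>T. openin (base B) T \<and> u \<in> T \<and> prim (6 * N) T (\<lambda>c. jac r s t (f c) (g c) (h c)) ?\<Gamma>" using j W(1) by blast
 qed
 then show ?thesis by blast
qed

end

section \<open>Operations on cohomology classes\<close>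

context oriented_bundle
begin

definition exact :: "('a, 'e, 'n, 'm) density_family => bool" where
 "exact \<omega> \<longleftrightarrow> (\<exists>N \<gamma>. prim N M \<omega> \<gamma>)"

lemma exact_lin:
 assumes "exact \<omega>" "exact \<omega>'"
 shows "exact (\<lambda>c p l. a * \<omega> c p l + b * \<omega>' c p l)"
proof -
 obtain N \<gamma> N' \<gamma>' where "prim N M \<omega> \<gamma>" "prim N' M \<omega>' \<gamma>'" using assms unfolding exact_def by blast
 then have "prim (max N N') M \<omega> \<gamma>" "prim (max N N') M \<omega>' \<gamma>'"
  using prim_mono[OF _ openin_topspace] max.cobounded1 max.cobounded2 by blast+
 from prim_lin[OF this openin_topspace] show ?thesis unfolding exact_def by blast
qed

lemma exact_cong:
 assumes "exact \<omega>" and eq: "\<And>c p. c \<in> charts B ==> fst p \<in> base_image c ==> \<omega>' c p = \<omega> c p"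
 shows "exact \<omega>'"
proof -
 obtain N \<gamma> where P: "prim N M \<omega> \<gamma>" using assms(1) unfolding exact_def by blast
 have "prim N M \<omega>' \<gamma>" by (rule prim_cong[OF P openin_topspace]) (simp add: eq img_M)
 then show ?thesis unfolding exact_def by blast
qed

lemma cohomologous_exact: "cohomologous B \<omega> \<omega>' \<longleftrightarrow> exact (\<lambda>c p l. \<omega> c p l - \<omega>' c p l)"
 unfolding exact_def by (rule cohomologous_iff)

lemma cohomologousI:
 assumes "\<And>c p. c \<in> charts B ==> fst p \<in> base_image c ==> \<omega> c p = \<omega>' c p"
 shows "cohomologous B \<omega> \<omega>'"
proof -
 have "exact (\<lambda>_ _ _. 0)" using prim_zero unfolding exact_def by blast
 then show ?thesis unfolding cohomologous_exact by (rule exact_cong) (simp add: assms)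
qed

lemma form_class_eqI:
 assumes "cohomologous B f g"
 shows "form_class B f = form_class B g"
proof -
 have fg: "exact (\<lambda>c p l. f c p l - g c p l)" using assms by (simp add: cohomologous_exact)
 have "exact (\<lambda>c p l. \<omega> c p l - f c p l) \<longleftrightarrow> exact (\<lambda>c p l. \<omega> c p l - g c p l)" for \<omega>
 proof
  assume "exact (\<lambda>c p l. \<omega> c p l - f c p l)"
  from exact_lin[OF this fg, of 1 1] show "exact (\<lambda>c p l. \<omega> c p l - g c p l)" by simp
 next
  assume "exact (\<lambda>c p l. \<omega> c p l - g c p l)"
  from exact_lin[OF this fg, of 1 "-1"] show "exact (\<lambda>c p l. \<omega> c p l - f c p l)" by simp
 qed
 then show ?thesis by (simp add: form_class_def cohomologous_exact)
qed

lemma form_class_self: "top_form B f ==> f \<in> form_class B f"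
 using cohomologousI[of f f] by (simp add: form_class_def)

lemma UN_form_class:
 assumes "top_form B f" "\<And>f'. f' \<in> form_class B f ==> F f' = X"
 shows "(\<Union>f'\<in>form_class B f. F f') = X"
 using form_class_self[OF assms(1)] assms(2) by auto

lemma form_classD:
 assumes "f' \<in> form_class B f"
 shows "top_form B f'" "cohomologous B f' f" "exact (\<lambda>c p l. f' c p l - f c p l)"
 using assms by (simp_all add: form_class_def cohomologous_exact)

lemma class_scale_form_class:
 assumes f: "top_form B f"
 shows "class_scale B r (form_class B f) = form_class B (\<lambda>c p l. r * f c p l)"
 unfolding class_scale_def
proof (rule UN_form_class[OF f form_class_eqI])
 fix f' assume "f' \<in> form_class B f"
 from exact_lin[OF form_classD(3)[OF this] form_classD(3)[OF this], of r 0]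
 show "cohomologous B (\<lambda>c p l. r * f' c p l) (\<lambda>c p l. r * f c p l)"
  unfolding cohomologous_exact by (simp add: right_diff_distrib)
qed

lemma class_add_form_class:
 assumes f: "top_form B f" and g: "top_form B g"
 shows "class_add B (form_class B f) (form_class B g) = form_class B (\<lambda>c p l. f c p l + g c p l)"
 unfolding class_add_def
proof (rule UN_form_class[OF f], rule UN_form_class[OF g form_class_eqI])
 fix f' g' assume "f' \<in> form_class B f" "g' \<in> form_class B g"
 from exact_lin[OF form_classD(3)[OF this(1)] form_classD(3)[OF this(2)], of 1 1]
 show "cohomologous B (\<lambda>c p l. f' c p l + g' c p l) (\<lambda>c p l. f c p l + g c p l)"
  unfolding cohomologous_exact by (simp add: add_diff_add)
qed

lemma cohomologous_cut:
 assumes coh: "cohomologous B f' f" and c: "c \<in> charts B"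
 obtains N \<gamma> where "\<And>i. \<gamma> i \<in> dens (base_image c) N"
  "cut (base_image c) (f' c) = cut (base_image c) (f c) + (\<Sum>i\<in>UNIV. dD (base_image c) i (\<gamma> i))"
proof -
 let ?U = "base_image c"
 note U = chart_facts(2)[OF c]
 obtain N \<gamma> where P: "prim N M (\<lambda>c p l. f' c p l - f c p l) \<gamma>" using coh unfolding cohomologous_iff by blast
 have r: "regular_density N ?U (\<gamma> c i)" for i using P c by (simp add: prim_def img_M)
 show ?thesis
 proof (rule that[of "\<lambda>i. cut ?U (\<gamma> c i)" N])
  show "cut ?U (\<gamma> c i) \<in> dens ?U N" for i by (rule cut_dens[OF U r])
  show "cut ?U (f' c) = cut ?U (f c) + (\<Sum>i\<in>UNIV. dD ?U i (cut ?U (\<gamma> c i)))"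
  proof (intro ext)
   fix p l
   show "cut ?U (f' c) p l = (cut ?U (f c) + (\<Sum>i\<in>UNIV. dD ?U i (cut ?U (\<gamma> c i)))) p l"
   proof (cases "fst p \<in> ?U")
    case True
    have "total_der i (cut ?U (\<gamma> c i)) p = total_der i (\<gamma> c i) p" for i
     by (rule total_der_cong[OF U True]) simp
    moreover have "f' c p l - f c p l = (\<Sum>i\<in>UNIV. total_der i (\<gamma> c i) p l)"
     using P c True unfolding prim_def img_M[OF c] by (cases p) (simp add: img_M)
    ultimately show ?thesis using True by (simp add: sum_apply dD_def)
   qed (simp add: sum_apply dD_def)
  qed
 qed
qed

text \<open>Representatives differ by divergences, which do not change the bracket even as a density.\<close>

lemma schouten_form_class:
 assumes f: "top_form B f" and g: "top_form B g"
 shows "schouten B (form_class B f) (form_class B g) = form_class B (\<lambda>c. schouten_density (f c) (g c))"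
 unfolding schouten_def
proof (rule UN_form_class[OF f], rule UN_form_class[OF g form_class_eqI[OF cohomologousI]])
 fix f' g' c and p :: "('n, 'm) jet"
 assume f': "f' \<in> form_class B f" and g': "g' \<in> form_class B g" and c: "c \<in> charts B" and p: "fst p \<in> base_image c"
 let ?U = "base_image c"
 note U = chart_facts(2)[OF c]
 interpret A: jet_superalgebra "dens ?U" dmul dpar "dD ?U" "dpd ?U :: _ => _ => ('n, 'm) density => _" "vanish {}"
  by (rule dens_superalgebra[OF U]) simp
 have reg: "\<exists>N. regular_density N ?U (h c)" if "top_form B h" for h using that c unfolding top_form_def by blast
 have div: "\<exists>N \<gamma>. cut ?U (h c) \<in> dens ?U N \<and> (\<forall>i. \<gamma> i \<in> dens ?U N) \<and> cut ?U (h' c) = cut ?U (h c) + (\<Sum>i\<in>UNIV. dD ?U i (\<gamma> i))"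
  if h: "top_form B h" "h' \<in> form_class B h" for h h'
 proof -
  obtain N where N: "regular_density N ?U (h c)" using reg[OF h(1)] by blast
  obtain N' \<gamma> where \<gamma>: "\<And>i. \<gamma> i \<in> dens ?U N'" "cut ?U (h' c) = cut ?U (h c) + (\<Sum>i\<in>UNIV. dD ?U i (\<gamma> i))"
   by (rule cohomologous_cut[OF form_classD(2)[OF h(2)] c]) blast
  show ?thesis
   by (intro exI[of _ "max N N'"] exI[of _ \<gamma>] conjI allI)
    (rule A.C_le[OF cut_dens[OF U N]], simp, rule A.C_le[OF \<gamma>(1)], simp, rule \<gamma>(2))
 qed
 obtain N \<gamma> where F: "cut ?U (f c) \<in> dens ?U N" "\<And>i. \<gamma> i \<in> dens ?U N"
  "cut ?U (f' c) = cut ?U (f c) + (\<Sum>i\<in>UNIV. dD ?U i (\<gamma> i))" using div[OF f f'] by blast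
 obtain N' \<gamma>' where G: "cut ?U (g c) \<in> dens ?U N'" "\<And>i. \<gamma>' i \<in> dens ?U N'"
  "cut ?U (g' c) = cut ?U (g c) + (\<Sum>i\<in>UNIV. dD ?U i (\<gamma>' i))" using div[OF g g'] by blast
 have "bracket ?U (cut ?U (f' c)) (cut ?U (g' c)) = bracket ?U (cut ?U (f c)) (cut ?U (g c))"
  unfolding F(3) G(3) A.br_div(1)[of "cut ?U (f c)" N \<gamma>, OF F(1,2)] by (rule A.br_div(2)[OF G(1,2)])
 moreover have "schouten_density (u c) (v c) p = bracket ?U (cut ?U (u c)) (cut ?U (v c)) p"
  if "top_form B u" "top_form B v" for u v
  using reg[OF that(1)] reg[OF that(2)] schouten_density_eq[OF U _ _ p] by blast
 ultimately show "schouten_density (f' c) (g' c) p = schouten_density (f c) (g c) p"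
  using f g form_classD(1)[OF f'] form_classD(1)[OF g'] by simp
qed

lemma top_form_scale: "top_form B f ==> top_form B (\<lambda>c p l. r * f c p l)"
 using top_form_lin[of f f r 0] by simp

lemma top_form_add: "top_form B f ==> top_form B g ==> top_form B (\<lambda>c p l. f c p l + g c p l)"
 using top_form_lin[of f g 1 1] by simp

lemma class_jacobi:
 assumes f: "top_form B f" "homogeneous B r f" and g: "top_form B g" "homogeneous B s g"
  and h: "top_form B h" "homogeneous B t h"
 shows "class_add B (class_add B
   (class_scale B (jac_sign r t) (schouten B (form_class B f) (schouten B (form_class B g) (form_class B h))))
   (class_scale B (jac_sign r s) (schouten B (form_class B g) (schouten B (form_class B h) (form_class B f)))))
   (class_scale B (jac_sign s t) (schouten B (form_class B h) (schouten B (form_class B f) (form_class B g)))) = class_zero B"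
proof -
 have S: "top_form B (\<lambda>c. schouten_density (u c) (schouten_density (v c) (w c)))"
   "class_scale B a (schouten B (form_class B u) (schouten B (form_class B v) (form_class B w))) =
    form_class B (\<lambda>c p l. a * schouten_density (u c) (schouten_density (v c) (w c)) p l)"
  if u: "top_form B u" "top_form B v" "top_form B w" for a u v w
 proof -
  note vw = top_form_schouten[OF u(2,3)]
  show 1: "top_form B (\<lambda>c. schouten_density (u c) (schouten_density (v c) (w c)))" by (rule top_form_schouten[OF u(1) vw])
  show "class_scale B a (schouten B (form_class B u) (schouten B (form_class B v) (form_class B w))) =
    form_class B (\<lambda>c p l. a * schouten_density (u c) (schouten_density (v c) (w c)) p l)"
   by (simp only: schouten_form_class[OF u(2,3)] schouten_form_class[OF u(1) vw] class_scale_form_class[OF 1])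
 qed
 have zero: "form_class B (\<lambda>c. jac r s t (f c) (g c) (h c)) = class_zero B" unfolding class_zero_def
 proof (rule form_class_eqI)
  have "exact (\<lambda>c. jac r s t (f c) (g c) (h c))"
   unfolding exact_def by (rule jac_exact[OF f(1) g(1) h(1) f(2) g(2) h(2)])
  then show "cohomologous B (\<lambda>c. jac r s t (f c) (g c) (h c)) (\<lambda>c p l. 0)" by (simp add: cohomologous_exact)
 qed
 note fgh = S(1)[OF f(1) g(1) h(1)] and ghf = S(1)[OF g(1) h(1) f(1)] and hfg = S(1)[OF h(1) f(1) g(1)]
 show ?thesis
  unfolding S(2)[OF f(1) g(1) h(1)] S(2)[OF g(1) h(1) f(1)] S(2)[OF h(1) f(1) g(1)]
   class_add_form_class[OF top_form_scale[OF fgh] top_form_scale[OF ghf]]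
   class_add_form_class[OF top_form_add[OF top_form_scale[OF fgh] top_form_scale[OF ghf]] top_form_scale[OF hfg]]
  using zero unfolding jac_def .
qed

end

theorem proposition2:
  fixes B :: "('a, 'e, 'n::finite, 'm::finite) vector_bundle"
    and \<xi> \<eta> \<zeta> :: "('a, 'e, 'n, 'm) form_class"
    and r s t :: nat
  assumes "oriented_vector_bundle B"
    and "variational_vector B r \<xi>"
    and "variational_vector B s \<eta>"
    and "variational_vector B t \<zeta>"
  shows "class_add B
           (class_add B
             (class_scale B ((-1) powi ((int r - 1) * (int t - 1)))
               (schouten B \<xi> (schouten B \<eta> \<zeta>)))
             (class_scale B ((-1) powi ((int r - 1) * (int s - 1)))
               (schouten B \<eta> (schouten B \<zeta> \<xi>))))
           (class_scale B ((-1) powi ((int s - 1) * (int t - 1)))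
             (schouten B \<zeta> (schouten B \<xi> \<eta>)))
         = class_zero B"
proof -
  interpret oriented_bundle B by standard (rule assms(1))
  obtain f g h where "top_form B f" "homogeneous B r f" "top_form B g" "homogeneous B s g"
    "top_form B h" "homogeneous B t h" and cl: "\<xi> = form_class B f" "\<eta> = form_class B g" "\<zeta> = form_class B h"
    using assms(2-4) unfolding variational_vector_def by blast
  from class_jacobi[OF this(1-6)] show ?thesis unfolding cl jac_sign_def .
qed

end
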